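(* Using assumption (A1') and the ALISE filter of the context, one obtains the `virtual' equivalent system $$\dot x_e=A_ex_e+u_e+w_e,\qquad y_e=C_2x_e+v_2,$$ with $A_e:=\overline A+G_2M_2\grave R_2^\top R_2^{-1}C_2$, $\overline A:=(I-G_2M_2C_2)\hat A-G_2M_2T_2\dot C$, $u_e=-G_2M_2\grave R_2^\top R_2^{-1}y_e$, $w_e=G_2M_2\grave R_2^\top R_2^{-1}v_2+\overline w$, $\overline w:=(I-G_2M_2C_2)Ww-(I-G_2M_2C_2)G_1M_1v_1-G_2M_2T_2\dot v$, with equivalent noise covariances $Q_e$ of $w_e$ and $\overline Q$ of $\overline w$, where $Q_e:=\overline Q-G_2M_2\grave R_2^\top R_2^{-1}\grave R_2M_2^\top G_2^\top$. If the equivalent system satisfies (A2) it is uniformly completely observable (pair $(A_e,C_2)$), (A3) it is uniformly completely controllable (pair $(A_e,Q_e^{1/2})$), (A4) $\|Q_e\|$ and $\|R_2\|$ are bounded below and above by positive constants, (A5) $\|A_e\|$ is bounded above, then the optimal (ALISE) filter is uniformly asymptotically stable. Moreover, every solution to the differential Riccati equation $\dot P^x=\overline AP^x+P^x\overline A^\top+\overline Q-LR_2L^\top$ starting at $\mathcal P_0^x\succ0$ converges to a unique $P^x$ as $t\to\infty$.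
   Context: **System.** All matrices and signals depend on time $t\ge t_0$ (argument omitted). $\dot x=Ax+Bu+Gd+Ww$, $y=Cx+Du+Hd+v$, with state $x\in\mathbb R^n$, known input $u\in\mathbb R^m$, unknown input $d\in\mathbb R^p$, output $y\in\mathbb R^l$, noises $w\in\mathbb R^q$, $v\in\mathbb R^l$; $A,B,G,C,D,W$ smooth, bounded, known; $H$ analytic, known, of constant rank $p_H$; $n\ge l\ge1$, $l\ge p\ge0$, $m\ge0$. $x(t_0)$ is independent of $v,w$; an initial estimate $\hat x_0$ with covariance $\mathcal P_0^x$ is given. **Decoupling.** $H=[U_1\ U_2]\begin{bmatrix}\Sigma&0\\ 0&0\end{bmatrix}[V_1\ V_2]^\top$ is a differentiable singular value decomposition, $\Sigma\in\mathbb R^{p_H\times p_H}$ diagonal of full rank, $[U_1\ U_2]$, $[V_1\ V_2]$ unitary, evolving with $\dot U_1=U_1E$, $\dot U_2=0$, $\dot V_1=V_1F$, $\dot V_2=0$ ($E,F$ skew-symmetric). $d_i=V_i^\top d$, $G_i=GV_i$; $T_1=U_1^\top-U_1^\top RU_2(U_2^\top RU_2)^{-1}U_2^\top$, $T_2=U_2^\top$ (constant); $z_i=T_iy$, $C_i=T_iC$, $D_i=T_iD$, $v_i=T_iv$, $R_i=T_iRT_i^\top$. **Assumption (A1').** (i) $\dot w+A_ww=B_ww_G$ and $\ddot v+A_{\dot v}\dot v+A_vv=B_vv_G$, with $w_G,v_G$ mutually uncorrelated zero-mean white noises with time-invariant intensities $Q_G\succeq0$, $R_G\succ0$; correlation times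 of $w,v$ are short compared to times of interest. With $\underline v=[v^\top\ \dot v^\top]^\top$, $\dot{\underline v}=\underline A_v\underline v+\underline B_vv_G$, $\underline A_v=\begin{bmatrix}0&I\\ -A_v&-A_{\dot v}\end{bmatrix}$, $\underline B_v=\begin{bmatrix}0\\ B_v\end{bmatrix}$. $A_w,A_v,A_{\dot v}$ are positive semidefinite diagonal; $-A_w$, $\underline A_v$ are time-invariant and stable; $B_w,B_v$ time-invariant and bounded; $w(t_0),\underline v(t_0)$ have covariances $\mathcal P_0^w,\mathcal P_0^v$. (ii) $u$ is twice and $d$ once differentiable; $u,\dot u,\ddot u,d,\dot d$ are bounded; the norms of the state, the system matrices and their derivatives are bounded. **Noise covariances.** $\dot P^w=-A_wP^w-P^wA_w^\top+B_wQ_GB_w^\top$, $P^w(t_0)=\mathcal P_0^w$; $\dot P^v=\underline A_vP^v+P^v\underline A_v^\top+\underline B_vR_G\underline B_v^\top$, $P^v(t_0)=\mathcal P_0^v$. In the filter $Q=P^w$, $R=[I\ 0]P^v[I\ 0]^\top$, $\overline R=[0\ I]P^v[0\ I]^\top$, $\grave R=[I\ 0]P^v[0\ I]^\top$ are used, and $\overline R_2=T_2\overline RT_2^\top$, $\grave R_2=T_2\grave RT_2^\top$, $\grave R_{12}=T_1\grave RT_2^\top$. **ALISE filter** (assuming ${\rm rk}(C_2G_2)=p-p_H$). $M_1=\Sigma^{-1}$, $\hat A=A-G_1M_1C_1$, $\hat Q=WP^wW^\top+G_1M_1R_1M_1^\top G_1^\top$, $\tilde R_2=(C_2\hat A+T_2\dot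 C)P^x(C_2\hat A+T_2\dot C)^\top+C_2\hat QC_2^\top+\overline R_2-\grave R_{12}^\top M_1^\top G_1^\top C_2^\top-C_2G_1M_1\grave R_{12}$, $M_2=(G_2^\top C_2^\top\tilde R_2^{-1}C_2G_2)^{-1}G_2^\top C_2^\top\tilde R_2^{-1}$, $\overline B=(I-G_2M_2C_2)(B-G_1M_1D_1)-G_2M_2T_2\dot D$, $\overline G=(I-G_2M_2C_2)G_1$, $\overline Q=(I-G_2M_2C_2)\hat Q(I-G_2M_2C_2)^\top+G_2M_2\overline R_2M_2^\top G_2^\top$, $L=(P^xC_2^\top-G_2M_2\grave R_2^\top)R_2^{-1}$, $P^x$ solving the Riccati equation of the claim with $P^x(t_0)=\mathcal P_0^x$, $\Phi_1=G_2M_2T_2$, $\Phi_2=-G_2M_2D_2$, $\hat x=G_2M_2z_2-G_2M_2D_2u+\theta$, $\dot\theta=(\overline A-LC_2)\hat x+(\overline B-LD_2)u+\overline GM_1z_1+Lz_2-\dot\Phi_1y-\dot\Phi_2u$, $\theta(t_0)=\hat x_0-G_2M_2z_2(t_0)+G_2M_2D_2u(t_0)$. **Stability.** The filter is uniformly asymptotically stable if $\dot\xi=(\overline A-LC_2)\xi$ is uniformly asymptotically stable. **Uniform complete controllability/observability.** For bounded $X(t)$, the pair $(X,Y)$ is uniformly completely controllable if there exist $\epsilon>0$ and $\mu_1(\epsilon),\mu_2(\epsilon)>0$ such that for all $t\ge t_0$, $\mu_1(\epsilon)I\preceq\int_{t-\epsilon}^t\Phi_X(t,s)Y(s)Y(s)^\top\Phi_X^\top(t,s)ds\preceq\mu_2(\epsilon)I$,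 where $\Phi_X$ is the transition matrix of $\dot x=Xx$. The pair $(X,Z)$ is uniformly completely observable if its dual pair $(X^\top,Z^\top)$ is uniformly completely controllable.
   Formalization: Covariances of w̄, w_e carry an extra Ξ+Ξᵀ, Ξ=(I−G2M2C2)G1M1R̀12M2ᵀG2ᵀ; the lower bound on ‖R2‖ is read as R2⪰αI; the dual pair is time-reversed (−A_eᵀ); in the Riccati claim M2 is held at the filter's own P^x and the limit is unique up to a vanishing difference. *)

theory Defs
  imports
    "HOL-Probability.Probability"
    "Jordan_Normal_Form.DL_Rank"
    "Jordan_Normal_Form.Char_Poly"
    "Jordan_Normal_Form.Gauss_Jordan_Elimination"
begin

hide_const (open)
  Finite_Cartesian_Product.mat Finite_Cartesian_Product.vec Finite_Cartesian_Product.row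
  Finite_Cartesian_Product.rows Finite_Cartesian_Product.column Finite_Cartesian_Product.columns
  Finite_Cartesian_Product.transpose Determinants.det
no_notation Finite_Cartesian_Product.vec_nth (infixl "$" 90)
no_notation Inner_Product.real_inner_class.inner (infix "\<bullet>" 70)

text \<open>
  Matrices and vectors are those of Jordan_Normal_Form: their dimensions are natural numbers and
  may be 0, so that empty blocks (no unknown input, no feedthrough, feedthrough of full column
  rank, no known input) are covered by the same formulas.
\<close>

section \<open>Matrices\<close>

definition minv :: "real mat \<Rightarrow> real mat" where
  "minv A = (case mat_inverse A of Some B \<Rightarrow> B | None \<Rightarrow> 0\<^sub>m (dim_col A) (dim_row A))"

definition hcat :: "real mat \<Rightarrow> real mat \<Rightarrow> real mat" where
  "hcat A B = transpose_mat (transpose_mat A @\<^sub>r transpose_mat B)"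

definition psd :: "nat \<Rightarrow> real mat \<Rightarrow> bool" where
  "psd n A \<longleftrightarrow> A \<in> carrier_mat n n \<and> transpose_mat A = A \<and>
    (\<forall>x \<in> carrier_vec n. 0 \<le> x \<bullet> (A *\<^sub>v x))"

definition posdef :: "nat \<Rightarrow> real mat \<Rightarrow> bool" where
  "posdef n A \<longleftrightarrow> A \<in> carrier_mat n n \<and> transpose_mat A = A \<and>
    (\<forall>x \<in> carrier_vec n. x \<noteq> 0\<^sub>v n \<longrightarrow> 0 < x \<bullet> (A *\<^sub>v x))"

definition loewner_le :: "nat \<Rightarrow> real mat \<Rightarrow> real mat \<Rightarrow> bool" where
  "loewner_le n A B \<longleftrightarrow> A \<in> carrier_mat n n \<and> B \<in> carrier_mat n n \<and> psd n (B - A)"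

definition vnorm :: "real vec \<Rightarrow> real" where
  "vnorm x = sqrt (x \<bullet> x)"

definition mnorm :: "real mat \<Rightarrow> real" where
  "mnorm A = sqrt (\<Sum>i<dim_row A. \<Sum>j<dim_col A. (A $$ (i,j))\<^sup>2)"

definition hurwitz :: "real mat \<Rightarrow> bool" where
  "hurwitz A \<longleftrightarrow> (\<forall>k. eigenvalue (map_mat complex_of_real A) k \<longrightarrow> Re k < 0)"

section \<open>Matrix- and vector-valued functions on a half line\<close>

definition has_mderiv :: "real \<Rightarrow> (real \<Rightarrow> real mat) \<Rightarrow> real mat \<Rightarrow> real \<Rightarrow> bool" where
  "has_mderiv a X X' t \<longleftrightarrow> dim_row X' = dim_row (X t) \<and> dim_col X' = dim_col (X t) \<and>
    (\<forall>i<dim_row (X t). \<forall>j<dim_col (X t).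
      ((\<lambda>s. X s $$ (i,j)) has_real_derivative X' $$ (i,j)) (at t within {a..}))"

definition has_vderiv :: "real \<Rightarrow> (real \<Rightarrow> real vec) \<Rightarrow> real vec \<Rightarrow> real \<Rightarrow> bool" where
  "has_vderiv a x x' t \<longleftrightarrow> dim_vec x' = dim_vec (x t) \<and>
    (\<forall>i<dim_vec (x t). ((\<lambda>s. x s $ i) has_real_derivative x' $ i) (at t within {a..}))"

definition mderiv :: "real \<Rightarrow> (real \<Rightarrow> real mat) \<Rightarrow> real \<Rightarrow> real mat" where
  "mderiv a X t = mat (dim_row (X t)) (dim_col (X t))
    (\<lambda>(i,j). vector_derivative (\<lambda>s. X s $$ (i,j)) (at t within {a..}))"

definition msmooth :: "real \<Rightarrow> (real \<Rightarrow> real mat) \<Rightarrow> bool" where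
  "msmooth a X \<longleftrightarrow> (\<exists>D. D 0 = X \<and> (\<forall>k. \<forall>t\<ge>a. has_mderiv a (D k) (D (Suc k) t) t))"

definition manalytic :: "real \<Rightarrow> (real \<Rightarrow> real mat) \<Rightarrow> bool" where
  "manalytic a X \<longleftrightarrow> (\<forall>t\<ge>a. \<forall>i<dim_row (X t). \<forall>j<dim_col (X t). \<exists>r>0. \<exists>c.
    \<forall>s\<ge>a. \<bar>s - t\<bar> < r \<longrightarrow> (\<lambda>k. c k * (s - t) ^ k) sums (X s $$ (i,j)))"

definition mbounded :: "real \<Rightarrow> (real \<Rightarrow> real mat) \<Rightarrow> bool" where
  "mbounded a X \<longleftrightarrow> (\<exists>K. \<forall>t\<ge>a. mnorm (X t) \<le> K)"

definition vbounded :: "real \<Rightarrow> (real \<Rightarrow> real vec) \<Rightarrow> bool" where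
  "vbounded a x \<longleftrightarrow> (\<exists>K. \<forall>t\<ge>a. vnorm (x t) \<le> K)"

definition mintegral :: "nat \<Rightarrow> nat \<Rightarrow> real set \<Rightarrow> (real \<Rightarrow> real mat) \<Rightarrow> real mat" where
  "mintegral n m I X = mat n m (\<lambda>(i,j). integral I (\<lambda>s. X s $$ (i,j)))"

section \<open>Stability, controllability, observability\<close>

definition solves_lin :: "real \<Rightarrow> nat \<Rightarrow> (real \<Rightarrow> real mat) \<Rightarrow> (real \<Rightarrow> real vec) \<Rightarrow> bool" where
  "solves_lin a n X x \<longleftrightarrow>
    (\<forall>t\<ge>a. x t \<in> carrier_vec n \<and> has_vderiv a x (X t *\<^sub>v x t) t)"

definition unif_asymp_stable :: "real \<Rightarrow> nat \<Rightarrow> (real \<Rightarrow> real mat) \<Rightarrow> bool" where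
  "unif_asymp_stable a n X \<longleftrightarrow>
    (\<forall>e>0. \<exists>d>0. \<forall>s\<ge>a. \<forall>x. solves_lin s n X x \<and> vnorm (x s) < d \<longrightarrow> (\<forall>t\<ge>s. vnorm (x t) < e)) \<and>
    (\<exists>c>0. \<forall>e>0. \<exists>T>0. \<forall>s\<ge>a. \<forall>x. solves_lin s n X x \<and> vnorm (x s) < c \<longrightarrow>
      (\<forall>t\<ge>s + T. vnorm (x t) < e))"

definition transition_matrix ::
  "real \<Rightarrow> nat \<Rightarrow> (real \<Rightarrow> real mat) \<Rightarrow> (real \<Rightarrow> real \<Rightarrow> real mat) \<Rightarrow> bool" where
  "transition_matrix a n X \<Phi> \<longleftrightarrow> (\<forall>s\<ge>a. \<Phi> s s = 1\<^sub>m n \<and>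
    (\<forall>t\<ge>a. \<Phi> t s \<in> carrier_mat n n \<and> has_mderiv a (\<lambda>r. \<Phi> r s) (X t * \<Phi> t s) t))"

text \<open>
  The data exist for times \<open>\<ge> a\<close> only, so the Gramian bounds are required for exactly those windows
  \<open>{t - \<epsilon>..t}\<close> that lie in the time domain.
\<close>

definition unif_compl_controllable ::
  "real \<Rightarrow> nat \<Rightarrow> (real \<Rightarrow> real mat) \<Rightarrow> (real \<Rightarrow> real mat) \<Rightarrow> bool" where
  "unif_compl_controllable a n X Y \<longleftrightarrow>
    (\<exists>\<Phi>. transition_matrix a n X \<Phi> \<and>
      (\<exists>\<epsilon>>0. \<exists>\<mu>1>0. \<exists>\<mu>2>0. \<forall>t\<ge>a + \<epsilon>.
        (let W = mintegral n n {t - \<epsilon>..t}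
               (\<lambda>s. \<Phi> t s * Y s * transpose_mat (Y s) * transpose_mat (\<Phi> t s))
         in loewner_le n (\<mu>1 \<cdot>\<^sub>m 1\<^sub>m n) W \<and> loewner_le n W (\<mu>2 \<cdot>\<^sub>m 1\<^sub>m n))))"

text \<open>
  Duality reverses time: the dual \<open>(X\<^sup>T, Z\<^sup>T)\<close> evolves in the time variable \<open>-t\<close>, hence its state
  matrix in forward time is \<open>-X\<^sup>T\<close>, with transition matrix \<open>\<Phi>\<^sub>X(s,t)\<^sup>T\<close>.  The Gramian obtained is the
  usual observability Gramian \<open>\<integral> \<Phi>\<^sub>X(s,t)\<^sup>T Z(s)\<^sup>T Z(s) \<Phi>\<^sub>X(s,t) ds\<close>.
\<close>

definition unif_compl_observable ::
  "real \<Rightarrow> nat \<Rightarrow> (real \<Rightarrow> real mat) \<Rightarrow> (real \<Rightarrow> real mat) \<Rightarrow> bool" where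
  "unif_compl_observable a n X Z \<longleftrightarrow>
    unif_compl_controllable a n (\<lambda>t. - transpose_mat (X t)) (\<lambda>t. transpose_mat (Z t))"

section \<open>Data of the system and of the filter\<close>

text \<open>
  \<open>nx, nu, nd, ny, nw\<close> are the dimensions of \<open>x, u, d, y, w\<close>; \<open>nwG, nvG\<close> those of the white noises
  \<open>w\<^sub>G, v\<^sub>G\<close>; \<open>pH\<close> is the rank of \<open>H\<close>.  A field \<open>mX\<close> holds the matrix \<open>X\<close>; \<open>mSg\<close> is \<open>\<Sigma>\<close>,
  \<open>mAvd\<close> the coefficient of the velocity of \<open>v\<close>; \<open>mPw, mPv, mPx\<close> are
  \<open>P\<^sup>w, P\<^sup>v, P\<^sup>x\<close> and \<open>mP0w, mP0v, mP0x\<close> their initial values.  The gain \<open>M2\<close> depends on \<open>P\<^sup>x\<close>.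
\<close>

record alise =
  t0 :: real
  nx :: nat  nu :: nat  nd :: nat  ny :: nat  nw :: nat
  nwG :: nat  nvG :: nat  pH :: nat
  mA :: "real \<Rightarrow> real mat"  mB :: "real \<Rightarrow> real mat"  mG :: "real \<Rightarrow> real mat"
  mC :: "real \<Rightarrow> real mat"  mD :: "real \<Rightarrow> real mat"  mH :: "real \<Rightarrow> real mat"
  mW :: "real \<Rightarrow> real mat"
  mU1 :: "real \<Rightarrow> real mat"  mU2 :: "real \<Rightarrow> real mat"
  mV1 :: "real \<Rightarrow> real mat"  mV2 :: "real \<Rightarrow> real mat"  mSg :: "real \<Rightarrow> real mat"
  mAw :: "real mat"  mBw :: "real mat"  mQG :: "real mat"
  mAv :: "real mat"  mAvd :: "real mat"  mBv :: "real mat"  mRG :: "real mat"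
  mP0w :: "real mat"  mP0v :: "real mat"  mP0x :: "real mat"
  mPw :: "real \<Rightarrow> real mat"  mPv :: "real \<Rightarrow> real mat"  mPx :: "real \<Rightarrow> real mat"

subsection \<open>Noise covariances\<close>

definition Av_aug :: "alise \<Rightarrow> real mat" where
  "Av_aug S = four_block_mat (0\<^sub>m (ny S) (ny S)) (1\<^sub>m (ny S)) (- mAv S) (- mAvd S)"

definition Bv_aug :: "alise \<Rightarrow> real mat" where
  "Bv_aug S = 0\<^sub>m (ny S) (nvG S) @\<^sub>r mBv S"

definition sel_v :: "alise \<Rightarrow> real mat" where
  "sel_v S = hcat (1\<^sub>m (ny S)) (0\<^sub>m (ny S) (ny S))"

definition sel_vd :: "alise \<Rightarrow> real mat" where
  "sel_vd S = hcat (0\<^sub>m (ny S) (ny S)) (1\<^sub>m (ny S))"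

definition noise_covariances :: "alise \<Rightarrow> bool" where
  "noise_covariances S \<longleftrightarrow> mPw S (t0 S) = mP0w S \<and> mPv S (t0 S) = mP0v S \<and>
    (\<forall>t\<ge>t0 S.
      mPw S t \<in> carrier_mat (nw S) (nw S) \<and>
      mPv S t \<in> carrier_mat (ny S + ny S) (ny S + ny S) \<and>
      has_mderiv (t0 S) (mPw S)
        (- (mAw S * mPw S t) - mPw S t * transpose_mat (mAw S)
          + mBw S * mQG S * transpose_mat (mBw S)) t \<and>
      has_mderiv (t0 S) (mPv S)
        (Av_aug S * mPv S t + mPv S t * transpose_mat (Av_aug S)
          + Bv_aug S * mRG S * transpose_mat (Bv_aug S)) t)"

definition Rn :: "alise \<Rightarrow> real \<Rightarrow> real mat" where
  "Rn S t = sel_v S * mPv S t * transpose_mat (sel_v S)"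

definition Rbar :: "alise \<Rightarrow> real \<Rightarrow> real mat" where
  "Rbar S t = sel_vd S * mPv S t * transpose_mat (sel_vd S)"

definition Rgrave :: "alise \<Rightarrow> real \<Rightarrow> real mat" where
  "Rgrave S t = sel_v S * mPv S t * transpose_mat (sel_vd S)"

subsection \<open>Decoupling\<close>

definition T2 :: "alise \<Rightarrow> real \<Rightarrow> real mat" where
  "T2 S t = transpose_mat (mU2 S t)"

definition T1 :: "alise \<Rightarrow> real \<Rightarrow> real mat" where
  "T1 S t = transpose_mat (mU1 S t) -
    transpose_mat (mU1 S t) * Rn S t * mU2 S t *
      minv (transpose_mat (mU2 S t) * Rn S t * mU2 S t) * transpose_mat (mU2 S t)"

definition G1 :: "alise \<Rightarrow> real \<Rightarrow> real mat" where "G1 S t = mG S t * mV1 S t"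
definition G2 :: "alise \<Rightarrow> real \<Rightarrow> real mat" where "G2 S t = mG S t * mV2 S t"
definition C1 :: "alise \<Rightarrow> real \<Rightarrow> real mat" where "C1 S t = T1 S t * mC S t"
definition C2 :: "alise \<Rightarrow> real \<Rightarrow> real mat" where "C2 S t = T2 S t * mC S t"
definition D1 :: "alise \<Rightarrow> real \<Rightarrow> real mat" where "D1 S t = T1 S t * mD S t"
definition D2 :: "alise \<Rightarrow> real \<Rightarrow> real mat" where "D2 S t = T2 S t * mD S t"
definition R1 :: "alise \<Rightarrow> real \<Rightarrow> real mat" where "R1 S t = T1 S t * Rn S t * transpose_mat (T1 S t)"
definition R2 :: "alise \<Rightarrow> real \<Rightarrow> real mat" where "R2 S t = T2 S t * Rn S t * transpose_mat (T2 S t)"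

definition Rbar2 :: "alise \<Rightarrow> real \<Rightarrow> real mat" where
  "Rbar2 S t = T2 S t * Rbar S t * transpose_mat (T2 S t)"
definition Rgrave2 :: "alise \<Rightarrow> real \<Rightarrow> real mat" where
  "Rgrave2 S t = T2 S t * Rgrave S t * transpose_mat (T2 S t)"
definition Rgrave12 :: "alise \<Rightarrow> real \<Rightarrow> real mat" where
  "Rgrave12 S t = T1 S t * Rgrave S t * transpose_mat (T2 S t)"

subsection \<open>Filter matrices\<close>

definition M1 :: "alise \<Rightarrow> real \<Rightarrow> real mat" where "M1 S t = minv (mSg S t)"

definition Ahat :: "alise \<Rightarrow> real \<Rightarrow> real mat" where
  "Ahat S t = mA S t - G1 S t * M1 S t * C1 S t"

definition Qhat :: "alise \<Rightarrow> real \<Rightarrow> real mat" where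
  "Qhat S t = mW S t * mPw S t * transpose_mat (mW S t) +
    G1 S t * M1 S t * R1 S t * transpose_mat (M1 S t) * transpose_mat (G1 S t)"

definition Cdot :: "alise \<Rightarrow> real \<Rightarrow> real mat" where "Cdot S t = mderiv (t0 S) (mC S) t"
definition Ddot :: "alise \<Rightarrow> real \<Rightarrow> real mat" where "Ddot S t = mderiv (t0 S) (mD S) t"

definition Rtil2 :: "alise \<Rightarrow> real \<Rightarrow> real mat" where
  "Rtil2 S t = (let N = C2 S t * Ahat S t + T2 S t * Cdot S t in
    N * mPx S t * transpose_mat N + C2 S t * Qhat S t * transpose_mat (C2 S t) + Rbar2 S t
    - transpose_mat (Rgrave12 S t) * transpose_mat (M1 S t) * transpose_mat (G1 S t) * transpose_mat (C2 S t)
    - C2 S t * G1 S t * M1 S t * Rgrave12 S t)"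

definition M2 :: "alise \<Rightarrow> real \<Rightarrow> real mat" where
  "M2 S t = minv (transpose_mat (G2 S t) * transpose_mat (C2 S t) * minv (Rtil2 S t) * C2 S t * G2 S t)
    * transpose_mat (G2 S t) * transpose_mat (C2 S t) * minv (Rtil2 S t)"

definition Proj :: "alise \<Rightarrow> real \<Rightarrow> real mat" where
  "Proj S t = 1\<^sub>m (nx S) - G2 S t * M2 S t * C2 S t"

definition Abar :: "alise \<Rightarrow> real \<Rightarrow> real mat" where
  "Abar S t = Proj S t * Ahat S t - G2 S t * M2 S t * T2 S t * Cdot S t"

definition Bbar :: "alise \<Rightarrow> real \<Rightarrow> real mat" where
  "Bbar S t = Proj S t * (mB S t - G1 S t * M1 S t * D1 S t) - G2 S t * M2 S t * T2 S t * Ddot S t"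

definition Gbar :: "alise \<Rightarrow> real \<Rightarrow> real mat" where
  "Gbar S t = Proj S t * G1 S t"

definition Qbar :: "alise \<Rightarrow> real \<Rightarrow> real mat" where
  "Qbar S t = Proj S t * Qhat S t * transpose_mat (Proj S t) +
    G2 S t * M2 S t * Rbar2 S t * transpose_mat (M2 S t) * transpose_mat (G2 S t)"

definition gain :: "alise \<Rightarrow> real \<Rightarrow> real mat \<Rightarrow> real mat" where
  "gain S t P = (P * transpose_mat (C2 S t) - G2 S t * M2 S t * transpose_mat (Rgrave2 S t)) * minv (R2 S t)"

definition L :: "alise \<Rightarrow> real \<Rightarrow> real mat" where
  "L S t = gain S t (mPx S t)"

text \<open>
  The coefficients \<open>Abar, Qbar, M2\<close> are those of the given filter (evaluated along its own \<open>P\<^sup>x\<close>);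
  the unknown \<open>P\<close> enters the equation explicitly and through the gain.
\<close>

definition riccati_solution :: "alise \<Rightarrow> (real \<Rightarrow> real mat) \<Rightarrow> bool" where
  "riccati_solution S P \<longleftrightarrow> (\<forall>t\<ge>t0 S. P t \<in> carrier_mat (nx S) (nx S) \<and>
    has_mderiv (t0 S) P
      (Abar S t * P t + P t * transpose_mat (Abar S t) + Qbar S t
        - gain S t (P t) * R2 S t * transpose_mat (gain S t (P t))) t)"

definition Phi1 :: "alise \<Rightarrow> real \<Rightarrow> real mat" where
  "Phi1 S t = G2 S t * M2 S t * T2 S t"

definition Phi2 :: "alise \<Rightarrow> real \<Rightarrow> real mat" where
  "Phi2 S t = - (G2 S t * M2 S t * D2 S t)"

subsection \<open>The virtual equivalent system\<close>

definition Kmix :: "alise \<Rightarrow> real \<Rightarrow> real mat" where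
  "Kmix S t = G2 S t * M2 S t * transpose_mat (Rgrave2 S t) * minv (R2 S t)"

definition Ae :: "alise \<Rightarrow> real \<Rightarrow> real mat" where
  "Ae S t = Abar S t + Kmix S t * C2 S t"

definition Qe :: "alise \<Rightarrow> real \<Rightarrow> real mat" where
  "Qe S t = Qbar S t - G2 S t * M2 S t * transpose_mat (Rgrave2 S t) * minv (R2 S t) * Rgrave2 S t
    * transpose_mat (M2 S t) * transpose_mat (G2 S t)"

text \<open>In the following four definitions \<open>w, v, vd, y\<close> are the values of the signals at time \<open>t\<close>.\<close>

definition v2 :: "alise \<Rightarrow> real \<Rightarrow> real vec \<Rightarrow> real vec" where
  "v2 S t v = T2 S t *\<^sub>v v"

definition wbar :: "alise \<Rightarrow> real \<Rightarrow> real vec \<Rightarrow> real vec \<Rightarrow> real vec \<Rightarrow> real vec" where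
  "wbar S t w v vd = Proj S t *\<^sub>v (mW S t *\<^sub>v w)
    - (Proj S t * G1 S t * M1 S t) *\<^sub>v (T1 S t *\<^sub>v v)
    - (G2 S t * M2 S t * T2 S t) *\<^sub>v vd"

definition we :: "alise \<Rightarrow> real \<Rightarrow> real vec \<Rightarrow> real vec \<Rightarrow> real vec \<Rightarrow> real vec" where
  "we S t w v vd = Kmix S t *\<^sub>v v2 S t v + wbar S t w v vd"

definition ue :: "alise \<Rightarrow> real \<Rightarrow> real vec \<Rightarrow> real vec" where
  "ue S t ye = - (Kmix S t *\<^sub>v ye)"

text \<open>The cross covariance of the \<open>v\<^sub>1\<close>- and the \<open>vd\<close>-part of \<open>wbar\<close>; it is not part of \<open>Qbar\<close>.\<close>

definition Xi :: "alise \<Rightarrow> real \<Rightarrow> real mat" where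
  "Xi S t = Proj S t * G1 S t * M1 S t * Rgrave12 S t * transpose_mat (M2 S t) * transpose_mat (G2 S t)"

definition equiv_system ::
  "alise \<Rightarrow> (real \<Rightarrow> real vec) \<Rightarrow> (real \<Rightarrow> real vec) \<Rightarrow> (real \<Rightarrow> real vec) \<Rightarrow>
    (real \<Rightarrow> real vec) \<Rightarrow> (real \<Rightarrow> real vec) \<Rightarrow> bool" where
  "equiv_system S w v vd xe ye \<longleftrightarrow> (\<forall>t\<ge>t0 S. xe t \<in> carrier_vec (nx S) \<and>
    has_vderiv (t0 S) xe (Ae S t *\<^sub>v xe t + ue S t (ye t) + we S t (w t) (v t) (vd t)) t \<and>
    ye t = C2 S t *\<^sub>v xe t + v2 S t (v t))"

definition correlated_system ::
  "alise \<Rightarrow> (real \<Rightarrow> real vec) \<Rightarrow> (real \<Rightarrow> real vec) \<Rightarrow> (real \<Rightarrow> real vec) \<Rightarrow>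
    (real \<Rightarrow> real vec) \<Rightarrow> (real \<Rightarrow> real vec) \<Rightarrow> bool" where
  "correlated_system S w v vd xe ye \<longleftrightarrow> (\<forall>t\<ge>t0 S. xe t \<in> carrier_vec (nx S) \<and>
    has_vderiv (t0 S) xe (Abar S t *\<^sub>v xe t + wbar S t (w t) (v t) (vd t)) t \<and>
    ye t = C2 S t *\<^sub>v xe t + v2 S t (v t))"

definition Le :: "alise \<Rightarrow> real \<Rightarrow> real mat" where
  "Le S t = mPx S t * transpose_mat (C2 S t) * minv (R2 S t)"

definition equiv_kalman_bucy :: "alise \<Rightarrow> (real \<Rightarrow> real vec) \<Rightarrow> (real \<Rightarrow> real vec) \<Rightarrow> bool" where
  "equiv_kalman_bucy S ye xh \<longleftrightarrow> (\<forall>t\<ge>t0 S. xh t \<in> carrier_vec (nx S) \<and>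
    has_vderiv (t0 S) xh
      (Ae S t *\<^sub>v xh t + ue S t (ye t) + Le S t *\<^sub>v (ye t - C2 S t *\<^sub>v xh t)) t)"

definition equiv_riccati :: "alise \<Rightarrow> bool" where
  "equiv_riccati S \<longleftrightarrow> (\<forall>t\<ge>t0 S. has_mderiv (t0 S) (mPx S)
    (Ae S t * mPx S t + mPx S t * transpose_mat (Ae S t) + Qe S t
      - Le S t * R2 S t * transpose_mat (Le S t)) t)"

definition error_dynamics ::
  "alise \<Rightarrow> (real \<Rightarrow> real vec) \<Rightarrow> (real \<Rightarrow> real vec) \<Rightarrow> (real \<Rightarrow> real vec) \<Rightarrow>
    (real \<Rightarrow> real vec) \<Rightarrow> bool" where
  "error_dynamics S w v vd e \<longleftrightarrow> (\<forall>t\<ge>t0 S. e t \<in> carrier_vec (nx S) \<and>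
    has_vderiv (t0 S) e
      ((Abar S t - L S t * C2 S t) *\<^sub>v e t + (wbar S t (w t) (v t) (vd t) - L S t *\<^sub>v v2 S t (v t))) t)"

section \<open>Standing assumptions\<close>

subsection \<open>System matrices\<close>

definition svd_of_H :: "alise \<Rightarrow> bool" where
  "svd_of_H S \<longleftrightarrow> (\<exists>E F. \<forall>t\<ge>t0 S.
    mU1 S t \<in> carrier_mat (ny S) (pH S) \<and> mU2 S t \<in> carrier_mat (ny S) (ny S - pH S) \<and>
    mV1 S t \<in> carrier_mat (nd S) (pH S) \<and> mV2 S t \<in> carrier_mat (nd S) (nd S - pH S) \<and>
    mSg S t \<in> carrier_mat (pH S) (pH S) \<and>
    diagonal_mat (mSg S t) \<and> vec_space.rank (pH S) (mSg S t) = pH S \<and>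
    mH S t = hcat (mU1 S t) (mU2 S t)
      * four_block_mat (mSg S t) (0\<^sub>m (pH S) (nd S - pH S))
          (0\<^sub>m (ny S - pH S) (pH S)) (0\<^sub>m (ny S - pH S) (nd S - pH S))
      * transpose_mat (hcat (mV1 S t) (mV2 S t)) \<and>
    transpose_mat (hcat (mU1 S t) (mU2 S t)) * hcat (mU1 S t) (mU2 S t) = 1\<^sub>m (ny S) \<and>
    transpose_mat (hcat (mV1 S t) (mV2 S t)) * hcat (mV1 S t) (mV2 S t) = 1\<^sub>m (nd S) \<and>
    (\<exists>Sg'. has_mderiv (t0 S) (mSg S) Sg' t) \<and>
    E t \<in> carrier_mat (pH S) (pH S) \<and> transpose_mat (E t) = - E t \<and>
    F t \<in> carrier_mat (pH S) (pH S) \<and> transpose_mat (F t) = - F t \<and>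
    has_mderiv (t0 S) (mU1 S) (mU1 S t * E t) t \<and>
    has_mderiv (t0 S) (mU2 S) (0\<^sub>m (ny S) (ny S - pH S)) t \<and>
    has_mderiv (t0 S) (mV1 S) (mV1 S t * F t) t \<and>
    has_mderiv (t0 S) (mV2 S) (0\<^sub>m (nd S) (nd S - pH S)) t)"

definition system_matrices :: "alise \<Rightarrow> bool" where
  "system_matrices S \<longleftrightarrow>
    ny S \<le> nx S \<and> 1 \<le> ny S \<and> nd S \<le> ny S \<and> pH S \<le> nd S \<and>
    (\<forall>t\<ge>t0 S.
      mA S t \<in> carrier_mat (nx S) (nx S) \<and> mB S t \<in> carrier_mat (nx S) (nu S) \<and>
      mG S t \<in> carrier_mat (nx S) (nd S) \<and> mW S t \<in> carrier_mat (nx S) (nw S) \<and>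
      mC S t \<in> carrier_mat (ny S) (nx S) \<and> mD S t \<in> carrier_mat (ny S) (nu S) \<and>
      mH S t \<in> carrier_mat (ny S) (nd S) \<and> vec_space.rank (ny S) (mH S t) = pH S) \<and>
    (\<forall>X \<in> {mA S, mB S, mG S, mC S, mD S, mW S}.
      msmooth (t0 S) X \<and> mbounded (t0 S) X \<and> mbounded (t0 S) (mderiv (t0 S) X)) \<and>
    manalytic (t0 S) (mH S) \<and> mbounded (t0 S) (mH S) \<and> mbounded (t0 S) (mderiv (t0 S) (mH S)) \<and>
    svd_of_H S"

subsection \<open>Noises\<close>

definition rand_vec :: "'a measure \<Rightarrow> nat \<Rightarrow> ('a \<Rightarrow> real vec) \<Rightarrow> bool" where
  "rand_vec M n X \<longleftrightarrow> (\<forall>\<omega>\<in>space M. X \<omega> \<in> carrier_vec n) \<and>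
    (\<forall>i<n. (\<lambda>\<omega>. X \<omega> $ i) \<in> borel_measurable M \<and> integrable M (\<lambda>\<omega>. (X \<omega> $ i)\<^sup>2))"

definition cov_mat ::
  "'a measure \<Rightarrow> nat \<Rightarrow> nat \<Rightarrow> ('a \<Rightarrow> real vec) \<Rightarrow> ('a \<Rightarrow> real vec) \<Rightarrow> real mat" where
  "cov_mat M n m X Y = mat n m (\<lambda>(i,j).
    (\<integral>\<omega>. (X \<omega> $ i - (\<integral>\<eta>. X \<eta> $ i \<partial>M)) * (Y \<omega> $ j - (\<integral>\<eta>. Y \<eta> $ j \<partial>M)) \<partial>M))"

text \<open>
  White noise of intensity \<open>Q\<close> is represented by its primitive \<open>\<beta>\<close>, a zero-mean process with
  orthogonal increments; \<open>X' = A X + B \<beta>'\<close> is understood in integrated form along sample paths.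
  As usual, the noise is uncorrelated with the initial value \<open>X a\<close>.
\<close>

definition white_noise_primitive ::
  "'a measure \<Rightarrow> real \<Rightarrow> nat \<Rightarrow> real mat \<Rightarrow> (real \<Rightarrow> 'a \<Rightarrow> real vec) \<Rightarrow> bool" where
  "white_noise_primitive M a k Q \<beta> \<longleftrightarrow>
    (\<forall>\<omega>\<in>space M. \<beta> a \<omega> = 0\<^sub>v k) \<and>
    (\<forall>t\<ge>a. rand_vec M k (\<beta> t) \<and> (\<forall>i<k. (\<integral>\<omega>. \<beta> t \<omega> $ i \<partial>M) = 0)) \<and>
    (\<forall>s\<ge>a. \<forall>t\<ge>a. cov_mat M k k (\<beta> s) (\<beta> t) = (min s t - a) \<cdot>\<^sub>m Q)"

definition white_noise_driven ::
  "'a measure \<Rightarrow> real \<Rightarrow> nat \<Rightarrow> nat \<Rightarrow> real mat \<Rightarrow> real mat \<Rightarrow> real mat \<Rightarrow> real mat \<Rightarrow>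
    (real \<Rightarrow> 'a \<Rightarrow> real vec) \<Rightarrow> (real \<Rightarrow> 'a \<Rightarrow> real vec) \<Rightarrow> bool" where
  "white_noise_driven M a n k A B Q P0 \<beta> X \<longleftrightarrow>
    white_noise_primitive M a k Q \<beta> \<and>
    (\<forall>t\<ge>a. rand_vec M n (X t)) \<and>
    cov_mat M n n (X a) (X a) = P0 \<and>
    (\<forall>t\<ge>a. cov_mat M n k (X a) (\<beta> t) = 0\<^sub>m n k) \<and>
    (\<forall>\<omega>\<in>space M. \<forall>i<n. continuous_on {a..} (\<lambda>t. X t \<omega> $ i)) \<and>
    (\<forall>\<omega>\<in>space M. \<forall>t\<ge>a. X t \<omega> =
      X a \<omega> + vec n (\<lambda>i. integral {a..t} (\<lambda>s. (A *\<^sub>v X s \<omega>) $ i)) + B *\<^sub>v \<beta> t \<omega>)"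

text \<open>\<open>vv\<close> is the process \<open>v\<close> stacked on top of its derivative.\<close>

definition noise_model ::
  "'a measure \<Rightarrow> alise \<Rightarrow> (real \<Rightarrow> 'a \<Rightarrow> real vec) \<Rightarrow> (real \<Rightarrow> 'a \<Rightarrow> real vec) \<Rightarrow> bool" where
  "noise_model M S w vv \<longleftrightarrow>
    mAw S \<in> carrier_mat (nw S) (nw S) \<and> diagonal_mat (mAw S) \<and> psd (nw S) (mAw S) \<and>
    mAv S \<in> carrier_mat (ny S) (ny S) \<and> diagonal_mat (mAv S) \<and> psd (ny S) (mAv S) \<and>
    mAvd S \<in> carrier_mat (ny S) (ny S) \<and> diagonal_mat (mAvd S) \<and> psd (ny S) (mAvd S) \<and>
    hurwitz (- mAw S) \<and> hurwitz (Av_aug S) \<and>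
    mBw S \<in> carrier_mat (nw S) (nwG S) \<and> mBv S \<in> carrier_mat (ny S) (nvG S) \<and>
    psd (nwG S) (mQG S) \<and> posdef (nvG S) (mRG S) \<and>
    (\<exists>\<beta>w \<beta>v.
      white_noise_driven M (t0 S) (nw S) (nwG S) (- mAw S) (mBw S) (mQG S) (mP0w S) \<beta>w w \<and>
      white_noise_driven M (t0 S) (ny S + ny S) (nvG S) (Av_aug S) (Bv_aug S) (mRG S) (mP0v S) \<beta>v vv \<and>
      (\<forall>s\<ge>t0 S. \<forall>t\<ge>t0 S. cov_mat M (nwG S) (nvG S) (\<beta>w s) (\<beta>v t) = 0\<^sub>m (nwG S) (nvG S)) \<and>
      (\<forall>t\<ge>t0 S. cov_mat M (nw S) (nvG S) (w (t0 S)) (\<beta>v t) = 0\<^sub>m (nw S) (nvG S)) \<and>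
      (\<forall>t\<ge>t0 S. cov_mat M (ny S + ny S) (nwG S) (vv (t0 S)) (\<beta>w t) = 0\<^sub>m (ny S + ny S) (nwG S)) \<and>
      cov_mat M (nw S) (ny S + ny S) (w (t0 S)) (vv (t0 S)) = 0\<^sub>m (nw S) (ny S + ny S))"

definition vpart :: "alise \<Rightarrow> (real \<Rightarrow> 'a \<Rightarrow> real vec) \<Rightarrow> real \<Rightarrow> 'a \<Rightarrow> real vec" where
  "vpart S vv t \<omega> = vec_first (vv t \<omega>) (ny S)"

definition vdpart :: "alise \<Rightarrow> (real \<Rightarrow> 'a \<Rightarrow> real vec) \<Rightarrow> real \<Rightarrow> 'a \<Rightarrow> real vec" where
  "vdpart S vv t \<omega> = vec_last (vv t \<omega>) (ny S)"

subsection \<open>Inputs, state and output\<close>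

definition inputs :: "'a measure \<Rightarrow> alise \<Rightarrow> (real \<Rightarrow> 'a \<Rightarrow> real vec) \<Rightarrow> (real \<Rightarrow> 'a \<Rightarrow> real vec) \<Rightarrow> bool" where
  "inputs M S u d \<longleftrightarrow> (\<forall>\<omega>\<in>space M.
    (\<forall>t\<ge>t0 S. u t \<omega> \<in> carrier_vec (nu S) \<and> d t \<omega> \<in> carrier_vec (nd S)) \<and>
    (\<exists>u' u'' d'.
      (\<forall>t\<ge>t0 S. has_vderiv (t0 S) (\<lambda>s. u s \<omega>) (u' t) t \<and> has_vderiv (t0 S) u' (u'' t) t \<and>
        has_vderiv (t0 S) (\<lambda>s. d s \<omega>) (d' t) t) \<and>
      vbounded (t0 S) (\<lambda>t. u t \<omega>) \<and> vbounded (t0 S) u' \<and> vbounded (t0 S) u'' \<and>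
      vbounded (t0 S) (\<lambda>t. d t \<omega>) \<and> vbounded (t0 S) d'))"

definition generators :: "'a measure \<Rightarrow> real set \<Rightarrow> nat \<Rightarrow> (real \<Rightarrow> 'a \<Rightarrow> real vec) \<Rightarrow> 'a set set" where
  "generators M I n X =
    {(\<lambda>\<omega>. X t \<omega> $ i) -` B \<inter> space M | t i B. t \<in> I \<and> i < n \<and> B \<in> sets borel}"

definition independent_of_noise ::
  "'a measure \<Rightarrow> alise \<Rightarrow> (real \<Rightarrow> 'a \<Rightarrow> real vec) \<Rightarrow> (real \<Rightarrow> 'a \<Rightarrow> real vec) \<Rightarrow>
    (real \<Rightarrow> 'a \<Rightarrow> real vec) \<Rightarrow> bool" where
  "independent_of_noise M S x w vv \<longleftrightarrow> prob_space.indep_set M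
    (sigma_sets (space M) (generators M {t0 S} (nx S) x))
    (sigma_sets (space M) (generators M {t0 S..} (nw S) w \<union> generators M {t0 S..} (ny S + ny S) vv))"

text \<open>Boundedness of the random state is boundedness in mean square.\<close>

definition state_and_output ::
  "'a measure \<Rightarrow> alise \<Rightarrow> (real \<Rightarrow> 'a \<Rightarrow> real vec) \<Rightarrow> (real \<Rightarrow> 'a \<Rightarrow> real vec) \<Rightarrow>
    (real \<Rightarrow> 'a \<Rightarrow> real vec) \<Rightarrow> (real \<Rightarrow> 'a \<Rightarrow> real vec) \<Rightarrow>
    (real \<Rightarrow> 'a \<Rightarrow> real vec) \<Rightarrow> (real \<Rightarrow> 'a \<Rightarrow> real vec) \<Rightarrow> bool" where
  "state_and_output M S w vv u d x y \<longleftrightarrow>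
    (\<forall>\<omega>\<in>space M. \<forall>t\<ge>t0 S. x t \<omega> \<in> carrier_vec (nx S) \<and>
      has_vderiv (t0 S) (\<lambda>s. x s \<omega>)
        (mA S t *\<^sub>v x t \<omega> + mB S t *\<^sub>v u t \<omega> + mG S t *\<^sub>v d t \<omega> + mW S t *\<^sub>v w t \<omega>) t \<and>
      y t \<omega> = mC S t *\<^sub>v x t \<omega> + mD S t *\<^sub>v u t \<omega> + mH S t *\<^sub>v d t \<omega> + vpart S vv t \<omega>) \<and>
    independent_of_noise M S x w vv \<and>
    (\<forall>t\<ge>t0 S. rand_vec M (nx S) (x t)) \<and>
    (\<exists>K. \<forall>t\<ge>t0 S. (\<integral>\<omega>. (vnorm (x t \<omega>))\<^sup>2 \<partial>M) \<le> K)"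

subsection \<open>The ALISE filter\<close>

text \<open>\<open>y, u, \<theta>\<close> are the values at time \<open>t\<close>.\<close>

definition xhat :: "alise \<Rightarrow> real \<Rightarrow> real vec \<Rightarrow> real vec \<Rightarrow> real vec \<Rightarrow> real vec" where
  "xhat S t y u \<theta> =
    (G2 S t * M2 S t) *\<^sub>v (T2 S t *\<^sub>v y) - (G2 S t * M2 S t * D2 S t) *\<^sub>v u + \<theta>"

text \<open>
  Positive definiteness of the covariance matrices \<open>R2\<close>, \<open>Rtil2\<close> says that the inverses
  occurring in the gains exist; \<open>Rtil2\<close> is used only if the block \<open>G2\<close> is not empty.
\<close>

definition alise_filter ::
  "'a measure \<Rightarrow> alise \<Rightarrow> (real \<Rightarrow> 'a \<Rightarrow> real vec) \<Rightarrow> (real \<Rightarrow> 'a \<Rightarrow> real vec) \<Rightarrow>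
    (real \<Rightarrow> 'a \<Rightarrow> real vec) \<Rightarrow> ('a \<Rightarrow> real vec) \<Rightarrow> (real \<Rightarrow> 'a \<Rightarrow> real vec) \<Rightarrow> bool" where
  "alise_filter M S u x y xh0 \<theta> \<longleftrightarrow>
    (\<forall>t\<ge>t0 S. vec_space.rank (ny S - pH S) (C2 S t * G2 S t) = nd S - pH S) \<and>
    (\<forall>t\<ge>t0 S. posdef (ny S - pH S) (R2 S t)) \<and>
    (pH S < nd S \<longrightarrow> (\<forall>t\<ge>t0 S. posdef (ny S - pH S) (Rtil2 S t))) \<and>
    riccati_solution S (mPx S) \<and> mPx S (t0 S) = mP0x S \<and>
    rand_vec M (nx S) xh0 \<and>
    cov_mat M (nx S) (nx S) (\<lambda>\<omega>. x (t0 S) \<omega> - xh0 \<omega>) (\<lambda>\<omega>. x (t0 S) \<omega> - xh0 \<omega>) = mP0x S \<and>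
    (\<forall>\<omega>\<in>space M.
      \<theta> (t0 S) \<omega> = xh0 \<omega>
        - (G2 S (t0 S) * M2 S (t0 S)) *\<^sub>v (T2 S (t0 S) *\<^sub>v y (t0 S) \<omega>)
        + (G2 S (t0 S) * M2 S (t0 S) * D2 S (t0 S)) *\<^sub>v u (t0 S) \<omega> \<and>
      (\<forall>t\<ge>t0 S. \<theta> t \<omega> \<in> carrier_vec (nx S) \<and>
        has_vderiv (t0 S) (\<lambda>s. \<theta> s \<omega>)
          ((Abar S t - L S t * C2 S t) *\<^sub>v xhat S t (y t \<omega>) (u t \<omega>) (\<theta> t \<omega>)
            + (Bbar S t - L S t * D2 S t) *\<^sub>v u t \<omega>
            + (Gbar S t * M1 S t) *\<^sub>v (T1 S t *\<^sub>v y t \<omega>)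
            + L S t *\<^sub>v (T2 S t *\<^sub>v y t \<omega>)
            - mderiv (t0 S) (Phi1 S) t *\<^sub>v y t \<omega>
            - mderiv (t0 S) (Phi2 S) t *\<^sub>v u t \<omega>) t))"

section \<open>Conditions on the equivalent system\<close>

definition cond_A2 :: "alise \<Rightarrow> bool" where
  "cond_A2 S \<longleftrightarrow> unif_compl_observable (t0 S) (nx S) (Ae S) (C2 S)"

definition cond_A3 :: "alise \<Rightarrow> bool" where
  "cond_A3 S \<longleftrightarrow> (\<exists>Qh. (\<forall>t\<ge>t0 S. psd (nx S) (Qh t) \<and> Qh t * Qh t = Qe S t) \<and>
    unif_compl_controllable (t0 S) (nx S) (Ae S) Qh)"

text \<open>
  \<open>R2\<close> is bounded below as an operator; a lower bound on \<open>mnorm (R2 S t)\<close> alone would allow some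
  measurements to become asymptotically noise-free.
\<close>

definition cond_A4 :: "alise \<Rightarrow> bool" where
  "cond_A4 S \<longleftrightarrow>
    (\<exists>\<alpha>>0. \<exists>\<beta>>0. \<forall>t\<ge>t0 S. \<alpha> \<le> mnorm (Qe S t) \<and> mnorm (Qe S t) \<le> \<beta>) \<and>
    (\<exists>\<alpha>>0. \<exists>\<beta>>0. \<forall>t\<ge>t0 S.
      loewner_le (ny S - pH S) (\<alpha> \<cdot>\<^sub>m 1\<^sub>m (ny S - pH S)) (R2 S t) \<and> mnorm (R2 S t) \<le> \<beta>)"

definition cond_A5 :: "alise \<Rightarrow> bool" where
  "cond_A5 S \<longleftrightarrow> mbounded (t0 S) (Ae S)"

text \<open>
  The Riccati equation is time varying, so solutions converge to a limit function
  \<open>Pinf\<close>, which is unique up to a difference that vanishes as \<open>t \<rightarrow> \<infinity>\<close>.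
\<close>

definition asymptotically_equal :: "(real \<Rightarrow> real mat) \<Rightarrow> (real \<Rightarrow> real mat) \<Rightarrow> bool" where
  "asymptotically_equal X Y \<longleftrightarrow> ((\<lambda>t. mnorm (X t - Y t)) \<longlongrightarrow> 0) at_top"

definition attracts_riccati :: "alise \<Rightarrow> (real \<Rightarrow> real mat) \<Rightarrow> bool" where
  "attracts_riccati S Pinf \<longleftrightarrow> riccati_solution S Pinf \<and>
    (\<forall>t\<ge>t0 S. psd (nx S) (Pinf t)) \<and>
    (\<forall>P. riccati_solution S P \<and> posdef (nx S) (P (t0 S)) \<longrightarrow> asymptotically_equal P Pinf)"

end

theory Submission
  imports Defs
begin

text \<open>The statement combines three facts of different nature.

The error of the filter does not see the unknown input. The component \<open>T2 y\<close> of the output is free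
of it, the component \<open>T1 y\<close> determines the part \<open>d1\<close> because \<open>mSg\<close> is invertible, and \<open>M2\<close> is a left
inverse of \<open>C2 G2\<close>, so that \<open>Proj = 1 - G2 M2 C2\<close> annihilates \<open>G2\<close>. Hence \<open>x - xhat\<close> can be written as
\<open>Proj x - G2 M2 v2 - \<theta>\<close>, and in its derivative all inputs cancel (\<open>filter_error\<close>). The driving noise
\<open>wbar\<close> contains the velocity of \<open>v\<close> and is therefore correlated with \<open>v2\<close>. Adding the vanishing term
\<open>Kmix (C2 xe - ye + v2)\<close> to the state equation leaves the solutions unchanged and removes this
correlation (\<open>correlated_iff_equiv\<close>); completing the square in the gain does the same to the Riccati
equation (\<open>equiv_riccati\<close>).

The covariance of a process \<open>X = \<integral> A X + B \<beta>\<close> driven by white noise satisfies a Lyapunov equation. As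
\<open>X - B \<beta>\<close> has differentiable paths, only ordinary calculus and Fubini's theorem are needed
(\<open>covariance_lyapunov\<close>). Uniqueness for this equation identifies \<open>mPw\<close> and \<open>mPv\<close> with the covariances
of the noises, and the covariances of \<open>wbar\<close> and \<open>we\<close> follow by bilinearity (\<open>wbar_covariance\<close>).

The equivalent system has a standard Riccati equation, to which the theory of Kalman and Bucy
applies. Along trajectories of the adjoint equation the value function \<open>inner l (P l)\<close> changes at a
rate that is known up to a square. Solutions that start positive semidefinite stay so (\<open>sol_pos\<close>). Observability
allows an adjoint trajectory to be steered to zero over a window, which bounds the solutions from
above (\<open>upper_bound_window\<close>); controllability bounds them from below (\<open>lower_bound\<close>). With both bounds,
the metric of the inverse of \<open>P\<close> is a Lyapunov function of the error equation. It loses a fixed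
fraction over each window: a trajectory with little loss is nearly a free adjoint trajectory, and
the loss along a free one is bounded below by a controllability Gramian (\<open>window_decay\<close>). Uniform exponential decay
follows (\<open>closed_loop_decay\<close>). The difference of two solutions of the Riccati equation solves the
two-sided equation \<open>X' = F1 X + X F2^T\<close> given by the two closed loops, and the same argument in the
product of the two metrics shows that all positive semidefinite solutions merge (\<open>solutions_merge\<close>).
So \<open>mPx\<close> itself attracts them, and its limit behaviour is unique.\<close>

section \<open>The algebra of finitely supported real matrices\<close>

text \<open>Matrices of all dimensions, 0 included, become elements of one ring, so that identities between
them are ring identities without conditions on dimensions. The ring has no unit; the images \<open>un n\<close> of
the identity matrices are idempotents that act as units on the elements of the right shape.\<close>

typedef fsmat = "{f :: nat \<Rightarrow> nat \<Rightarrow> real. \<exists>N. \<forall>i j. N \<le> i \<or> N \<le> j \<longrightarrow> f i j = 0}"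
  morphisms ent Abs_fsmat
  by (rule exI[of _ "\<lambda>_ _. 0"]) auto

setup_lifting type_definition_fsmat

definition supported_in :: "nat \<Rightarrow> fsmat \<Rightarrow> bool" where
  "supported_in N X \<longleftrightarrow> (\<forall>i j. N \<le> i \<or> N \<le> j \<longrightarrow> ent X i j = 0)"

definition supp_bound :: "fsmat \<Rightarrow> nat" where
  "supp_bound X = (LEAST N. supported_in N X)"

lemma fsmat_eqI: "(\<And>i j. ent X i j = ent Y i j) \<Longrightarrow> X = Y"
  by (metis ent_inject ext)

lemma supported_in_supp_bound: "supported_in (supp_bound X) X"
proof -
  have "\<exists>N. supported_in N X" using ent[of X] by (simp add: supported_in_def)
  then show ?thesis unfolding supp_bound_def by (rule LeastI_ex)
qed

lemma supported_in_mono: "supported_in N X \<Longrightarrow> N \<le> N' \<Longrightarrow> supported_in N' X"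
  unfolding supported_in_def using le_trans by blast

lemma supported_in_ge: "supp_bound X \<le> N \<Longrightarrow> supported_in N X"
  using supported_in_supp_bound supported_in_mono by blast

lemma supported_in_zero: "supported_in N X \<Longrightarrow> N \<le> i \<or> N \<le> j \<Longrightarrow> ent X i j = 0"
  by (auto simp: supported_in_def)

lemma sum_extend_zero:
  fixes f :: "nat \<Rightarrow> 'b :: comm_monoid_add"
  assumes "\<And>i. N \<le> i \<Longrightarrow> f i = 0" "\<And>i. N' \<le> i \<Longrightarrow> f i = 0"
  shows "sum f {..<N} = sum f {..<N'}"
proof -
  have "sum f {..<N} = sum f {..<max N N'}"
    by (rule sum.mono_neutral_left) (use assms in auto)
  moreover have "sum f {..<N'} = sum f {..<max N N'}"
    by (rule sum.mono_neutral_left) (use assms in auto)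
  ultimately show ?thesis by simp
qed

instantiation fsmat :: real_vector
begin

lift_definition zero_fsmat :: fsmat is "\<lambda>_ _. 0" by auto

lift_definition plus_fsmat :: "fsmat \<Rightarrow> fsmat \<Rightarrow> fsmat" is "\<lambda>f g i j. f i j + g i j"
proof -
  fix f g :: "nat \<Rightarrow> nat \<Rightarrow> real"
  assume "\<exists>N. \<forall>i j. N \<le> i \<or> N \<le> j \<longrightarrow> f i j = 0" "\<exists>N. \<forall>i j. N \<le> i \<or> N \<le> j \<longrightarrow> g i j = 0"
  then obtain M N where "\<forall>i j. M \<le> i \<or> M \<le> j \<longrightarrow> f i j = 0" "\<forall>i j. N \<le> i \<or> N \<le> j \<longrightarrow> g i j = 0"
    by blast
  then show "\<exists>N. \<forall>i j. N \<le> i \<or> N \<le> j \<longrightarrow> f i j + g i j = 0"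
    by (intro exI[of _ "max M N"]) auto
qed

lift_definition uminus_fsmat :: "fsmat \<Rightarrow> fsmat" is "\<lambda>f i j. - f i j" by auto

definition minus_fsmat :: "fsmat \<Rightarrow> fsmat \<Rightarrow> fsmat" where "minus_fsmat X Y = X + - Y"

lift_definition scaleR_fsmat :: "real \<Rightarrow> fsmat \<Rightarrow> fsmat" is "\<lambda>r f i j. r * f i j" by auto

lemmas rep_eqs = zero_fsmat.rep_eq plus_fsmat.rep_eq uminus_fsmat.rep_eq scaleR_fsmat.rep_eq

instance
proof
  fix X Y Z :: fsmat and r q :: real
  show "X + Y + Z = X + (Y + Z)" by (rule fsmat_eqI) (simp add: rep_eqs)
  show "X + Y = Y + X" by (rule fsmat_eqI) (simp add: rep_eqs)
  show "0 + X = X" by (rule fsmat_eqI) (simp add: rep_eqs)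
  show "- X + X = 0" by (rule fsmat_eqI) (simp add: rep_eqs)
  show "X - Y = X + - Y" by (rule minus_fsmat_def)
  show "r *\<^sub>R (X + Y) = r *\<^sub>R X + r *\<^sub>R Y" by (rule fsmat_eqI) (simp add: rep_eqs distrib_left)
  show "(r + q) *\<^sub>R X = r *\<^sub>R X + q *\<^sub>R X" by (rule fsmat_eqI) (simp add: rep_eqs distrib_right)
  show "r *\<^sub>R q *\<^sub>R X = (r * q) *\<^sub>R X" by (rule fsmat_eqI) (simp add: rep_eqs)
  show "1 *\<^sub>R X = X" by (rule fsmat_eqI) (simp add: rep_eqs)
qed

end

lemma ent_zero [simp]: "ent 0 i j = 0" by (simp add: zero_fsmat.rep_eq)
lemma ent_add [simp]: "ent (X + Y) i j = ent X i j + ent Y i j" by (simp add: plus_fsmat.rep_eq)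
lemma ent_uminus [simp]: "ent (- X) i j = - ent X i j" by (simp add: uminus_fsmat.rep_eq)
lemma ent_diff [simp]: "ent (X - Y) i j = ent X i j - ent Y i j"
  by (simp only: minus_fsmat_def ent_add ent_uminus)
lemma ent_scaleR [simp]: "ent (r *\<^sub>R X) i j = r * ent X i j" by (simp add: scaleR_fsmat.rep_eq)

lemma ent_sum [simp]: "ent (sum f A) i j = (\<Sum>a\<in>A. ent (f a) i j)"
  by (induction A rule: infinite_finite_induct) auto

lift_definition adj :: "fsmat \<Rightarrow> fsmat" is "\<lambda>f i j. f j i" by auto

lemma ent_adj [simp]: "ent (adj X) i j = ent X j i" by (simp add: adj.rep_eq)

instantiation fsmat :: ring
begin

lift_definition times_fsmat :: "fsmat \<Rightarrow> fsmat \<Rightarrow> fsmat" is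
  "\<lambda>f g i k. \<Sum>j<(LEAST N. \<forall>i j. N \<le> i \<or> N \<le> j \<longrightarrow> f i j = 0). f i j * g j k"
proof -
  fix f g :: "nat \<Rightarrow> nat \<Rightarrow> real"
  assume "\<exists>N. \<forall>i j. N \<le> i \<or> N \<le> j \<longrightarrow> f i j = 0" "\<exists>N. \<forall>i j. N \<le> i \<or> N \<le> j \<longrightarrow> g i j = 0"
  then obtain M N where "\<forall>i j. M \<le> i \<or> M \<le> j \<longrightarrow> f i j = 0" "\<forall>i j. N \<le> i \<or> N \<le> j \<longrightarrow> g i j = 0"
    by blast
  then show "\<exists>N. \<forall>i k. N \<le> i \<or> N \<le> k \<longrightarrow>
      (\<Sum>j<(LEAST N. \<forall>i j. N \<le> i \<or> N \<le> j \<longrightarrow> f i j = 0). f i j * g j k) = 0"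
    by (intro exI[of _ "max M N"]) (auto intro!: sum.neutral)
qed

lemma ent_times_raw: "ent (X * Y) i k = (\<Sum>j<supp_bound X. ent X i j * ent Y j k)"
  by (simp add: times_fsmat.rep_eq supp_bound_def supported_in_def)

text \<open>The definition sums up to the least bound of the left factor; any bound of either factor will do.\<close>

lemma ent_times:
  assumes "supported_in N X \<or> supported_in N Y"
  shows "ent (X * Y) i k = (\<Sum>j<N. ent X i j * ent Y j k)"
proof -
  have X: "\<And>j. supp_bound X \<le> j \<Longrightarrow> ent X i j * ent Y j k = 0"
    using supported_in_zero[OF supported_in_supp_bound] by simp
  have "\<And>j. N \<le> j \<Longrightarrow> ent X i j * ent Y j k = 0"
    using assms supported_in_zero by (metis mult_eq_0_iff)
  then show ?thesis
    unfolding ent_times_raw using X by (intro sum_extend_zero) auto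
qed

lemma supported_in_times:
  "supported_in N X \<Longrightarrow> supported_in N Y \<Longrightarrow> supported_in N (X * Y)"
  by (auto simp: supported_in_def ent_times_raw intro!: sum.neutral)

instance
proof
  fix X Y Z :: fsmat
  define N where "N = Max {supp_bound X, supp_bound Y, supp_bound Z, supp_bound (X + Y)}"
  have N: "supported_in N X" "supported_in N Y" "supported_in N Z" "supported_in N (X + Y)"
    by (auto intro!: supported_in_ge simp: N_def)
  show "X * Y * Z = X * (Y * Z)"
    by (rule fsmat_eqI)
      (simp add: ent_times[of N] N supported_in_times sum_distrib_left sum_distrib_right,
       subst sum.swap, simp add: mult.assoc)
  show "(X + Y) * Z = X * Z + Y * Z"
    by (rule fsmat_eqI) (simp add: ent_times[of N] N sum.distrib distrib_right)
  show "X * (Y + Z) = X * Y + X * Z"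
    by (rule fsmat_eqI) (simp add: ent_times[of N] N sum.distrib distrib_left)
qed

end

instance fsmat :: real_algebra
proof
  fix X Y :: fsmat and r :: real
  define N where "N = Max {supp_bound X, supp_bound Y, supp_bound (r *\<^sub>R X)}"
  have N: "supported_in N X" "supported_in N Y" "supported_in N (r *\<^sub>R X)"
    by (auto intro!: supported_in_ge simp: N_def)
  show "r *\<^sub>R X * Y = r *\<^sub>R (X * Y)" "X * r *\<^sub>R Y = r *\<^sub>R (X * Y)"
    by (auto intro!: fsmat_eqI simp: ent_times[of N] N sum_distrib_left algebra_simps)
qed

text \<open>The Frobenius norm is submultiplicative and comes from an inner product, so that the calculus of
normed algebras and the estimates of quadratic forms use the same norm.\<close>

instantiation fsmat :: real_inner
begin

definition inner_fsmat :: "fsmat \<Rightarrow> fsmat \<Rightarrow> real" where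
  "inner_fsmat X Y = (\<Sum>i<supp_bound X. \<Sum>j<supp_bound X. ent X i j * ent Y i j)"

definition norm_fsmat :: "fsmat \<Rightarrow> real" where "norm_fsmat X = sqrt (inner X X)"
definition sgn_fsmat :: "fsmat \<Rightarrow> fsmat" where "sgn_fsmat X = X /\<^sub>R norm X"
definition dist_fsmat :: "fsmat \<Rightarrow> fsmat \<Rightarrow> real" where "dist_fsmat X Y = norm (X - Y)"
definition uniformity_fsmat :: "(fsmat \<times> fsmat) filter" where
  "uniformity_fsmat = (INF e\<in>{0<..}. principal {(x, y). dist x y < e})"
definition open_fsmat :: "fsmat set \<Rightarrow> bool" where
  "open_fsmat U \<longleftrightarrow> (\<forall>x\<in>U. \<forall>\<^sub>F (x', y) in uniformity. x' = x \<longrightarrow> y \<in> U)"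

lemma inner_fsmat_eq:
  assumes "supported_in N X \<or> supported_in N Y"
  shows "inner X Y = (\<Sum>i<N. \<Sum>j<N. ent X i j * ent Y i j)"
proof -
  let ?B = "supp_bound X"
  have z1: "ent X i j * ent Y i j = 0" if "?B \<le> i \<or> ?B \<le> j" for i j
    using supported_in_zero[OF supported_in_supp_bound that] by simp
  have z2: "ent X i j * ent Y i j = 0" if "N \<le> i \<or> N \<le> j" for i j
    using supported_in_zero[OF _ that] assms by auto
  have "(\<Sum>i<?B. \<Sum>j<?B. ent X i j * ent Y i j) = (\<Sum>i<?B. \<Sum>j<N. ent X i j * ent Y i j)"
    by (intro sum.cong refl sum_extend_zero) (use z1 z2 in auto)
  also have "\<dots> = (\<Sum>i<N. \<Sum>j<N. ent X i j * ent Y i j)"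
    by (intro sum_extend_zero sum.neutral) (use z1 z2 in auto)
  finally show ?thesis by (simp add: inner_fsmat_def)
qed

instance
proof
  fix X Y Z :: fsmat and r :: real
  define N where "N = Max {supp_bound X, supp_bound Y, supp_bound Z}"
  have N: "supported_in N X" "supported_in N Y" "supported_in N Z"
    by (auto intro!: supported_in_ge simp: N_def)
  show "inner X Y = inner Y X"
    by (simp add: inner_fsmat_eq[of N] N mult.commute)
  show "inner (X + Y) Z = inner X Z + inner Y Z"
    by (simp add: inner_fsmat_eq[of N] N sum.distrib distrib_right)
  show "inner (r *\<^sub>R X) Y = r * inner X Y"
    by (simp add: inner_fsmat_eq[of N] N sum_distrib_left algebra_simps)
  show "0 \<le> inner X X" by (simp add: inner_fsmat_def sum_nonneg)
  show "inner X X = 0 \<longleftrightarrow> X = 0"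
  proof
    assume "inner X X = 0"
    then have "\<forall>i<N. \<forall>j<N. ent X i j = 0"
      by (simp add: inner_fsmat_eq[of N] N sum_nonneg_eq_0_iff sum_nonneg)
    then show "X = 0"
      using N(1) by (intro fsmat_eqI) (metis ent_zero supported_in_zero not_less)
  qed (simp add: inner_fsmat_def)
qed (simp_all add: norm_fsmat_def sgn_fsmat_def dist_fsmat_def uniformity_fsmat_def open_fsmat_def)

end

instance fsmat :: real_normed_algebra
proof
  fix X Y :: fsmat
  define N where "N = Max {supp_bound X, supp_bound Y}"
  have N: "supported_in N X" "supported_in N Y"
    by (auto intro!: supported_in_ge simp: N_def)
  have "inner (X * Y) (X * Y) = (\<Sum>i<N. \<Sum>k<N. (\<Sum>j<N. ent X i j * ent Y j k)\<^sup>2)"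
    by (simp add: inner_fsmat_eq[of N] ent_times[of N] N supported_in_times power2_eq_square)
  also have "\<dots> \<le> (\<Sum>i<N. \<Sum>k<N. (\<Sum>j<N. (ent X i j)\<^sup>2) * (\<Sum>j<N. (ent Y j k)\<^sup>2))"
    by (intro sum_mono Cauchy_Schwarz_ineq_sum)
  also have "\<dots> = (\<Sum>i<N. \<Sum>j<N. (ent X i j)\<^sup>2) * (\<Sum>k<N. \<Sum>j<N. (ent Y j k)\<^sup>2)"
    by (rule sum_product[symmetric])
  also have "\<dots> = inner X X * inner Y Y"
    using sum.swap[of "\<lambda>k j. (ent Y j k)\<^sup>2" "{..<N}" "{..<N}"]
    by (simp add: inner_fsmat_eq[of N] N power2_eq_square)
  finally show "norm (X * Y) \<le> norm X * norm Y"
    by (simp add: norm_fsmat_def real_sqrt_mult[symmetric])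
qed

lemma supported_in_adj: "supported_in N (adj X) \<longleftrightarrow> supported_in N X"
  by (auto simp: supported_in_def)

lemma adj_adj [simp]: "adj (adj X) = X" by (rule fsmat_eqI) simp
lemma adj_zero [simp]: "adj 0 = 0" by (rule fsmat_eqI) simp
lemma adj_add [simp]: "adj (X + Y) = adj X + adj Y" by (rule fsmat_eqI) simp
lemma adj_diff [simp]: "adj (X - Y) = adj X - adj Y" by (rule fsmat_eqI) simp
lemma adj_uminus [simp]: "adj (- X) = - adj X" by (rule fsmat_eqI) simp
lemma adj_scaleR [simp]: "adj (r *\<^sub>R X) = r *\<^sub>R adj X" by (rule fsmat_eqI) simp
lemma adj_inject [simp]: "adj X = adj Y \<longleftrightarrow> X = Y" by (metis adj_adj)

lemma adj_times [simp]: "adj (X * Y) = adj Y * adj X"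
proof (rule fsmat_eqI)
  fix i j
  have "supported_in (supp_bound X) X" by (rule supported_in_supp_bound)
  then show "ent (adj (X * Y)) i j = ent (adj Y * adj X) i j"
    by (simp add: ent_times[of "supp_bound X"] supported_in_adj mult.commute)
qed

lemma inner_adj_adj [simp]: "inner (adj X) (adj Y) = inner X Y"
  by (subst (1 2) inner_fsmat_eq[of "supp_bound X"])
    (auto simp: supported_in_adj supported_in_supp_bound intro: sum.swap)

lemma norm_adj [simp]: "norm (adj X) = norm X"
  by (simp add: norm_eq_sqrt_inner)

text \<open>Moving a factor to the other side of the inner product is the way in which \<open>adj\<close> enters all
computations with quadratic forms.\<close>

lemma inner_times_left: "inner (X * Y) Z = inner Y (adj X * Z)"
proof -
  define N where "N = Max {supp_bound X, supp_bound Y, supp_bound Z}"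
  have N: "supported_in N X" "supported_in N Y" "supported_in N Z" "supported_in N (adj X)"
    by (auto intro!: supported_in_ge simp: N_def supported_in_adj)
  have "inner (X * Y) Z = (\<Sum>i<N. \<Sum>k<N. \<Sum>j<N. ent X i j * ent Y j k * ent Z i k)"
    by (simp add: inner_fsmat_eq[of N] ent_times[of N] N supported_in_times sum_distrib_right)
  also have "\<dots> = (\<Sum>j<N. \<Sum>k<N. \<Sum>i<N. ent X i j * ent Y j k * ent Z i k)"
    by (subst sum.swap, subst (2) sum.swap, subst (1) sum.swap) simp
  also have "\<dots> = inner Y (adj X * Z)"
    by (simp add: inner_fsmat_eq[of N] ent_times[of N] N supported_in_times sum_distrib_left
        algebra_simps)
  finally show ?thesis .
qed

lemma inner_times_right: "inner (X * Y) Z = inner X (Z * adj Y)"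
  using inner_times_left[of "adj Y" "adj X" "adj Z"]
  by (metis adj_adj adj_times inner_adj_adj)

lemma bounded_linear_adj: "bounded_linear adj"
  by (rule bounded_linear_intro[of _ 1]) simp_all

subsection \<open>Elementary matrices and coordinates\<close>

lift_definition elem :: "nat \<Rightarrow> nat \<Rightarrow> fsmat" is "\<lambda>i j k l. if k = i \<and> l = j then 1 else 0"
  subgoal for i j by (intro exI[of _ "Suc (max i j)"]) auto
  done

lemma ent_elem: "ent (elem i j) k l = (if k = i \<and> l = j then 1 else 0)"
  by (simp add: elem.rep_eq)

subsection \<open>Matrices with dimensions inside the algebra\<close>

definition fm :: "real mat \<Rightarrow> fsmat" where
  "fm A = (\<Sum>i<dim_row A. \<Sum>j<dim_col A. (A $$ (i,j)) *\<^sub>R elem i j)"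

definition fv :: "real vec \<Rightarrow> fsmat" where
  "fv x = (\<Sum>i<dim_vec x. (x $ i) *\<^sub>R elem i 0)"

definition un :: "nat \<Rightarrow> fsmat" where "un n = fm (1\<^sub>m n)"

lemma ent_fm: "ent (fm A) i j = (if i < dim_row A \<and> j < dim_col A then A $$ (i,j) else 0)"
proof -
  have "(\<Sum>l<dim_col A. A $$ (k, l) * (if i = k \<and> j = l then 1 else 0))
      = (if i = k \<and> j < dim_col A then A $$ (k, j) else 0)" for k
    by (cases "i = k") (simp_all add: if_distrib cong: if_cong)
  then show ?thesis by (auto simp: fm_def ent_elem)
qed

lemma ent_fv: "ent (fv x) i j = (if i < dim_vec x \<and> j = 0 then x $ i else 0)"
  by (cases "j = 0") (simp_all add: fv_def ent_elem if_distrib cong: if_cong)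

lemma ent_un: "ent (un n) i j = (if i < n \<and> i = j then 1 else 0)"
  by (auto simp: un_def ent_fm)

lemma supported_in_fm: "dim_row A \<le> N \<Longrightarrow> dim_col A \<le> N \<Longrightarrow> supported_in N (fm A)"
  by (auto simp: supported_in_def ent_fm)

lemma fm_inject:
  assumes "A \<in> carrier_mat n m" "B \<in> carrier_mat n m" "fm A = fm B"
  shows "A = B"
proof (rule eq_matI)
  fix i j assume "i < dim_row B" "j < dim_col B"
  then show "A $$ (i,j) = B $$ (i,j)"
    using assms by (metis ent_fm carrier_matD)
qed (use assms in auto)

lemma fv_inject:
  assumes "x \<in> carrier_vec n" "y \<in> carrier_vec n" "fv x = fv y"
  shows "x = y"
proof (rule eq_vecI)
  fix i assume "i < dim_vec y"
  then show "x $ i = y $ i"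
    using assms by (metis ent_fv carrier_vecD)
qed (use assms in auto)

lemma fm_add: "A \<in> carrier_mat n m \<Longrightarrow> B \<in> carrier_mat n m \<Longrightarrow> fm (A + B) = fm A + fm B"
  by (rule fsmat_eqI) (auto simp: ent_fm)
lemma fm_diff: "A \<in> carrier_mat n m \<Longrightarrow> B \<in> carrier_mat n m \<Longrightarrow> fm (A - B) = fm A - fm B"
  by (rule fsmat_eqI) (auto simp: ent_fm)
lemma fm_uminus: "fm (- A) = - fm A"
  by (rule fsmat_eqI) (auto simp: ent_fm)
lemma fm_smult: "fm (r \<cdot>\<^sub>m A) = r *\<^sub>R fm A"
  by (rule fsmat_eqI) (auto simp: ent_fm)
lemma fm_transpose: "fm (transpose_mat A) = adj (fm A)"
  by (rule fsmat_eqI) (auto simp: ent_fm)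
lemma fm_zero: "fm (0\<^sub>m n m) = 0"
  by (rule fsmat_eqI) (auto simp: ent_fm)
lemma fm_times:
  assumes "dim_col A = dim_row B"
  shows "fm (A * B) = fm A * fm B"
proof (rule fsmat_eqI)
  fix i j
  define N where "N = Max {dim_row A, dim_col A}"
  have "supported_in N (fm A)" by (rule supported_in_fm) (auto simp: N_def)
  then have "ent (fm A * fm B) i j = (\<Sum>k<N. ent (fm A) i k * ent (fm B) k j)"
    by (simp add: ent_times[of N])
  also have "\<dots> = (\<Sum>k<dim_col A. ent (fm A) i k * ent (fm B) k j)"
    by (rule sum_extend_zero) (auto simp: ent_fm N_def)
  also have "\<dots> = ent (fm (A * B)) i j"
    using assms by (auto simp: ent_fm scalar_prod_def atLeast0LessThan)
  finally show "ent (fm (A * B)) i j = ent (fm A * fm B) i j" by simp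
qed

lemma fv_add: "x \<in> carrier_vec n \<Longrightarrow> y \<in> carrier_vec n \<Longrightarrow> fv (x + y) = fv x + fv y"
  by (rule fsmat_eqI) (auto simp: ent_fv)
lemma fv_diff: "x \<in> carrier_vec n \<Longrightarrow> y \<in> carrier_vec n \<Longrightarrow> fv (x - y) = fv x - fv y"
  by (rule fsmat_eqI) (auto simp: ent_fv)
lemma fv_uminus: "fv (- x) = - fv x"
  by (rule fsmat_eqI) (auto simp: ent_fv)
lemma fv_zero: "fv (0\<^sub>v n) = 0"
  by (rule fsmat_eqI) (auto simp: ent_fv)

lemma fv_as_fm: "fv x = fm (mat (dim_vec x) 1 (\<lambda>(i,_). x $ i))"
  by (rule fsmat_eqI) (auto simp: ent_fv ent_fm)

lemma fv_mult_mat: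
  assumes "dim_col A = dim_vec x"
  shows "fv (A *\<^sub>v x) = fm A * fv x"
proof -
  have "mat (dim_row A) 1 (\<lambda>(i,_). (A *\<^sub>v x) $ i) = A * mat (dim_vec x) 1 (\<lambda>(i,_). x $ i)"
    by (rule eq_matI) (use assms in \<open>auto simp: scalar_prod_def\<close>)
  then show ?thesis
    using assms by (simp add: fv_as_fm fm_times[symmetric])
qed

lemma inner_fv: "dim_vec x = dim_vec y \<Longrightarrow> inner (fv x) (fv y) = x \<bullet> y"
proof -
  assume d: "dim_vec x = dim_vec y"
  define N where "N = Suc (dim_vec x)"
  have "supported_in N (fv x)" by (auto simp: supported_in_def ent_fv N_def)
  then have "inner (fv x) (fv y) = (\<Sum>i<N. \<Sum>j<N. ent (fv x) i j * ent (fv y) i j)"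
    by (simp add: inner_fsmat_eq[of N])
  also have "\<dots> = (\<Sum>i<N. ent (fv x) i 0 * ent (fv y) i 0)"
  proof (rule sum.cong[OF refl])
    fix i
    have "(\<Sum>j<N. ent (fv x) i j * ent (fv y) i j) = (\<Sum>j\<in>{0}. ent (fv x) i j * ent (fv y) i j)"
      by (rule sum.mono_neutral_right) (auto simp: ent_fv N_def)
    then show "(\<Sum>j<N. ent (fv x) i j * ent (fv y) i j) = ent (fv x) i 0 * ent (fv y) i 0" by simp
  qed
  also have "\<dots> = (\<Sum>i<dim_vec x. ent (fv x) i 0 * ent (fv y) i 0)"
    by (rule sum_extend_zero) (auto simp: ent_fv N_def)
  also have "\<dots> = x \<bullet> y"
    using d by (auto simp: ent_fv scalar_prod_def atLeast0LessThan)
  finally show ?thesis .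
qed

lemma vnorm_fv: "vnorm x = norm (fv x)"
  by (simp add: vnorm_def norm_eq_sqrt_inner inner_fv)

lemma mnorm_fm: "mnorm A = norm (fm A)"
proof -
  define N where "N = max (dim_row A) (dim_col A)"
  have "inner (fm A) (fm A) = (\<Sum>i<N. \<Sum>j<N. (ent (fm A) i j)\<^sup>2)"
    by (subst inner_fsmat_eq[of N]) (auto simp: supported_in_fm N_def power2_eq_square)
  also have "\<dots> = (\<Sum>i<dim_row A. \<Sum>j<N. (ent (fm A) i j)\<^sup>2)"
    by (rule sum_extend_zero) (auto simp: ent_fm N_def)
  also have "\<dots> = (\<Sum>i<dim_row A. \<Sum>j<dim_col A. (ent (fm A) i j)\<^sup>2)"
    by (intro sum.cong refl sum_extend_zero) (auto simp: ent_fm N_def)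
  finally show ?thesis
    by (simp add: mnorm_def norm_eq_sqrt_inner ent_fm)
qed

definition shape :: "nat \<Rightarrow> nat \<Rightarrow> fsmat \<Rightarrow> bool" where
  "shape n m X \<longleftrightarrow> (\<forall>i j. n \<le> i \<or> m \<le> j \<longrightarrow> ent X i j = 0)"

lemma un_times: "shape n m X \<Longrightarrow> un n * X = X"
proof (rule fsmat_eqI)
  fix i j assume X: "shape n m X"
  have "ent (un n * X) i j = (\<Sum>k<n. ent (un n) i k * ent X k j)"
    by (subst ent_times[of n]) (auto simp: supported_in_def ent_un)
  also have "\<dots> = (\<Sum>k<n. if k = i then ent X k j else 0)"
    by (rule sum.cong) (auto simp: ent_un)
  also have "\<dots> = ent X i j" using X by (auto simp: shape_def)
  finally show "ent (un n * X) i j = ent X i j" .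
qed

lemma adj_un [simp]: "adj (un n) = un n"
  by (rule fsmat_eqI) (auto simp: ent_un)

lemma shape_adj: "shape n m X \<Longrightarrow> shape m n (adj X)"
  by (auto simp: shape_def)

lemma times_un: "shape n m X \<Longrightarrow> X * un m = X"
  using un_times[OF shape_adj, of n m X] by (metis adj_adj adj_times adj_un)

lemma shape_fm: "A \<in> carrier_mat n m \<Longrightarrow> shape n m (fm A)"
  by (auto simp: shape_def ent_fm)
lemma shape_fv: "x \<in> carrier_vec n \<Longrightarrow> shape n 1 (fv x)"
  by (auto simp: shape_def ent_fv)
lemma shape_un: "shape n n (un n)" by (auto simp: shape_def ent_un)
lemma shape_zero: "shape n m 0" by (auto simp: shape_def)
lemma shape_add: "shape n m X \<Longrightarrow> shape n m Y \<Longrightarrow> shape n m (X + Y)" by (auto simp: shape_def)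
lemma shape_diff: "shape n m X \<Longrightarrow> shape n m Y \<Longrightarrow> shape n m (X - Y)" by (auto simp: shape_def)
lemma shape_times: "shape n m X \<Longrightarrow> shape m' k Y \<Longrightarrow> shape n k (X * Y)"
  by (auto simp: shape_def ent_times_raw intro!: sum.neutral)

lemma shape_obtain_mat:
  assumes "shape n m X"
  obtains A where "A \<in> carrier_mat n m" "fm A = X"
proof
  show "mat n m (\<lambda>(i,j). ent X i j) \<in> carrier_mat n m" by simp
  show "fm (mat n m (\<lambda>(i,j). ent X i j)) = X"
    using assms by (intro fsmat_eqI) (auto simp: ent_fm shape_def)
qed

section \<open>Positive semidefinite elements\<close>

text \<open>The argument of the form ranges over all elements and not only over columns: the value at \<open>Z\<close> is the
sum of the values at the columns of \<open>Z\<close> (\<open>inner_columns\<close>), and forms in matrix arguments can then be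
estimated directly.\<close>

definition pos :: "fsmat \<Rightarrow> bool" where
  "pos X \<longleftrightarrow> adj X = X \<and> (\<forall>Z. 0 \<le> inner Z (X * Z))"

lemma posD: "pos X \<Longrightarrow> 0 \<le> inner Z (X * Z)" by (simp add: pos_def)
lemma pos_adj: "pos X \<Longrightarrow> adj X = X" by (simp add: pos_def)

lemma pos_congruence: "pos X \<Longrightarrow> pos (adj Y * X * Y)"
  by (simp add: pos_def mult.assoc) (metis inner_times_left adj_adj mult.assoc)

lemma pos_zero: "pos 0" by (simp add: pos_def)

lemma inner_le_norm: "inner Z ((X :: fsmat) * Z) \<le> norm X * (norm Z)\<^sup>2"
proof -
  have "inner Z (X * Z) \<le> norm Z * norm (X * Z)" by (rule norm_cauchy_schwarz)
  also have "\<dots> \<le> norm Z * (norm X * norm Z)"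
    by (rule mult_left_mono[OF norm_mult_ineq norm_ge_zero])
  finally show ?thesis by (simp add: power2_eq_square algebra_simps)
qed

lemma inner_ge_norm: "- (norm (X :: fsmat) * (norm Z)\<^sup>2) \<le> inner Z (X * Z)"
  using inner_le_norm[of Z "- X"] by simp

lemma pos_Cauchy_Schwarz:
  assumes "pos M"
  shows "(inner x (M * y))\<^sup>2 \<le> inner x (M * x) * inner y (M * y)"
proof -
  let ?a = "inner y (M * y)" and ?b = "inner x (M * y)" and ?c = "inner x (M * x)"
  have sym: "inner y (M * x) = ?b"
    using pos_adj[OF assms] by (metis inner_commute inner_times_left)
  have q: "0 \<le> ?c + 2 * r * ?b + r\<^sup>2 * ?a" for r
    using posD[OF assms, of "x + r *\<^sub>R y"] sym
    by (simp add: distrib_left inner_add_left inner_add_right power2_eq_square algebra_simps)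
  show ?thesis
  proof (cases "?a = 0")
    case True
    have "?b = 0"
    proof (rule ccontr)
      assume b: "?b \<noteq> 0"
      have "0 \<le> ?c + 2 * (- (?c + 1) / (2 * ?b)) * ?b" using q[of "- (?c + 1) / (2 * ?b)"] True by simp
      also have "\<dots> = - 1" using b by (simp add: field_simps)
      finally show False by simp
    qed
    then show ?thesis using True by simp
  next
    case False
    then have a: "?a > 0" using posD[OF assms, of y] by simp
    have "0 \<le> ?a * (?c + 2 * (- ?b / ?a) * ?b + (- ?b / ?a)\<^sup>2 * ?a)"
      using q[of "- ?b / ?a"] a by (intro mult_nonneg_nonneg) auto
    also have "\<dots> = ?a * ?c - ?b\<^sup>2" using a by (simp add: field_simps power2_eq_square)
    finally show ?thesis by (simp add: algebra_simps)
  qed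
qed

lemma square_le_cancel: "(x::real) * x \<le> c * x \<Longrightarrow> 0 \<le> c \<Longrightarrow> x \<le> c"
  by (cases "x \<le> 0") (auto simp: mult_le_cancel_right)

text \<open>Cauchy-Schwarz for the form of \<open>M\<close>, applied to \<open>x\<close> and \<open>M x\<close>. The estimate takes the place of a square
root of \<open>M\<close>.\<close>

lemma pos_norm_mult_sq:
  assumes "pos M" and k: "\<And>Z. inner Z (M * Z) \<le> k * (norm Z)\<^sup>2"
  shows "(norm (M * x))\<^sup>2 \<le> k * inner x (M * x)"
proof -
  let ?y = "M * x"
  have n: "(norm ?y)\<^sup>2 = inner x (M * ?y)"
    using pos_adj[OF assms(1)] by (metis inner_times_left power2_norm_eq_inner)
  have "((norm ?y)\<^sup>2)\<^sup>2 \<le> inner x (M * x) * inner ?y (M * ?y)"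
    unfolding n by (rule pos_Cauchy_Schwarz[OF assms(1)])
  also have "\<dots> \<le> inner x (M * x) * (k * (norm ?y)\<^sup>2)"
    using k posD[OF assms(1)] by (intro mult_left_mono) auto
  finally have "(norm ?y)\<^sup>2 * (norm ?y)\<^sup>2 \<le> (k * inner x (M * x)) * (norm ?y)\<^sup>2"
    by (simp add: power2_eq_square algebra_simps)
  moreover have "0 \<le> k * inner x (M * x)"
  proof (cases "x = 0")
    case False
    have "0 \<le> k * (norm x)\<^sup>2" using k[of x] posD[OF assms(1), of x] by linarith
    then have "0 \<le> k" using False by (simp add: zero_le_mult_iff)
    then show ?thesis using posD[OF assms(1), of x] by simp
  qed simp
  ultimately show ?thesis by (rule square_le_cancel)
qed

lemma pos_norm_mult_sq_norm: "pos M \<Longrightarrow> (norm (M * x))\<^sup>2 \<le> norm M * inner x (M * x)"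
  by (rule pos_norm_mult_sq) (auto intro: inner_le_norm)

lemma un_mult_un: "un m * un n = un (min m n)"
proof (rule fsmat_eqI)
  fix i j
  have "ent (un m * un n) i j = (\<Sum>k<m. ent (un m) i k * ent (un n) k j)"
    by (subst ent_times[of m]) (auto simp: supported_in_def ent_un)
  also have "\<dots> = (\<Sum>k<m. if k = i then ent (un n) k j else 0)"
    by (rule sum.cong) (auto simp: ent_un)
  also have "\<dots> = ent (un (min m n)) i j" by (auto simp: ent_un)
  finally show "ent (un m * un n) i j = ent (un (min m n)) i j" .
qed

lemma pos_un: "pos (un n)"
  unfolding pos_def
proof (intro conjI allI)
  fix Z
  have "inner Z (un n * Z) = inner (un n * Z) (un n * Z)"
    by (simp add: inner_times_left mult.assoc[symmetric] un_mult_un)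
  then show "0 \<le> inner Z (un n * Z)" by simp
qed simp

lemma norm_un_times_sq: "(norm (un n * Z))\<^sup>2 = inner Z (un n * Z)"
  by (simp add: power2_norm_eq_inner inner_times_left mult.assoc[symmetric] un_mult_un)

lemma norm_un_times_le: "norm (un n * Z) \<le> norm Z"
proof -
  have "(norm (un n * Z))\<^sup>2 \<le> norm Z * norm (un n * Z)"
    unfolding norm_un_times_sq by (rule norm_cauchy_schwarz)
  then show ?thesis
    by (cases "norm (un n * Z) = 0") (auto simp: power2_eq_square)
qed

lemma elem_pick: "ent (X * elem k l) i j = (if j = l then ent X i k else 0)"
proof -
  have "ent (X * elem k l) i j = (\<Sum>m<Suc (max k l). ent X i m * ent (elem k l) m j)"
    by (subst ent_times[of "Suc (max k l)"]) (auto simp: supported_in_def ent_elem)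
  also have "\<dots> = (\<Sum>m<Suc (max k l). if m = k then (if j = l then ent X i k else 0) else 0)"
    by (rule sum.cong) (auto simp: ent_elem)
  also have "\<dots> = (if j = l then ent X i k else 0)" by simp
  finally show ?thesis .
qed

lemma inner_elem: "inner (elem i j) X = ent X i j"
proof -
  let ?N = "Suc (max i j)"
  have "inner (elem i j) X = (\<Sum>k<?N. \<Sum>l<?N. ent (elem i j) k l * ent X k l)"
    by (rule inner_fsmat_eq) (auto simp: supported_in_def ent_elem)
  also have "\<dots> = (\<Sum>k<?N. \<Sum>l<?N. if l = j then (if k = i then ent X i j else 0) else 0)"
    by (intro sum.cong refl) (simp add: ent_elem)
  also have "\<dots> = ent X i j" by simp
  finally show ?thesis .
qed

lemma adj_elem: "adj (elem i j) = elem j i" by (rule fsmat_eqI) (auto simp: ent_elem)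

lemma inner_elem_times: "inner (elem k 0) (X * elem l 0) = ent X k l"
  by (simp add: inner_elem elem_pick)

text \<open>Subtracting from \<open>B\<close> the rank-one matrix built from a column with nonzero diagonal entry leaves a
positive semidefinite matrix in which one more row and column vanish, and \<open>P\<close> is nonnegative on the
rank-one part. Induction on the number of nonzero diagonal entries reduces \<open>B\<close> to zero.\<close>

lemma pos_trace_product:
  assumes "pos P" "pos B"
  shows "0 \<le> inner P B"
proof -
  have "0 \<le> inner P B"
    if "pos B" "card {k. ent B k k \<noteq> 0} = c" "finite {k. ent B k k \<noteq> 0}" for c B
    using that
  proof (induction c arbitrary: B rule: less_induct)
    case (less c)
    have sym: "ent B i j = ent B j i" for i j
      using pos_adj[OF less.prems(1)] by (metis ent_adj)
    have CS: "(ent B i j)\<^sup>2 \<le> ent B i i * ent B j j" for i j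
      using pos_Cauchy_Schwarz[OF less.prems(1), of "elem i 0" "elem j 0"]
      by (simp add: inner_elem_times)
    show ?case
    proof (cases "\<exists>k. ent B k k \<noteq> 0")
      case False
      then have "ent B i j = 0" for i j using CS[of i j] by simp
      then have "B = 0" by (intro fsmat_eqI) simp
      then show ?thesis by simp
    next
      case True
      then obtain k where k: "ent B k k \<noteq> 0" by blast
      then have kp: "ent B k k > 0"
        using posD[OF less.prems(1), of "elem k 0"] by (simp add: inner_elem_times)
      define b where "b = B * elem k 0"
      define B' where "B' = B - (1 / ent B k k) *\<^sub>R (b * adj b)"
      have eb: "ent b i j = (if j = 0 then ent B i k else 0)" for i j
        by (simp add: b_def elem_pick)
      have ebb: "ent (b * adj b) i j = ent B i k * ent B j k" for i j
      proof -
        define N where "N = Suc (supp_bound b)"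
        have "supported_in N b" unfolding N_def by (rule supported_in_ge) simp
        then have "ent (b * adj b) i j = (\<Sum>l<N. ent b i l * ent (adj b) l j)"
          by (simp add: ent_times[of N])
        also have "\<dots> = (\<Sum>l<N. if l = 0 then ent B i k * ent B j k else 0)"
          by (rule sum.cong) (auto simp: eb)
        finally show ?thesis by (simp add: N_def)
      qed
      have eB': "ent B' i j = ent B i j - ent B i k * ent B j k / ent B k k" for i j
        by (simp add: B'_def ebb)
      have bz: "inner z (b * adj b * z) \<le> ent B k k * inner z (B * z)" for z
      proof -
        \<comment> \<open>Cauchy-Schwarz is applied to \<open>z\<close> column by column, through \<open>elem k 0 * adj b * z\<close>.\<close>
        define w where "w = elem k 0 * (adj b * z)"
        have e: "b * adj b * z = B * w" by (simp add: b_def w_def mult.assoc)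
        have "inner w (B * w) = ent B k k * (norm (adj b * z))\<^sup>2"
        proof -
          have "elem 0 k * B * elem k 0 = ent B k k *\<^sub>R elem 0 0"
          proof (rule fsmat_eqI)
            fix i j
            have "ent (elem 0 k * (B * elem k 0)) i j = ent (adj (adj (B * elem k 0) * elem k 0)) i j"
              by (simp add: adj_elem)
            also have "\<dots> = (if i = 0 \<and> j = 0 then ent B k k else 0)"
              by (simp only: ent_adj elem_pick) (auto simp: elem_pick)
            finally show "ent (elem 0 k * B * elem k 0) i j = ent (ent B k k *\<^sub>R elem 0 0) i j"
              by (simp add: mult.assoc ent_elem)
          qed
          moreover have "elem 0 0 * (adj b * z) = adj b * z"
          proof -
            have "b * elem 0 0 = b" by (rule fsmat_eqI) (auto simp: elem_pick eb)
            then have "elem 0 0 * adj b = adj b" by (metis adj_elem adj_times)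
            then show ?thesis by (simp add: mult.assoc[symmetric])
          qed
          moreover have "inner w (B * w) = inner (adj b * z) (elem 0 k * B * elem k 0 * (adj b * z))"
            by (simp add: w_def inner_times_left adj_elem mult.assoc)
          ultimately show ?thesis by (simp add: power2_norm_eq_inner)
        qed
        moreover have "inner z (b * adj b * z) = (norm (adj b * z))\<^sup>2"
          by (simp add: power2_norm_eq_inner inner_times_left mult.assoc)
        moreover have "(inner z (B * w))\<^sup>2 \<le> inner z (B * z) * inner w (B * w)"
          by (rule pos_Cauchy_Schwarz[OF less.prems(1)])
        ultimately have "((norm (adj b * z))\<^sup>2) * ((norm (adj b * z))\<^sup>2)
            \<le> (ent B k k * inner z (B * z)) * (norm (adj b * z))\<^sup>2"
          using e by (simp add: power2_eq_square algebra_simps)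
        moreover have "0 \<le> ent B k k * inner z (B * z)"
          using kp posD[OF less.prems(1)] by simp
        ultimately have "(norm (adj b * z))\<^sup>2 \<le> ent B k k * inner z (B * z)"
          by (rule square_le_cancel)
        then show ?thesis using \<open>inner z (b * adj b * z) = _\<close> by simp
      qed
      have "pos B'"
        unfolding pos_def
      proof (intro conjI allI)
        show "adj B' = B'" using sym by (intro fsmat_eqI) (simp add: eB' mult.commute)
        fix z
        have "inner z (B' * z) = inner z (B * z) - inner z (b * adj b * z) / ent B k k"
          by (simp add: B'_def left_diff_distrib inner_diff_right)
        moreover have "inner z (b * adj b * z) / ent B k k \<le> inner z (B * z)"
          using bz[of z] kp by (simp add: divide_le_eq mult.commute)
        ultimately show "0 \<le> inner z (B' * z)" by simp
      qed
      moreover have sub: "{i. ent B' i i \<noteq> 0} \<subset> {i. ent B i i \<noteq> 0}"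
      proof -
        have "ent B' k k = 0" using k by (simp add: eB')
        moreover have "ent B' i i = 0" if "ent B i i = 0" for i
          using that CS[of i k] by (simp add: eB')
        ultimately show ?thesis using k by auto
      qed
      ultimately have "0 \<le> inner P B'"
        using less.IH[of "card {i. ent B' i i \<noteq> 0}" B'] less.prems
        by (metis finite_subset psubset_card_mono psubset_imp_subset)
      moreover have "inner P B = inner P B' + (1 / ent B k k) * inner b (P * b)"
        by (simp add: B'_def inner_diff_right inner_times_right inner_commute[of P])
      moreover have "0 \<le> inner b (P * b)" using assms(1) by (rule posD)
      ultimately show ?thesis using kp by simp
    qed
  qed
  moreover have "finite {k. ent B k k \<noteq> 0}"
  proof (rule finite_subset)
    show "{k. ent B k k \<noteq> 0} \<subseteq> {..<supp_bound B}"
      using supported_in_zero[OF supported_in_supp_bound[of B]] not_le by blast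
  qed simp
  ultimately show ?thesis using assms(2) by blast
qed

subsection \<open>Transfer of definiteness\<close>

lemma sum_elem_diag: "(\<Sum>j<n. elem j j) = un n"
proof (rule fsmat_eqI)
  fix k l
  show "ent (\<Sum>j<n. elem j j) k l = ent (un n) k l"
    by (cases "k = l") (auto simp: ent_elem ent_un)
qed

lemma elem_times_elem: "elem i j * elem j k = elem i k"
  by (rule fsmat_eqI) (simp add: elem_pick, simp add: ent_elem)

lemma inner_columns:
  assumes "shape n m Z"
  shows "inner Z (X * Z) = (\<Sum>j<m. inner (Z * elem j 0) (X * (Z * elem j 0)))"
proof -
  have "inner (Z * elem j 0) (X * (Z * elem j 0)) = inner Z (X * Z * elem j j)" for j
    by (simp add: inner_times_right adj_elem mult.assoc elem_times_elem)
  then have "(\<Sum>j<m. inner (Z * elem j 0) (X * (Z * elem j 0))) = inner Z (X * Z * un m)"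
    by (simp add: sum_elem_diag[symmetric] sum_distrib_left inner_sum_right)
  then show ?thesis using assms by (simp add: mult.assoc times_un)
qed

lemma column_obtain_vec:
  assumes "shape n m Z"
  obtains x where "x \<in> carrier_vec n" "fv x = Z * elem j 0"
proof
  show "vec n (\<lambda>i. ent Z i j) \<in> carrier_vec n" by simp
  show "fv (vec n (\<lambda>i. ent Z i j)) = Z * elem j 0"
    using assms by (intro fsmat_eqI) (auto simp: ent_fv elem_pick shape_def)
qed

lemma shape_supp: "shape n (supp_bound Z) (un n * Z)"
proof -
  have "shape (supp_bound Z) (supp_bound Z) Z"
    using supported_in_supp_bound[of Z] by (auto simp: shape_def supported_in_def)
  then show ?thesis by (rule shape_times[OF shape_un])
qed

text \<open>A bound for the form on vectors is applied to each column of \<open>un n * Z\<close>.\<close>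

lemma inner_vec_ge_imp:
  assumes A: "A \<in> carrier_mat n n"
    and ge: "\<And>x. x \<in> carrier_vec n \<Longrightarrow> c * (x \<bullet> x) \<le> x \<bullet> (A *\<^sub>v x)"
  shows "c * (norm (un n * Z))\<^sup>2 \<le> inner Z (fm A * Z)"
proof -
  define Y where "Y = un n * Z"
  define m where "m = supp_bound Z"
  have Y: "shape n m Y" unfolding Y_def m_def by (rule shape_supp)
  have AY: "inner Z (fm A * Z) = inner Y (fm A * Y)"
  proof -
    have "fm A = un n * fm A * un n"
      using un_times[OF shape_fm[OF A]] times_un[OF shape_fm[OF A]] by simp
    then have "inner Z (fm A * Z) = inner Z (un n * fm A * un n * Z)" by simp
    then show ?thesis by (simp add: Y_def inner_times_left mult.assoc)
  qed
  have c: "c * inner (Y * elem j 0) (Y * elem j 0) \<le> inner (Y * elem j 0) (fm A * (Y * elem j 0))" for j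
  proof -
    obtain x where x: "x \<in> carrier_vec n" "fv x = Y * elem j 0"
      using column_obtain_vec[OF Y] by blast
    have "inner (fv x) (fv (A *\<^sub>v x)) = x \<bullet> (A *\<^sub>v x)"
      by (rule inner_fv) (use x A in simp)
    then have "inner (fv x) (fm A * fv x) = x \<bullet> (A *\<^sub>v x)"
      using x A by (simp add: fv_mult_mat)
    moreover have "inner (fv x) (fv x) = x \<bullet> x" by (rule inner_fv) simp
    ultimately show ?thesis using ge[OF x(1)] x(2) by simp
  qed
  have "inner Y Y = inner Y (un n * Y)" using un_times[OF Y] by simp
  also have "\<dots> = (\<Sum>j<m. inner (Y * elem j 0) (un n * (Y * elem j 0)))" by (rule inner_columns[OF Y])
  also have "\<dots> = (\<Sum>j<m. inner (Y * elem j 0) (Y * elem j 0))"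
    using un_times[OF Y] by (simp add: mult.assoc[symmetric])
  finally have "c * inner Y Y \<le> inner Y (fm A * Y)"
    unfolding inner_columns[OF Y, of "fm A"] by (simp add: sum_distrib_left sum_mono c)
  then show ?thesis by (simp add: AY Y_def power2_norm_eq_inner)
qed

lemma psd_iff_pos: "psd n A \<longleftrightarrow> A \<in> carrier_mat n n \<and> pos (fm A)"
proof
  assume p: "psd n A"
  then have A: "A \<in> carrier_mat n n" "transpose_mat A = A"
    and ge: "\<And>x. x \<in> carrier_vec n \<Longrightarrow> 0 * (x \<bullet> x) \<le> x \<bullet> (A *\<^sub>v x)" by (auto simp: psd_def)
  show "A \<in> carrier_mat n n \<and> pos (fm A)"
    using A inner_vec_ge_imp[OF A(1) ge] fm_transpose[of A] by (simp add: pos_def)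
next
  assume p: "A \<in> carrier_mat n n \<and> pos (fm A)"
  then have A: "A \<in> carrier_mat n n" by simp
  have "transpose_mat A = A"
    using A p by (intro fm_inject[of _ n n]) (auto simp: fm_transpose pos_adj)
  moreover have "0 \<le> x \<bullet> (A *\<^sub>v x)" if "x \<in> carrier_vec n" for x
  proof -
    have "inner (fv x) (fv (A *\<^sub>v x)) = x \<bullet> (A *\<^sub>v x)"
      by (rule inner_fv) (use that A in simp)
    then have "x \<bullet> (A *\<^sub>v x) = inner (fv x) (fm A * fv x)"
      using that A by (simp add: fv_mult_mat)
    then show ?thesis using p posD by auto
  qed
  ultimately show "psd n A" using A by (simp add: psd_def)
qed

lemma posdef_imp_psd: "posdef n A \<Longrightarrow> psd n A"
  unfolding posdef_def psd_def by (metis less_eq_real_def scalar_prod_left_zero mult_mat_vec_carrier)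

lemma mult_mat_vec_zero_iff:
  assumes "A \<in> carrier_mat n m" "x \<in> carrier_vec m"
  shows "A *\<^sub>v x = 0\<^sub>v n \<longleftrightarrow> fm A * fv x = 0"
proof -
  have "fm A * fv x = fv (A *\<^sub>v x)" using assms by (simp add: fv_mult_mat)
  moreover have "fv (A *\<^sub>v x) = 0 \<longleftrightarrow> A *\<^sub>v x = 0\<^sub>v n"
    using assms fv_inject[of "A *\<^sub>v x" n "0\<^sub>v n"] by (auto simp: fv_zero)
  ultimately show ?thesis by simp
qed

text \<open>An injective square matrix has nonzero determinant, so the elimination behind \<open>minv\<close> returns an
inverse and not the default value.\<close>

lemma minv_of_injective:
  assumes A: "A \<in> carrier_mat n n"
    and inj: "\<And>x. x \<in> carrier_vec n \<Longrightarrow> A *\<^sub>v x = 0\<^sub>v n \<Longrightarrow> x = 0\<^sub>v n"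
  shows "minv A \<in> carrier_mat n n" "fm A * fm (minv A) = un n" "fm (minv A) * fm A = un n"
proof -
  have "det A \<noteq> 0" using inj det_0_iff_vec_prod_zero_field[OF A] by blast
  then have "A \<in> Units (ring_mat TYPE(real) n ())" by (rule det_non_zero_imp_unit[OF A])
  then obtain B where B: "mat_inverse A = Some B" using mat_inverse(1)[OF A, of "()"]
    by (cases "mat_inverse A") auto
  from mat_inverse(2)[OF A B] have inv: "A * B = 1\<^sub>m n" "B * A = 1\<^sub>m n" "B \<in> carrier_mat n n" by auto
  then show "minv A \<in> carrier_mat n n" "fm A * fm (minv A) = un n" "fm (minv A) * fm A = un n"
    using A B by (auto simp: minv_def un_def fm_times[symmetric])
qed

lemma minv_carrier: "A \<in> carrier_mat n n \<Longrightarrow> minv A \<in> carrier_mat n n"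
  using mat_inverse(2)[of A n] by (auto simp: minv_def split: option.split)

lemma posdef_injective:
  assumes "posdef n A" "x \<in> carrier_vec n" "A *\<^sub>v x = 0\<^sub>v n"
  shows "x = 0\<^sub>v n"
  using assms unfolding posdef_def by (metis less_irrefl scalar_prod_right_zero)

lemma minv_posdef:
  assumes "posdef n A"
  shows "minv A \<in> carrier_mat n n" "fm A * fm (minv A) = un n" "fm (minv A) * fm A = un n"
    "pos (fm (minv A))"
proof -
  have A: "A \<in> carrier_mat n n" using assms by (simp add: posdef_def)
  note i = minv_of_injective[OF A posdef_injective[OF assms]]
  show "minv A \<in> carrier_mat n n" "fm A * fm (minv A) = un n" "fm (minv A) * fm A = un n"
    using i by auto
  let ?B = "fm (minv A)"
  have p: "pos (fm A)" using posdef_imp_psd[OF assms] by (simp add: psd_iff_pos)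
  have B: "un n * ?B = ?B" "?B * un n = ?B" using shape_fm[OF i(1)] by (auto intro: un_times times_un)
  have adjB: "adj ?B = ?B"
  proof -
    have "adj ?B * fm A = un n" using i(2) by (metis adj_times adj_un p pos_adj)
    then have "adj ?B * fm A * ?B = ?B" using B by simp
    then have "adj ?B * un n = ?B" using i(2) by (simp add: mult.assoc)
    moreover have "adj ?B * un n = adj ?B" using shape_fm[OF i(1)] by (intro times_un shape_adj)
    ultimately show ?thesis by simp
  qed
  have "adj ?B * fm A * ?B = ?B" using i B by (simp add: adjB)
  then show "pos ?B" using pos_congruence[OF p, of ?B] by simp
qed

section \<open>Calculus in the algebra\<close>

text \<open>The image of a matrix is a fixed finite combination of elementary matrices with its entries as
coefficients; entrywise derivatives are therefore derivatives in the normed algebra.\<close>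

lemma has_mderiv_fm:
  assumes "has_mderiv a X X' t" "a \<le> t" and c: "\<And>s. a \<le> s \<Longrightarrow> X s \<in> carrier_mat n m"
  shows "((\<lambda>s. fm (X s)) has_vector_derivative fm X') (at t within {a..})"
proof -
  have X': "X' \<in> carrier_mat n m" using assms(1) c[OF assms(2)] by (auto simp: has_mderiv_def)
  have "((\<lambda>s. \<Sum>i<n. \<Sum>j<m. X s $$ (i,j) *\<^sub>R elem i j) has_vector_derivative
      (\<Sum>i<n. \<Sum>j<m. X' $$ (i,j) *\<^sub>R elem i j)) (at t within {a..})"
  proof (intro derivative_intros)
    fix i j assume "i \<in> {..<n}" "j \<in> {..<m}"
    then have "((\<lambda>s. X s $$ (i,j)) has_real_derivative X' $$ (i,j)) (at t within {a..})"
      using assms(1) c[OF assms(2)] by (auto simp: has_mderiv_def)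
    from has_vector_derivative_scaleR[OF this has_vector_derivative_const[of "elem i j"]]
    show "((\<lambda>s. X s $$ (i,j) *\<^sub>R elem i j) has_vector_derivative X' $$ (i,j) *\<^sub>R elem i j) (at t within {a..})"
      by simp
  qed
  moreover have "(\<Sum>i<n. \<Sum>j<m. X' $$ (i,j) *\<^sub>R elem i j) = fm X'" using X' by (simp add: fm_def)
  moreover have e: "(\<Sum>i<n. \<Sum>j<m. X s $$ (i,j) *\<^sub>R elem i j) = fm (X s)" if "s \<in> {a..}" for s
    using c[of s] that by (simp add: fm_def)
  ultimately have "((\<lambda>s. \<Sum>i<n. \<Sum>j<m. X s $$ (i,j) *\<^sub>R elem i j) has_vector_derivative fm X')
      (at t within {a..})" by simp
  then show ?thesis
    by (rule has_vector_derivative_transform[rotated 2]) (use assms(2) e in auto)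
qed

lemma has_vector_derivative_ent:
  "(f has_vector_derivative f') F \<Longrightarrow> ((\<lambda>s. ent (f s) i j) has_real_derivative ent f' i j) F"
  using bounded_linear.has_vector_derivative[OF bounded_linear_inner_right[of "elem i j"]]
  by (simp add: inner_elem has_real_derivative_iff_has_vector_derivative)

lemma has_mderiv_of_fm:
  assumes d: "(Y has_vector_derivative fm X') (at t within {a..})" and "a \<le> t"
    and Y: "\<And>s. a \<le> s \<Longrightarrow> Y s = fm (X s)"
    and c: "\<And>s. a \<le> s \<Longrightarrow> X s \<in> carrier_mat n m" "X' \<in> carrier_mat n m"
  shows "has_mderiv a X X' t"
  unfolding has_mderiv_def
proof (intro conjI allI impI)
  show "dim_row X' = dim_row (X t)" "dim_col X' = dim_col (X t)" using c assms(2) by auto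
  fix i j assume ij: "i < dim_row (X t)" "j < dim_col (X t)"
  then have "i < n" "j < m" using c(1)[OF assms(2)] by auto
  then have "((\<lambda>s. ent (Y s) i j) has_real_derivative X' $$ (i,j)) (at t within {a..})"
    using has_vector_derivative_ent[OF d, of i j] c(2) by (simp add: ent_fm)
  then show "((\<lambda>s. X s $$ (i,j)) has_real_derivative X' $$ (i,j)) (at t within {a..})"
    by (rule has_field_derivative_transform_within[where d = 1])
      (use assms(2) Y c \<open>i < n\<close> \<open>j < m\<close> in \<open>auto simp: ent_fm\<close>)
qed

lemma has_vderiv_iff_has_mderiv:
  assumes t: "a \<le> t" and c: "\<And>s. a \<le> s \<Longrightarrow> x s \<in> carrier_vec n" and x': "x' \<in> carrier_vec n"
  shows "has_vderiv a x x' t \<longleftrightarrow>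
    has_mderiv a (\<lambda>s. mat n 1 (\<lambda>(i,_). x s $ i)) (mat n 1 (\<lambda>(i,_). x' $ i)) t"
proof -
  have "dim_vec (x t) = n" "dim_vec x' = n" using c[OF t] x' by auto
  then show ?thesis by (auto simp: has_vderiv_def has_mderiv_def)
qed

lemma has_vderiv_fv:
  assumes d: "has_vderiv a x x' t" and t: "a \<le> t" and c: "\<And>s. a \<le> s \<Longrightarrow> x s \<in> carrier_vec n"
  shows "((\<lambda>s. fv (x s)) has_vector_derivative fv x') (at t within {a..})"
proof -
  have x': "x' \<in> carrier_vec n"
    using d carrier_vecD[OF c[OF t]] by (intro carrier_vecI) (simp add: has_vderiv_def)
  have "((\<lambda>s. fm (mat n 1 (\<lambda>(i,_). x s $ i))) has_vector_derivative
      fm (mat n 1 (\<lambda>(i,_). x' $ i))) (at t within {a..})"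
    by (rule has_mderiv_fm[where n = n and m = 1])
      (use d has_vderiv_iff_has_mderiv[OF t c x'] t in auto)
  moreover have e: "fm (mat n 1 (\<lambda>(i,_). y $ i)) = fv y" if "y \<in> carrier_vec n" for y
    using that by (simp add: fv_as_fm)
  ultimately have "((\<lambda>s. fm (mat n 1 (\<lambda>(i,_). x s $ i))) has_vector_derivative fv x') (at t within {a..})"
    using x' by simp
  then show ?thesis
    by (rule has_vector_derivative_transform[rotated 2]) (use t c e in auto)
qed

lemma has_vderiv_of_fv:
  assumes d: "(Y has_vector_derivative fv x') (at t within {a..})" and t: "a \<le> t"
    and Y: "\<And>s. a \<le> s \<Longrightarrow> Y s = fv (x s)"
    and c: "\<And>s. a \<le> s \<Longrightarrow> x s \<in> carrier_vec n" "x' \<in> carrier_vec n"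
  shows "has_vderiv a x x' t"
proof -
  have e: "fm (mat n 1 (\<lambda>(i,_). y $ i)) = fv y" if "y \<in> carrier_vec n" for y
    using that by (simp add: fv_as_fm)
  have "has_mderiv a (\<lambda>s. mat n 1 (\<lambda>(i,_). x s $ i)) (mat n 1 (\<lambda>(i,_). x' $ i)) t"
    by (rule has_mderiv_of_fm[where Y = Y and n = n and m = 1]) (use d t Y c e in auto)
  then show ?thesis by (simp only: has_vderiv_iff_has_mderiv[of a t x n, OF t c])
qed

lemma has_vector_derivative_adj:
  "(f has_vector_derivative f') F \<Longrightarrow> ((\<lambda>s. adj (f s)) has_vector_derivative adj f') F"
  by (rule bounded_linear.has_vector_derivative[OF bounded_linear_adj])

lemma has_vector_derivative_inner:
  "(f has_vector_derivative f') (at t within T) \<Longrightarrow> (g has_vector_derivative g') (at t within T) \<Longrightarrow>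
    ((\<lambda>s. inner (f s) (g s) :: real) has_real_derivative inner (f t) g' + inner f' (g t)) (at t within T)"
  unfolding has_real_derivative_iff_has_vector_derivative
  by (rule bounded_bilinear.has_vector_derivative[OF bounded_bilinear_inner])

lemma continuous_on_adj [continuous_intros]:
  "continuous_on T f \<Longrightarrow> continuous_on T (\<lambda>s. adj (f s))"
  by (rule bounded_linear.continuous_on[OF bounded_linear_adj])

lemma has_vector_derivative_within_iff:
  fixes f :: "real \<Rightarrow> 'b :: real_normed_vector"
  shows "(f has_vector_derivative f') (at t within T) \<longleftrightarrow>
    ((\<lambda>s. (f s - f t) /\<^sub>R (s - t)) \<longlongrightarrow> f') (at t within T)"
proof -
  have "norm ((f s - f t) - (s - t) *\<^sub>R f') / norm (s - t) = norm ((f s - f t) /\<^sub>R (s - t) - f')"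
    if "s \<noteq> t" for s
  proof -
    have "(f s - f t) /\<^sub>R (s - t) - f' = ((f s - f t) - (s - t) *\<^sub>R f') /\<^sub>R (s - t)"
      using that by (simp add: scaleR_diff_right)
    then show ?thesis by (simp add: divide_inverse mult.commute)
  qed
  then have "((\<lambda>s. norm ((f s - f t) - (s - t) *\<^sub>R f') / norm (s - t)) \<longlongrightarrow> 0) (at t within T) \<longleftrightarrow>
      ((\<lambda>s. norm ((f s - f t) /\<^sub>R (s - t) - f')) \<longlongrightarrow> 0) (at t within T)"
    by (intro Lim_cong_within) auto
  also have "\<dots> \<longleftrightarrow> ((\<lambda>s. (f s - f t) /\<^sub>R (s - t)) \<longlongrightarrow> f') (at t within T)"
    by (simp only: tendsto_norm_zero_iff LIM_zero_iff)
  finally show ?thesis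
    by (simp add: has_vector_derivative_def has_derivative_iff_norm bounded_linear_scaleR_left)
qed

lemma norm_mult3_le: "norm (x * y * z) \<le> norm x * (norm y * norm z)"
  for x y z :: "'b :: real_normed_algebra"
  unfolding mult.assoc
  by (rule order_trans[OF norm_mult_ineq mult_left_mono[OF norm_mult_ineq norm_ge_zero]])

text \<open>Differentiability of an inverse relative to a corner unit \<open>u\<close>: the resolvent identity
  \<open>b s - b t = - b s (a s - a t) b t\<close> gives local boundedness, then continuity, then the derivative.\<close>

lemma inverse_has_vector_derivative:
  fixes a b :: "real \<Rightarrow> fsmat"
  assumes d: "(a has_vector_derivative a') (at t within T)" and t: "t \<in> T"
    and ab: "\<And>s. s \<in> T \<Longrightarrow> a s * b s = u" "\<And>s. s \<in> T \<Longrightarrow> b s * a s = u"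
    and ub: "\<And>s. s \<in> T \<Longrightarrow> u * b s = b s" "\<And>s. s \<in> T \<Longrightarrow> b s * u = b s"
  shows "(b has_vector_derivative - (b t * a' * b t)) (at t within T)"
proof -
  have res: "b s - b t = - (b s * (a s - a t) * b t)" if "s \<in> T" for s
  proof -
    have "b s * (a s - a t) * b t = b s * a s * b t - b s * (a t * b t)"
      by (simp add: algebra_simps)
    also have "\<dots> = b t - b s" using ab ub t that by simp
    finally show ?thesis by simp
  qed
  have la: "((\<lambda>s. a s - a t) \<longlongrightarrow> 0) (at t within T)"
    using has_vector_derivative_continuous[OF d] by (simp add: continuous_within LIM_zero)
  then have "((\<lambda>s. norm (a s - a t) * norm (b t)) \<longlongrightarrow> 0) (at t within T)"
    by (intro tendsto_mult_left_zero tendsto_norm_zero)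
  then have "eventually (\<lambda>s. norm (a s - a t) * norm (b t) < 1/2) (at t within T)"
    by (rule order_tendstoD) simp
  then have small: "eventually (\<lambda>s. norm (a s - a t) * norm (b t) < 1/2 \<and> s \<in> T) (at t within T)"
    by (simp add: eventually_at_filter eventually_conj_iff)
  have bd: "eventually (\<lambda>s. norm (b s) \<le> 2 * norm (b t)) (at t within T)"
    using small
  proof (rule eventually_mono)
    fix s assume s: "norm (a s - a t) * norm (b t) < 1/2 \<and> s \<in> T"
    have "b s = b t - b s * (a s - a t) * b t" using res[of s] s by (simp add: algebra_simps)
    then have "norm (b s) \<le> norm (b t) + norm (b s * (a s - a t) * b t)" by (metis norm_triangle_ineq4)
    also have "norm (b s * (a s - a t) * b t) \<le> norm (b s) * (norm (a s - a t) * norm (b t))"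
      by (rule norm_mult3_le)
    also have "\<dots> \<le> norm (b s) * (1/2)" using s by (intro mult_left_mono) auto
    finally show "norm (b s) \<le> 2 * norm (b t)" by simp
  qed
  have "((\<lambda>s. b s - b t) \<longlongrightarrow> 0) (at t within T)"
  proof (rule Lim_null_comparison)
    show "((\<lambda>s. 2 * norm (b t) * (norm (a s - a t) * norm (b t))) \<longlongrightarrow> 0) (at t within T)"
      using la by (intro tendsto_mult_right_zero tendsto_mult_left_zero tendsto_norm_zero)
    show "eventually (\<lambda>s. norm (b s - b t) \<le> 2 * norm (b t) * (norm (a s - a t) * norm (b t))) (at t within T)"
      using bd small
    proof eventually_elim
      case (elim s)
      have "norm (b s - b t) = norm (b s * (a s - a t) * b t)" using res[of s] elim by simp
      also have "\<dots> \<le> norm (b s) * (norm (a s - a t) * norm (b t))"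
        by (rule norm_mult3_le)
      also have "\<dots> \<le> 2 * norm (b t) * (norm (a s - a t) * norm (b t))"
        using elim by (intro mult_right_mono) auto
      finally show ?case .
    qed
  qed
  then have cb: "(b \<longlongrightarrow> b t) (at t within T)" by (rule LIM_zero_cancel)
  have "((\<lambda>s. (b s - b t) /\<^sub>R (s - t)) \<longlongrightarrow> - (b t * a' * b t)) (at t within T)"
  proof (rule Lim_transform_eventually)
    have "((\<lambda>s. (a s - a t) /\<^sub>R (s - t)) \<longlongrightarrow> a') (at t within T)"
      using d by (simp add: has_vector_derivative_within_iff)
    then show "((\<lambda>s. - (b s * ((a s - a t) /\<^sub>R (s - t)) * b t)) \<longlongrightarrow> - (b t * a' * b t)) (at t within T)"
      by (intro tendsto_intros cb)
    show "eventually (\<lambda>s. - (b s * ((a s - a t) /\<^sub>R (s - t)) * b t) = (b s - b t) /\<^sub>R (s - t)) (at t within T)"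
      using small by eventually_elim (auto simp: res)
  qed
  then show ?thesis by (simp add: has_vector_derivative_within_iff)
qed

subsection \<open>Differential inequalities on a half line\<close>

lemma nondecreasing_on_interval:
  fixes f :: "real \<Rightarrow> real"
  assumes d: "\<And>r. s \<le> r \<Longrightarrow> r \<le> t \<Longrightarrow> (f has_real_derivative f' r) (at r within {s..t})"
    and nn: "\<And>r. s \<le> r \<Longrightarrow> r \<le> t \<Longrightarrow> 0 \<le> f' r" and "s \<le> t"
  shows "f s \<le> f t"
proof (cases "s = t")
  case False
  then have "s < t" using assms(3) by simp
  have "(f has_derivative (*) (f' r)) (at r within {s..t})" if "s \<le> r" "r \<le> t" for r
    using d[OF that] by (simp add: has_field_derivative_def)
  from mvt_simple[OF \<open>s < t\<close> this] obtain x where "x \<in> {s<..<t}" "f t - f s = f' x * (t - s)" by auto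
  then show ?thesis using nn[of x] \<open>s < t\<close> by (smt (verit) greaterThanLessThan_iff mult_nonneg_nonneg)
qed simp

lemma nondecreasing_within:
  fixes f :: "real \<Rightarrow> real"
  assumes d: "\<And>r. s \<le> r \<Longrightarrow> r \<le> t \<Longrightarrow> (f has_real_derivative f' r) (at r within {a..})"
    and nn: "\<And>r. s \<le> r \<Longrightarrow> r \<le> t \<Longrightarrow> 0 \<le> f' r" and "a \<le> s" "s \<le> t"
  shows "f s \<le> f t"
  by (rule nondecreasing_on_interval[OF DERIV_subset[OF d] nn]) (use assms(3,4) in auto)

text \<open>With the integrating factor \<open>exp (k (r - s))\<close> the inequality becomes monotonicity. The
inhomogeneity is given by a primitive \<open>g\<close>, so that no integral has to be estimated.\<close>

lemma gronwall_backward: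
  fixes \<phi> g :: "real \<Rightarrow> real"
  assumes \<phi>: "\<And>r. s \<le> r \<Longrightarrow> r \<le> t \<Longrightarrow> (\<phi> has_real_derivative \<phi>' r) (at r within {a..})"
    and g: "\<And>r. s \<le> r \<Longrightarrow> r \<le> t \<Longrightarrow> (g has_real_derivative g' r) (at r within {a..})"
    and g0: "\<And>r. s \<le> r \<Longrightarrow> r \<le> t \<Longrightarrow> 0 \<le> g' r"
    and ineq: "\<And>r. s \<le> r \<Longrightarrow> r \<le> t \<Longrightarrow> - k * \<phi> r - g' r \<le> \<phi>' r"
    and "0 \<le> k" "a \<le> s" "s \<le> t"
  shows "\<phi> s \<le> exp (k * (t - s)) * (\<phi> t + g t - g s)"
proof -
  let ?E = "exp (k * (t - s))"
  define h where "h r = exp (k * (r - s)) * \<phi> r + ?E * g r" for r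
  define h' where "h' r = exp (k * (r - s)) * (k * \<phi> r + \<phi>' r) + ?E * g' r" for r
  have "h s \<le> h t"
  proof (rule nondecreasing_within[of s t h h' a])
    fix r assume r: "s \<le> r" "r \<le> t"
    show "(h has_real_derivative h' r) (at r within {a..})"
      unfolding h_def h'_def
      by (rule derivative_eq_intros \<phi>[OF r] g[OF r] refl | simp add: algebra_simps)+
    have e: "exp (k * (r - s)) \<le> ?E" using r assms(5) by (simp add: mult_left_mono)
    have "0 \<le> exp (k * (r - s)) * (k * \<phi> r + \<phi>' r + g' r)"
      using ineq[OF r] by simp
    also have "\<dots> \<le> h' r"
      using mult_right_mono[OF e g0[OF r]] by (simp add: h'_def distrib_left)
    finally show "0 \<le> h' r" .
  qed (use assms in auto)
  then show ?thesis by (simp add: h_def algebra_simps)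
qed

lemma gronwall_forward_integral:
  fixes \<phi> g :: "real \<Rightarrow> real"
  assumes \<phi>: "\<And>r. s \<le> r \<Longrightarrow> r \<le> t \<Longrightarrow> (\<phi> has_real_derivative \<phi>' r) (at r within {s..t})"
    and g: "\<And>r. s \<le> r \<Longrightarrow> r \<le> t \<Longrightarrow> (g has_real_derivative g' r) (at r within {s..t})"
    and g0: "\<And>r. s \<le> r \<Longrightarrow> r \<le> t \<Longrightarrow> 0 \<le> g' r"
    and ineq: "\<And>r. s \<le> r \<Longrightarrow> r \<le> t \<Longrightarrow> \<phi>' r \<le> k * \<phi> r + g' r"
    and "0 \<le> k" "s \<le> t"
  shows "\<phi> t \<le> exp (k * (t - s)) * (\<phi> s + g t - g s)"
proof -
  define h where "h r = g r - exp (- k * (r - s)) * \<phi> r" for r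
  have "h s \<le> h t"
  proof (rule nondecreasing_on_interval[of s t h "\<lambda>r. g' r - exp (- k * (r - s)) * (\<phi>' r - k * \<phi> r)"])
    fix r assume r: "s \<le> r" "r \<le> t"
    show "(h has_real_derivative g' r - exp (- k * (r - s)) * (\<phi>' r - k * \<phi> r)) (at r within {s..t})"
      unfolding h_def
      by (rule derivative_eq_intros \<phi>[OF r] g[OF r] refl | simp add: algebra_simps)+
    have "exp (- k * (r - s)) * (\<phi>' r - k * \<phi> r) \<le> exp (- k * (r - s)) * g' r"
      using ineq[OF r] by (intro mult_left_mono) auto
    also have "\<dots> \<le> 1 * g' r" using r assms(5) by (intro mult_right_mono g0) auto
    finally show "0 \<le> g' r - exp (- k * (r - s)) * (\<phi>' r - k * \<phi> r)" by simp
  qed (use assms in auto)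
  then have "exp (- k * (t - s)) * \<phi> t \<le> \<phi> s + g t - g s" by (simp add: h_def)
  then have "exp (k * (t - s)) * (exp (- k * (t - s)) * \<phi> t) \<le> exp (k * (t - s)) * (\<phi> s + g t - g s)"
    by (intro mult_left_mono) auto
  then show ?thesis by (simp add: mult.assoc[symmetric] exp_add[symmetric])
qed

lemma gronwall_forward:
  fixes \<phi> :: "real \<Rightarrow> real"
  assumes \<phi>: "\<And>r. s \<le> r \<Longrightarrow> r \<le> t \<Longrightarrow> (\<phi> has_real_derivative \<phi>' r) (at r within {a..})"
    and ineq: "\<And>r. s \<le> r \<Longrightarrow> r \<le> t \<Longrightarrow> \<phi>' r \<le> k * \<phi> r"
    and "0 \<le> k" "a \<le> s" "s \<le> t"
  shows "\<phi> t \<le> exp (k * (t - s)) * \<phi> s"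
  using gronwall_forward_integral[where \<phi> = \<phi> and g = "\<lambda>_. 0" and g' = "\<lambda>_. 0", OF DERIV_subset[OF \<phi>]] assms(2-)
  by auto

lemma continuous_norm_bounded:
  fixes f :: "real \<Rightarrow> 'b :: real_normed_vector"
  assumes "continuous_on {a..} f" "a \<le> s"
  obtains K where "K > 0" "\<And>r. s \<le> r \<Longrightarrow> r \<le> t \<Longrightarrow> norm (f r) \<le> K"
proof -
  have "compact (f ` {s..t})"
    using assms by (intro compact_continuous_image continuous_on_subset[OF assms(1)]) auto
  then obtain K where "\<forall>x\<in>f ` {s..t}. norm x \<le> K" using compact_imp_bounded bounded_iff by metis
  then show ?thesis by (intro that[of "max K 1"]) (auto simp: le_max_iff_disj)
qed

text \<open>Gronwall's inequality for the squared norm. Every uniqueness argument for linear differential equations below,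
and every proof that a solution is symmetric, applies this to a difference.\<close>

lemma linear_ode_zero:
  fixes X :: "real \<Rightarrow> fsmat"
  assumes d: "\<And>r. a \<le> r \<Longrightarrow> (X has_vector_derivative A r * X r + X r * B r) (at r within {a..})"
    and c: "continuous_on {a..} A" "continuous_on {a..} B" and X0: "X a = 0" and "a \<le> t"
  shows "X t = 0"
proof -
  obtain K1 where K1: "K1 > 0" "\<And>r. a \<le> r \<Longrightarrow> r \<le> t \<Longrightarrow> norm (A r) \<le> K1"
    using continuous_norm_bounded[OF c(1) order_refl] by metis
  obtain K2 where K2: "K2 > 0" "\<And>r. a \<le> r \<Longrightarrow> r \<le> t \<Longrightarrow> norm (B r) \<le> K2"
    using continuous_norm_bounded[OF c(2) order_refl] by metis
  have "(norm (X t))\<^sup>2 \<le> exp (2 * (K1 + K2) * (t - a)) * (norm (X a))\<^sup>2"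
  proof (rule gronwall_forward[of a t _ "\<lambda>r. 2 * inner (X r) (A r * X r + X r * B r)" a])
    fix r assume r: "a \<le> r" "r \<le> t"
    show "((\<lambda>r. (norm (X r))\<^sup>2) has_real_derivative 2 * inner (X r) (A r * X r + X r * B r)) (at r within {a..})"
      using has_vector_derivative_inner[OF d[OF r(1)] d[OF r(1)]]
      by (simp add: power2_norm_eq_inner inner_commute)
    have "inner (X r) (A r * X r) \<le> K1 * (norm (X r))\<^sup>2"
      using inner_le_norm[of "X r" "A r"] K1(2)[OF r]
      by (meson mult_right_mono order_trans zero_le_power2)
    moreover have "inner (X r) (X r * B r) \<le> K2 * (norm (X r))\<^sup>2"
      using inner_le_norm[of "adj (X r)" "adj (B r)"] K2(2)[OF r]
      by (metis adj_times inner_adj_adj norm_adj mult_right_mono order_trans zero_le_power2)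
    ultimately show "2 * inner (X r) (A r * X r + X r * B r) \<le> 2 * (K1 + K2) * (norm (X r))\<^sup>2"
      by (simp add: inner_add_right algebra_simps)
  qed (use assms K1(1) K2(1) in auto)
  then show ?thesis using X0 by simp
qed

section \<open>Riccati equations\<close>

lemma pos_shift_un:
  assumes "pos X \<or> adj X = X" and ge: "\<And>Z. c * (norm (un n * Z))\<^sup>2 \<le> inner Z (X * Z)"
  shows "pos (X - c *\<^sub>R un n)"
proof -
  have "adj X = X" using assms(1) pos_adj by blast
  moreover have "0 \<le> inner Z ((X - c *\<^sub>R un n) * Z)" for Z
    using ge[of Z] by (simp add: left_diff_distrib inner_diff_right norm_un_times_sq)
  ultimately show ?thesis by (simp add: pos_def)
qed

text \<open>Coercivity makes the matrix injective; evaluating the form at the inverse bounds the inverse.\<close>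

lemma corner_inverse:
  assumes X: "shape n n X" and c: "0 < c"
    and ge: "\<And>Z. c * (norm (un n * Z))\<^sup>2 \<le> inner Z (X * Z)"
  obtains Y where "shape n n Y" "X * Y = un n" "Y * X = un n" "norm Y \<le> norm (un n) / c"
proof -
  obtain A where A: "A \<in> carrier_mat n n" "fm A = X" using shape_obtain_mat[OF X] .
  have inj: "x = 0\<^sub>v n" if x: "x \<in> carrier_vec n" "A *\<^sub>v x = 0\<^sub>v n" for x
  proof -
    have "X * fv x = 0" using x A mult_mat_vec_zero_iff by blast
    moreover have "un n * fv x = fv x" using shape_fv[OF x(1)] by (rule un_times)
    ultimately have "c * (norm (fv x))\<^sup>2 \<le> 0" using ge[of "fv x"] by simp
    then have "fv x = 0" using c by (simp add: mult_le_0_iff)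
    then show ?thesis using fv_inject[OF x(1), of "0\<^sub>v n"] by (simp add: fv_zero)
  qed
  note i = minv_of_injective[OF A(1) inj]
  let ?Y = "fm (minv A)"
  have Y: "shape n n ?Y" using i(1) by (rule shape_fm)
  have XY: "X * ?Y = un n" "?Y * X = un n" using i(2,3) A(2) by auto
  have "c * (norm ?Y)\<^sup>2 \<le> norm ?Y * norm (un n)"
  proof -
    have "c * (norm (un n * ?Y))\<^sup>2 \<le> inner ?Y (X * ?Y)" by (rule ge)
    also have "\<dots> \<le> norm ?Y * norm (un n)" unfolding XY by (rule norm_cauchy_schwarz)
    finally show ?thesis by (simp add: un_times[OF Y])
  qed
  then have "norm ?Y * norm ?Y \<le> (norm (un n) / c) * norm ?Y"
    using c by (simp add: power2_eq_square field_simps)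
  then have "norm ?Y \<le> norm (un n) / c"
    by (rule square_le_cancel) (use c in simp)
  then show ?thesis using that Y XY by blast
qed

lemma pos_inner_diff_le:
  assumes "pos M"
  shows "inner (x - y) (M * (x - y)) \<le> 2 * inner x (M * x) + 2 * inner y (M * y)"
  using posD[OF assms, of "x + y"]
  by (simp add: distrib_left right_diff_distrib inner_add_left inner_add_right inner_diff_left
      inner_diff_right algebra_simps)

lemma norm_diff_sq_le: "(norm (x - y))\<^sup>2 \<le> 2 * (norm x)\<^sup>2 + 2 * (norm y)\<^sup>2"
  for x y :: "'b :: real_inner"
  using inner_ge_zero[of "x + y"]
  by (simp add: power2_norm_eq_inner inner_add_left inner_add_right inner_diff_left inner_diff_right
      inner_commute)

text \<open>The data of the Riccati equation \<open>P' = A P + P A^T + Q - P S P\<close>; for a filter, \<open>S\<close> is \<open>C^T R^-1 C\<close>. The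
function \<open>\<Psi> r t\<close> is the transition matrix of the adjoint equation \<open>l' = - A^T l\<close> from time \<open>t\<close> to time
\<open>r\<close>. It is part of the data, because the controllability and observability conditions provide it.\<close>

locale riccati =
  fixes a :: real and n :: nat and A Q S :: "real \<Rightarrow> fsmat" and \<Psi> :: "real \<Rightarrow> real \<Rightarrow> fsmat"
    and \<alpha> q \<sigma> :: real
  assumes shA: "a \<le> t \<Longrightarrow> shape n n (A t)" and shQ: "a \<le> t \<Longrightarrow> shape n n (Q t)"
    and shS: "a \<le> t \<Longrightarrow> shape n n (S t)"
    and contA: "continuous_on {a..} A" and contQ: "continuous_on {a..} Q"
    and contS: "continuous_on {a..} S"
    and posQ: "a \<le> t \<Longrightarrow> pos (Q t)" and posS: "a \<le> t \<Longrightarrow> pos (S t)"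
    and bdA: "a \<le> t \<Longrightarrow> norm (A t) \<le> \<alpha>" and bdQ: "a \<le> t \<Longrightarrow> norm (Q t) \<le> q"
    and bdS: "a \<le> t \<Longrightarrow> norm (S t) \<le> \<sigma>"
    and sh\<Psi>: "a \<le> r \<Longrightarrow> a \<le> t \<Longrightarrow> shape n n (\<Psi> r t)"
    and \<Psi>_refl: "a \<le> t \<Longrightarrow> \<Psi> t t = un n"
    and \<Psi>_deriv: "a \<le> r \<Longrightarrow> a \<le> t \<Longrightarrow>
      ((\<lambda>r. \<Psi> r t) has_vector_derivative - (adj (A r) * \<Psi> r t)) (at r within {a..})"
begin

definition sol :: "(real \<Rightarrow> fsmat) \<Rightarrow> bool" where
  "sol P \<longleftrightarrow> (\<forall>t\<ge>a. shape n n (P t) \<and> adj (P t) = P t \<and>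
    (P has_vector_derivative A t * P t + P t * adj (A t) + Q t - P t * S t * P t) (at t within {a..}))"

lemma solD:
  assumes "sol P" "a \<le> t"
  shows "shape n n (P t)" "adj (P t) = P t"
    "(P has_vector_derivative A t * P t + P t * adj (A t) + Q t - P t * S t * P t) (at t within {a..})"
  using assms by (auto simp: sol_def)

lemma sol_continuous: "sol P \<Longrightarrow> continuous_on {a..} P"
  by (auto simp: continuous_on_eq_continuous_within intro!: has_vector_derivative_continuous solD)

lemma \<alpha>_nonneg: "0 \<le> \<alpha>" and q_nonneg: "0 \<le> q" and \<sigma>_nonneg: "0 \<le> \<sigma>"
  using bdA[of a] bdQ[of a] bdS[of a] norm_ge_zero order_trans by blast+

lemma riccati_restrict: "a \<le> b \<Longrightarrow> riccati b n A Q S \<Psi> \<alpha> q \<sigma>"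
  by (unfold_locales)
    (auto intro: shA shQ shS posQ posS bdA bdQ bdS sh\<Psi> \<Psi>_refl continuous_on_subset[OF contA]
      continuous_on_subset[OF contQ] continuous_on_subset[OF contS]
      has_vector_derivative_within_subset[OF \<Psi>_deriv])

lemma sol_restrict: "sol P \<Longrightarrow> a \<le> b \<Longrightarrow> riccati.sol b n A Q S P"
proof -
  assume P: "sol P" and b: "a \<le> b"
  have "(P has_vector_derivative A t * P t + P t * adj (A t) + Q t - P t * S t * P t) (at t within {b..})"
    if "b \<le> t" for t
    by (rule has_vector_derivative_within_subset[OF solD(3)[OF P]]) (use b that in auto)
  then show ?thesis
    unfolding riccati.sol_def[OF riccati_restrict[OF b]] using solD(1,2)[OF P] b by auto
qed

lemma inner_Q_le: "a \<le> t \<Longrightarrow> inner Z (Q t * Z) \<le> q * (norm Z)\<^sup>2"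
  using inner_le_norm[of Z "Q t"] bdQ[of t] by (meson mult_right_mono order_trans zero_le_power2)

lemma inner_S_le: "a \<le> t \<Longrightarrow> inner Z (S t * Z) \<le> \<sigma> * (norm Z)\<^sup>2"
  using inner_le_norm[of Z "S t"] bdS[of t] by (meson mult_right_mono order_trans zero_le_power2)

lemma inner_A_le:
  assumes "a \<le> t"
  shows "inner Z (A t * Z) \<le> \<alpha> * (norm Z)\<^sup>2" "- (\<alpha> * (norm Z)\<^sup>2) \<le> inner Z (A t * Z)"
    "inner Z (adj (A t) * Z) \<le> \<alpha> * (norm Z)\<^sup>2" "- (\<alpha> * (norm Z)\<^sup>2) \<le> inner Z (adj (A t) * Z)"
proof -
  have b: "norm (A t) * (norm Z)\<^sup>2 \<le> \<alpha> * (norm Z)\<^sup>2" using bdA[OF assms] by (simp add: mult_right_mono)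
  show "inner Z (A t * Z) \<le> \<alpha> * (norm Z)\<^sup>2" "- (\<alpha> * (norm Z)\<^sup>2) \<le> inner Z (A t * Z)"
    "inner Z (adj (A t) * Z) \<le> \<alpha> * (norm Z)\<^sup>2" "- (\<alpha> * (norm Z)\<^sup>2) \<le> inner Z (adj (A t) * Z)"
    using b inner_le_norm[of Z "A t"] inner_ge_norm[of "A t" Z] inner_le_norm[of Z "adj (A t)"]
      inner_ge_norm[of "adj (A t)" Z] by simp_all
qed

lemma \<Psi>_norm_le:
  assumes "a \<le> r" "r \<le> t"
  shows "(norm (\<Psi> r t * Z))\<^sup>2 \<le> exp (2 * \<alpha> * (t - r)) * (norm Z)\<^sup>2"
proof -
  let ?l = "\<lambda>r. \<Psi> r t * Z"
  have "(norm (?l r))\<^sup>2 \<le> exp (2 * \<alpha> * (t - r)) * ((norm (?l t))\<^sup>2 + 0 - 0)"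
  proof (rule gronwall_backward[of r t _ "\<lambda>r. - 2 * inner (?l r) (adj (A r) * ?l r)" a "\<lambda>_. 0" "\<lambda>_. 0"])
    fix s assume s: "r \<le> s" "s \<le> t"
    have "(?l has_vector_derivative - (adj (A s) * ?l s)) (at s within {a..})"
      using has_vector_derivative_mult[OF \<Psi>_deriv[of s t] has_vector_derivative_const[of Z]] s assms
      by (simp add: mult.assoc)
    from has_vector_derivative_inner[OF this this]
    show "((\<lambda>r. (norm (?l r))\<^sup>2) has_real_derivative - 2 * inner (?l s) (adj (A s) * ?l s)) (at s within {a..})"
      by (simp add: power2_norm_eq_inner inner_commute)
    show "- (2 * \<alpha>) * (norm (?l s))\<^sup>2 - 0 \<le> - 2 * inner (?l s) (adj (A s) * ?l s)"
      using inner_A_le(3)[of s "?l s"] s assms by simp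
  qed (use assms \<alpha>_nonneg in auto)
  also have "(norm (?l t))\<^sup>2 \<le> (norm Z)\<^sup>2"
    using \<Psi>_refl[of t] assms norm_un_times_le by simp
  finally show ?thesis by (simp add: mult_left_mono)
qed

lemma \<Psi>_norm_ge:
  assumes "a \<le> r" "r \<le> t"
  shows "exp (- 2 * \<alpha> * (t - r)) * (norm (un n * Z))\<^sup>2 \<le> (norm (\<Psi> r t * Z))\<^sup>2"
proof -
  let ?l = "\<lambda>r. \<Psi> r t * Z"
  have "(norm (?l t))\<^sup>2 \<le> exp (2 * \<alpha> * (t - r)) * (norm (?l r))\<^sup>2"
  proof (rule gronwall_forward[of r t _ "\<lambda>r. - 2 * inner (?l r) (adj (A r) * ?l r)" a])
    fix s assume s: "r \<le> s" "s \<le> t"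
    have "(?l has_vector_derivative - (adj (A s) * ?l s)) (at s within {a..})"
      using has_vector_derivative_mult[OF \<Psi>_deriv[of s t] has_vector_derivative_const[of Z]] s assms
      by (simp add: mult.assoc)
    from has_vector_derivative_inner[OF this this]
    show "((\<lambda>r. (norm (?l r))\<^sup>2) has_real_derivative - 2 * inner (?l s) (adj (A s) * ?l s)) (at s within {a..})"
      by (simp add: power2_norm_eq_inner inner_commute)
    show "- 2 * inner (?l s) (adj (A s) * ?l s) \<le> 2 * \<alpha> * (norm (?l s))\<^sup>2"
      using inner_A_le(4)[of s "?l s"] s assms by simp
  qed (use assms \<alpha>_nonneg in auto)
  then have "exp (- 2 * \<alpha> * (t - r)) * (norm (?l t))\<^sup>2
      \<le> exp (- 2 * \<alpha> * (t - r)) * (exp (2 * \<alpha> * (t - r)) * (norm (?l r))\<^sup>2)"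
    by (rule mult_left_mono) simp
  then show ?thesis using \<Psi>_refl[of t] assms by (simp add: mult.assoc[symmetric] exp_add[symmetric])
qed

text \<open>Completion of squares: along an adjoint trajectory driven by \<open>S * \<eta>\<close>, the cost
  \<open>inner \<lambda> (Q * \<lambda>) + inner \<eta> (S * \<eta>)\<close> exceeds the rate of the value function
  \<open>inner \<lambda> (P * \<lambda>)\<close> by a square that vanishes for the optimal feedback \<open>\<eta> = P * \<lambda>\<close>.\<close>

lemma value_derivative:
  assumes P: "sol P" and r: "a \<le> r"
    and l: "(l has_vector_derivative - (adj (A r) * l r) + S r * \<eta>) (at r within {a..})"
  shows "((\<lambda>r. inner (l r) (P r * l r)) has_real_derivative
    inner (l r) (Q r * l r) + inner \<eta> (S r * \<eta>)
      - inner (\<eta> - P r * l r) (S r * (\<eta> - P r * l r))) (at r within {a..})"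
proof -
  note p = solD[OF P r]
  have aS: "adj (S r) = S r" using posS[OF r] by (rule pos_adj)
  let ?l = "l r" and ?P = "P r" and ?A = "A r" and ?S = "S r"
  have e1: "inner ?l (?P * (adj ?A * ?l)) = inner (adj ?A * ?l) (?P * ?l)"
    using p(2) by (metis inner_commute inner_times_left)
  have e2: "inner ?l (?A * (?P * ?l)) = inner (adj ?A * ?l) (?P * ?l)"
    by (simp add: inner_times_left)
  have e3: "inner ?l (?P * (?S * (?P * ?l))) = inner (?P * ?l) (?S * (?P * ?l))"
    using p(2) by (metis inner_times_left)
  have e4: "inner ?l (?P * (?S * \<eta>)) = inner (?P * ?l) (?S * \<eta>)"
    using p(2) by (metis inner_times_left)
  have e5: "inner \<eta> (?S * (?P * ?l)) = inner (?P * ?l) (?S * \<eta>)"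
    using aS by (metis inner_commute inner_times_left)
  have e6: "inner (?S * \<eta>) (?P * ?l) = inner (?P * ?l) (?S * \<eta>)"
    by (rule inner_commute)
  show ?thesis
    by (rule DERIV_cong[OF has_vector_derivative_inner[OF l has_vector_derivative_mult[OF p(3) l]]])
      (simp add: algebra_simps inner_add_left inner_add_right inner_diff_left inner_diff_right e1 e2 e3 e4 e5 e6)
qed

lemma free_deriv:
  assumes "a \<le> r" "a \<le> t"
  shows "((\<lambda>r. \<Psi> r t * Z) has_vector_derivative - (adj (A r) * (\<Psi> r t * Z)) + S r * 0) (at r within {a..})"
  using has_vector_derivative_mult[OF \<Psi>_deriv[OF assms] has_vector_derivative_const[of Z]]
  by (simp add: mult.assoc)

lemma inner_un_restrict:
  "a \<le> t \<Longrightarrow> sol P \<Longrightarrow> inner (un n * Z) (P t * (un n * Z)) = inner Z (P t * Z)"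
  using un_times[OF solD(1)] times_un[OF solD(1)]
  by (simp add: inner_times_left mult.assoc[symmetric])

subsection \<open>Solutions stay positive semidefinite\<close>

text \<open>On a short interval a lower bound \<open>- m\<close> for the solution improves to \<open>- m / 2\<close>: the only
  negative contribution to the value function is quadratic in \<open>P\<close>, hence small where \<open>P\<close> is not
  far below zero.  Iterating the improvement leaves no room below zero.\<close>

lemma pos_improve:
  assumes P: "sol P" and t1: "a \<le> t1" "t1 \<le> t2" "t2 \<le> t1 + h" "h \<le> 1" "0 \<le> h"
    and p: "\<And>t. t1 \<le> t \<Longrightarrow> t \<le> t2 \<Longrightarrow> norm (P t) \<le> p"
    and start: "pos (P t1)"
    and m: "0 \<le> m" "m \<le> p"
    and low: "\<And>t Z. t1 \<le> t \<Longrightarrow> t \<le> t2 \<Longrightarrow> - (m * (norm Z)\<^sup>2) \<le> inner Z (P t * Z)"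
    and h: "6 * p * \<sigma> * exp (2 * \<alpha>) * h \<le> 1/2"
    and t: "t1 \<le> t" "t \<le> t2"
  shows "- (m/2 * (norm Z)\<^sup>2) \<le> inner Z (P t * Z)"
proof -
  have at: "a \<le> t" using t t1 by simp
  have p0: "0 \<le> p" using m by simp
  define V where "V r = inner (\<Psi> r t * Z) (P r * (\<Psi> r t * Z))" for r
  define V' where "V' r = inner (\<Psi> r t * Z) (Q r * (\<Psi> r t * Z))
    - inner (P r * (\<Psi> r t * Z)) (S r * (P r * (\<Psi> r t * Z)))" for r
  define c where "c = 6 * p * \<sigma> * exp (2 * \<alpha>) * m * (norm Z)\<^sup>2"
  have "V t1 \<le> exp (4 * p * \<sigma> * (t - t1)) * (V t + c * t - c * t1)"
  proof (rule gronwall_backward[of t1 t V V' a "\<lambda>r. c * r" "\<lambda>_. c"])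
    fix r assume r: "t1 \<le> r" "r \<le> t"
    then have ar: "a \<le> r" using t1 by simp
    let ?l = "\<Psi> r t * Z"
    show "(V has_real_derivative V' r) (at r within {a..})"
      unfolding V_def V'_def
      using value_derivative[OF P ar free_deriv[OF ar at, of Z]]
      by (simp add: minus_mult_right[symmetric])
    show "((*) c has_real_derivative c) (at r within {a..})"
      by (auto intro!: derivative_eq_intros)
    show "0 \<le> c" using p0 \<sigma>_nonneg m by (simp add: c_def)
    define N where "N = P r + m *\<^sub>R un n"
    have unl: "un n * ?l = ?l" using un_times[OF sh\<Psi>[OF ar at]] by (simp add: mult.assoc[symmetric])
    have Nle: "inner Y (N * Y) \<le> 2 * p * (norm Y)\<^sup>2" for Y
    proof -
      have "inner Y (P r * Y) \<le> p * (norm Y)\<^sup>2"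
        using inner_le_norm[of Y "P r"] p[of r] r t by (meson mult_right_mono order_trans zero_le_power2)
      moreover have "m * inner Y (un n * Y) \<le> p * (norm Y)\<^sup>2"
        using norm_un_times_le[of n Y] m
        by (intro mult_mono) (auto simp: norm_un_times_sq[symmetric] power_mono)
      ultimately show ?thesis by (simp add: N_def distrib_right inner_add_right)
    qed
    have posN: "pos N"
      unfolding pos_def
    proof (intro conjI allI)
      show "adj N = N" using solD(2)[OF P ar] by (simp add: N_def)
      fix Y
      have "- (m * (norm (un n * Y))\<^sup>2) \<le> inner (un n * Y) (P r * (un n * Y))"
        using low[of r] r t by simp
      then show "0 \<le> inner Y (N * Y)"
        using inner_un_restrict[OF ar P, of Y]
        by (simp add: N_def distrib_right inner_add_right norm_un_times_sq)
    qed
    have "P r * ?l = N * ?l - m *\<^sub>R ?l" by (simp add: N_def distrib_right unl)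
    then have "(norm (P r * ?l))\<^sup>2 \<le> 2 * (norm (N * ?l))\<^sup>2 + 2 * (norm (m *\<^sub>R ?l))\<^sup>2"
      using norm_diff_sq_le by metis
    also have "(norm (N * ?l))\<^sup>2 \<le> 2 * p * inner ?l (N * ?l)"
      by (rule pos_norm_mult_sq[OF posN Nle])
    also have "inner ?l (N * ?l) = V r + m * (norm ?l)\<^sup>2"
      by (simp add: N_def V_def distrib_right inner_add_right unl power2_norm_eq_inner)
    also have "(norm (m *\<^sub>R ?l))\<^sup>2 \<le> (m * p) * (norm ?l)\<^sup>2"
      unfolding norm_scaleR power_mult_distrib
      using m by (intro mult_right_mono) (auto simp: power2_eq_square intro: mult_left_mono)
    finally have Pl: "(norm (P r * ?l))\<^sup>2 \<le> 4 * p * V r + 6 * p * m * (norm ?l)\<^sup>2"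
      by (simp add: algebra_simps)
    have "(norm ?l)\<^sup>2 \<le> exp (2 * \<alpha> * (t - r)) * (norm Z)\<^sup>2" by (rule \<Psi>_norm_le) (use ar r in auto)
    also have "\<dots> \<le> exp (2 * \<alpha>) * (norm Z)\<^sup>2"
    proof -
      have "t - r \<le> 1" using r t t1 by simp
      then have "\<alpha> * (t - r) \<le> \<alpha> * 1" using \<alpha>_nonneg by (rule mult_left_mono)
      then show ?thesis by (intro mult_right_mono) auto
    qed
    finally have "6 * p * m * (norm ?l)\<^sup>2 \<le> 6 * p * m * (exp (2 * \<alpha>) * (norm Z)\<^sup>2)"
      using p0 m by (intro mult_left_mono) auto
    with Pl have "(norm (P r * ?l))\<^sup>2 \<le> 4 * p * V r + 6 * p * m * (exp (2 * \<alpha>) * (norm Z)\<^sup>2)" by simp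
    then have "\<sigma> * (norm (P r * ?l))\<^sup>2 \<le> \<sigma> * (4 * p * V r + 6 * p * m * (exp (2 * \<alpha>) * (norm Z)\<^sup>2))"
      using \<sigma>_nonneg by (rule mult_left_mono)
    moreover have "inner (P r * ?l) (S r * (P r * ?l)) \<le> \<sigma> * (norm (P r * ?l))\<^sup>2"
      by (rule inner_S_le[OF ar])
    moreover have "0 \<le> inner ?l (Q r * ?l)" by (rule posD[OF posQ[OF ar]])
    ultimately show "- (4 * p * \<sigma>) * V r - c \<le> V' r"
      by (simp add: V'_def c_def algebra_simps)
  qed (use t t1 p0 \<sigma>_nonneg in auto)
  moreover have "0 \<le> V t1" unfolding V_def by (rule posD[OF start])
  ultimately have "0 \<le> exp (4 * p * \<sigma> * (t - t1)) * (V t + c * t - c * t1)" by linarith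
  then have "0 \<le> V t + c * t - c * t1" by (simp add: zero_le_mult_iff)
  then have "0 \<le> V t + c * (t - t1)" by (simp add: algebra_simps)
  moreover have "V t = inner Z (P t * Z)"
    unfolding V_def \<Psi>_refl[OF at] by (rule inner_un_restrict[OF at P])
  moreover have "c * (t - t1) \<le> m/2 * (norm Z)\<^sup>2"
  proof -
    have c0: "0 \<le> 6 * p * \<sigma> * exp (2 * \<alpha>)" using p0 \<sigma>_nonneg by simp
    have "6 * p * \<sigma> * exp (2 * \<alpha>) * (t - t1) \<le> 6 * p * \<sigma> * exp (2 * \<alpha>) * h"
      using t t1 c0 by (intro mult_left_mono) auto
    then have "(6 * p * \<sigma> * exp (2 * \<alpha>) * (t - t1)) * (m * (norm Z)\<^sup>2) \<le> 1/2 * (m * (norm Z)\<^sup>2)"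
      using h m by (intro mult_right_mono) auto
    then show ?thesis by (simp add: c_def algebra_simps)
  qed
  ultimately show ?thesis by linarith
qed

lemma sol_pos:
  assumes P: "sol P" and start: "pos (P a)" and T: "a \<le> T"
  shows "pos (P T)"
proof -
  obtain p where p: "p > 0" "\<And>t. a \<le> t \<Longrightarrow> t \<le> T \<Longrightarrow> norm (P t) \<le> p"
    using continuous_norm_bounded[OF sol_continuous[OF P] order_refl] by metis
  define K where "K = 6 * p * \<sigma> * exp (2 * \<alpha>)"
  have K: "0 \<le> K" using p \<sigma>_nonneg by (simp add: K_def)
  define h where "h = 1 / (2 * K + 1)"
  have h: "0 < h" "h \<le> 1" "K * h \<le> 1/2" using K by (auto simp: h_def field_simps)
  have step: "pos (P t)" if t1: "a \<le> t1" "pos (P t1)" "t1 \<le> t" "t \<le> t1 + h" "t \<le> T" for t1 t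
  proof -
    have iter: "- (p / 2 ^ j * (norm Z)\<^sup>2) \<le> inner Z (P s * Z)" if "t1 \<le> s" "s \<le> t" for s Z j
      using that
    proof (induction j arbitrary: s Z)
      case 0
      have "norm (P s) \<le> p" using p 0 t1 by auto
      then have "norm (P s) * (norm Z)\<^sup>2 \<le> p * (norm Z)\<^sup>2" by (simp add: mult_right_mono)
      then show ?case using inner_ge_norm[of "P s" Z] by simp
    next
      case (Suc j)
      have "- (p / 2 ^ j / 2 * (norm Z)\<^sup>2) \<le> inner Z (P s * Z)"
      proof (rule pos_improve[OF P, of t1 t h p])
        show "p / 2 ^ j \<le> p" using p by (simp add: divide_le_eq mult_le_cancel_left1)
        show "- (p / 2 ^ j * (norm Y)\<^sup>2) \<le> inner Y (P r * Y)" if "t1 \<le> r" "r \<le> t" for r Y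
          by (rule Suc.IH[OF that])
      qed (use Suc.prems t1 h p K_def in auto)
      then show ?case by simp
    qed
    have "0 \<le> inner Z (P t * Z)" for Z
    proof (rule LIMSEQ_le_const2)
      have "(\<lambda>j. - (p * (norm Z)\<^sup>2 * (1/2) ^ j)) \<longlonglongrightarrow> - (p * (norm Z)\<^sup>2 * 0)"
        by (intro tendsto_intros LIMSEQ_realpow_zero) auto
      then show "(\<lambda>j. inner Z (P t * Z) - (inner Z (P t * Z) + p * (norm Z)\<^sup>2 * (1/2) ^ j)) \<longlonglongrightarrow> 0"
        by simp
      show "\<exists>N. \<forall>j\<ge>N. inner Z (P t * Z) - (inner Z (P t * Z) + p * (norm Z)\<^sup>2 * (1/2) ^ j) \<le> inner Z (P t * Z)"
        using iter[of t _ Z] t1 by (auto simp: power_one_over field_simps)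
    qed
    moreover have "adj (P t) = P t" using solD(2)[OF P] t1 by simp
    ultimately show ?thesis by (simp add: pos_def)
  qed
  have "pos (P t)" if "a \<le> t" "t \<le> T" "t \<le> a + real k * h" for k t
    using that
  proof (induction k arbitrary: t)
    case 0
    then show ?case using start by simp
  next
    case (Suc k)
    show ?case
    proof (cases "t \<le> a + real k * h")
      case False
      show ?thesis
        by (rule step[of "a + real k * h"])
          (use Suc False h in \<open>auto simp: algebra_simps intro!: Suc.IH\<close>)
    qed (use Suc in auto)
  qed
  moreover obtain k where "(T - a) / h \<le> real k" using real_arch_simple by blast
  ultimately show ?thesis using T h by (auto simp: field_simps)
qed

subsection \<open>Uniform bounds from observability and controllability\<close>

text \<open>Gramians over the window \<open>{t - \<epsilon>..t}\<close>, given by primitives. \<open>W r\<close> is the observability Gramian of the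
part of the window after \<open>r\<close>, and \<open>B\<close> inverts the one of the whole window; \<open>\<Phi>\<close> is the transition matrix
of \<open>A\<close> from time \<open>t\<close>. The uniform bounds are that of \<open>B\<close> and \<open>\<mu>\<close>.\<close>

definition observable :: "real \<Rightarrow> real \<Rightarrow> bool" where
  "observable \<epsilon> b \<longleftrightarrow> 0 < \<epsilon> \<and> (\<forall>t\<ge>a + \<epsilon>. \<exists>\<Phi> W B. \<Phi> t = un n \<and> W t = 0 \<and>
    W (t - \<epsilon>) * B = un n \<and> norm B \<le> b \<and>
    (\<forall>r. t - \<epsilon> \<le> r \<and> r \<le> t \<longrightarrow>
      (\<Phi> has_vector_derivative A r * \<Phi> r) (at r within {a..}) \<and>
      (W has_vector_derivative - (adj (\<Phi> r) * S r * \<Phi> r)) (at r within {a..}) \<and>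
      \<Psi> r t * adj (\<Phi> r) = un n))"

definition controllable :: "real \<Rightarrow> real \<Rightarrow> bool" where
  "controllable \<epsilon> \<mu> \<longleftrightarrow> 0 < \<epsilon> \<and> 0 < \<mu> \<and> (\<forall>t\<ge>a + \<epsilon>. \<exists>\<Gamma>.
    (\<forall>r. t - \<epsilon> \<le> r \<and> r \<le> t \<longrightarrow>
      (\<Gamma> has_vector_derivative adj (\<Psi> r t) * Q r * \<Psi> r t) (at r within {a..})) \<and>
    (\<forall>Z. \<mu> * (norm (un n * Z))\<^sup>2 \<le> inner Z ((\<Gamma> t - \<Gamma> (t - \<epsilon>)) * Z)))"

text \<open>An adjoint trajectory ending in \<open>z\<close> is steered to zero at the start of the window; its cost
  bounds the value function whatever the initial value of the solution.\<close>

lemma upper_bound_window: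
  assumes P: "sol P" and ps: "\<And>t. a \<le> t \<Longrightarrow> pos (P t)" and ob: "observable \<epsilon> b"
    and t: "a + \<epsilon> \<le> t"
  shows "inner z (P t * z) \<le> \<epsilon> * (q * (exp ((2 * \<alpha> + 1) * \<epsilon>) * (1 + \<sigma>\<^sup>2 * exp (2 * \<alpha> * \<epsilon>) * b\<^sup>2 * \<epsilon>))
    + \<sigma> * exp (2 * \<alpha> * \<epsilon>) * b\<^sup>2) * (norm z)\<^sup>2"
proof -
  have e0: "0 < \<epsilon>" using ob by (simp add: observable_def)
  have at: "a \<le> t" "a \<le> t - \<epsilon>" using t e0 by auto
  from ob t obtain \<Phi> W B where \<Phi>t: "\<Phi> t = un n" and Wt: "W t = 0" and WB: "W (t - \<epsilon>) * B = un n"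
    and B: "norm B \<le> b"
    and win: "\<And>r. t - \<epsilon> \<le> r \<Longrightarrow> r \<le> t \<Longrightarrow> (\<Phi> has_vector_derivative A r * \<Phi> r) (at r within {a..})"
      "\<And>r. t - \<epsilon> \<le> r \<Longrightarrow> r \<le> t \<Longrightarrow>
        (W has_vector_derivative - (adj (\<Phi> r) * S r * \<Phi> r)) (at r within {a..})"
      "\<And>r. t - \<epsilon> \<le> r \<Longrightarrow> r \<le> t \<Longrightarrow> \<Psi> r t * adj (\<Phi> r) = un n"
    unfolding observable_def by blast
  define y where "y = B * z"
  define Y where "Y = b\<^sup>2 * (norm z)\<^sup>2"
  have yY: "(norm y)\<^sup>2 \<le> Y"
  proof -
    have "norm y \<le> norm B * norm z" unfolding y_def by (rule norm_mult_ineq)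
    also have "\<dots> \<le> b * norm z" using B by (simp add: mult_right_mono)
    finally have "(norm y)\<^sup>2 \<le> (b * norm z)\<^sup>2" by (rule power_mono) simp
    then show ?thesis by (simp add: Y_def power_mult_distrib)
  qed
  \<comment> \<open>The control that steers \<open>z\<close> to zero: the choice of \<open>y\<close> makes \<open>l\<close> vanish at the start of the window.\<close>
  define \<eta> where "\<eta> r = \<Phi> r * y" for r
  define l where "l r = \<Psi> r t * (un n * z - W r * y)" for r
  have ld: "(l has_vector_derivative - (adj (A r) * l r) + S r * \<eta> r) (at r within {a..})"
    if r: "t - \<epsilon> \<le> r" "r \<le> t" for r
  proof -
    have ar: "a \<le> r" using at r by simp
    have "(l has_vector_derivative \<Psi> r t * (0 - (W r * 0 + - (adj (\<Phi> r) * S r * \<Phi> r) * y))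
        + - (adj (A r) * \<Psi> r t) * (un n * z - W r * y)) (at r within {a..})"
      unfolding l_def
      by (intro has_vector_derivative_mult has_vector_derivative_diff has_vector_derivative_const
          \<Psi>_deriv win ar at r)
    moreover have "\<Psi> r t * (adj (\<Phi> r) * (S r * (\<Phi> r * y))) = S r * \<eta> r"
      using win(3)[OF r] un_times[OF shS[OF ar]] by (metis \<eta>_def mult.assoc)
    ultimately show ?thesis by (simp add: l_def mult.assoc algebra_simps)
  qed
  have lt: "l t = un n * z"
    using \<Psi>_refl[OF at(1)] Wt un_times[OF shape_un] by (simp add: l_def mult.assoc[symmetric])
  have ls: "l (t - \<epsilon>) = 0" using WB by (simp add: l_def y_def mult.assoc[symmetric])
  define E where "E = exp (2 * \<alpha> * \<epsilon>)"
  have \<eta>b: "(norm (\<eta> r))\<^sup>2 \<le> E * Y" if r: "t - \<epsilon> \<le> r" "r \<le> t" for r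
  proof -
    have "(norm (\<eta> r))\<^sup>2 \<le> exp (2 * \<alpha> * (t - r)) * ((norm (\<eta> t))\<^sup>2 + 0 - 0)"
    proof (rule gronwall_backward[of r t _ "\<lambda>r. 2 * inner (\<eta> r) (A r * \<eta> r)" a "\<lambda>_. 0" "\<lambda>_. 0"])
      fix s assume s: "r \<le> s" "s \<le> t"
      have "(\<eta> has_vector_derivative A s * \<eta> s) (at s within {a..})"
        unfolding \<eta>_def
        using has_vector_derivative_mult[OF win(1)[of s] has_vector_derivative_const[of y]] s r
        by (simp add: mult.assoc)
      from has_vector_derivative_inner[OF this this]
      show "((\<lambda>r. (norm (\<eta> r))\<^sup>2) has_real_derivative 2 * inner (\<eta> s) (A s * \<eta> s)) (at s within {a..})"
        by (simp add: power2_norm_eq_inner inner_commute)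
      show "- (2 * \<alpha>) * (norm (\<eta> s))\<^sup>2 - 0 \<le> 2 * inner (\<eta> s) (A s * \<eta> s)"
        using inner_A_le(2)[of s "\<eta> s"] s r at by simp
    qed (use r at \<alpha>_nonneg in auto)
    also have "\<dots> \<le> E * Y"
    proof (intro mult_mono)
      show "exp (2 * \<alpha> * (t - r)) \<le> E"
        unfolding E_def exp_le_cancel_iff by (rule mult_left_mono) (use r \<alpha>_nonneg in auto)
      have "norm (\<eta> t) \<le> norm y" unfolding \<eta>_def \<Phi>t by (rule norm_un_times_le)
      then have "(norm (\<eta> t))\<^sup>2 \<le> (norm y)\<^sup>2" by (rule power_mono) simp
      then show "(norm (\<eta> t))\<^sup>2 + 0 - 0 \<le> Y" using yY by linarith
    qed (auto simp: E_def)
    finally show ?thesis .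
  qed
  define \<Lambda> where "\<Lambda> = exp ((2 * \<alpha> + 1) * \<epsilon>) * ((norm z)\<^sup>2 + \<sigma>\<^sup>2 * (E * Y) * \<epsilon>)"
  have EY: "0 \<le> E * Y" by (simp add: E_def Y_def)
  have lb: "(norm (l r))\<^sup>2 \<le> \<Lambda>" if r: "t - \<epsilon> \<le> r" "r \<le> t" for r
  proof -
    let ?c = "\<sigma>\<^sup>2 * (E * Y)"
    have "(norm (l r))\<^sup>2 \<le> exp ((2 * \<alpha> + 1) * (t - r)) * ((norm (l t))\<^sup>2 + ?c * t - ?c * r)"
    proof (rule gronwall_backward[of r t _ "\<lambda>r. 2 * inner (l r) (- (adj (A r) * l r) + S r * \<eta> r)" a
          "\<lambda>r. ?c * r" "\<lambda>_. ?c"])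
      fix s assume s: "r \<le> s" "s \<le> t"
      then have s': "t - \<epsilon> \<le> s" "a \<le> s" using r at by auto
      from has_vector_derivative_inner[OF ld[OF s'(1) s(2)] ld[OF s'(1) s(2)]]
      show "((\<lambda>r. (norm (l r))\<^sup>2) has_real_derivative 2 * inner (l s) (- (adj (A s) * l s) + S s * \<eta> s)) (at s within {a..})"
        by (simp add: power2_norm_eq_inner inner_commute)
      show "((*) ?c has_real_derivative ?c) (at s within {a..})" by (auto intro!: derivative_eq_intros)
      have "- (2 * \<alpha> * (norm (l s))\<^sup>2) \<le> - 2 * inner (l s) (adj (A s) * l s)"
        using inner_A_le(3)[OF s'(2), of "l s"] by simp
      moreover have "- ((norm (l s))\<^sup>2 + ?c) \<le> 2 * inner (l s) (S s * \<eta> s)"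
      proof -
        have "norm (S s * \<eta> s) \<le> \<sigma> * norm (\<eta> s)"
          by (rule order_trans[OF norm_mult_ineq mult_right_mono[OF bdS[OF s'(2)]]]) simp
        then have "(norm (S s * \<eta> s))\<^sup>2 \<le> (\<sigma> * norm (\<eta> s))\<^sup>2" by (rule power_mono) simp
        also have "\<dots> \<le> ?c"
          using \<eta>b[OF s'(1) s(2)] by (simp add: power_mult_distrib mult_left_mono)
        finally have "(norm (S s * \<eta> s))\<^sup>2 \<le> ?c" .
        moreover have "0 \<le> (norm (l s + S s * \<eta> s))\<^sup>2" by simp
        ultimately show ?thesis
          by (simp add: power2_norm_eq_inner inner_add_left inner_add_right inner_commute)
      qed
      ultimately show "- (2 * \<alpha> + 1) * (norm (l s))\<^sup>2 - ?c \<le> 2 * inner (l s) (- (adj (A s) * l s) + S s * \<eta> s)"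
        by (simp add: inner_diff_right inner_add_right algebra_simps)
    qed (use r at \<alpha>_nonneg EY in auto)
    also have "\<dots> \<le> \<Lambda>"
      unfolding \<Lambda>_def
    proof (intro mult_mono)
      show "exp ((2 * \<alpha> + 1) * (t - r)) \<le> exp ((2 * \<alpha> + 1) * \<epsilon>)"
        unfolding exp_le_cancel_iff by (rule mult_left_mono) (use r \<alpha>_nonneg in auto)
      have "?c * (t - r) \<le> ?c * \<epsilon>" using r EY by (intro mult_left_mono) auto
      moreover have "(norm (l t))\<^sup>2 \<le> (norm z)\<^sup>2"
        unfolding lt by (intro power_mono norm_un_times_le) simp
      moreover have "?c * (t - r) = ?c * t - ?c * r" by (rule right_diff_distrib)
      ultimately show "(norm (l t))\<^sup>2 + ?c * t - ?c * r \<le> (norm z)\<^sup>2 + ?c * \<epsilon>" by linarith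
      show "0 \<le> (norm (l t))\<^sup>2 + ?c * t - ?c * r"
      proof -
        have "?c * r \<le> ?c * t" using r EY by (intro mult_left_mono) auto
        then show ?thesis using zero_le_power2[of "norm (l t)"] by linarith
      qed
    qed simp
    finally show ?thesis .
  qed
  define c where "c = q * \<Lambda> + \<sigma> * (E * Y)"
  define V' where "V' r = inner (l r) (Q r * l r) + inner (\<eta> r) (S r * \<eta> r)
    - inner (\<eta> r - P r * l r) (S r * (\<eta> r - P r * l r))" for r
  have "c * (t - \<epsilon>) - inner (l (t - \<epsilon>)) (P (t - \<epsilon>) * l (t - \<epsilon>)) \<le> c * t - inner (l t) (P t * l t)"
  proof (rule nondecreasing_within[of "t - \<epsilon>" t "\<lambda>r. c * r - inner (l r) (P r * l r)" "\<lambda>r. c - V' r" a])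
    fix r assume r: "t - \<epsilon> \<le> r" "r \<le> t"
    then have ar: "a \<le> r" using at by simp
    show "((\<lambda>r. c * r - inner (l r) (P r * l r)) has_real_derivative c - V' r) (at r within {a..})"
      using value_derivative[OF P ar ld[OF r]] unfolding V'_def
      by (auto intro!: derivative_eq_intros)
    have "inner (l r) (Q r * l r) \<le> q * \<Lambda>"
      using inner_Q_le[OF ar, of "l r"] mult_left_mono[OF lb[OF r] q_nonneg] by simp
    moreover have "inner (\<eta> r) (S r * \<eta> r) \<le> \<sigma> * (E * Y)"
      using inner_S_le[OF ar, of "\<eta> r"] mult_left_mono[OF \<eta>b[OF r] \<sigma>_nonneg] by simp
    moreover have "0 \<le> inner (\<eta> r - P r * l r) (S r * (\<eta> r - P r * l r))"
      by (rule posD[OF posS[OF ar]])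
    ultimately show "0 \<le> c - V' r" by (simp add: V'_def c_def)
  qed (use at e0 in auto)
  then have "inner (un n * z) (P t * (un n * z)) \<le> c * \<epsilon>" by (simp add: ls lt algebra_simps)
  then have "inner z (P t * z) \<le> c * \<epsilon>" using inner_un_restrict[OF at(1) P] by simp
  also have "c * \<epsilon> = \<epsilon> * (q * (exp ((2 * \<alpha> + 1) * \<epsilon>) * (1 + \<sigma>\<^sup>2 * exp (2 * \<alpha> * \<epsilon>) * b\<^sup>2 * \<epsilon>))
    + \<sigma> * exp (2 * \<alpha> * \<epsilon>) * b\<^sup>2) * (norm z)\<^sup>2"
    by (simp add: c_def \<Lambda>_def Y_def E_def algebra_simps)
  finally show ?thesis .
qed

lemma norm_le_of_inner_le:
  assumes "pos X" "shape n n X" "0 \<le> k" "\<And>Z. inner Z (X * Z) \<le> k * (norm Z)\<^sup>2"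
  shows "norm X \<le> k * norm (un n)"
proof -
  have "(norm (X * un n))\<^sup>2 \<le> k * inner (un n) (X * un n)"
    by (rule pos_norm_mult_sq) (use assms in auto)
  also have "\<dots> \<le> k * (k * (norm (un n))\<^sup>2)" using assms by (intro mult_left_mono) auto
  finally have "(norm X)\<^sup>2 \<le> (k * norm (un n))\<^sup>2"
    using times_un[OF assms(2)] by (simp add: power2_eq_square algebra_simps)
  then show ?thesis by (rule power2_le_imp_le) (use assms in simp)
qed

lemma upper_bound:
  assumes P: "sol P" and ps: "\<And>t. a \<le> t \<Longrightarrow> pos (P t)" and ob: "observable \<epsilon> b"
  obtains p where "0 < p" "\<And>t. a \<le> t \<Longrightarrow> norm (P t) \<le> p"
proof -
  have e0: "0 < \<epsilon>" using ob by (simp add: observable_def)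
  define k where "k = \<epsilon> * (q * (exp ((2 * \<alpha> + 1) * \<epsilon>) * (1 + \<sigma>\<^sup>2 * exp (2 * \<alpha> * \<epsilon>) * b\<^sup>2 * \<epsilon>))
    + \<sigma> * exp (2 * \<alpha> * \<epsilon>) * b\<^sup>2)"
  have k: "0 \<le> k" using e0 q_nonneg \<sigma>_nonneg by (simp add: k_def)
  obtain p1 where p1: "p1 > 0" "\<And>t. a \<le> t \<Longrightarrow> t \<le> a + \<epsilon> \<Longrightarrow> norm (P t) \<le> p1"
    using continuous_norm_bounded[OF sol_continuous[OF P] order_refl] by metis
  have "norm (P t) \<le> p1 + k * norm (un n)" if "a \<le> t" for t
  proof (cases "t \<le> a + \<epsilon>")
    case True
    then show ?thesis using p1(2)[OF that] k by (simp add: add_increasing2)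
  next
    case False
    have "norm (P t) \<le> k * norm (un n)"
      by (rule norm_le_of_inner_le)
        (use ps that solD(1)[OF P that] k False upper_bound_window[OF P ps ob] k_def in auto)
    then show ?thesis using p1(1) by simp
  qed
  then show ?thesis using that[of "p1 + k * norm (un n)"] p1(1) k by (simp add: add_pos_nonneg)
qed

text \<open>Along a free adjoint trajectory the value function collects the controllability Gramian up to
  a loss that is at most proportional to the value function itself.\<close>

lemma lower_bound:
  assumes P: "sol P" and ps: "\<And>t. a \<le> t \<Longrightarrow> pos (P t)" and co: "controllable \<epsilon> \<mu>"
    and p: "0 < p" "\<And>t. a \<le> t \<Longrightarrow> norm (P t) \<le> p" and t: "a + \<epsilon> \<le> t"
  shows "exp (- (\<sigma> * p * \<epsilon>)) * \<mu> * (norm (un n * Z))\<^sup>2 \<le> inner Z (P t * Z)"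
proof -
  have e0: "0 < \<epsilon>" using co by (simp add: controllable_def)
  have at: "a \<le> t" "a \<le> t - \<epsilon>" using t e0 by auto
  from co t obtain \<Gamma> where
    \<Gamma>: "\<And>r. t - \<epsilon> \<le> r \<Longrightarrow> r \<le> t \<Longrightarrow>
      (\<Gamma> has_vector_derivative adj (\<Psi> r t) * Q r * \<Psi> r t) (at r within {a..})"
    and \<mu>: "\<mu> * (norm (un n * Z))\<^sup>2 \<le> inner Z ((\<Gamma> t - \<Gamma> (t - \<epsilon>)) * Z)"
    unfolding controllable_def by blast
  define k where "k = \<sigma> * p"
  have k: "0 \<le> k" using \<sigma>_nonneg p by (simp add: k_def)
  define l where "l r = \<Psi> r t * Z" for r
  define V where "V r = inner (l r) (P r * l r)" for r
  define V' where "V' r = inner (l r) (Q r * l r) - inner (P r * l r) (S r * (P r * l r))" for r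
  define h where "h r = exp (k * (r - (t - \<epsilon>))) * V r - inner Z (\<Gamma> r * Z)" for r
  have "h (t - \<epsilon>) \<le> h t"
  proof (rule nondecreasing_within[of "t - \<epsilon>" t h
      "\<lambda>r. exp (k * (r - (t - \<epsilon>))) * (k * V r + V' r) - inner (l r) (Q r * l r)" a])
    fix r assume r: "t - \<epsilon> \<le> r" "r \<le> t"
    then have ar: "a \<le> r" using at by simp
    have Vd: "(V has_real_derivative V' r) (at r within {a..})"
      unfolding V_def V'_def l_def
      using value_derivative[OF P ar free_deriv[OF ar at(1), of Z]]
      by (simp add: minus_mult_right[symmetric])
    have "((\<lambda>r. inner Z (\<Gamma> r * Z)) has_real_derivative inner (l r) (Q r * l r)) (at r within {a..})"
      using has_vector_derivative_inner[OF has_vector_derivative_const[of Z]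
          has_vector_derivative_mult[OF \<Gamma>[OF r] has_vector_derivative_const[of Z]]]
      by (simp add: l_def inner_times_left mult.assoc)
    then show "(h has_real_derivative exp (k * (r - (t - \<epsilon>))) * (k * V r + V' r) - inner (l r) (Q r * l r))
        (at r within {a..})"
      unfolding h_def
      by (auto intro!: derivative_eq_intros Vd simp: algebra_simps)
    have "inner (P r * l r) (S r * (P r * l r)) \<le> \<sigma> * (norm (P r * l r))\<^sup>2" by (rule inner_S_le[OF ar])
    also have "(norm (P r * l r))\<^sup>2 \<le> p * V r"
      unfolding V_def
    proof (rule pos_norm_mult_sq[OF ps[OF ar]])
      show "inner Y (P r * Y) \<le> p * (norm Y)\<^sup>2" for Y
        using inner_le_norm[of Y "P r"] p(2)[OF ar] by (meson mult_right_mono order_trans zero_le_power2)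
    qed
    finally have "inner (P r * l r) (S r * (P r * l r)) \<le> k * V r"
      using \<sigma>_nonneg by (simp add: k_def mult.assoc mult_left_mono)
    then have "inner (l r) (Q r * l r) \<le> k * V r + V' r" by (simp add: V'_def)
    moreover have q0: "0 \<le> inner (l r) (Q r * l r)" by (rule posD[OF posQ[OF ar]])
    moreover have "1 \<le> exp (k * (r - (t - \<epsilon>)))" using k r by simp
    ultimately have "1 * inner (l r) (Q r * l r) \<le> exp (k * (r - (t - \<epsilon>))) * (k * V r + V' r)"
      by (intro mult_mono) auto
    then show "0 \<le> exp (k * (r - (t - \<epsilon>))) * (k * V r + V' r) - inner (l r) (Q r * l r)" by simp
  qed (use at e0 in auto)
  moreover have "0 \<le> V (t - \<epsilon>)" unfolding V_def by (rule posD[OF ps[OF at(2)]])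
  ultimately have "inner Z ((\<Gamma> t - \<Gamma> (t - \<epsilon>)) * Z) \<le> exp (k * \<epsilon>) * V t"
    by (simp add: h_def left_diff_distrib inner_diff_right)
  with \<mu> have "\<mu> * (norm (un n * Z))\<^sup>2 \<le> exp (k * \<epsilon>) * V t" by simp
  then have "exp (- (k * \<epsilon>)) * (\<mu> * (norm (un n * Z))\<^sup>2) \<le> exp (- (k * \<epsilon>)) * (exp (k * \<epsilon>) * V t)"
    by (rule mult_left_mono) simp
  moreover have "V t = inner Z (P t * Z)"
    unfolding V_def l_def \<Psi>_refl[OF at(1)] by (rule inner_un_restrict[OF at(1) P])
  ultimately show ?thesis by (simp add: k_def mult.assoc[symmetric] exp_add[symmetric])
qed

end

section \<open>Exponential decay of the error equation\<close>

text \<open>A solution between two uniform bounds, together with its inverse \<open>Pi\<close>. The constants are parameters,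
since the decay estimate has to be independent of the initial time.\<close>

locale riccati_inverse = riccati +
  fixes P Pi :: "real \<Rightarrow> fsmat" and p \<kappa> c :: real
  assumes solP: "sol P"
    and bdP: "a \<le> t \<Longrightarrow> norm (P t) \<le> p" and p_pos: "0 < p"
    and lowP: "a \<le> t \<Longrightarrow> c * (norm (un n * Z))\<^sup>2 \<le> inner Z (P t * Z)" and c_pos: "0 < c"
    and shPi: "a \<le> t \<Longrightarrow> shape n n (Pi t)"
    and P_Pi: "a \<le> t \<Longrightarrow> P t * Pi t = un n" and Pi_P: "a \<le> t \<Longrightarrow> Pi t * P t = un n"
    and bdPi: "a \<le> t \<Longrightarrow> norm (Pi t) \<le> \<kappa>" and \<kappa>_pos: "0 < \<kappa>"
begin

lemma posP:
  assumes t: "a \<le> t"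
  shows "pos (P t)"
proof -
  have "0 \<le> inner Z (P t * Z)" for Z
  proof -
    have "0 \<le> c * (norm (un n * Z))\<^sup>2" using c_pos by simp
    then show ?thesis using lowP[OF t, of Z] by linarith
  qed
  then show ?thesis using solD(2)[OF solP t] by (simp add: pos_def)
qed

lemma posP_shift: "a \<le> t \<Longrightarrow> pos (P t - c *\<^sub>R un n)"
  by (rule pos_shift_un) (use posP lowP in auto)

lemma adj_Pi: "a \<le> t \<Longrightarrow> adj (Pi t) = Pi t"
proof -
  assume t: "a \<le> t"
  have "adj (Pi t) = adj (Pi t) * (P t * Pi t)"
    using P_Pi[OF t] times_un[OF shape_adj[OF shPi[OF t]]] by simp
  also have "\<dots> = adj (P t * Pi t) * Pi t"
    using solD(2)[OF solP t] by (simp add: mult.assoc)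
  also have "\<dots> = Pi t" using P_Pi[OF t] un_times[OF shPi[OF t]] by simp
  finally show ?thesis .
qed

lemma mult_simps:
  assumes "a \<le> t"
  shows "P t * (Pi t * X) = un n * X" "Pi t * (P t * X) = un n * X"
    "un n * (S t * X) = S t * X" "un n * (Q t * X) = Q t * X" "un n * (A t * X) = A t * X"
    "un n * (adj (A t) * X) = adj (A t) * X" "un n * (P t * X) = P t * X" "un n * (Pi t * X) = Pi t * X"
    "un n * S t = S t" "un n * Q t = Q t" "un n * A t = A t" "un n * adj (A t) = adj (A t)"
    "un n * P t = P t" "un n * Pi t = Pi t"
    "S t * un n = S t" "Q t * un n = Q t" "A t * un n = A t" "adj (A t) * un n = adj (A t)"
    "P t * un n = P t" "Pi t * un n = Pi t"
    "S t * (un n * X) = S t * X" "Q t * (un n * X) = Q t * X" "A t * (un n * X) = A t * X"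
    "adj (A t) * (un n * X) = adj (A t) * X" "P t * (un n * X) = P t * X" "Pi t * (un n * X) = Pi t * X"
  using assms
  by (simp_all add: mult.assoc[symmetric] P_Pi Pi_P un_times[OF shS] un_times[OF shQ] un_times[OF shA]
      un_times[OF shape_adj[OF shA]] un_times[OF solD(1)[OF solP]] un_times[OF shPi]
      times_un[OF shS] times_un[OF shQ] times_un[OF shA]
      times_un[OF shape_adj[OF shA]] times_un[OF solD(1)[OF solP]] times_un[OF shPi])

text \<open>The inverse solves a Riccati equation in which \<open>Q\<close> and \<open>S\<close> have exchanged their roles.\<close>

lemma Pi_deriv:
  assumes t: "a \<le> t"
  shows "(Pi has_vector_derivative
    - (Pi t * A t) - adj (A t) * Pi t - Pi t * Q t * Pi t + S t) (at t within {a..})"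
proof -
  have "(Pi has_vector_derivative
      - (Pi t * (A t * P t + P t * adj (A t) + Q t - P t * S t * P t) * Pi t)) (at t within {a..})"
    by (rule inverse_has_vector_derivative[where u = "un n" and a = P])
      (use t solD(3)[OF solP] P_Pi Pi_P mult_simps in auto)
  moreover have "- (Pi t * (A t * P t + P t * adj (A t) + Q t - P t * S t * P t) * Pi t)
    = - (Pi t * A t) - adj (A t) * Pi t - Pi t * Q t * Pi t + S t"
    using t by (simp add: algebra_simps mult_simps P_Pi Pi_P)
  ultimately show ?thesis by simp
qed

end

text \<open>The trace inequality for \<open>P - c un m\<close> and \<open>adj Y * M * Y\<close>: a lower bound for \<open>P\<close> may be taken out of the
inner product.\<close>

lemma inner_weighted_left_ge:
  assumes "pos (P - c *\<^sub>R un m)" "pos M" "shape k m Y"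
  shows "c * inner Y (M * Y) \<le> inner (Y * P) (M * Y)"
proof -
  have "0 \<le> inner (P - c *\<^sub>R un m) (adj Y * M * Y)"
    by (intro pos_trace_product pos_congruence assms)
  also have "\<dots> = inner P (adj Y * (M * Y)) - c * inner (un m) (adj Y * (M * Y))"
    by (simp add: inner_diff_left mult.assoc)
  also have "inner P (adj Y * (M * Y)) = inner (Y * P) (M * Y)" by (simp add: inner_times_left)
  also have "inner (un m) (adj Y * (M * Y)) = inner (Y * un m) (M * Y)" by (simp add: inner_times_left)
  finally show ?thesis using times_un[OF assms(3)] by simp
qed

lemma inner_weighted_right_ge:
  assumes "pos (P - c *\<^sub>R un n)" "pos M" "shape n k Y"
  shows "c * inner Y (Y * M) \<le> inner (P * Y) (Y * M)"
proof -
  have e: "inner (adj Y * P) (M * adj Y) = inner (P * Y) (Y * M)"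
  proof -
    have "adj P = P"
      using pos_adj[OF assms(1)] by simp
    then have "adj (P * Y) = adj Y * P" "adj (Y * M) = M * adj Y"
      using pos_adj[OF assms(2)] by simp_all
    then show ?thesis using inner_adj_adj[of "P * Y" "Y * M"] by simp
  qed
  have "inner (adj Y) (adj (Y * M)) = inner Y (Y * M)" by (rule inner_adj_adj)
  then have "inner (adj Y) (M * adj Y) = inner Y (Y * M)" using pos_adj[OF assms(2)] by simp
  then show ?thesis
    using inner_weighted_left_ge[OF assms(1,2) shape_adj[OF assms(3)]] e by simp
qed

lemma pos_zero_shift: "pos M \<Longrightarrow> pos (M - 0 *\<^sub>R un n)" by simp

text \<open>The two-sided equation \<open>X' = F1 X + X F2^T\<close> with the closed-loop matrices \<open>Fi = Ai - Pi Si\<close>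
  of two filters governs the difference of two Riccati solutions; with a trivial second filter of
  dimension one it is the error equation of a single filter.  The Lyapunov function is the squared
  length of \<open>X\<close> in the metrics of the two inverses.\<close>

locale two_sided =
  one: riccati_inverse a n A1 Q1 S1 \<Psi>1 \<alpha>1 q1 \<sigma>1 P1 Pi1 p1 \<kappa>1 c1 +
  two: riccati_inverse a m A2 Q2 S2 \<Psi>2 \<alpha>2 q2 \<sigma>2 P2 Pi2 p2 \<kappa>2 c2
  for a n A1 Q1 S1 \<Psi>1 \<alpha>1 q1 \<sigma>1 P1 Pi1 p1 \<kappa>1 c1 m A2 Q2 S2 \<Psi>2 \<alpha>2 q2 \<sigma>2 P2 Pi2 p2 \<kappa>2 c2 +
  fixes \<epsilon> \<mu> :: real and X :: "real \<Rightarrow> fsmat"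
  assumes contr: "one.controllable \<epsilon> \<mu>"
    and shX: "a \<le> t \<Longrightarrow> shape n m (X t)"
    and X_deriv: "a \<le> t \<Longrightarrow> (X has_vector_derivative
      (A1 t - P1 t * S1 t) * X t + X t * adj (A2 t - P2 t * S2 t)) (at t within {a..})"
begin

definition "G t = Pi1 t * X t * Pi2 t"
definition "v t = inner (X t) (G t)"
definition "j1 t = inner (G t) (Q1 t * G t)"
definition "j2 t = inner (G t) (G t * Q2 t)"

lemma shG: "a \<le> t \<Longrightarrow> shape n m (G t)"
  unfolding G_def by (rule shape_times[OF shape_times[OF one.shPi shX] two.shPi])

lemma X_G: "a \<le> t \<Longrightarrow> X t = P1 t * G t * P2 t"
  by (simp add: G_def mult.assoc two.Pi_P one.mult_simps times_un[OF shX] un_times[OF shX])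

lemma G_deriv:
  assumes t: "a \<le> t"
  shows "(G has_vector_derivative - (adj (A1 t) * G t) - G t * A2 t - Pi1 t * (Q1 t * G t)
    - G t * Q2 t * Pi2 t) (at t within {a..})"
proof -
  have Xu: "un n * X t = X t" "X t * un m = X t" "un n * (X t * Y) = X t * Y" "X t * (un m * Y) = X t * Y" for Y
    by (simp_all add: mult.assoc[symmetric] times_un[OF shX] un_times[OF shX] t)
  have adjs: "adj (P2 t) = P2 t" "adj (S2 t) = S2 t"
    using two.solD(2)[OF two.solP t] pos_adj[OF two.posS[OF t]] by auto
  show ?thesis
    unfolding G_def
    by (rule has_vector_derivative_eq_rhs[OF has_vector_derivative_mult[OF
          has_vector_derivative_mult[OF one.Pi_deriv[OF t] X_deriv[OF t]] two.Pi_deriv[OF t]]])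
      (simp add: algebra_simps one.mult_simps[OF t] two.mult_simps[OF t] one.Pi_P[OF t] two.P_Pi[OF t]
        adjs Xu)
qed

text \<open>After the terms with \<open>A1\<close> and \<open>A2\<close> have cancelled, four traces of products of positive semidefinite
matrices remain. Those with \<open>S1\<close> and \<open>S2\<close> are dropped; those with \<open>Q1\<close> and \<open>Q2\<close> are the dissipation.\<close>

lemma v_deriv:
  assumes t: "a \<le> t"
  shows "\<exists>D. (v has_real_derivative D) (at t within {a..}) \<and> D \<le> - (c2 * j1 t + c1 * j2 t)"
proof -
  let ?X = "X t" and ?G = "G t"
  define D where "D = inner ?X (- (adj (A1 t) * ?G) - ?G * A2 t - Pi1 t * (Q1 t * ?G) - ?G * Q2 t * Pi2 t)
      + inner ((A1 t - P1 t * S1 t) * ?X + ?X * adj (A2 t - P2 t * S2 t)) ?G"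
  have "(v has_real_derivative D) (at t within {a..})"
    unfolding v_def D_def by (rule has_vector_derivative_inner[OF X_deriv[OF t] G_deriv[OF t]])
  moreover have "D \<le> - (c2 * j1 t + c1 * j2 t)"
  proof -
    have adjs: "adj (P2 t) = P2 t" "adj (S2 t) = S2 t" "adj (P1 t) = P1 t" "adj (S1 t) = S1 t"
      "adj (Pi1 t) = Pi1 t" "adj (Pi2 t) = Pi2 t"
      using two.solD(2)[OF two.solP t] pos_adj[OF two.posS[OF t]]
        one.solD(2)[OF one.solP t] pos_adj[OF one.posS[OF t]] one.adj_Pi[OF t] two.adj_Pi[OF t] by auto
    have Gu: "?G * un m = ?G" "un n * ?G = ?G" using shG[OF t] times_un un_times by auto
    have D: "D = - inner ?X (S1 t * (P1 t * ?G)) - inner ?X (?G * P2 t * S2 t)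
        - inner ?X (Pi1 t * (Q1 t * ?G)) - inner ?X (?G * Q2 t * Pi2 t)"
      unfolding D_def
      by (simp add: algebra_simps inner_add_left inner_add_right inner_diff_left inner_diff_right
          inner_times_left[of "A1 t"] inner_times_left[of "P1 t"] inner_times_left[of "S1 t"]
          inner_times_right[of ?X] adjs)
    have X: "?X = P1 t * ?G * P2 t" by (rule X_G[OF t])
    have "0 * inner (P1 t * ?G) (S1 t * (P1 t * ?G)) \<le> inner (P1 t * ?G * P2 t) (S1 t * (P1 t * ?G))"
      by (rule inner_weighted_left_ge[where m = m and k = n])
        (use one.posS two.posP t in \<open>auto intro!: pos_zero_shift shape_times one.solD(1)[OF one.solP] shG\<close>)
    then have 1: "0 \<le> inner ?X (S1 t * (P1 t * ?G))" using X by simp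
    have "0 * inner (?G * P2 t) (?G * P2 t * S2 t) \<le> inner (P1 t * (?G * P2 t)) (?G * P2 t * S2 t)"
      by (rule inner_weighted_right_ge[where n = n and k = m])
        (use one.posP two.posS t in \<open>auto intro!: pos_zero_shift shape_times two.solD(1)[OF two.solP] shG\<close>)
    then have 2: "0 \<le> inner ?X (?G * P2 t * S2 t)" using X by (simp add: mult.assoc)
    have "inner ?X (Pi1 t * (Q1 t * ?G)) = inner (Pi1 t * ?X) (Q1 t * ?G)"
      using inner_times_left[of "Pi1 t" ?X "Q1 t * ?G"] adjs by simp
    also have "Pi1 t * ?X = ?G * P2 t"
      unfolding X by (simp add: mult.assoc one.mult_simps[OF t]) (simp add: mult.assoc[symmetric] Gu)
    finally have 3: "c2 * j1 t \<le> inner ?X (Pi1 t * (Q1 t * ?G))"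
      unfolding j1_def
      using inner_weighted_left_ge[OF two.posP_shift[OF t] one.posQ[OF t] shG[OF t]] by simp
    have "inner ?X (?G * Q2 t * Pi2 t) = inner (?X * Pi2 t) (?G * Q2 t)"
      using inner_times_right[of ?X "Pi2 t" "?G * Q2 t"] adjs by simp
    also have "?X * Pi2 t = P1 t * ?G"
      unfolding X by (simp add: mult.assoc two.P_Pi[OF t] Gu)
    finally have 4: "c1 * j2 t \<le> inner ?X (?G * Q2 t * Pi2 t)"
      unfolding j2_def
      using inner_weighted_right_ge[OF one.posP_shift[OF t] two.posQ[OF t] shG[OF t]] by simp
    show ?thesis using D 1 2 3 4 by linarith
  qed
  ultimately show ?thesis by blast
qed

lemma j1_nonneg: "a \<le> t \<Longrightarrow> 0 \<le> j1 t"
  unfolding j1_def by (intro posD one.posQ)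

lemma j2_nonneg: "a \<le> t \<Longrightarrow> 0 \<le> j2 t"
proof -
  assume t: "a \<le> t"
  have "j2 t = inner (adj (G t)) (Q2 t * adj (G t))"
    unfolding j2_def using pos_adj[OF two.posQ[OF t]] by (metis adj_times inner_adj_adj)
  then show ?thesis using posD[OF two.posQ[OF t]] by simp
qed

text \<open>Only the inequality for the derivative is needed from here on, not its formula.\<close>

definition "v' t = (SOME D. (v has_real_derivative D) (at t within {a..}) \<and> D \<le> - (c2 * j1 t + c1 * j2 t))"

lemma v':
  assumes "a \<le> t"
  shows "(v has_real_derivative v' t) (at t within {a..})" "c2 * j1 t + c1 * j2 t \<le> - v' t"
  using someI_ex[OF v_deriv[OF assms]] unfolding v'_def by auto

lemma v'_nonpos: "a \<le> t \<Longrightarrow> v' t \<le> 0"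
proof -
  assume t: "a \<le> t"
  have "0 \<le> c2 * j1 t" "0 \<le> c1 * j2 t"
    using j1_nonneg[OF t] j2_nonneg[OF t] one.c_pos two.c_pos by simp_all
  then show ?thesis using v'(2)[OF t] by linarith
qed

lemma v_antimono:
  assumes "a \<le> s" "s \<le> t"
  shows "v t \<le> v s"
proof -
  have "- v s \<le> - v t"
  proof (rule nondecreasing_within[of s t "\<lambda>r. - v r" "\<lambda>r. - v' r" a])
    fix r assume "s \<le> r" "r \<le> t"
    then have r: "a \<le> r" using assms by simp
    show "((\<lambda>r. - v r) has_real_derivative - v' r) (at r within {a..})"
      by (intro derivative_intros v' r)
    show "0 \<le> - v' r" using v'_nonpos[OF r] by simp
  qed (use assms in auto)
  then show ?thesis by simp
qed

lemma norm3_bound: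
  assumes "norm (x :: fsmat) \<le> b1" "norm z \<le> b2"
  shows "norm (x * y * z) \<le> b1 * b2 * norm y"
proof -
  have "norm (x * y * z) \<le> norm x * (norm y * norm z)" by (rule norm_mult3_le)
  also have "\<dots> \<le> b1 * (norm y * b2)"
    using assms order_trans[OF norm_ge_zero] by (intro mult_mono mult_nonneg_nonneg) auto
  finally show ?thesis by (simp add: mult_ac)
qed

lemma norm_X_le: "a \<le> t \<Longrightarrow> norm (X t) \<le> p1 * p2 * norm (G t)"
  by (subst X_G) (auto intro!: norm3_bound one.bdP two.bdP)

lemma v_le_G: "a \<le> t \<Longrightarrow> v t \<le> p1 * p2 * (norm (G t))\<^sup>2"
proof -
  assume t: "a \<le> t"
  have "v t \<le> norm (X t) * norm (G t)" unfolding v_def by (rule norm_cauchy_schwarz)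
  also have "\<dots> \<le> p1 * p2 * norm (G t) * norm (G t)" by (intro mult_right_mono norm_X_le t) simp
  finally show ?thesis by (simp add: power2_eq_square mult.assoc)
qed

lemma v_le_X: "a \<le> t \<Longrightarrow> v t \<le> \<kappa>1 * \<kappa>2 * (norm (X t))\<^sup>2"
proof -
  assume t: "a \<le> t"
  have "v t \<le> norm (X t) * norm (G t)" unfolding v_def by (rule norm_cauchy_schwarz)
  also have "\<dots> \<le> norm (X t) * (\<kappa>1 * \<kappa>2 * norm (X t))"
    unfolding G_def by (intro mult_left_mono norm3_bound one.bdPi two.bdPi t) simp
  finally show ?thesis by (simp add: power2_eq_square mult_ac)
qed

lemma v_ge_X: "a \<le> t \<Longrightarrow> c1 * c2 / (p1 * p2)\<^sup>2 * (norm (X t))\<^sup>2 \<le> v t"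
proof -
  assume t: "a \<le> t"
  have Gu: "un n * G t = G t" using shG[OF t] un_times by auto
  have "c1 * (norm (G t))\<^sup>2 \<le> inner (G t) (P1 t * G t)" using one.lowP[OF t, of "G t"] Gu by simp
  then have "c2 * (c1 * (norm (G t))\<^sup>2) \<le> c2 * inner (G t) (P1 t * G t)"
    using two.c_pos by (intro mult_left_mono) auto
  also have "\<dots> \<le> inner (G t * P2 t) (P1 t * G t)"
    by (rule inner_weighted_left_ge[OF two.posP_shift[OF t] one.posP[OF t] shG[OF t]])
  also have "\<dots> = inner (P1 t * (G t * P2 t)) (G t)"
    using one.solD(2)[OF one.solP t] by (metis inner_commute inner_times_left)
  also have "\<dots> = v t" using X_G[OF t] by (simp add: v_def mult.assoc)
  finally have vG: "c1 * c2 * (norm (G t))\<^sup>2 \<le> v t" by (simp add: mult_ac)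
  have "(norm (X t))\<^sup>2 \<le> (p1 * p2 * norm (G t))\<^sup>2" by (rule power_mono[OF norm_X_le[OF t]]) simp
  then have "(norm (X t))\<^sup>2 / (p1 * p2)\<^sup>2 \<le> (norm (G t))\<^sup>2"
    using one.p_pos two.p_pos by (simp add: divide_le_eq power_mult_distrib mult_ac)
  then have "c1 * c2 * ((norm (X t))\<^sup>2 / (p1 * p2)\<^sup>2) \<le> c1 * c2 * (norm (G t))\<^sup>2"
    using one.c_pos two.c_pos by (intro mult_left_mono) auto
  then show ?thesis using vG by simp
qed

text \<open>Over one controllability window the Lyapunov function drops by a fixed fraction.  Up to
  terms that the dissipation controls, \<open>G\<close> is a free two-sided adjoint trajectory, along which the
  dissipation integrates to a controllability Gramian.\<close>

definition "lossK = \<kappa>1\<^sup>2 * q1 / c2 + \<kappa>2\<^sup>2 * q2 / c1"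
definition "growth = exp ((2 * \<alpha>1 + 2 * \<alpha>2 + 2) * \<epsilon>)"
definition "rate = exp (- 2 * \<alpha>2 * \<epsilon>) * \<mu> / (p1 * p2 * (2 / c2 + 2 * q1 * growth * lossK * \<epsilon>))"

lemma eps_mu: "0 < \<epsilon>" "0 < \<mu>" using contr by (auto simp: one.controllable_def)

lemma lossK_nonneg: "0 \<le> lossK"
  using one.q_nonneg two.q_nonneg one.c_pos two.c_pos by (simp add: lossK_def)

lemma rate_pos: "0 < rate"
proof -
  have "0 < 2 / c2 + 2 * q1 * growth * lossK * \<epsilon>"
    using two.c_pos one.q_nonneg lossK_nonneg eps_mu by (intro add_pos_nonneg) (auto simp: growth_def)
  then show ?thesis using one.p_pos two.p_pos eps_mu by (simp add: rate_def)
qed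

text \<open>The deviation of \<open>G\<close> from the free two-sided adjoint trajectory that ends in the same value is driven
by \<open>Pi1 Q1 G\<close> and \<open>G Q2 Pi2\<close>, whose squares are bounded by the dissipation and hence by the loss of \<open>v\<close>.\<close>

lemma deviation_bound:
  assumes t: "a \<le> t - \<epsilon>" and r: "t - \<epsilon> \<le> r" "r \<le> t"
  shows "(norm (G r - \<Psi>1 r t * G t * adj (\<Psi>2 r t)))\<^sup>2 \<le> growth * (lossK * (v (t - \<epsilon>) - v t))"
proof -
  have at: "a \<le> t" using t eps_mu by simp
  let ?H = "G t"
  define k where "k = 2 * \<alpha>1 + 2 * \<alpha>2 + 2"
  have k: "0 \<le> k" using one.\<alpha>_nonneg two.\<alpha>_nonneg by (simp add: k_def)
  define e where "e s = G s - \<Psi>1 s t * ?H * adj (\<Psi>2 s t)" for s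
  define f where "f s = Pi1 s * (Q1 s * G s) + G s * Q2 s * Pi2 s" for s
  define e' where "e' s = - (adj (A1 s) * e s) - e s * A2 s - f s" for s
  have ed: "(e has_vector_derivative e' s) (at s within {a..})" if s: "a \<le> s" for s
    unfolding e_def
    by (rule has_vector_derivative_eq_rhs[OF has_vector_derivative_diff[OF G_deriv[OF s]
        has_vector_derivative_mult[OF has_vector_derivative_mult[OF one.\<Psi>_deriv[OF s at]
        has_vector_derivative_const[of ?H]] has_vector_derivative_adj[OF two.\<Psi>_deriv[OF s at]]]]])
      (simp add: e'_def e_def f_def algebra_simps)
  have "(norm (e r))\<^sup>2 \<le> exp (k * (t - r)) * ((norm (e t))\<^sup>2 + (- lossK * v t) - (- lossK * v r))"
  proof (rule gronwall_backward[of r t _ "\<lambda>s. 2 * inner (e s) (e' s)" a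
        "\<lambda>s. - lossK * v s" "\<lambda>s. - lossK * v' s"])
    fix s assume s: "r \<le> s" "s \<le> t"
    then have as: "a \<le> s" using r t by simp
    from has_vector_derivative_inner[OF ed[OF as] ed[OF as]]
    show "((\<lambda>s. (norm (e s))\<^sup>2) has_real_derivative 2 * inner (e s) (e' s)) (at s within {a..})"
      by (simp add: power2_norm_eq_inner inner_commute)
    show "((\<lambda>s. - lossK * v s) has_real_derivative - lossK * v' s) (at s within {a..})"
      by (auto intro!: derivative_eq_intros v' as)
    show "0 \<le> - lossK * v' s"
      using lossK_nonneg v'_nonpos[OF as] by (simp add: mult_nonneg_nonpos)
    have 1: "inner (e s) (adj (A1 s) * e s) \<le> \<alpha>1 * (norm (e s))\<^sup>2" by (rule one.inner_A_le(3)[OF as])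
    have 2: "inner (e s) (e s * A2 s) \<le> \<alpha>2 * (norm (e s))\<^sup>2"
      using two.inner_A_le(3)[OF as, of "adj (e s)"] by (metis adj_times inner_adj_adj norm_adj)
    have 3: "2 * inner (e s) (Pi1 s * (Q1 s * G s)) \<le> (norm (e s))\<^sup>2 + \<kappa>1\<^sup>2 * (q1 * j1 s)"
    proof -
      let ?y = "Pi1 s * (Q1 s * G s)"
      have "norm ?y \<le> \<kappa>1 * norm (Q1 s * G s)"
        by (rule order_trans[OF norm_mult_ineq mult_right_mono[OF one.bdPi[OF as]]]) simp
      then have "(norm ?y)\<^sup>2 \<le> (\<kappa>1 * norm (Q1 s * G s))\<^sup>2" by (rule power_mono) simp
      also have "\<dots> \<le> \<kappa>1\<^sup>2 * (q1 * j1 s)"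
        unfolding power_mult_distrib j1_def
        by (intro mult_left_mono pos_norm_mult_sq one.posQ one.inner_Q_le as) simp
      finally have "(norm ?y)\<^sup>2 \<le> \<kappa>1\<^sup>2 * (q1 * j1 s)" .
      moreover have "0 \<le> (norm (e s - ?y))\<^sup>2" by simp
      ultimately show ?thesis
        by (simp add: power2_norm_eq_inner inner_diff_left inner_diff_right inner_commute)
    qed
    have 4: "2 * inner (e s) (G s * Q2 s * Pi2 s) \<le> (norm (e s))\<^sup>2 + \<kappa>2\<^sup>2 * (q2 * j2 s)"
    proof -
      let ?y = "G s * Q2 s * Pi2 s"
      have "norm ?y \<le> \<kappa>2 * norm (G s * Q2 s)"
        by (subst mult.commute, rule order_trans[OF norm_mult_ineq mult_left_mono[OF two.bdPi[OF as]]]) simp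
      then have "(norm ?y)\<^sup>2 \<le> (\<kappa>2 * norm (G s * Q2 s))\<^sup>2" by (rule power_mono) simp
      also have "\<dots> = \<kappa>2\<^sup>2 * (norm (Q2 s * adj (G s)))\<^sup>2"
        using pos_adj[OF two.posQ[OF as]] by (metis adj_times norm_adj power_mult_distrib)
      also have "\<dots> \<le> \<kappa>2\<^sup>2 * (q2 * inner (adj (G s)) (Q2 s * adj (G s)))"
        by (intro mult_left_mono pos_norm_mult_sq two.posQ two.inner_Q_le as) simp
      also have "inner (adj (G s)) (Q2 s * adj (G s)) = j2 s"
        unfolding j2_def using pos_adj[OF two.posQ[OF as]] by (metis adj_times inner_adj_adj)
      finally have "(norm ?y)\<^sup>2 \<le> \<kappa>2\<^sup>2 * (q2 * j2 s)" .
      moreover have "0 \<le> (norm (e s - ?y))\<^sup>2" by simp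
      ultimately show ?thesis
        by (simp add: power2_norm_eq_inner inner_diff_left inner_diff_right inner_commute)
    qed
    have 5: "\<kappa>1\<^sup>2 * (q1 * j1 s) + \<kappa>2\<^sup>2 * (q2 * j2 s) \<le> lossK * (- v' s)"
    proof -
      let ?u = "\<kappa>1\<^sup>2 * q1 / c2" and ?w = "\<kappa>2\<^sup>2 * q2 / c1"
      have uw: "0 \<le> ?u" "0 \<le> ?w" using one.q_nonneg two.q_nonneg one.c_pos two.c_pos by auto
      have "0 \<le> ?u * (c1 * j2 s)" "0 \<le> ?w * (c2 * j1 s)"
        by (intro mult_nonneg_nonneg uw j1_nonneg[OF as] j2_nonneg[OF as] less_imp_le[OF one.c_pos]
            less_imp_le[OF two.c_pos])+
      moreover have "\<kappa>1\<^sup>2 * (q1 * j1 s) = ?u * (c2 * j1 s)" "\<kappa>2\<^sup>2 * (q2 * j2 s) = ?w * (c1 * j2 s)"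
        using one.c_pos two.c_pos by auto
      ultimately have "\<kappa>1\<^sup>2 * (q1 * j1 s) + \<kappa>2\<^sup>2 * (q2 * j2 s) \<le> lossK * (c2 * j1 s + c1 * j2 s)"
        by (simp add: lossK_def algebra_simps)
      also have "\<dots> \<le> lossK * (- v' s)" by (rule mult_left_mono[OF v'(2)[OF as] lossK_nonneg])
      finally show ?thesis .
    qed
    have "inner (e s) (e' s) = - inner (e s) (adj (A1 s) * e s) - inner (e s) (e s * A2 s)
        - inner (e s) (Pi1 s * (Q1 s * G s)) - inner (e s) (G s * Q2 s * Pi2 s)"
      by (simp add: e'_def f_def inner_diff_right inner_add_right)
    then show "- k * (norm (e s))\<^sup>2 - - lossK * v' s \<le> 2 * inner (e s) (e' s)"
      using 1 2 3 4 5 by (simp add: k_def algebra_simps)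
  qed (use r t k in auto)
  also have "e t = 0"
    using one.\<Psi>_refl[OF at] two.\<Psi>_refl[OF at] un_times[OF shG[OF at]] times_un[OF shG[OF at]]
    by (simp add: e_def)
  also have "exp (k * (t - r)) * ((norm (0 :: fsmat))\<^sup>2 + (- lossK * v t) - (- lossK * v r))
      = exp (k * (t - r)) * (lossK * (v r - v t))" by (simp add: algebra_simps)
  also have "\<dots> \<le> growth * (lossK * (v (t - \<epsilon>) - v t))"
  proof (intro mult_mono)
    show "exp (k * (t - r)) \<le> growth"
      unfolding growth_def exp_le_cancel_iff k_def[symmetric] by (rule mult_left_mono[OF _ k]) (use r in simp)
    show "v r - v t \<le> v (t - \<epsilon>) - v t" using v_antimono[OF t r(1)] by simp
    show "0 \<le> lossK * (v r - v t)"
      using lossK_nonneg v_antimono[of r t] r t by simp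
  qed (use lossK_nonneg growth_def v_antimono[of r t] r t in auto)
  finally show ?thesis by (simp add: e_def)
qed

lemma window_decay:
  assumes t: "a \<le> t - \<epsilon>"
  shows "(1 + rate) * v t \<le> v (t - \<epsilon>)"
proof -
  have at: "a \<le> t" using t eps_mu by simp
  from contr at t obtain \<Gamma> where
    \<Gamma>: "\<And>r. t - \<epsilon> \<le> r \<Longrightarrow> r \<le> t \<Longrightarrow>
      (\<Gamma> has_vector_derivative adj (\<Psi>1 r t) * Q1 r * \<Psi>1 r t) (at r within {a..})"
    and \<mu>: "\<And>Z. \<mu> * (norm (un n * Z))\<^sup>2 \<le> inner Z ((\<Gamma> t - \<Gamma> (t - \<epsilon>)) * Z)"
    unfolding one.controllable_def by (metis add.commute le_diff_eq)
  let ?H = "G t"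
  define \<Delta> where "\<Delta> = v (t - \<epsilon>) - v t"
  define l where "l = exp (- 2 * \<alpha>2 * \<epsilon>)"
  define b where "b = growth * (lossK * \<Delta>)"
  define \<gamma> where "\<gamma> r = inner ?H (\<Gamma> r * ?H)" for r
  define Y where "Y r = \<Psi>1 r t * ?H" for r
  have Hu: "un n * ?H = ?H" "?H * un m = ?H" using un_times[OF shG[OF at]] times_un[OF shG[OF at]] by auto
  define h where "h r = - (2 / c2) * v r + 2 * q1 * b * r - l * \<gamma> r" for r
  have "h (t - \<epsilon>) \<le> h t"
  proof (rule nondecreasing_within[of "t - \<epsilon>" t h
      "\<lambda>r. - (2 / c2) * v' r + 2 * q1 * b - l * inner (Y r) (Q1 r * Y r)" a])
    fix r assume r: "t - \<epsilon> \<le> r" "r \<le> t"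
    then have ar: "a \<le> r" using t by simp
    have "(\<gamma> has_real_derivative inner (Y r) (Q1 r * Y r)) (at r within {a..})"
      unfolding \<gamma>_def
      using has_vector_derivative_inner[OF has_vector_derivative_const[of ?H]
          has_vector_derivative_mult[OF \<Gamma>[OF r] has_vector_derivative_const[of ?H]]]
      by (simp add: Y_def inner_times_left mult.assoc)
    then show "(h has_real_derivative - (2 / c2) * v' r + 2 * q1 * b - l * inner (Y r) (Q1 r * Y r)) (at r within {a..})"
      unfolding h_def using v'(1)[OF ar] two.c_pos by (auto intro!: derivative_eq_intros)
    let ?e = "G r - Y r * adj (\<Psi>2 r t)"
    have eb: "(norm ?e)\<^sup>2 \<le> b"
      using deviation_bound[OF t r] by (simp add: b_def \<Delta>_def Y_def)
    have Yu: "Y r * un m = Y r" by (simp add: Y_def mult.assoc Hu)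
    have "pos (adj (\<Psi>2 r t) * \<Psi>2 r t - l *\<^sub>R un m)"
    proof (rule pos_shift_un)
      show "l * (norm (un m * Z))\<^sup>2 \<le> inner Z (adj (\<Psi>2 r t) * \<Psi>2 r t * Z)" for Z
      proof -
        have "l \<le> exp (- 2 * \<alpha>2 * (t - r))"
        proof -
          have "\<alpha>2 * (t - r) \<le> \<alpha>2 * \<epsilon>" using r two.\<alpha>_nonneg by (intro mult_left_mono) auto
          then show ?thesis by (simp add: l_def)
        qed
        then have "l * (norm (un m * Z))\<^sup>2 \<le> exp (- 2 * \<alpha>2 * (t - r)) * (norm (un m * Z))\<^sup>2"
          by (rule mult_right_mono) simp
        also have "\<dots> \<le> (norm (\<Psi>2 r t * Z))\<^sup>2" by (rule two.\<Psi>_norm_ge[OF ar r(2)])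
        also have "\<dots> = inner Z (adj (\<Psi>2 r t) * \<Psi>2 r t * Z)"
          by (simp add: power2_norm_eq_inner inner_times_left mult.assoc)
        finally show ?thesis .
      qed
    qed simp
    then have "l * inner (Y r) (Q1 r * Y r) \<le> inner (Y r * (adj (\<Psi>2 r t) * \<Psi>2 r t)) (Q1 r * Y r)"
      by (rule inner_weighted_left_ge[OF _ one.posQ[OF ar], where k = n])
        (auto simp: Y_def intro!: shape_times one.sh\<Psi> ar at shG)
    also have "\<dots> = inner (Y r * adj (\<Psi>2 r t)) (Q1 r * (Y r * adj (\<Psi>2 r t)))"
      by (simp add: mult.assoc[symmetric] inner_times_right[of "Y r * adj (\<Psi>2 r t)"])
    also have "Y r * adj (\<Psi>2 r t) = G r - ?e" by simp
    also have "inner (G r - ?e) (Q1 r * (G r - ?e)) \<le> 2 * j1 r + 2 * inner ?e (Q1 r * ?e)"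
      unfolding j1_def by (rule pos_inner_diff_le[OF one.posQ[OF ar]])
    also have "inner ?e (Q1 r * ?e) \<le> q1 * b"
      using one.inner_Q_le[OF ar, of ?e] mult_left_mono[OF eb one.q_nonneg] by simp
    finally have 1: "l * inner (Y r) (Q1 r * Y r) \<le> 2 * j1 r + 2 * (q1 * b)" by simp
    have "0 \<le> c1 * j2 r" using j2_nonneg[OF ar] one.c_pos by simp
    then have "c2 * j1 r \<le> - v' r" using v'(2)[OF ar] by linarith
    then have "(2 / c2) * (c2 * j1 r) \<le> (2 / c2) * - v' r"
      using two.c_pos by (intro mult_left_mono) auto
    then have "2 * j1 r \<le> - (2 / c2) * v' r" using two.c_pos by simp
    with 1 show "0 \<le> - (2 / c2) * v' r + 2 * q1 * b - l * inner (Y r) (Q1 r * Y r)" by simp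
  qed (use t eps_mu in auto)
  then have "l * (\<gamma> t - \<gamma> (t - \<epsilon>)) \<le> (2 / c2) * \<Delta> + 2 * q1 * b * \<epsilon>"
    by (simp add: h_def \<Delta>_def algebra_simps)
  also have "\<dots> = (2 / c2 + 2 * q1 * growth * lossK * \<epsilon>) * \<Delta>" by (simp add: b_def algebra_simps)
  finally have 2: "l * (\<gamma> t - \<gamma> (t - \<epsilon>)) \<le> (2 / c2 + 2 * q1 * growth * lossK * \<epsilon>) * \<Delta>" .
  have "\<mu> * (norm ?H)\<^sup>2 \<le> \<gamma> t - \<gamma> (t - \<epsilon>)"
    using \<mu>[of ?H] Hu by (simp add: \<gamma>_def left_diff_distrib inner_diff_right)
  then have "l * (\<mu> * (norm ?H)\<^sup>2) \<le> l * (\<gamma> t - \<gamma> (t - \<epsilon>))" by (rule mult_left_mono) (simp add: l_def)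
  with 2 have 3: "l * \<mu> * (norm ?H)\<^sup>2 \<le> (2 / c2 + 2 * q1 * growth * lossK * \<epsilon>) * \<Delta>" by simp
  have pp: "0 < p1 * p2" using one.p_pos two.p_pos by simp
  have K: "0 < 2 / c2 + 2 * q1 * growth * lossK * \<epsilon>"
    using two.c_pos one.q_nonneg lossK_nonneg eps_mu by (intro add_pos_nonneg) (auto simp: growth_def)
  have lm: "0 \<le> l * \<mu>" using eps_mu by (simp add: l_def)
  have "l * \<mu> * v t \<le> l * \<mu> * (p1 * p2 * (norm ?H)\<^sup>2)" by (rule mult_left_mono[OF v_le_G[OF at] lm])
  also have "\<dots> = p1 * p2 * (l * \<mu> * (norm ?H)\<^sup>2)" by (simp add: mult_ac)
  also have "\<dots> \<le> p1 * p2 * ((2 / c2 + 2 * q1 * growth * lossK * \<epsilon>) * \<Delta>)"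
    by (rule mult_left_mono[OF 3]) (use pp in simp)
  finally have "rate * v t \<le> \<Delta>"
  proof -
    let ?D = "p1 * p2 * (2 / c2 + 2 * q1 * growth * lossK * \<epsilon>)"
    have D: "0 < ?D" using pp K by simp
    assume "l * \<mu> * v t \<le> p1 * p2 * ((2 / c2 + 2 * q1 * growth * lossK * \<epsilon>) * \<Delta>)"
    then have "l * \<mu> * v t / ?D \<le> \<Delta>" unfolding pos_divide_le_eq[OF D] by (simp add: mult_ac)
    then show ?thesis by (simp add: rate_def l_def)
  qed
  then show ?thesis by (simp add: \<Delta>_def algebra_simps)
qed

lemma decay:
  assumes "a + real k * \<epsilon> \<le> t"
  shows "(norm (X t))\<^sup>2 \<le> (p1 * p2)\<^sup>2 * (\<kappa>1 * \<kappa>2) / (c1 * c2) / (1 + rate) ^ k * (norm (X a))\<^sup>2"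
proof -
  have v: "(1 + rate) ^ k * v t \<le> v a" if "a + real k * \<epsilon> \<le> t" for t
    using that
  proof (induction k arbitrary: t)
    case 0
    then show ?case using v_antimono[of a t] by simp
  next
    case (Suc k)
    have le: "a + real k * \<epsilon> \<le> t - \<epsilon>" using Suc.prems by (simp add: algebra_simps)
    moreover have "0 \<le> real k * \<epsilon>" using eps_mu by simp
    ultimately have w: "(1 + rate) * v t \<le> v (t - \<epsilon>)" by (intro window_decay) simp
    have "(1 + rate) ^ k * ((1 + rate) * v t) \<le> (1 + rate) ^ k * v (t - \<epsilon>)"
      using rate_pos by (intro mult_left_mono w) simp
    also have "\<dots> \<le> v a" by (rule Suc.IH[OF le])
    finally show ?case by (simp add: mult_ac)
  qed
  have at: "a \<le> t" using assms eps_mu by (smt (verit) mult_nonneg_nonneg of_nat_0_le_iff)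
  have r: "0 < (1 + rate) ^ k" using rate_pos by simp
  have cc: "0 < c1 * c2" "0 < (p1 * p2)\<^sup>2" using one.c_pos two.c_pos one.p_pos two.p_pos by auto
  have "(1 + rate) ^ k * (c1 * c2 / (p1 * p2)\<^sup>2 * (norm (X t))\<^sup>2) \<le> (1 + rate) ^ k * v t"
    using v_ge_X[OF at] r by (intro mult_left_mono) auto
  also have "\<dots> \<le> \<kappa>1 * \<kappa>2 * (norm (X a))\<^sup>2" using v[OF assms] v_le_X[of a] by simp
  finally have "(norm (X t))\<^sup>2 * ((1 + rate) ^ k * (c1 * c2)) \<le> (\<kappa>1 * \<kappa>2 * (norm (X a))\<^sup>2) * (p1 * p2)\<^sup>2"
    using cc by (simp add: field_simps)
  then have "(norm (X t))\<^sup>2 \<le> (\<kappa>1 * \<kappa>2 * (norm (X a))\<^sup>2) * (p1 * p2)\<^sup>2 / ((1 + rate) ^ k * (c1 * c2))"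
    using cc r by (simp add: pos_le_divide_eq)
  then show ?thesis by (simp add: field_simps)
qed

end

text \<open>The constants of the decay estimate do not depend on the initial time, which makes the
  estimate uniform.\<close>

lemma (in riccati_inverse) riccati_inverse_restrict:
  "a \<le> b \<Longrightarrow> riccati_inverse b n A Q S \<Psi> \<alpha> q \<sigma> P Pi p \<kappa> c"
  unfolding riccati_inverse_def riccati_inverse_axioms_def
  using riccati_restrict[of b] sol_restrict[OF solP, of b]
  by (auto intro: bdP p_pos lowP c_pos shPi P_Pi Pi_P bdPi \<kappa>_pos)

lemma (in riccati) controllable_restrict:
  assumes co: "controllable \<epsilon> \<mu>" and b: "a \<le> b"
  shows "riccati.controllable b n Q \<Psi> \<epsilon> \<mu>"
  unfolding riccati.controllable_def[OF riccati_restrict[OF b]]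
proof (intro conjI allI impI)
  show "0 < \<epsilon>" "0 < \<mu>" using co by (auto simp: controllable_def)
  fix t assume t: "b + \<epsilon> \<le> t"
  then have "a + \<epsilon> \<le> t" using b by simp
  with co obtain \<Gamma> where
    \<Gamma>: "\<And>r. t - \<epsilon> \<le> r \<Longrightarrow> r \<le> t \<Longrightarrow>
      (\<Gamma> has_vector_derivative adj (\<Psi> r t) * Q r * \<Psi> r t) (at r within {a..})"
    and \<mu>: "\<And>Z. \<mu> * (norm (un n * Z))\<^sup>2 \<le> inner Z ((\<Gamma> t - \<Gamma> (t - \<epsilon>)) * Z)"
    unfolding controllable_def by blast
  have "(\<Gamma> has_vector_derivative adj (\<Psi> r t) * Q r * \<Psi> r t) (at r within {b..})"
    if "t - \<epsilon> \<le> r" "r \<le> t" for r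
    by (rule has_vector_derivative_within_subset[OF \<Gamma>[OF that]]) (use b in auto)
  with \<mu> show "\<exists>\<Gamma>. (\<forall>r. t - \<epsilon> \<le> r \<and> r \<le> t \<longrightarrow>
      (\<Gamma> has_vector_derivative adj (\<Psi> r t) * Q r * \<Psi> r t) (at r within {b..})) \<and>
    (\<forall>Z. \<mu> * (norm (un n * Z))\<^sup>2 \<le> inner Z ((\<Gamma> t - \<Gamma> (t - \<epsilon>)) * Z))"
    by blast
qed

lemma two_sided_decay:
  assumes one: "riccati_inverse b n A1 Q1 S1 \<Psi>1 \<alpha>1 q1 \<sigma>1 P1 Pi1 p1 \<kappa>1 c1"
    and two: "riccati_inverse b m A2 Q2 S2 \<Psi>2 \<alpha>2 q2 \<sigma>2 P2 Pi2 p2 \<kappa>2 c2"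
    and co: "riccati.controllable b n Q1 \<Psi>1 \<epsilon> \<mu>"
  obtains C \<delta> where "0 < C" "0 < \<delta>"
    "\<And>s X t k. b \<le> s \<Longrightarrow> (\<And>t. s \<le> t \<Longrightarrow> shape n m (X t)) \<Longrightarrow>
      (\<And>t. s \<le> t \<Longrightarrow> (X has_vector_derivative
        (A1 t - P1 t * S1 t) * X t + X t * adj (A2 t - P2 t * S2 t)) (at t within {s..})) \<Longrightarrow>
      s + real k * \<epsilon> \<le> t \<Longrightarrow> (norm (X t))\<^sup>2 \<le> C / (1 + \<delta>) ^ k * (norm (X s))\<^sup>2"
proof -
  interpret o: riccati_inverse b n A1 Q1 S1 \<Psi>1 \<alpha>1 q1 \<sigma>1 P1 Pi1 p1 \<kappa>1 c1 by (rule one)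
  interpret w: riccati_inverse b m A2 Q2 S2 \<Psi>2 \<alpha>2 q2 \<sigma>2 P2 Pi2 p2 \<kappa>2 c2 by (rule two)
  define C where "C = (p1 * p2)\<^sup>2 * (\<kappa>1 * \<kappa>2) / (c1 * c2)"
  define K where "K = \<kappa>1\<^sup>2 * q1 / c2 + \<kappa>2\<^sup>2 * q2 / c1"
  define g where "g = exp ((2 * \<alpha>1 + 2 * \<alpha>2 + 2) * \<epsilon>)"
  define \<delta> where "\<delta> = exp (- 2 * \<alpha>2 * \<epsilon>) * \<mu> / (p1 * p2 * (2 / c2 + 2 * q1 * g * K * \<epsilon>))"
  have ts: "two_sided s n A1 Q1 S1 \<Psi>1 \<alpha>1 q1 \<sigma>1 P1 Pi1 p1 \<kappa>1 c1 m A2 Q2 S2 \<Psi>2 \<alpha>2 q2 \<sigma>2 P2 Pi2 p2 \<kappa>2 c2 \<epsilon> \<mu> X"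
    if "b \<le> s" "\<And>t. s \<le> t \<Longrightarrow> shape n m (X t)"
      "\<And>t. s \<le> t \<Longrightarrow> (X has_vector_derivative
        (A1 t - P1 t * S1 t) * X t + X t * adj (A2 t - P2 t * S2 t)) (at t within {s..})" for s X
    using o.riccati_inverse_restrict[OF that(1)] w.riccati_inverse_restrict[OF that(1)]
      o.controllable_restrict[OF co that(1)] that(2,3)
    by (simp add: two_sided_def two_sided_axioms_def)
  have \<delta>: "0 < \<delta>"
  proof -
    have "two_sided b n A1 Q1 S1 \<Psi>1 \<alpha>1 q1 \<sigma>1 P1 Pi1 p1 \<kappa>1 c1 m A2 Q2 S2 \<Psi>2 \<alpha>2 q2 \<sigma>2 P2 Pi2 p2 \<kappa>2 c2 \<epsilon> \<mu> (\<lambda>_. 0)"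
      by (rule ts) (auto intro: shape_zero)
    then interpret t: two_sided b n A1 Q1 S1 \<Psi>1 \<alpha>1 q1 \<sigma>1 P1 Pi1 p1 \<kappa>1 c1 m A2 Q2 S2 \<Psi>2 \<alpha>2 q2 \<sigma>2 P2 Pi2
        p2 \<kappa>2 c2 \<epsilon> \<mu> "\<lambda>_. 0" .
    show ?thesis using t.rate_pos by (simp add: \<delta>_def t.rate_def t.lossK_def t.growth_def K_def g_def)
  qed
  show ?thesis
  proof (rule that[of C \<delta>])
    show "0 < C" using o.p_pos w.p_pos o.\<kappa>_pos w.\<kappa>_pos o.c_pos w.c_pos by (simp add: C_def)
    fix s X t k
    assume X: "b \<le> s" "\<And>t. s \<le> t \<Longrightarrow> shape n m (X t)"
      "\<And>t. s \<le> t \<Longrightarrow> (X has_vector_derivative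
        (A1 t - P1 t * S1 t) * X t + X t * adj (A2 t - P2 t * S2 t)) (at t within {s..})"
      and t: "s + real k * \<epsilon> \<le> t"
    interpret t: two_sided s n A1 Q1 S1 \<Psi>1 \<alpha>1 q1 \<sigma>1 P1 Pi1 p1 \<kappa>1 c1 m A2 Q2 S2 \<Psi>2 \<alpha>2 q2 \<sigma>2 P2 Pi2
        p2 \<kappa>2 c2 \<epsilon> \<mu> X by (rule ts[OF X])
    show "(norm (X t))\<^sup>2 \<le> C / (1 + \<delta>) ^ k * (norm (X s))\<^sup>2"
      using t.decay[OF t]
      by (simp add: C_def \<delta>_def t.rate_def t.lossK_def t.growth_def K_def g_def)
  qed (rule \<delta>)
qed

text \<open>In dimension one, with all coefficients zero and the constant solution 1, the second factor of the
two-sided equation disappears.\<close>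

lemma riccati_inverse_trivial:
  "riccati_inverse a 1 (\<lambda>_. 0) (\<lambda>_. 0) (\<lambda>_. 0) (\<lambda>_ _. un 1) 0 0 0 (\<lambda>_. un 1) (\<lambda>_. un 1)
    (norm (un 1)) (norm (un 1)) 1"
proof -
  have r: "riccati a 1 (\<lambda>_. 0) (\<lambda>_. 0) (\<lambda>_. 0) (\<lambda>_ _. un 1) 0 0 0"
    by unfold_locales (auto intro: shape_zero shape_un pos_zero)
  have "ent (un 1) 0 0 = 1" by (simp add: ent_un)
  then have "un 1 \<noteq> 0" by (metis ent_zero zero_neq_one)
  then show ?thesis
    unfolding riccati_inverse_def riccati_inverse_axioms_def riccati.sol_def[OF r]
    using r by (auto simp: shape_un un_mult_un norm_un_times_sq)
qed

lemma linear_growth_bound: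
  fixes X :: "real \<Rightarrow> fsmat"
  assumes d: "\<And>r. s \<le> r \<Longrightarrow> (X has_vector_derivative F r * X r) (at r within {s..})"
    and F: "\<And>r. s \<le> r \<Longrightarrow> norm (F r) \<le> f" and t: "s \<le> t"
  shows "(norm (X t))\<^sup>2 \<le> exp (2 * f * (t - s)) * (norm (X s))\<^sup>2"
proof (rule gronwall_forward[of s t _ "\<lambda>r. 2 * inner (X r) (F r * X r)" s])
  fix r assume r: "s \<le> r" "r \<le> t"
  show "((\<lambda>r. (norm (X r))\<^sup>2) has_real_derivative 2 * inner (X r) (F r * X r)) (at r within {s..})"
    using has_vector_derivative_inner[OF d[OF r(1)] d[OF r(1)]]
    by (simp add: power2_norm_eq_inner inner_commute)
  have "inner (X r) (F r * X r) \<le> f * (norm (X r))\<^sup>2"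
    using inner_le_norm[of "X r" "F r"] F[OF r(1)] by (meson mult_right_mono order_trans zero_le_power2)
  then show "2 * inner (X r) (F r * X r) \<le> 2 * f * (norm (X r))\<^sup>2" by simp
next
  show "0 \<le> 2 * f" using order_trans[OF norm_ge_zero F[OF order_refl]] by simp
qed (use t in auto)

subsection \<open>Kalman-Bucy stability\<close>

locale kalman_bucy = riccati +
  fixes \<epsilon>o b \<epsilon>c \<mu> :: real
  assumes obs: "observable \<epsilon>o b" and contr: "controllable \<epsilon>c \<mu>" and n_pos: "0 < n"
begin

lemma eps_pos: "0 < \<epsilon>c" "0 < \<mu>" using contr by (auto simp: controllable_def)

text \<open>The upper bound holds from the beginning, the lower one as soon as a controllability window has
passed; from then on \<open>corner_inverse\<close> provides the inverse.\<close>

lemma inverse_after_window: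
  assumes P: "sol P" and ps: "\<And>t. a \<le> t \<Longrightarrow> pos (P t)"
  obtains Pi p \<kappa> c where "riccati_inverse (a + \<epsilon>c) n A Q S \<Psi> \<alpha> q \<sigma> P Pi p \<kappa> c"
    "\<And>t. a \<le> t \<Longrightarrow> norm (P t) \<le> p"
proof -
  obtain p where p: "0 < p" "\<And>t. a \<le> t \<Longrightarrow> norm (P t) \<le> p"
    using upper_bound[OF P ps obs] by blast
  define c where "c = exp (- (\<sigma> * p * \<epsilon>c)) * \<mu>"
  have c: "0 < c" using eps_pos by (simp add: c_def)
  have low: "c * (norm (un n * Z))\<^sup>2 \<le> inner Z (P t * Z)" if "a + \<epsilon>c \<le> t" for t Z
    unfolding c_def by (rule lower_bound[OF P ps contr p that])
  have "\<exists>Y. shape n n Y \<and> P t * Y = un n \<and> Y * P t = un n \<and> norm Y \<le> norm (un n) / c"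
    if "a + \<epsilon>c \<le> t" for t
    using corner_inverse[OF solD(1)[OF P] c low[OF that]] that eps_pos
    by (metis add_le_same_cancel1 le_add_same_cancel1 less_imp_le order_trans)
  then obtain Pi where Pi: "\<And>t. a + \<epsilon>c \<le> t \<Longrightarrow> shape n n (Pi t) \<and> P t * Pi t = un n \<and>
      Pi t * P t = un n \<and> norm (Pi t) \<le> norm (un n) / c" by metis
  have "ent (un n) 0 0 = 1" using n_pos by (simp add: ent_un)
  then have "un n \<noteq> 0" by (metis ent_zero zero_neq_one)
  then have "0 < norm (un n) / c" using c by simp
  then have "riccati_inverse (a + \<epsilon>c) n A Q S \<Psi> \<alpha> q \<sigma> P Pi p (norm (un n) / c) c"
    unfolding riccati_inverse_def riccati_inverse_axioms_def
    using riccati_restrict[of "a + \<epsilon>c"] sol_restrict[OF P, of "a + \<epsilon>c"] eps_pos p c low Pi by auto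
  then show ?thesis using that p(2) by blast
qed

text \<open>The two-sided equation with the trivial second system, started one window late. On the first
window the solution of the Riccati equation need not be invertible; there the boundedness of the
closed-loop matrix limits the growth.\<close>

theorem closed_loop_decay:
  assumes P: "sol P" and ps: "\<And>t. a \<le> t \<Longrightarrow> pos (P t)"
  obtains C \<delta> where "0 < C" "0 < \<delta>"
    "\<And>s x t. a \<le> s \<Longrightarrow> (\<And>t. s \<le> t \<Longrightarrow> shape n 1 (x t)) \<Longrightarrow>
      (\<And>t. s \<le> t \<Longrightarrow> (x has_vector_derivative (A t - P t * S t) * x t) (at t within {s..})) \<Longrightarrow>
      s \<le> t \<Longrightarrow> (norm (x t))\<^sup>2 \<le> C * (norm (x s))\<^sup>2"
    "\<And>s x t k. a \<le> s \<Longrightarrow> (\<And>t. s \<le> t \<Longrightarrow> shape n 1 (x t)) \<Longrightarrow>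
      (\<And>t. s \<le> t \<Longrightarrow> (x has_vector_derivative (A t - P t * S t) * x t) (at t within {s..})) \<Longrightarrow>
      s + real (Suc k) * \<epsilon>c \<le> t \<Longrightarrow> (norm (x t))\<^sup>2 \<le> C / (1 + \<delta>) ^ k * (norm (x s))\<^sup>2"
proof -
  obtain Pi p \<kappa> c where inv: "riccati_inverse (a + \<epsilon>c) n A Q S \<Psi> \<alpha> q \<sigma> P Pi p \<kappa> c"
    and p: "\<And>t. a \<le> t \<Longrightarrow> norm (P t) \<le> p"
    using inverse_after_window[OF P ps] by blast
  have e0: "0 \<le> \<epsilon>c" using eps_pos by simp
  obtain C \<delta> where C: "0 < C" "0 < \<delta>"
    and dec: "\<And>s X t k. a + \<epsilon>c \<le> s \<Longrightarrow> (\<And>t. s \<le> t \<Longrightarrow> shape n 1 (X t)) \<Longrightarrow>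
      (\<And>t. s \<le> t \<Longrightarrow> (X has_vector_derivative
        (A t - P t * S t) * X t + X t * adj (0 - un 1 * 0)) (at t within {s..})) \<Longrightarrow>
      s + real k * \<epsilon>c \<le> t \<Longrightarrow> (norm (X t))\<^sup>2 \<le> C / (1 + \<delta>) ^ k * (norm (X s))\<^sup>2"
    using two_sided_decay[OF inv riccati_inverse_trivial controllable_restrict[OF contr]] e0
    by (metis add_increasing2 le_add_same_cancel1)
  define f where "f = \<alpha> + p * \<sigma>"
  have F: "norm (A t - P t * S t) \<le> f" if "a \<le> t" for t
  proof -
    have "norm (P t * S t) \<le> norm (P t) * norm (S t)" by (rule norm_mult_ineq)
    also have "\<dots> \<le> p * \<sigma>"
      by (intro mult_mono p bdS that order_trans[OF norm_ge_zero p[OF that]]) simp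
    finally show ?thesis using bdA[OF that] norm_triangle_ineq4[of "A t" "P t * S t"] by (simp add: f_def)
  qed
  have f: "0 \<le> f" using F[of a] norm_ge_zero order_trans by blast
  define E where "E = exp (2 * f * \<epsilon>c)"
  have E: "1 \<le> E" using f e0 by (simp add: E_def)
  have growth: "(norm (x t))\<^sup>2 \<le> E * (norm (x s))\<^sup>2"
    if "a \<le> s" "\<And>t. s \<le> t \<Longrightarrow> (x has_vector_derivative (A t - P t * S t) * x t) (at t within {s..})"
      "s \<le> t" "t \<le> s + \<epsilon>c" for s x t
  proof -
    have "(norm (x t))\<^sup>2 \<le> exp (2 * f * (t - s)) * (norm (x s))\<^sup>2"
      by (rule linear_growth_bound[OF that(2) F]) (use that in auto)
    also have "\<dots> \<le> E * (norm (x s))\<^sup>2"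
    proof (rule mult_right_mono)
      show "exp (2 * f * (t - s)) \<le> E"
        unfolding E_def exp_le_cancel_iff by (rule mult_left_mono) (use that f in auto)
    qed simp
    finally show ?thesis .
  qed
  have late: "(norm (x t))\<^sup>2 \<le> C * E / (1 + \<delta>) ^ k * (norm (x s))\<^sup>2"
    if "a \<le> s" "\<And>t. s \<le> t \<Longrightarrow> shape n 1 (x t)"
      "\<And>t. s \<le> t \<Longrightarrow> (x has_vector_derivative (A t - P t * S t) * x t) (at t within {s..})"
      "s + real (Suc k) * \<epsilon>c \<le> t" for s x t k
  proof -
    have "(norm (x t))\<^sup>2 \<le> C / (1 + \<delta>) ^ k * (norm (x (s + \<epsilon>c)))\<^sup>2"
    proof (rule dec)
      fix r assume r: "s + \<epsilon>c \<le> r"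
      show "shape n 1 (x r)" using that(2) r e0 by simp
      have "(x has_vector_derivative (A r - P r * S r) * x r) (at r within {s + \<epsilon>c..})"
        by (rule has_vector_derivative_within_subset[OF that(3)]) (use r e0 in auto)
      then show "(x has_vector_derivative (A r - P r * S r) * x r + x r * adj (0 - un 1 * 0)) (at r within {s + \<epsilon>c..})"
        by simp
    qed (use that e0 in \<open>auto simp: algebra_simps\<close>)
    also have "\<dots> \<le> C / (1 + \<delta>) ^ k * (E * (norm (x s))\<^sup>2)"
      by (intro mult_left_mono growth that(1) that(3)) (use C e0 in auto)
    finally show ?thesis by simp
  qed
  show ?thesis
  proof (rule that[of "max E (C * E)" \<delta>])
    fix s x t
    assume x: "a \<le> s" "\<And>t. s \<le> t \<Longrightarrow> shape n 1 (x t)"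
      "\<And>t. s \<le> t \<Longrightarrow> (x has_vector_derivative (A t - P t * S t) * x t) (at t within {s..})"
    {
      assume t: "s \<le> t"
      show "(norm (x t))\<^sup>2 \<le> max E (C * E) * (norm (x s))\<^sup>2"
      proof (cases "t \<le> s + \<epsilon>c")
        case True
        have "(norm (x t))\<^sup>2 \<le> E * (norm (x s))\<^sup>2" by (rule growth[OF x(1,3) t True])
        also have "\<dots> \<le> max E (C * E) * (norm (x s))\<^sup>2" by (rule mult_right_mono) auto
        finally show ?thesis .
      next
        case False
        then have "(norm (x t))\<^sup>2 \<le> C * E * (norm (x s))\<^sup>2" using late[OF x, of 0 t] by simp
        also have "\<dots> \<le> max E (C * E) * (norm (x s))\<^sup>2" by (rule mult_right_mono) auto
        finally show ?thesis .
      qed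
    }
    fix k assume t: "s + real (Suc k) * \<epsilon>c \<le> t"
    have "(norm (x t))\<^sup>2 \<le> C * E / (1 + \<delta>) ^ k * (norm (x s))\<^sup>2" by (rule late[OF x t])
    also have "\<dots> \<le> max E (C * E) / (1 + \<delta>) ^ k * (norm (x s))\<^sup>2"
      using C by (intro mult_right_mono divide_right_mono) auto
    finally show "(norm (x t))\<^sup>2 \<le> max E (C * E) / (1 + \<delta>) ^ k * (norm (x s))\<^sup>2" .
  qed (use C E in auto)
qed

text \<open>In the difference of two Riccati equations the quadratic terms combine with the linear ones to the
two closed-loop matrices, one on each side.\<close>

theorem solutions_merge:
  assumes P1: "sol P1" "\<And>t. a \<le> t \<Longrightarrow> pos (P1 t)" and P2: "sol P2" "\<And>t. a \<le> t \<Longrightarrow> pos (P2 t)"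
  shows "((\<lambda>t. norm (P1 t - P2 t)) \<longlongrightarrow> 0) at_top"
proof -
  obtain Pi1 p1 k1 c1 where i1: "riccati_inverse (a + \<epsilon>c) n A Q S \<Psi> \<alpha> q \<sigma> P1 Pi1 p1 k1 c1"
    by (rule inverse_after_window[OF P1]) (assumption, erule that)
  obtain Pi2 p2 k2 c2 where i2: "riccati_inverse (a + \<epsilon>c) n A Q S \<Psi> \<alpha> q \<sigma> P2 Pi2 p2 k2 c2"
    by (rule inverse_after_window[OF P2]) (assumption, erule that)
  let ?b = "a + \<epsilon>c" and ?X = "\<lambda>t. P1 t - P2 t"
  have e0: "0 < \<epsilon>c" using eps_pos by simp
  have "riccati.controllable ?b n Q \<Psi> \<epsilon>c \<mu>" by (rule controllable_restrict[OF contr]) (use e0 in simp)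
  then obtain C \<delta> where C: "0 < C" "0 < \<delta>"
    and dec: "\<And>s X t k. ?b \<le> s \<Longrightarrow> (\<And>t. s \<le> t \<Longrightarrow> shape n n (X t)) \<Longrightarrow>
      (\<And>t. s \<le> t \<Longrightarrow> (X has_vector_derivative
        (A t - P1 t * S t) * X t + X t * adj (A t - P2 t * S t)) (at t within {s..})) \<Longrightarrow>
      s + real k * \<epsilon>c \<le> t \<Longrightarrow> (norm (X t))\<^sup>2 \<le> C / (1 + \<delta>) ^ k * (norm (X s))\<^sup>2"
    using two_sided_decay[OF i1 i2] by blast
  have bd: "(norm (?X t))\<^sup>2 \<le> C / (1 + \<delta>) ^ k * (norm (?X ?b))\<^sup>2" if "?b + real k * \<epsilon>c \<le> t" for k t
  proof (rule dec[OF order_refl _ _ that])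
    fix t assume "?b \<le> t"
    then have t: "a \<le> t" using e0 by simp
    show "shape n n (?X t)" by (intro shape_diff solD(1)[OF P1(1) t] solD(1)[OF P2(1) t])
    have "(?X has_vector_derivative (A t - P1 t * S t) * ?X t + ?X t * adj (A t - P2 t * S t)) (at t within {a..})"
      by (rule has_vector_derivative_eq_rhs[OF has_vector_derivative_diff[OF
            solD(3)[OF P1(1) t] solD(3)[OF P2(1) t]]])
        (simp add: algebra_simps solD(2)[OF P2(1) t] pos_adj[OF posS[OF t]])
    then show "(?X has_vector_derivative (A t - P1 t * S t) * ?X t + ?X t * adj (A t - P2 t * S t)) (at t within {?b..})"
      by (rule has_vector_derivative_within_subset) (use e0 in auto)
  qed
  show ?thesis
  proof (rule tendstoI)
    fix e :: real assume e: "0 < e"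
    have "(\<lambda>k. C * (norm (?X ?b))\<^sup>2 * (1 / (1 + \<delta>)) ^ k) \<longlonglongrightarrow> C * (norm (?X ?b))\<^sup>2 * 0"
      using C by (intro tendsto_intros LIMSEQ_realpow_zero) auto
    then have "eventually (\<lambda>k. C * (norm (?X ?b))\<^sup>2 * (1 / (1 + \<delta>)) ^ k < e\<^sup>2) sequentially"
      using e by (intro order_tendstoD(2)) auto
    then obtain k where "C * (norm (?X ?b))\<^sup>2 * (1 / (1 + \<delta>)) ^ k < e\<^sup>2"
      by (auto simp: eventually_sequentially)
    then have k: "C / (1 + \<delta>) ^ k * (norm (?X ?b))\<^sup>2 < e\<^sup>2" by (simp add: power_one_over mult_ac)
    have "norm (?X t) < e" if "?b + real k * \<epsilon>c \<le> t" for t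
      using bd[OF that] k e by (intro power2_less_imp_less[of _ e]) auto
    then show "eventually (\<lambda>t. dist (norm (?X t)) 0 < e) at_top"
      by (auto simp: eventually_at_top_linorder)
  qed
qed

end

section \<open>Covariances of linear systems driven by white noise\<close>

context prob_space
begin

definition sq_int :: "('a \<Rightarrow> real) \<Rightarrow> bool" where
  "sq_int f \<longleftrightarrow> f \<in> borel_measurable M \<and> integrable M (\<lambda>\<omega>. (f \<omega>)\<^sup>2)"

lemma sq_int_product:
  assumes "sq_int f" "sq_int g"
  shows "integrable M (\<lambda>\<omega>. f \<omega> * g \<omega>)"
    and "expectation (\<lambda>\<omega>. \<bar>f \<omega> * g \<omega>\<bar>) \<le> expectation (\<lambda>\<omega>. (f \<omega>)\<^sup>2) + expectation (\<lambda>\<omega>. (g \<omega>)\<^sup>2)"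
proof -
  have i: "integrable M (\<lambda>\<omega>. (f \<omega>)\<^sup>2 + (g \<omega>)\<^sup>2)" using assms by (simp add: sq_int_def)
  have b: "\<bar>f \<omega> * g \<omega>\<bar> \<le> (f \<omega>)\<^sup>2 + (g \<omega>)\<^sup>2" for \<omega>
  proof -
    have "0 \<le> (\<bar>f \<omega>\<bar> - \<bar>g \<omega>\<bar>)\<^sup>2" by simp
    then have "2 * (\<bar>f \<omega>\<bar> * \<bar>g \<omega>\<bar>) \<le> (f \<omega>)\<^sup>2 + (g \<omega>)\<^sup>2" by (simp add: power2_diff)
    moreover have "0 \<le> \<bar>f \<omega>\<bar> * \<bar>g \<omega>\<bar>" by simp
    ultimately show ?thesis unfolding abs_mult by linarith
  qed
  show p: "integrable M (\<lambda>\<omega>. f \<omega> * g \<omega>)"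
    by (rule Bochner_Integration.integrable_bound[OF i]) (use assms b in \<open>auto simp: sq_int_def\<close>)
  have "expectation (\<lambda>\<omega>. \<bar>f \<omega> * g \<omega>\<bar>) \<le> expectation (\<lambda>\<omega>. (f \<omega>)\<^sup>2 + (g \<omega>)\<^sup>2)"
    by (intro integral_mono i b) (use p in auto)
  then show "expectation (\<lambda>\<omega>. \<bar>f \<omega> * g \<omega>\<bar>) \<le> expectation (\<lambda>\<omega>. (f \<omega>)\<^sup>2) + expectation (\<lambda>\<omega>. (g \<omega>)\<^sup>2)"
    using assms by (simp add: sq_int_def)
qed

lemma sq_int_const: "sq_int (\<lambda>_. c)" by (simp add: sq_int_def)

lemma sq_int_integrable: "sq_int f \<Longrightarrow> integrable M f"
  using sq_int_product(1)[of f "\<lambda>_. 1"] sq_int_const by simp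

lemma sq_int_add: "sq_int f \<Longrightarrow> sq_int g \<Longrightarrow> sq_int (\<lambda>\<omega>. f \<omega> + g \<omega>)"
  using sq_int_product(1)[of f g] by (auto simp: sq_int_def power2_sum mult.assoc)

lemma sq_int_mult: "sq_int f \<Longrightarrow> sq_int (\<lambda>\<omega>. c * f \<omega>)"
  by (auto simp: sq_int_def power_mult_distrib)

lemma sq_int_diff: "sq_int f \<Longrightarrow> sq_int g \<Longrightarrow> sq_int (\<lambda>\<omega>. f \<omega> - g \<omega>)"
  using sq_int_add[of f "\<lambda>\<omega>. - 1 * g \<omega>"] sq_int_mult[of g "- 1"] by simp

lemma sq_int_sum: "(\<And>i. i \<in> I \<Longrightarrow> sq_int (f i)) \<Longrightarrow> sq_int (\<lambda>\<omega>. \<Sum>i\<in>I. f i \<omega>)"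
  by (induction I rule: infinite_finite_induct) (auto intro: sq_int_const sq_int_add)

text \<open>A process with continuous paths is jointly measurable, being the limit of its
  discretizations in time; hence expectation and time integral may be exchanged.\<close>

lemma continuous_process_measurable:
  fixes f :: "real \<Rightarrow> 'a \<Rightarrow> real"
  assumes m: "\<And>s. f s \<in> borel_measurable M"
    and c: "\<And>\<omega>. \<omega> \<in> space M \<Longrightarrow> continuous_on UNIV (\<lambda>s. f s \<omega>)"
  shows "(\<lambda>p. f (fst p) (snd p)) \<in> borel_measurable (lborel \<Otimes>\<^sub>M M)"
proof (rule borel_measurable_LIMSEQ_real)
  define u where "u n p = f (of_int \<lfloor>real (Suc n) * fst p\<rfloor> / real (Suc n)) (snd p)" for n and p :: "real \<times> 'a"
  show "(\<lambda>n. u n p) \<longlonglongrightarrow> f (fst p) (snd p)" if "p \<in> space (lborel \<Otimes>\<^sub>M M)" for p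
  proof -
    have w: "snd p \<in> space M" using that by (auto simp: space_pair_measure)
    let ?r = "\<lambda>n. of_int \<lfloor>real (Suc n) * fst p\<rfloor> / real (Suc n)"
    have "(\<lambda>n. ?r n - fst p) \<longlonglongrightarrow> 0"
    proof (rule Lim_null_comparison)
      show "eventually (\<lambda>n. norm (?r n - fst p) \<le> inverse (real (Suc n))) sequentially"
      proof (rule always_eventually, rule allI)
        fix n
        have "?r n - fst p = (of_int \<lfloor>real (Suc n) * fst p\<rfloor> - real (Suc n) * fst p) / real (Suc n)"
          by (simp add: field_simps del: of_nat_Suc)
        moreover have "\<bar>of_int \<lfloor>real (Suc n) * fst p\<rfloor> - real (Suc n) * fst p\<bar> \<le> 1" by linarith
        ultimately show "norm (?r n - fst p) \<le> inverse (real (Suc n))"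
          by (simp add: divide_inverse mult_left_le_one_le abs_mult del: of_nat_Suc)
      qed
    qed (rule LIMSEQ_inverse_real_of_nat)
    then have "?r \<longlonglongrightarrow> fst p" by (rule LIM_zero_cancel)
    then show ?thesis
      unfolding u_def using c[OF w] by (intro continuous_on_tendsto_compose[of UNIV "\<lambda>s. f s (snd p)"]) auto
  qed
  show "u n \<in> borel_measurable (lborel \<Otimes>\<^sub>M M)" for n
    unfolding u_def
    by (rule measurable_compose_countable[where f = "\<lambda>k p. f (of_int k / real (Suc n)) (snd p)"
        and g = "\<lambda>p. \<lfloor>real (Suc n) * fst p\<rfloor>"])
      (auto intro!: measurable_compose[OF measurable_snd m])
qed

lemma expectation_integral:
  fixes f :: "real \<Rightarrow> 'a \<Rightarrow> real"
  assumes m: "\<And>s. a \<le> s \<Longrightarrow> f s \<in> borel_measurable M"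
    and c: "\<And>\<omega>. \<omega> \<in> space M \<Longrightarrow> continuous_on {a..} (\<lambda>s. f s \<omega>)"
    and i: "\<And>s. a \<le> s \<Longrightarrow> s \<le> t \<Longrightarrow> integrable M (f s)"
    and K: "\<And>s. a \<le> s \<Longrightarrow> s \<le> t \<Longrightarrow> expectation (\<lambda>\<omega>. \<bar>f s \<omega>\<bar>) \<le> K"
    and t: "a \<le> t"
  shows "integrable M (\<lambda>\<omega>. integral {a..t} (\<lambda>s. f s \<omega>))"
    and "(\<lambda>s. expectation (f s)) integrable_on {a..t}"
    and "expectation (\<lambda>\<omega>. integral {a..t} (\<lambda>s. f s \<omega>)) = integral {a..t} (\<lambda>s. expectation (f s))"
proof -
  interpret pair_sigma_finite lborel M ..
  \<comment> \<open>Freezing the process outside of \<open>{a..t}\<close> makes its paths continuous on the whole line.\<close>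
  define cl where "cl s = max a (min s t)" for s
  define F where "F s \<omega> = f (cl s) \<omega>" for s \<omega>
  have cl: "a \<le> cl s" "cl s \<le> t" for s using t by (auto simp: cl_def)
  have cl_id: "cl s = s" if "s \<in> {a..t}" for s using that by (auto simp: cl_def)
  have Fc: "continuous_on UNIV (\<lambda>s. F s \<omega>)" if "\<omega> \<in> space M" for \<omega>
  proof -
    have c1: "continuous_on UNIV cl" unfolding cl_def by (intro continuous_intros)
    have c2: "continuous_on (range cl) (\<lambda>s. f s \<omega>)"
      by (rule continuous_on_subset[OF c[OF that]]) (use cl in auto)
    show ?thesis unfolding F_def by (rule continuous_on_compose2[OF c2 c1]) auto
  qed
  have Fm: "(\<lambda>p. F (fst p) (snd p)) \<in> borel_measurable (lborel \<Otimes>\<^sub>M M)"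
    by (rule continuous_process_measurable) (use Fc m cl in \<open>auto simp: F_def\<close>)
  define h where "h p = indicator {a..t} (fst p) * F (fst p) (snd p)" for p :: "real \<times> 'a"
  have hm: "h \<in> borel_measurable (lborel \<Otimes>\<^sub>M M)" unfolding h_def using Fm by measurable
  have hi: "integrable (lborel \<Otimes>\<^sub>M M) h"
  proof (rule Fubini_integrable[OF hm])
    show "AE x in lborel. integrable M (\<lambda>y. h (x, y))"
      using i cl by (auto simp: h_def F_def)
    have bound: "integrable lborel (\<lambda>x. \<bar>K\<bar> * indicator {a..t} x :: real)"
      by (intro Bochner_Integration.integrable_mult_right integrable_real_indicator)
        (auto simp: emeasure_lborel_Icc_eq)
    show "integrable lborel (\<lambda>x. expectation (\<lambda>y. norm (h (x, y))))"
    proof (rule Bochner_Integration.integrable_bound[OF bound])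
      show "(\<lambda>x. expectation (\<lambda>y. norm (h (x, y)))) \<in> borel_measurable lborel"
        using hm by measurable
      show "AE x in lborel. norm (expectation (\<lambda>y. norm (h (x, y)))) \<le> norm (\<bar>K\<bar> * indicator {a..t} x :: real)"
      proof (rule AE_I2)
        fix x
        have "expectation (\<lambda>y. norm (h (x, y))) = indicator {a..t} x * expectation (\<lambda>y. \<bar>f (cl x) y\<bar>)"
          by (simp add: h_def F_def abs_mult)
        moreover have "expectation (\<lambda>y. \<bar>f (cl x) y\<bar>) \<le> \<bar>K\<bar>" using K[OF cl, of x] by simp
        moreover have "0 \<le> expectation (\<lambda>y. \<bar>f (cl x) y\<bar>)" by simp
        ultimately show "norm (expectation (\<lambda>y. norm (h (x, y)))) \<le> norm (\<bar>K\<bar> * indicator {a..t} x :: real)"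
          by (auto simp: indicator_def)
      qed
    qed
  qed
  have path: "(\<integral>x. h (x, \<omega>) \<partial>lborel) = integral {a..t} (\<lambda>s. f s \<omega>)" if w: "\<omega> \<in> space M" for \<omega>
  proof -
    have "set_integrable lborel {a..t} (\<lambda>s. F s \<omega>)"
      by (rule borel_integrable_atLeastAtMost') (rule continuous_on_subset[OF Fc[OF w]], simp)
    then have "(LINT s:{a..t}|lborel. F s \<omega>) = integral {a..t} (\<lambda>s. F s \<omega>)"
      by (rule set_borel_integral_eq_integral)
    also have "\<dots> = integral {a..t} (\<lambda>s. f s \<omega>)"
      by (rule Henstock_Kurzweil_Integration.integral_cong) (simp add: F_def cl_id)
    finally show ?thesis by (simp add: h_def set_lebesgue_integral_def)
  qed
  have "integrable M (\<lambda>\<omega>. \<integral>x. h (x, \<omega>) \<partial>lborel)"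
    using integrable_snd[of "\<lambda>x y. h (x, y)"] hi by simp
  then show "integrable M (\<lambda>\<omega>. integral {a..t} (\<lambda>s. f s \<omega>))"
    by (rule Bochner_Integration.integrable_cong[THEN iffD1, rotated -1]) (auto simp: path)
  have ts: "set_integrable lborel {a..t} (\<lambda>s. expectation (F s))"
  proof -
    have "h = (\<lambda>(x, y). indicator {a..t} x * F x y)" by (auto simp: h_def)
    then show ?thesis
      using integrable_fst[of "\<lambda>x y. indicator {a..t} x * F x y"] hi by (simp add: set_integrable_def)
  qed
  have cong: "expectation (F s) = expectation (f s)" if "s \<in> {a..t}" for s
    using cl_id[OF that] by (simp add: F_def[abs_def])
  show "(\<lambda>s. expectation (f s)) integrable_on {a..t}"
    using set_borel_integral_eq_integral(1)[OF ts] cong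
    by (rule Henstock_Kurzweil_Integration.integrable_eq)
  have "expectation (\<lambda>\<omega>. integral {a..t} (\<lambda>s. f s \<omega>)) = expectation (\<lambda>\<omega>. \<integral>x. h (x, \<omega>) \<partial>lborel)"
    by (rule Bochner_Integration.integral_cong) (auto simp: path)
  also have "\<dots> = (\<integral>x. expectation (\<lambda>\<omega>. h (x, \<omega>)) \<partial>lborel)"
    using Fubini_integral[of "\<lambda>x y. h (x, y)"] hi by simp
  also have "\<dots> = (LINT s:{a..t}|lborel. expectation (F s))"
    by (simp add: h_def set_lebesgue_integral_def)
  also have "\<dots> = integral {a..t} (\<lambda>s. expectation (F s))"
    by (rule set_borel_integral_eq_integral(2)[OF ts])
  also have "\<dots> = integral {a..t} (\<lambda>s. expectation (f s))"
    by (rule Henstock_Kurzweil_Integration.integral_cong) (rule cong)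
  finally show "expectation (\<lambda>\<omega>. integral {a..t} (\<lambda>s. f s \<omega>)) = integral {a..t} (\<lambda>s. expectation (f s))" .
qed

end

subsection \<open>Integral equations\<close>

lemma at_within_Icc_Ici: "t < b \<Longrightarrow> at t within {a..b} = at t within {a..}" for a b t :: real
  by (rule at_within_nhd[of t "{..<b}"]) auto

lemma continuous_on_Ici_of_Icc:
  fixes f :: "real \<Rightarrow> 'b :: topological_space"
  assumes "\<And>b. a \<le> b \<Longrightarrow> continuous_on {a..b} f"
  shows "continuous_on {a..} f"
  unfolding continuous_on_eq_continuous_within
proof
  fix t assume "t \<in> {a..}"
  then have "continuous (at t within {a..t + 1}) f"
    using assms[of "t + 1"] by (simp add: continuous_on_eq_continuous_within)
  then show "continuous (at t within {a..}) f" by (simp add: at_within_Icc_Ici continuous_within)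
qed

lemma integral_equation_continuous:
  fixes F h :: "real \<Rightarrow> real"
  assumes F: "\<And>t. a \<le> t \<Longrightarrow> F t = y + integral {a..t} h"
    and i: "\<And>t. a \<le> t \<Longrightarrow> h integrable_on {a..t}"
  shows "continuous_on {a..} F"
proof (rule continuous_on_Ici_of_Icc)
  fix b assume "a \<le> b"
  have "continuous_on {a..b} (\<lambda>t. y + integral {a..t} h)"
    by (intro continuous_intros indefinite_integral_continuous_1 i[OF \<open>a \<le> b\<close>])
  then show "continuous_on {a..b} F"
    by (rule continuous_on_eq) (use F in auto)
qed

lemma integral_equation_deriv:
  fixes F h :: "real \<Rightarrow> real"
  assumes F: "\<And>t. a \<le> t \<Longrightarrow> F t = y + integral {a..t} h"
    and h: "continuous_on {a..} h" and t: "a \<le> t"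
  shows "(F has_real_derivative h t) (at t within {a..})"
proof -
  have "((\<lambda>t. integral {a..t} h) has_real_derivative h t) (at t within {a..t + 1})"
    by (rule integral_has_real_derivative) (use t in \<open>auto intro: continuous_on_subset[OF h]\<close>)
  then have "((\<lambda>t. y + integral {a..t} h) has_real_derivative h t) (at t within {a..})"
    by (auto simp: at_within_Icc_Ici intro!: derivative_eq_intros)
  then show ?thesis
    by (rule has_field_derivative_transform_within[where d = 1]) (use t F in auto)
qed

lemma continuous_Ici_integrable:
  "continuous_on {a..} h \<Longrightarrow> h integrable_on {a..t}" for h :: "real \<Rightarrow> real"
  by (rule integrable_continuous_real) (auto intro: continuous_on_subset)

text \<open>The equation itself shows first continuity and then differentiability; Gronwall's inequality applies
to the sum of squares.\<close>

lemma linear_integral_equation_zero: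
  fixes D :: "nat \<Rightarrow> real \<Rightarrow> real" and A :: "nat \<Rightarrow> nat \<Rightarrow> real"
  assumes D: "\<And>i t. i < n \<Longrightarrow> a \<le> t \<Longrightarrow> t \<le> b \<Longrightarrow> D i t = integral {a..t} (\<lambda>s. \<Sum>k<n. A i k * D k s)"
    and int: "\<And>i. i < n \<Longrightarrow> D i integrable_on {a..b}"
    and t: "a \<le> t" "t \<le> b" and i: "i < n"
  shows "D i t = 0"
proof -
  have hi: "(\<lambda>s. \<Sum>k<n. A j k * D k s) integrable_on {a..b}" for j
    using Henstock_Kurzweil_Integration.integrable_cmul[OF int]
    by (auto intro!: Henstock_Kurzweil_Integration.integrable_sum)
  have cont: "continuous_on {a..b} (D j)" if "j < n" for j
  proof -
    have "continuous_on {a..b} (\<lambda>t. integral {a..t} (\<lambda>s. \<Sum>k<n. A j k * D k s))"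
      by (rule indefinite_integral_continuous_1[OF hi])
    then show ?thesis by (rule continuous_on_eq) (use D[OF that] in auto)
  qed
  define h where "h j s = (\<Sum>k<n. A j k * D k s)" for j s
  have hc: "continuous_on {a..b} (h j)" for j
    unfolding h_def by (intro continuous_intros cont) auto
  have deriv: "(D j has_real_derivative h j r) (at r within {a..b})" if "j < n" "a \<le> r" "r \<le> b" for j r
  proof -
    have "((\<lambda>t. integral {a..t} (h j)) has_real_derivative h j r) (at r within {a..b})"
      by (rule integral_has_real_derivative[OF hc]) (use that in auto)
    then show ?thesis
      by (rule has_field_derivative_transform_within[where d = 1])
        (use that D in \<open>auto simp: h_def[abs_def]\<close>)
  qed
  define \<phi> where "\<phi> s = (\<Sum>j<n. (D j s)\<^sup>2)" for s
  define k where "k = (\<Sum>j<n. \<Sum>l<n. \<bar>A j l\<bar>)"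
  have D0: "D j a = 0" if "j < n" for j using D[OF that, of a] t by simp
  have pk: "\<bar>D j r * (A j l * D l r)\<bar> \<le> \<bar>A j l\<bar> * \<phi> r" if "j < n" "l < n" for j l r
  proof -
    have "(D j r)\<^sup>2 \<le> \<phi> r" "(D l r)\<^sup>2 \<le> \<phi> r"
      unfolding \<phi>_def using that by (auto intro!: member_le_sum)
    moreover have "2 * (\<bar>D j r\<bar> * \<bar>D l r\<bar>) \<le> (D j r)\<^sup>2 + (D l r)\<^sup>2"
      using zero_le_power2[of "\<bar>D j r\<bar> - \<bar>D l r\<bar>"] by (simp add: power2_diff)
    ultimately have "\<bar>D j r\<bar> * \<bar>D l r\<bar> \<le> \<phi> r" by linarith
    then show ?thesis by (simp add: abs_mult mult.left_commute mult_left_mono)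
  qed
  define \<phi>' where "\<phi>' s = (\<Sum>j<n. 2 * (D j s * h j s))" for s
  have \<phi>d: "(\<phi> has_real_derivative \<phi>' r) (at r within {a..b})" if "a \<le> r" "r \<le> b" for r
    unfolding \<phi>_def \<phi>'_def
    by (auto intro!: derivative_eq_intros deriv that sum.cong simp: mult_ac)
  have le: "\<phi>' r \<le> 2 * k * \<phi> r" for r
  proof -
    have "\<phi>' r = 2 * (\<Sum>j<n. \<Sum>l<n. D j r * (A j l * D l r))"
      by (simp add: \<phi>'_def h_def sum_distrib_left)
    also have "(\<Sum>j<n. \<Sum>l<n. D j r * (A j l * D l r)) \<le> (\<Sum>j<n. \<Sum>l<n. \<bar>A j l\<bar> * \<phi> r)"
      by (intro sum_mono order_trans[OF abs_ge_self pk]) auto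
    also have "\<dots> = k * \<phi> r" by (simp add: k_def sum_distrib_right)
    finally show ?thesis by simp
  qed
  have "\<phi> t \<le> exp (2 * k * (t - a)) * (\<phi> a + 0 - 0)"
  proof (rule gronwall_forward_integral[where \<phi>' = \<phi>' and g = "\<lambda>_. 0" and g' = "\<lambda>_. 0"])
    show "(\<phi> has_real_derivative \<phi>' r) (at r within {a..t})" if "a \<le> r" "r \<le> t" for r
      by (rule DERIV_subset[OF \<phi>d]) (use that t in auto)
    show "0 \<le> 2 * k" by (auto simp: k_def intro!: sum_nonneg)
  qed (use le t in auto)
  moreover have "\<phi> a = 0" by (simp add: \<phi>_def D0)
  ultimately have "\<phi> t \<le> 0" by simp
  moreover have "(D i t)\<^sup>2 \<le> \<phi> t" unfolding \<phi>_def using i by (intro member_le_sum) auto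
  ultimately have "(D i t)\<^sup>2 \<le> 0" by linarith
  then show ?thesis by simp
qed

subsection \<open>The Lyapunov equation of the covariance\<close>

text \<open>The components of a process \<open>X = X a + \<integral> A X + g\<close>; the part \<open>X - g\<close> has differentiable paths.\<close>

locale noise_state = prob_space M for M :: "'a measure" +
  fixes a :: real and n :: nat and A :: "nat \<Rightarrow> nat \<Rightarrow> real" and X g :: "nat \<Rightarrow> real \<Rightarrow> 'a \<Rightarrow> real"
  assumes Xsq: "i < n \<Longrightarrow> a \<le> s \<Longrightarrow> sq_int (X i s)" and gsq: "i < n \<Longrightarrow> a \<le> s \<Longrightarrow> sq_int (g i s)"
    and Xcont: "\<omega> \<in> space M \<Longrightarrow> i < n \<Longrightarrow> continuous_on {a..} (\<lambda>s. X i s \<omega>)"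
    and X_eq: "\<omega> \<in> space M \<Longrightarrow> i < n \<Longrightarrow> a \<le> t \<Longrightarrow>
      X i t \<omega> = X i a \<omega> + integral {a..t} (\<lambda>s. \<Sum>k<n. A i k * X k s \<omega>) + g i t \<omega>"
    and gbound: "a \<le> T \<Longrightarrow> \<exists>K. \<forall>i<n. \<forall>s. a \<le> s \<and> s \<le> T \<longrightarrow> expectation (\<lambda>\<omega>. (g i s \<omega>)\<^sup>2) \<le> K"
begin

definition "Z i t \<omega> = X i t \<omega> - g i t \<omega>"
definition "H i t \<omega> = (\<Sum>k<n. A i k * X k t \<omega>)"

lemma Zsq: "i < n \<Longrightarrow> a \<le> s \<Longrightarrow> sq_int (Z i s)"
  unfolding Z_def by (intro sq_int_diff Xsq gsq)

lemma Hsq: "a \<le> s \<Longrightarrow> sq_int (H i s)"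
  unfolding H_def by (intro sq_int_sum sq_int_mult Xsq) auto

lemma Hcont: "\<omega> \<in> space M \<Longrightarrow> continuous_on {a..} (\<lambda>s. H i s \<omega>)"
  unfolding H_def by (intro continuous_intros Xcont) auto

lemma Z_eq: "\<omega> \<in> space M \<Longrightarrow> i < n \<Longrightarrow> a \<le> t \<Longrightarrow> Z i t \<omega> = X i a \<omega> + integral {a..t} (\<lambda>s. H i s \<omega>)"
  using X_eq[of \<omega> i t] by (simp add: Z_def H_def)

lemma Z_start: "\<omega> \<in> space M \<Longrightarrow> i < n \<Longrightarrow> Z i a \<omega> = X i a \<omega>"
  using Z_eq[of \<omega> i a] by simp

lemma Z_deriv: "\<omega> \<in> space M \<Longrightarrow> i < n \<Longrightarrow> a \<le> t \<Longrightarrow>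
    ((\<lambda>t. Z i t \<omega>) has_real_derivative H i t \<omega>) (at t within {a..})"
  by (rule integral_equation_deriv[OF Z_eq Hcont]) auto

lemma Zcont: "\<omega> \<in> space M \<Longrightarrow> i < n \<Longrightarrow> continuous_on {a..} (\<lambda>s. Z i s \<omega>)"
  unfolding continuous_on_eq_continuous_within
  by (auto intro: DERIV_continuous[OF Z_deriv])

lemma gcont: "\<omega> \<in> space M \<Longrightarrow> i < n \<Longrightarrow> continuous_on {a..} (\<lambda>s. g i s \<omega>)"
  using continuous_on_diff[OF Xcont Zcont, of \<omega> i \<omega> i] by (simp add: Z_def)

text \<open>Gronwall's inequality along paths bounds the second moments locally uniformly in time.\<close>

lemma Z_square_bound:
  assumes w: "\<omega> \<in> space M" and t: "a \<le> t" "t \<le> T"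
  shows "(\<Sum>i<n. (Z i t \<omega>)\<^sup>2) \<le> exp (3 * (\<Sum>i<n. \<Sum>k<n. \<bar>A i k\<bar>) * (T - a)) *
    ((\<Sum>i<n. (X i a \<omega>)\<^sup>2) + (\<Sum>i<n. \<Sum>k<n. \<bar>A i k\<bar>) * integral {a..T} (\<lambda>s. \<Sum>k<n. (g k s \<omega>)\<^sup>2))"
proof -
  let ?\<kappa> = "\<Sum>i<n. \<Sum>k<n. \<bar>A i k\<bar>"
  define \<phi> where "\<phi> s = (\<Sum>i<n. (Z i s \<omega>)\<^sup>2)" for s
  define \<gamma> where "\<gamma> s = (\<Sum>k<n. (g k s \<omega>)\<^sup>2)" for s
  define \<phi>' where "\<phi>' s = (\<Sum>i<n. 2 * (Z i s \<omega> * H i s \<omega>))" for s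
  have \<kappa>: "0 \<le> ?\<kappa>" by (intro sum_nonneg) simp
  have \<gamma>c: "continuous_on {a..} \<gamma>" unfolding \<gamma>_def by (intro continuous_intros gcont w) auto
  have \<gamma>0: "0 \<le> \<gamma> s" for s by (simp add: \<gamma>_def sum_nonneg)
  have \<gamma>i: "\<gamma> integrable_on {a..b}" for b by (rule continuous_Ici_integrable[OF \<gamma>c])
  have "\<phi> t \<le> exp (3 * ?\<kappa> * (t - a)) * (\<phi> a + ?\<kappa> * integral {a..t} \<gamma> - ?\<kappa> * integral {a..a} \<gamma>)"
  proof (rule gronwall_forward_integral[where \<phi>' = \<phi>' and g' = "\<lambda>r. ?\<kappa> * \<gamma> r"])
    fix r assume r: "a \<le> r" "r \<le> t"
    show "(\<phi> has_real_derivative \<phi>' r) (at r within {a..t})"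
      unfolding \<phi>_def \<phi>'_def
      by (auto intro!: derivative_eq_intros DERIV_subset[OF Z_deriv] w r sum.cong simp: mult_ac)
    show "((\<lambda>t. ?\<kappa> * integral {a..t} \<gamma>) has_real_derivative ?\<kappa> * \<gamma> r) (at r within {a..t})"
      by (intro DERIV_cmult integral_has_real_derivative) (use r in \<open>auto intro: continuous_on_subset[OF \<gamma>c]\<close>)
    show "0 \<le> ?\<kappa> * \<gamma> r" using \<kappa> \<gamma>0 by simp
    have summand: "2 * (Z i r \<omega> * (A i k * X k r \<omega>)) \<le> \<bar>A i k\<bar> * (3 * \<phi> r + \<gamma> r)"
      if "i < n" "k < n" for i k
    proof -
      have ge: "(Z i r \<omega>)\<^sup>2 \<le> \<phi> r" "(Z k r \<omega>)\<^sup>2 \<le> \<phi> r" "(g k r \<omega>)\<^sup>2 \<le> \<gamma> r"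
        unfolding \<phi>_def \<gamma>_def using that by (auto intro!: member_le_sum)
      have X: "X k r \<omega> = Z k r \<omega> + g k r \<omega>" by (simp add: Z_def)
      have "2 * \<bar>Z i r \<omega> * X k r \<omega>\<bar> \<le> 2 * (\<bar>Z i r \<omega>\<bar> * \<bar>Z k r \<omega>\<bar>) + 2 * (\<bar>Z i r \<omega>\<bar> * \<bar>g k r \<omega>\<bar>)"
        unfolding X abs_mult by (simp add: distrib_left[symmetric] mult_left_mono abs_triangle_ineq)
      also have "2 * (\<bar>Z i r \<omega>\<bar> * \<bar>Z k r \<omega>\<bar>) \<le> (Z i r \<omega>)\<^sup>2 + (Z k r \<omega>)\<^sup>2"
        using zero_le_power2[of "\<bar>Z i r \<omega>\<bar> - \<bar>Z k r \<omega>\<bar>"] by (simp add: power2_diff)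
      also have "2 * (\<bar>Z i r \<omega>\<bar> * \<bar>g k r \<omega>\<bar>) \<le> (Z i r \<omega>)\<^sup>2 + (g k r \<omega>)\<^sup>2"
        using zero_le_power2[of "\<bar>Z i r \<omega>\<bar> - \<bar>g k r \<omega>\<bar>"] by (simp add: power2_diff)
      finally have b: "2 * \<bar>Z i r \<omega> * X k r \<omega>\<bar> \<le> 3 * \<phi> r + \<gamma> r" using ge by linarith
      have "2 * (Z i r \<omega> * (A i k * X k r \<omega>)) \<le> \<bar>2 * (Z i r \<omega> * (A i k * X k r \<omega>))\<bar>" by (rule abs_ge_self)
      also have "\<dots> = \<bar>A i k\<bar> * (2 * \<bar>Z i r \<omega> * X k r \<omega>\<bar>)" by (simp add: abs_mult mult_ac)
      also have "\<dots> \<le> \<bar>A i k\<bar> * (3 * \<phi> r + \<gamma> r)" by (rule mult_left_mono[OF b]) simp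
      finally show ?thesis .
    qed
    have "\<phi>' r = (\<Sum>i<n. \<Sum>k<n. 2 * (Z i r \<omega> * (A i k * X k r \<omega>)))"
      by (simp add: \<phi>'_def H_def sum_distrib_left)
    also have "\<dots> \<le> (\<Sum>i<n. \<Sum>k<n. \<bar>A i k\<bar> * (3 * \<phi> r + \<gamma> r))" by (intro sum_mono summand) auto
    also have "\<dots> = 3 * ?\<kappa> * \<phi> r + ?\<kappa> * \<gamma> r"
      by (simp add: sum_distrib_left sum_distrib_right sum.distrib algebra_simps)
    finally show "\<phi>' r \<le> 3 * ?\<kappa> * \<phi> r + ?\<kappa> * \<gamma> r" .
  qed (use t \<kappa> in auto)
  also have "\<dots> = exp (3 * ?\<kappa> * (t - a)) * (\<phi> a + ?\<kappa> * integral {a..t} \<gamma>)" by simp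
  also have "\<dots> \<le> exp (3 * ?\<kappa> * (T - a)) * (\<phi> a + ?\<kappa> * integral {a..T} \<gamma>)"
  proof (intro mult_mono add_mono mult_left_mono[OF _ \<kappa>] order_refl)
    show "exp (3 * ?\<kappa> * (t - a)) \<le> exp (3 * ?\<kappa> * (T - a))"
      unfolding exp_le_cancel_iff by (rule mult_left_mono) (use t \<kappa> in auto)
    show "integral {a..t} \<gamma> \<le> integral {a..T} \<gamma>"
      by (rule integral_subset_le) (use t \<gamma>i \<gamma>0 in auto)
    show "0 \<le> \<phi> a + ?\<kappa> * integral {a..t} \<gamma>"
      using \<kappa> by (auto intro!: add_nonneg_nonneg mult_nonneg_nonneg
          Henstock_Kurzweil_Integration.integral_nonneg \<gamma>i \<gamma>0 simp: \<phi>_def sum_nonneg)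
  qed (use \<kappa> \<gamma>i \<gamma>0 in \<open>auto intro!: Henstock_Kurzweil_Integration.integral_nonneg\<close>)
  also have "\<phi> a = (\<Sum>i<n. (X i a \<omega>)\<^sup>2)" unfolding \<phi>_def by (simp add: Z_start w)
  finally show ?thesis by (simp add: \<phi>_def \<gamma>_def[abs_def])
qed

lemma second_moment_bounds:
  assumes T: "a \<le> T"
  obtains K where "0 \<le> K" "\<And>i s. i < n \<Longrightarrow> a \<le> s \<Longrightarrow> s \<le> T \<Longrightarrow> expectation (\<lambda>\<omega>. (X i s \<omega>)\<^sup>2) \<le> K"
    "\<And>i s. i < n \<Longrightarrow> a \<le> s \<Longrightarrow> s \<le> T \<Longrightarrow> expectation (\<lambda>\<omega>. (Z i s \<omega>)\<^sup>2) \<le> K"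
    "\<And>i s. i < n \<Longrightarrow> a \<le> s \<Longrightarrow> s \<le> T \<Longrightarrow> expectation (\<lambda>\<omega>. (g i s \<omega>)\<^sup>2) \<le> K"
    "\<And>i s. a \<le> s \<Longrightarrow> s \<le> T \<Longrightarrow> expectation (\<lambda>\<omega>. (H i s \<omega>)\<^sup>2) \<le> K * (real n * (\<Sum>k<n. (A i k)\<^sup>2))"
proof -
  obtain Kg where Kg: "\<And>i s. i < n \<Longrightarrow> a \<le> s \<Longrightarrow> s \<le> T \<Longrightarrow> expectation (\<lambda>\<omega>. (g i s \<omega>)\<^sup>2) \<le> Kg"
    using gbound[OF T] by blast
  let ?\<kappa> = "\<Sum>i<n. \<Sum>k<n. \<bar>A i k\<bar>"
  let ?G = "\<lambda>s \<omega>. \<Sum>k<n. (g k s \<omega>)\<^sup>2"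
  have Gi: "integrable M (?G s)" if "a \<le> s" for s
    using gsq that by (auto simp: sq_int_def)
  have "integrable M (\<lambda>\<omega>. integral {a..T} (\<lambda>s. ?G s \<omega>))"
  proof (rule expectation_integral(1))
    fix s assume s: "a \<le> s" "s \<le> T"
    have "expectation (\<lambda>\<omega>. \<bar>?G s \<omega>\<bar>) = (\<Sum>k<n. expectation (\<lambda>\<omega>. (g k s \<omega>)\<^sup>2))"
      using gsq s by (simp add: sum_nonneg sq_int_def)
    also have "\<dots> \<le> (\<Sum>k<n. Kg)" by (intro sum_mono Kg s) auto
    finally show "expectation (\<lambda>\<omega>. \<bar>?G s \<omega>\<bar>) \<le> (\<Sum>k<n. Kg)" .
  next
    show "continuous_on {a..} (\<lambda>s. ?G s \<omega>)" if "\<omega> \<in> space M" for \<omega>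
      by (intro continuous_intros gcont that) auto
  qed (use Gi T in auto)
  then have Bi: "integrable M (\<lambda>\<omega>. exp (3 * ?\<kappa> * (T - a)) *
      ((\<Sum>i<n. (X i a \<omega>)\<^sup>2) + ?\<kappa> * integral {a..T} (\<lambda>s. ?G s \<omega>)))" (is "integrable M ?B")
    using Xsq by (auto simp: sq_int_def intro!: Bochner_Integration.integrable_add
        Bochner_Integration.integrable_mult_right Bochner_Integration.integrable_sum)
  define KZ where "KZ = expectation ?B"
  have KZ: "expectation (\<lambda>\<omega>. (Z i s \<omega>)\<^sup>2) \<le> KZ" if "i < n" "a \<le> s" "s \<le> T" for i s
    unfolding KZ_def
  proof (rule integral_mono[OF _ Bi])
    show "integrable M (\<lambda>\<omega>. (Z i s \<omega>)\<^sup>2)" using Zsq[OF that(1,2)] by (simp add: sq_int_def)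
    fix \<omega> assume w: "\<omega> \<in> space M"
    have "(Z i s \<omega>)\<^sup>2 \<le> (\<Sum>i<n. (Z i s \<omega>)\<^sup>2)" using that(1) by (intro member_le_sum) auto
    also have "\<dots> \<le> ?B \<omega>" by (rule Z_square_bound[OF w that(2,3)])
    finally show "(Z i s \<omega>)\<^sup>2 \<le> ?B \<omega>" .
  qed
  define K where "K = max 0 (max (max KZ Kg) (2 * KZ + 2 * Kg))"
  have KX: "expectation (\<lambda>\<omega>. (X i s \<omega>)\<^sup>2) \<le> K" if "i < n" "a \<le> s" "s \<le> T" for i s
  proof -
    have zi: "integrable M (\<lambda>\<omega>. (Z i s \<omega>)\<^sup>2)" "integrable M (\<lambda>\<omega>. (g i s \<omega>)\<^sup>2)" "integrable M (\<lambda>\<omega>. (X i s \<omega>)\<^sup>2)"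
      using Zsq[OF that(1,2)] gsq[OF that(1,2)] Xsq[OF that(1,2)] by (auto simp: sq_int_def)
    have "expectation (\<lambda>\<omega>. (X i s \<omega>)\<^sup>2) \<le> expectation (\<lambda>\<omega>. 2 * (Z i s \<omega>)\<^sup>2 + 2 * (g i s \<omega>)\<^sup>2)"
    proof (rule integral_mono)
      fix \<omega>
      show "(X i s \<omega>)\<^sup>2 \<le> 2 * (Z i s \<omega>)\<^sup>2 + 2 * (g i s \<omega>)\<^sup>2"
        using zero_le_power2[of "Z i s \<omega> - g i s \<omega>"] by (simp add: Z_def power2_eq_square algebra_simps)
    qed (use zi in auto)
    also have "\<dots> \<le> 2 * KZ + 2 * Kg" using zi KZ[OF that] Kg[OF that] by simp
    finally show ?thesis by (simp add: K_def)
  qed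
  have KH: "expectation (\<lambda>\<omega>. (H i s \<omega>)\<^sup>2) \<le> K * (real n * (\<Sum>k<n. (A i k)\<^sup>2))" if "a \<le> s" "s \<le> T" for i s
  proof -
    let ?A = "\<Sum>k<n. (A i k)\<^sup>2"
    have xi: "integrable M (\<lambda>\<omega>. (X k s \<omega>)\<^sup>2)" if "k < n" for k
      using Xsq[OF that \<open>a \<le> s\<close>] by (simp add: sq_int_def)
    have "expectation (\<lambda>\<omega>. (H i s \<omega>)\<^sup>2) \<le> expectation (\<lambda>\<omega>. ?A * (\<Sum>k<n. (X k s \<omega>)\<^sup>2))"
    proof (rule integral_mono)
      show "integrable M (\<lambda>\<omega>. (H i s \<omega>)\<^sup>2)" using Hsq[OF that(1)] by (simp add: sq_int_def)
      show "integrable M (\<lambda>\<omega>. ?A * (\<Sum>k<n. (X k s \<omega>)\<^sup>2))" using xi by auto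
      show "(H i s \<omega>)\<^sup>2 \<le> ?A * (\<Sum>k<n. (X k s \<omega>)\<^sup>2)" for \<omega>
        unfolding H_def by (rule Cauchy_Schwarz_ineq_sum)
    qed
    also have "\<dots> = ?A * (\<Sum>k<n. expectation (\<lambda>\<omega>. (X k s \<omega>)\<^sup>2))" using xi by simp
    also have "\<dots> \<le> ?A * (\<Sum>k<n. K)" by (intro mult_left_mono sum_mono KX) (auto simp: sum_nonneg that)
    finally show ?thesis by (simp add: mult_ac)
  qed
  show ?thesis
  proof (rule that[of K])
    show "0 \<le> K" by (simp add: K_def)
    show "expectation (\<lambda>\<omega>. (Z i s \<omega>)\<^sup>2) \<le> K" if "i < n" "a \<le> s" "s \<le> T" for i s
      using KZ[OF that] by (simp add: K_def)
    show "expectation (\<lambda>\<omega>. (g i s \<omega>)\<^sup>2) \<le> K" if "i < n" "a \<le> s" "s \<le> T" for i s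
      using Kg[OF that] by (simp add: K_def)
  qed (fact KX KH)+
qed

text \<open>The mean solves the same integral equation without noise. Subtracting it reduces covariances to
expectations of products.\<close>

lemma centered:
  assumes g0: "\<And>i s. i < n \<Longrightarrow> a \<le> s \<Longrightarrow> expectation (g i s) = 0"
  shows "noise_state M a n A (\<lambda>i t \<omega>. X i t \<omega> - expectation (X i t)) g"
proof -
  have mean: "(\<lambda>s. \<Sum>k<n. A i k * expectation (X k s)) integrable_on {a..t}
      \<and> expectation (X i t) = expectation (X i a) + integral {a..t} (\<lambda>s. \<Sum>k<n. A i k * expectation (X k s))"
    if i: "i < n" and t: "a \<le> t" for i t
  proof -
    obtain K where K: "0 \<le> K" "\<And>i s. a \<le> s \<Longrightarrow> s \<le> t \<Longrightarrow> expectation (\<lambda>\<omega>. (H i s \<omega>)\<^sup>2) \<le> K * (real n * (\<Sum>k<n. (A i k)\<^sup>2))"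
      using second_moment_bounds[OF t] by metis
    have Hi: "expectation (H i s) = (\<Sum>k<n. A i k * expectation (X k s))" if "a \<le> s" for s
      unfolding H_def using sq_int_integrable[OF Xsq] that
      by (subst Bochner_Integration.integral_sum) auto
    have b: "expectation (\<lambda>\<omega>. \<bar>H i s \<omega>\<bar>) \<le> K * (real n * (\<Sum>k<n. (A i k)\<^sup>2)) + 1" if "a \<le> s" "s \<le> t" for s
      using sq_int_product(2)[OF Hsq[OF that(1)] sq_int_const[of 1], of i] K(2)[OF that, of i]
      by (simp add: prob_space)
    note Hi' = sq_int_integrable[OF Hsq]
    have e1: "integrable M (\<lambda>\<omega>. integral {a..t} (\<lambda>s. H i s \<omega>))"
      by (rule expectation_integral(1)[OF borel_measurable_integrable[OF Hi'] Hcont Hi' b t])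
    have e2: "(\<lambda>s. expectation (H i s)) integrable_on {a..t}"
      by (rule expectation_integral(2)[OF borel_measurable_integrable[OF Hi'] Hcont Hi' b t])
    have e3: "expectation (\<lambda>\<omega>. integral {a..t} (\<lambda>s. H i s \<omega>)) = integral {a..t} (\<lambda>s. expectation (H i s))"
      by (rule expectation_integral(3)[OF borel_measurable_integrable[OF Hi'] Hcont Hi' b t])
    have "expectation (X i t) = expectation (\<lambda>\<omega>. X i a \<omega> + integral {a..t} (\<lambda>s. H i s \<omega>) + g i t \<omega>)"
      by (rule Bochner_Integration.integral_cong[OF refl]) (unfold H_def, rule X_eq[OF _ i t])
    also have "\<dots> = expectation (X i a) + expectation (\<lambda>\<omega>. integral {a..t} (\<lambda>s. H i s \<omega>)) + expectation (g i t)"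
      using e1 sq_int_integrable[OF Xsq[OF i]] sq_int_integrable[OF gsq[OF i t]] by simp
    also have "\<dots> = expectation (X i a) + integral {a..t} (\<lambda>s. expectation (H i s))"
      using e3 g0[OF i t] by simp
    also have "integral {a..t} (\<lambda>s. expectation (H i s)) = integral {a..t} (\<lambda>s. \<Sum>k<n. A i k * expectation (X k s))"
      by (rule Henstock_Kurzweil_Integration.integral_cong) (simp add: Hi)
    finally show ?thesis
      using Henstock_Kurzweil_Integration.integrable_eq[OF e2] Hi by auto
  qed
  have mc: "continuous_on {a..} (\<lambda>s. expectation (X i s))" if "i < n" for i
    by (rule integral_equation_continuous[OF conjunct2[OF mean[OF that]] conjunct1[OF mean[OF that]]])
  show ?thesis
  proof
    fix i s \<omega> t assume i: "i < n"
    show "sq_int (\<lambda>\<omega>. X i s \<omega> - expectation (X i s))" if "a \<le> s"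
      by (intro sq_int_diff Xsq sq_int_const i that)
    show "sq_int (g i s)" if "a \<le> s" by (rule gsq[OF i that])
    assume w: "\<omega> \<in> space M"
    show "continuous_on {a..} (\<lambda>s. X i s \<omega> - expectation (X i s))"
      by (intro continuous_intros Xcont w i mc)
    assume t: "a \<le> t"
    have "integral {a..t} (\<lambda>s. \<Sum>k<n. A i k * (X k s \<omega> - expectation (X k s)))
      = integral {a..t} (\<lambda>s. (\<Sum>k<n. A i k * X k s \<omega>) - (\<Sum>k<n. A i k * expectation (X k s)))"
      by (simp add: right_diff_distrib sum_subtractf)
    also have "\<dots> = integral {a..t} (\<lambda>s. \<Sum>k<n. A i k * X k s \<omega>) - integral {a..t} (\<lambda>s. \<Sum>k<n. A i k * expectation (X k s))"
      using mean[OF i t] continuous_Ici_integrable[OF Hcont[OF w], of i t]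
      by (intro Henstock_Kurzweil_Integration.integral_diff) (auto simp: H_def)
    finally show "X i t \<omega> - expectation (X i t) = X i a \<omega> - expectation (X i a)
        + integral {a..t} (\<lambda>s. \<Sum>k<n. A i k * (X k s \<omega> - expectation (X k s))) + g i t \<omega>"
      using X_eq[OF w i t] mean[OF i t] by simp
  qed (rule gbound)
qed

end

text \<open>Two such processes whose noise primitives have jointly orthogonal increments; \<open>N\<close> is the joint
intensity of the two noises, after multiplication by their input matrices.\<close>

locale noise_pair =
  one: noise_state M a n1 A1 X1 g1 + two: noise_state M a n2 A2 X2 g2
  for M :: "'a measure" and a n1 A1 X1 g1 n2 A2 X2 g2 +
  fixes N :: "nat \<Rightarrow> nat \<Rightarrow> real"
  assumes gg: "i < n1 \<Longrightarrow> j < n2 \<Longrightarrow> a \<le> s \<Longrightarrow> a \<le> t \<Longrightarrow>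
      one.expectation (\<lambda>\<omega>. g1 i s \<omega> * g2 j t \<omega>) = (min s t - a) * N i j"
    and Xg: "i < n1 \<Longrightarrow> j < n2 \<Longrightarrow> a \<le> t \<Longrightarrow> one.expectation (\<lambda>\<omega>. X1 i a \<omega> * g2 j t \<omega>) = 0"
    and gX: "i < n1 \<Longrightarrow> j < n2 \<Longrightarrow> a \<le> t \<Longrightarrow> one.expectation (\<lambda>\<omega>. X2 j a \<omega> * g1 i t \<omega>) = 0"
begin

lemma swap: "noise_pair M a n2 A2 X2 g2 n1 A1 X1 g1 (\<lambda>i j. N j i)"
proof unfold_locales
  fix i j s t assume "i < n2" "j < n1" "a \<le> s" "a \<le> t"
  then show "one.expectation (\<lambda>\<omega>. g2 i s \<omega> * g1 j t \<omega>) = (min s t - a) * N j i"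
    using gg[of j i t s] by (simp add: mult.commute min.commute)
qed (use Xg gX in auto)

definition "c i j t = one.expectation (\<lambda>\<omega>. one.Z i t \<omega> * g2 j t \<omega>)"

text \<open>Increments of the second primitive after time \<open>t\<close> are uncorrelated with the first process up
  to time \<open>t\<close>: the covariances satisfy a homogeneous linear integral equation.\<close>

lemma c_integral_equation:
  assumes i: "i < n1" and j: "j < n2" and t: "a \<le> t"
  shows "(\<lambda>s. \<Sum>k<n1. A1 i k * (c k j s + (s - a) * N k j)) integrable_on {a..t}"
    and "c i j t = 0 + integral {a..t} (\<lambda>s. \<Sum>k<n1. A1 i k * (c k j s + (s - a) * N k j))"
proof -
  define e where "e u k s = one.expectation (\<lambda>\<omega>. one.Z k s \<omega> * g2 j u \<omega>)" for u k s
  have gi: "one.sq_int (g2 j u)" if "a \<le> u" for u by (rule two.gsq[OF j that])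
  have XG: "one.expectation (\<lambda>\<omega>. X1 k s \<omega> * g2 j u \<omega>) = e u k s + (s - a) * N k j"
    if "k < n1" "a \<le> s" "s \<le> u" for k s u
  proof -
    have "a \<le> u" using that by simp
    have "one.expectation (\<lambda>\<omega>. X1 k s \<omega> * g2 j u \<omega>)
        = one.expectation (\<lambda>\<omega>. one.Z k s \<omega> * g2 j u \<omega> + g1 k s \<omega> * g2 j u \<omega>)"
      by (simp add: one.Z_def algebra_simps)
    also have "\<dots> = e u k s + one.expectation (\<lambda>\<omega>. g1 k s \<omega> * g2 j u \<omega>)"
      unfolding e_def using that gi[OF \<open>a \<le> u\<close>]
      by (intro Bochner_Integration.integral_add one.sq_int_product one.Zsq one.gsq) auto
    finally show ?thesis using gg[OF that(1) j that(2) \<open>a \<le> u\<close>] that by simp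
  qed
  have main: "(\<lambda>s. e u k s) integrable_on {a..u} \<and> (i' < n1 \<longrightarrow> a \<le> r \<longrightarrow> r \<le> u \<longrightarrow>
      e u i' r = integral {a..r} (\<lambda>s. \<Sum>k<n1. A1 i' k * (e u k s + (s - a) * N k j)))"
    if u: "a \<le> u" and k: "k < n1" for u k i' r
  proof
    obtain K where K: "0 \<le> K"
      "\<And>i s. i < n1 \<Longrightarrow> a \<le> s \<Longrightarrow> s \<le> u \<Longrightarrow> one.expectation (\<lambda>\<omega>. (X1 i s \<omega>)\<^sup>2) \<le> K"
      "\<And>i s. a \<le> s \<Longrightarrow> s \<le> u \<Longrightarrow> one.expectation (\<lambda>\<omega>. (one.H i s \<omega>)\<^sup>2) \<le> K * (real n1 * (\<Sum>k<n1. (A1 i k)\<^sup>2))"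
      using one.second_moment_bounds[OF u] by metis
    define E where "E = one.expectation (\<lambda>\<omega>. (g2 j u \<omega>)\<^sup>2)"
    have "(\<lambda>s. one.expectation (\<lambda>\<omega>. X1 k s \<omega> * g2 j u \<omega>)) integrable_on {a..u}"
    proof (rule one.expectation_integral(2)[where K = "K + E"])
      fix s assume s: "a \<le> s" "s \<le> u"
      show "integrable M (\<lambda>\<omega>. X1 k s \<omega> * g2 j u \<omega>)"
        by (intro one.sq_int_product one.Xsq gi k s u)
      show "one.expectation (\<lambda>\<omega>. \<bar>X1 k s \<omega> * g2 j u \<omega>\<bar>) \<le> K + E"
        using one.sq_int_product(2)[OF one.Xsq[OF k s(1)] gi[OF u]] K(2)[OF k s] by (simp add: E_def)
    next
      show "(\<lambda>\<omega>. X1 k s \<omega> * g2 j u \<omega>) \<in> borel_measurable M" if "a \<le> s" for s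
        by (intro borel_measurable_integrable one.sq_int_product one.Xsq gi k that u)
      show "continuous_on {a..} (\<lambda>s. X1 k s \<omega> * g2 j u \<omega>)" if "\<omega> \<in> space M" for \<omega>
        by (intro continuous_intros one.Xcont that k)
    qed (rule u)
    moreover have "(\<lambda>s. (s - a) * N k j) integrable_on {a..u}"
      by (intro integrable_continuous_real continuous_intros)
    ultimately have "(\<lambda>s. one.expectation (\<lambda>\<omega>. X1 k s \<omega> * g2 j u \<omega>) - (s - a) * N k j) integrable_on {a..u}"
      by (rule Henstock_Kurzweil_Integration.integrable_diff)
    then show "(\<lambda>s. e u k s) integrable_on {a..u}"
      by (rule Henstock_Kurzweil_Integration.integrable_eq) (use XG k in auto)
    show "i' < n1 \<longrightarrow> a \<le> r \<longrightarrow> r \<le> u \<longrightarrow>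
      e u i' r = integral {a..r} (\<lambda>s. \<Sum>k<n1. A1 i' k * (e u k s + (s - a) * N k j))"
    proof (intro impI)
      assume i': "i' < n1" and r: "a \<le> r" "r \<le> u"
      define f where "f s \<omega> = one.H i' s \<omega> * g2 j u \<omega>" for s \<omega>
      have fi: "integrable M (f s)" if "a \<le> s" for s
        unfolding f_def by (intro one.sq_int_product one.Hsq gi that u)
      have fK: "one.expectation (\<lambda>\<omega>. \<bar>f s \<omega>\<bar>) \<le> K * (real n1 * (\<Sum>k<n1. (A1 i' k)\<^sup>2)) + E" if s: "a \<le> s" "s \<le> r" for s
        using one.sq_int_product(2)[OF one.Hsq[OF s(1)] gi[OF u], of i'] K(3)[OF s(1), of i'] s r
        by (simp add: E_def f_def)
      have fc: "continuous_on {a..} (\<lambda>s. f s \<omega>)" if "\<omega> \<in> space M" for \<omega>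
        unfolding f_def by (intro continuous_intros one.Hcont that)
      have ef: "integrable M (\<lambda>\<omega>. integral {a..r} (\<lambda>s. f s \<omega>))"
        by (rule one.expectation_integral(1)[OF borel_measurable_integrable[OF fi] fc fi fK r(1)])
      have ef2: "one.expectation (\<lambda>\<omega>. integral {a..r} (\<lambda>s. f s \<omega>)) = integral {a..r} (\<lambda>s. one.expectation (f s))"
        by (rule one.expectation_integral(3)[OF borel_measurable_integrable[OF fi] fc fi fK r(1)])
      have "e u i' r = one.expectation (\<lambda>\<omega>. X1 i' a \<omega> * g2 j u \<omega> + integral {a..r} (\<lambda>s. f s \<omega>))"
        unfolding e_def
      proof (rule Bochner_Integration.integral_cong[OF refl])
        fix \<omega> assume w: "\<omega> \<in> space M"
        have "integral {a..r} (\<lambda>s. f s \<omega>) = integral {a..r} (\<lambda>s. one.H i' s \<omega>) * g2 j u \<omega>"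
          unfolding f_def by simp
        then show "one.Z i' r \<omega> * g2 j u \<omega> = X1 i' a \<omega> * g2 j u \<omega> + integral {a..r} (\<lambda>s. f s \<omega>)"
          using one.Z_eq[OF w i' r(1)] by (simp add: distrib_right)
      qed
      also have "\<dots> = one.expectation (\<lambda>\<omega>. X1 i' a \<omega> * g2 j u \<omega>) + one.expectation (\<lambda>\<omega>. integral {a..r} (\<lambda>s. f s \<omega>))"
        by (intro Bochner_Integration.integral_add ef one.sq_int_product one.Xsq gi i' u) simp
      also have "\<dots> = integral {a..r} (\<lambda>s. one.expectation (f s))"
        using Xg[OF i' j u] ef2 by simp
      also have "\<dots> = integral {a..r} (\<lambda>s. \<Sum>k<n1. A1 i' k * (e u k s + (s - a) * N k j))"
      proof (rule Henstock_Kurzweil_Integration.integral_cong)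
        fix s assume "s \<in> {a..r}"
        then have s: "a \<le> s" "s \<le> u" using r by auto
        have "one.expectation (f s) = one.expectation (\<lambda>\<omega>. \<Sum>k<n1. A1 i' k * (X1 k s \<omega> * g2 j u \<omega>))"
          by (simp add: f_def[abs_def] one.H_def sum_distrib_right mult.assoc)
        also have "\<dots> = (\<Sum>k<n1. A1 i' k * one.expectation (\<lambda>\<omega>. X1 k s \<omega> * g2 j u \<omega>))"
          using one.sq_int_product(1)[OF one.Xsq gi[OF u]] s by (subst Bochner_Integration.integral_sum) auto
        finally show "one.expectation (f s) = (\<Sum>k<n1. A1 i' k * (e u k s + (s - a) * N k j))"
          using XG s by simp
      qed
      finally show "e u i' r = integral {a..r} (\<lambda>s. \<Sum>k<n1. A1 i' k * (e u k s + (s - a) * N k j))" .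
    qed
  qed
  have e_indep: "e u k s = c k j s" if k: "k < n1" and s: "a \<le> s" "s \<le> u" for u k s
  proof -
    have u: "a \<le> u" using s by simp
    define D where "D k r = e u k r - e s k r" for k r
    have int: "D k integrable_on {a..s}" if "k < n1" for k
      unfolding D_def
      using main[OF u that, of 0 0] main[OF s(1) that, of 0 0] s
      by (intro Henstock_Kurzweil_Integration.integrable_diff)
        (auto intro: integrable_subinterval_real)
    have "D k s = 0"
    proof (rule linear_integral_equation_zero[where D = D and n = n1 and A = A1 and a = a and b = s])
      fix i t assume it: "i < n1" "a \<le> t" "t \<le> s"
      have int': "(\<lambda>r. \<Sum>k<n1. A1 i k * (e v k r + (r - a) * N k j)) integrable_on {a..t}"
        if "a \<le> v" "t \<le> v" for v
      proof -
        have "(\<lambda>r. e v k r) integrable_on {a..t}" if "k < n1" for k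
          using main[OF \<open>a \<le> v\<close> that, of 0 0] \<open>t \<le> v\<close> by (auto intro: integrable_subinterval_real)
        moreover have "(\<lambda>s. (s - a) * N k j) integrable_on {a..t}" for k
          by (intro integrable_continuous_real continuous_intros)
        ultimately have "(\<lambda>r. A1 i k *\<^sub>R (e v k r + (r - a) * N k j)) integrable_on {a..t}" if "k < n1" for k
          using that by (intro Henstock_Kurzweil_Integration.integrable_cmul
              Henstock_Kurzweil_Integration.integrable_add) auto
        then show ?thesis by (intro Henstock_Kurzweil_Integration.integrable_sum) auto
      qed
      have "D i t = integral {a..t} (\<lambda>r. \<Sum>k<n1. A1 i k * (e u k r + (r - a) * N k j))
          - integral {a..t} (\<lambda>r. \<Sum>k<n1. A1 i k * (e s k r + (r - a) * N k j))"
        using main[OF u it(1), of i t] main[OF s(1) it(1), of i t] it s by (simp add: D_def)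
      also have "\<dots> = integral {a..t} (\<lambda>r. (\<Sum>k<n1. A1 i k * (e u k r + (r - a) * N k j))
          - (\<Sum>k<n1. A1 i k * (e s k r + (r - a) * N k j)))"
        by (rule Henstock_Kurzweil_Integration.integral_diff[symmetric]) (use int' u s it in auto)
      also have "\<dots> = integral {a..t} (\<lambda>r. \<Sum>k<n1. A1 i k * D k r)"
        by (rule Henstock_Kurzweil_Integration.integral_cong)
          (simp add: D_def sum_subtractf[symmetric] algebra_simps)
      finally show "D i t = integral {a..t} (\<lambda>r. \<Sum>k<n1. A1 i k * D k r)" .
    qed (use int s k in auto)
    then show ?thesis by (simp add: D_def e_def c_def)
  qed
  have ci: "(\<lambda>s. c k j s) integrable_on {a..t}" if "k < n1" for k
    using main[OF t that, of 0 0] e_indep[OF that]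
    by (auto intro: Henstock_Kurzweil_Integration.integrable_eq)
  have "(\<lambda>s. A1 i k *\<^sub>R (c k j s + (s - a) * N k j)) integrable_on {a..t}" if "k < n1" for k
    by (intro Henstock_Kurzweil_Integration.integrable_cmul Henstock_Kurzweil_Integration.integrable_add
        ci that integrable_continuous_real continuous_intros)
  then show "(\<lambda>s. \<Sum>k<n1. A1 i k * (c k j s + (s - a) * N k j)) integrable_on {a..t}"
    by (intro Henstock_Kurzweil_Integration.integrable_sum) auto
  have "c i j t = e t i t" by (simp add: c_def e_def)
  also have "\<dots> = integral {a..t} (\<lambda>s. \<Sum>k<n1. A1 i k * (e t k s + (s - a) * N k j))"
    using main[OF t i, of i t] i t by simp
  also have "\<dots> = integral {a..t} (\<lambda>s. \<Sum>k<n1. A1 i k * (c k j s + (s - a) * N k j))"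
    by (rule Henstock_Kurzweil_Integration.integral_cong) (simp add: e_indep)
  finally show "c i j t = 0 + integral {a..t} (\<lambda>s. \<Sum>k<n1. A1 i k * (c k j s + (s - a) * N k j))" by simp
qed

lemma c_continuous: "i < n1 \<Longrightarrow> j < n2 \<Longrightarrow> continuous_on {a..} (c i j)"
  by (rule integral_equation_continuous[OF c_integral_equation(2) c_integral_equation(1)]) auto

lemma c_deriv:
  "i < n1 \<Longrightarrow> j < n2 \<Longrightarrow> a \<le> t \<Longrightarrow>
    (c i j has_real_derivative (\<Sum>k<n1. A1 i k * (c k j t + (t - a) * N k j))) (at t within {a..})"
  by (rule integral_equation_deriv[OF c_integral_equation(2)])
    (auto intro!: continuous_intros c_continuous)

definition "z i j t = one.expectation (\<lambda>\<omega>. one.Z i t \<omega> * two.Z j t \<omega>)"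
definition "c2 j i t = one.expectation (\<lambda>\<omega>. two.Z j t \<omega> * g1 i t \<omega>)"

lemma c2_continuous: "i < n1 \<Longrightarrow> j < n2 \<Longrightarrow> continuous_on {a..} (c2 j i)"
  using noise_pair.c_continuous[OF swap, of j i] noise_pair.c_def[OF swap]
  by (simp add: c2_def[abs_def])

lemma c2_deriv:
  "i < n1 \<Longrightarrow> j < n2 \<Longrightarrow> a \<le> t \<Longrightarrow>
    (c2 j i has_real_derivative (\<Sum>k<n2. A2 j k * (c2 k i t + (t - a) * N i k))) (at t within {a..})"
  using noise_pair.c_deriv[OF swap, of j i t] noise_pair.c_def[OF swap, abs_def]
  by (simp add: c2_def[abs_def])

lemma z_integral_equation:
  assumes i: "i < n1" and j: "j < n2" and t: "a \<le> t"
  shows "(\<lambda>s. (\<Sum>k<n1. A1 i k * (z k j s + c2 j k s)) + (\<Sum>k<n2. A2 j k * (z i k s + c i k s)))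
      integrable_on {a..t}"
    and "z i j t = z i j a + integral {a..t}
      (\<lambda>s. (\<Sum>k<n1. A1 i k * (z k j s + c2 j k s)) + (\<Sum>k<n2. A2 j k * (z i k s + c i k s)))"
proof -
  obtain K1 where K1: "0 \<le> K1"
    "\<And>i s. i < n1 \<Longrightarrow> a \<le> s \<Longrightarrow> s \<le> t \<Longrightarrow> one.expectation (\<lambda>\<omega>. (one.Z i s \<omega>)\<^sup>2) \<le> K1"
    "\<And>i s. a \<le> s \<Longrightarrow> s \<le> t \<Longrightarrow> one.expectation (\<lambda>\<omega>. (one.H i s \<omega>)\<^sup>2) \<le> K1 * (real n1 * (\<Sum>k<n1. (A1 i k)\<^sup>2))"
    using one.second_moment_bounds[OF t] by metis
  obtain K2 where K2: "0 \<le> K2"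
    "\<And>i s. i < n2 \<Longrightarrow> a \<le> s \<Longrightarrow> s \<le> t \<Longrightarrow> one.expectation (\<lambda>\<omega>. (two.Z i s \<omega>)\<^sup>2) \<le> K2"
    "\<And>i s. a \<le> s \<Longrightarrow> s \<le> t \<Longrightarrow> one.expectation (\<lambda>\<omega>. (two.H i s \<omega>)\<^sup>2) \<le> K2 * (real n2 * (\<Sum>k<n2. (A2 i k)\<^sup>2))"
    using two.second_moment_bounds[OF t] by metis
  define f where "f s \<omega> = one.H i s \<omega> * two.Z j s \<omega> + one.Z i s \<omega> * two.H j s \<omega>" for s \<omega>
  define K where "K = (K1 * (real n1 * (\<Sum>k<n1. (A1 i k)\<^sup>2)) + K2) + (K1 + K2 * (real n2 * (\<Sum>k<n2. (A2 j k)\<^sup>2)))"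
  have p1: "integrable M (\<lambda>\<omega>. one.H i s \<omega> * two.Z j s \<omega>)" "integrable M (\<lambda>\<omega>. one.Z i s \<omega> * two.H j s \<omega>)"
    if "a \<le> s" for s
    by (intro one.sq_int_product one.Hsq two.Zsq one.Zsq two.Hsq i j that)+
  have fi: "integrable M (f s)" if "a \<le> s" for s
    using p1[OF that] by (simp add: f_def[abs_def])
  have fK: "one.expectation (\<lambda>\<omega>. \<bar>f s \<omega>\<bar>) \<le> K" if s: "a \<le> s" "s \<le> t" for s
  proof -
    have "one.expectation (\<lambda>\<omega>. \<bar>f s \<omega>\<bar>)
        \<le> one.expectation (\<lambda>\<omega>. \<bar>one.H i s \<omega> * two.Z j s \<omega>\<bar> + \<bar>one.Z i s \<omega> * two.H j s \<omega>\<bar>)"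
      by (intro integral_mono) (use p1[OF s(1)] fi[OF s(1)] abs_triangle_ineq in \<open>auto simp: f_def\<close>)
    also have "\<dots> = one.expectation (\<lambda>\<omega>. \<bar>one.H i s \<omega> * two.Z j s \<omega>\<bar>) + one.expectation (\<lambda>\<omega>. \<bar>one.Z i s \<omega> * two.H j s \<omega>\<bar>)"
      using p1[OF s(1)] by (intro Bochner_Integration.integral_add) auto
    also have "\<dots> \<le> K"
      unfolding K_def
      using one.sq_int_product(2)[OF one.Hsq[OF s(1)] two.Zsq[OF j s(1)], of i] K1(3)[OF s, of i] K2(2)[OF j s]
        one.sq_int_product(2)[OF one.Zsq[OF i s(1)] two.Hsq[OF s(1)], of j] K2(3)[OF s, of j] K1(2)[OF i s]
      by linarith
    finally show ?thesis .
  qed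
  have fc: "continuous_on {a..} (\<lambda>s. f s \<omega>)" if "\<omega> \<in> space M" for \<omega>
    unfolding f_def by (intro continuous_intros one.Hcont two.Zcont one.Zcont two.Hcont that i j)
  have fm: "f s \<in> borel_measurable M" if "a \<le> s" for s
    using fi[OF that] by (rule borel_measurable_integrable)
  have e1: "integrable M (\<lambda>\<omega>. integral {a..t} (\<lambda>s. f s \<omega>))"
    by (rule one.expectation_integral(1)[OF fm fc fi fK t])
  have e2: "(\<lambda>s. one.expectation (f s)) integrable_on {a..t}"
    by (rule one.expectation_integral(2)[OF fm fc fi fK t])
  have e3: "one.expectation (\<lambda>\<omega>. integral {a..t} (\<lambda>s. f s \<omega>)) = integral {a..t} (\<lambda>s. one.expectation (f s))"
    by (rule one.expectation_integral(3)[OF fm fc fi fK t])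
  have Ef: "one.expectation (f s) = (\<Sum>k<n1. A1 i k * (z k j s + c2 j k s)) + (\<Sum>k<n2. A2 j k * (z i k s + c i k s))"
    if s: "a \<le> s" for s
  proof -
    have XZ: "one.expectation (\<lambda>\<omega>. X1 k s \<omega> * two.Z j s \<omega>) = z k j s + c2 j k s" if "k < n1" for k
    proof -
      have "one.expectation (\<lambda>\<omega>. X1 k s \<omega> * two.Z j s \<omega>)
          = one.expectation (\<lambda>\<omega>. one.Z k s \<omega> * two.Z j s \<omega> + two.Z j s \<omega> * g1 k s \<omega>)"
        by (simp add: one.Z_def algebra_simps)
      then show ?thesis
        unfolding z_def c2_def
        by (subst (asm) Bochner_Integration.integral_add)
          (auto intro!: one.sq_int_product one.Zsq two.Zsq one.gsq that j s)
    qed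
    have ZX: "one.expectation (\<lambda>\<omega>. one.Z i s \<omega> * X2 k s \<omega>) = z i k s + c i k s" if "k < n2" for k
    proof -
      have "one.expectation (\<lambda>\<omega>. one.Z i s \<omega> * X2 k s \<omega>)
          = one.expectation (\<lambda>\<omega>. one.Z i s \<omega> * two.Z k s \<omega> + one.Z i s \<omega> * g2 k s \<omega>)"
        by (simp add: two.Z_def algebra_simps)
      then show ?thesis
        unfolding z_def c_def
        by (subst (asm) Bochner_Integration.integral_add)
          (auto intro!: one.sq_int_product one.Zsq two.Zsq two.gsq that i s)
    qed
    have "one.expectation (f s) = one.expectation (\<lambda>\<omega>. one.H i s \<omega> * two.Z j s \<omega>)
        + one.expectation (\<lambda>\<omega>. one.Z i s \<omega> * two.H j s \<omega>)"
      unfolding f_def[abs_def] by (intro Bochner_Integration.integral_add p1 s)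
    also have "one.expectation (\<lambda>\<omega>. one.H i s \<omega> * two.Z j s \<omega>)
        = one.expectation (\<lambda>\<omega>. \<Sum>k<n1. A1 i k * (X1 k s \<omega> * two.Z j s \<omega>))"
      by (simp add: one.H_def sum_distrib_right mult.assoc)
    also have "\<dots> = (\<Sum>k<n1. A1 i k * one.expectation (\<lambda>\<omega>. X1 k s \<omega> * two.Z j s \<omega>))"
      using one.sq_int_product(1)[OF one.Xsq two.Zsq[OF j s]] s by (subst Bochner_Integration.integral_sum) auto
    also have "one.expectation (\<lambda>\<omega>. one.Z i s \<omega> * two.H j s \<omega>)
        = one.expectation (\<lambda>\<omega>. \<Sum>k<n2. A2 j k * (one.Z i s \<omega> * X2 k s \<omega>))"
      by (simp add: two.H_def sum_distrib_left mult_ac)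
    also have "\<dots> = (\<Sum>k<n2. A2 j k * one.expectation (\<lambda>\<omega>. one.Z i s \<omega> * X2 k s \<omega>))"
      using one.sq_int_product(1)[OF one.Zsq[OF i s] two.Xsq] s by (subst Bochner_Integration.integral_sum) auto
    finally show ?thesis using XZ ZX by simp
  qed
  show "(\<lambda>s. (\<Sum>k<n1. A1 i k * (z k j s + c2 j k s)) + (\<Sum>k<n2. A2 j k * (z i k s + c i k s))) integrable_on {a..t}"
    by (rule Henstock_Kurzweil_Integration.integrable_eq[OF e2]) (use Ef in auto)
  have "z i j t = one.expectation (\<lambda>\<omega>. one.Z i a \<omega> * two.Z j a \<omega> + integral {a..t} (\<lambda>s. f s \<omega>))"
    unfolding z_def
  proof (rule Bochner_Integration.integral_cong[OF refl])
    fix \<omega> assume w: "\<omega> \<in> space M"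
    have "((\<lambda>s. f s \<omega>) has_integral one.Z i t \<omega> * two.Z j t \<omega> - one.Z i a \<omega> * two.Z j a \<omega>) {a..t}"
    proof (rule fundamental_theorem_of_calculus[OF t])
      fix s assume "s \<in> {a..t}"
      then have s: "a \<le> s" by simp
      have "((\<lambda>s. one.Z i s \<omega> * two.Z j s \<omega>) has_real_derivative f s \<omega>) (at s within {a..})"
        unfolding f_def
        by (auto intro!: derivative_eq_intros one.Z_deriv two.Z_deriv w i j s simp: algebra_simps)
      then have "((\<lambda>s. one.Z i s \<omega> * two.Z j s \<omega>) has_real_derivative f s \<omega>) (at s within {a..t})"
        by (rule DERIV_subset) auto
      then show "((\<lambda>s. one.Z i s \<omega> * two.Z j s \<omega>) has_vector_derivative f s \<omega>) (at s within {a..t})"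
        by (simp add: has_real_derivative_iff_has_vector_derivative)
    qed
    then show "one.Z i t \<omega> * two.Z j t \<omega> = one.Z i a \<omega> * two.Z j a \<omega> + integral {a..t} (\<lambda>s. f s \<omega>)"
      by (simp add: integral_unique)
  qed
  also have "\<dots> = z i j a + one.expectation (\<lambda>\<omega>. integral {a..t} (\<lambda>s. f s \<omega>))"
    unfolding z_def
    by (intro Bochner_Integration.integral_add e1 one.sq_int_product one.Zsq two.Zsq i j) auto
  also have "one.expectation (\<lambda>\<omega>. integral {a..t} (\<lambda>s. f s \<omega>)) = integral {a..t}
      (\<lambda>s. (\<Sum>k<n1. A1 i k * (z k j s + c2 j k s)) + (\<Sum>k<n2. A2 j k * (z i k s + c i k s)))"
    unfolding e3 by (rule Henstock_Kurzweil_Integration.integral_cong) (simp add: Ef)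
  finally show "z i j t = z i j a + integral {a..t}
      (\<lambda>s. (\<Sum>k<n1. A1 i k * (z k j s + c2 j k s)) + (\<Sum>k<n2. A2 j k * (z i k s + c i k s)))" .
qed

lemma z_continuous: "i < n1 \<Longrightarrow> j < n2 \<Longrightarrow> continuous_on {a..} (z i j)"
  by (rule integral_equation_continuous[OF z_integral_equation(2) z_integral_equation(1)]) auto

lemma z_deriv:
  "i < n1 \<Longrightarrow> j < n2 \<Longrightarrow> a \<le> t \<Longrightarrow> (z i j has_real_derivative
    (\<Sum>k<n1. A1 i k * (z k j t + c2 j k t)) + (\<Sum>k<n2. A2 j k * (z i k t + c i k t))) (at t within {a..})"
  by (rule integral_equation_deriv[OF z_integral_equation(2)])
    (auto intro!: continuous_intros c_continuous c2_continuous z_continuous)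

definition "C i j t = one.expectation (\<lambda>\<omega>. X1 i t \<omega> * X2 j t \<omega>)"

lemma C_split:
  assumes i: "i < n1" and j: "j < n2" and t: "a \<le> t"
  shows "C i j t = z i j t + c i j t + c2 j i t + (t - a) * N i j"
proof -
  have "C i j t = one.expectation (\<lambda>\<omega>. ((one.Z i t \<omega> * two.Z j t \<omega> + one.Z i t \<omega> * g2 j t \<omega>)
      + two.Z j t \<omega> * g1 i t \<omega>) + g1 i t \<omega> * g2 j t \<omega>)"
    unfolding C_def by (rule Bochner_Integration.integral_cong) (auto simp: one.Z_def two.Z_def algebra_simps)
  also have "\<dots> = z i j t + c i j t + c2 j i t + one.expectation (\<lambda>\<omega>. g1 i t \<omega> * g2 j t \<omega>)"
    unfolding z_def c_def c2_def
    by (subst Bochner_Integration.integral_add, (intro Bochner_Integration.integrable_add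
        one.sq_int_product one.Zsq two.Zsq one.gsq two.gsq i j t)+)+ simp
  finally show ?thesis using gg[OF i j t t] by simp
qed

text \<open>The product of \<open>Z1 + g1\<close> and \<open>Z2 + g2\<close> has four parts with known derivatives; the last one, the
expectation of \<open>g1 g2\<close>, contributes the inhomogeneity \<open>N\<close>.\<close>

theorem C_deriv:
  assumes i: "i < n1" and j: "j < n2" and t: "a \<le> t"
  shows "(C i j has_real_derivative
    (\<Sum>k<n1. A1 i k * C k j t) + (\<Sum>k<n2. A2 j k * C i k t) + N i j) (at t within {a..})"
proof -
  have "((\<lambda>t. z i j t + c i j t + c2 j i t + (t - a) * N i j) has_real_derivative
    ((\<Sum>k<n1. A1 i k * (z k j t + c2 j k t)) + (\<Sum>k<n2. A2 j k * (z i k t + c i k t)))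
    + (\<Sum>k<n1. A1 i k * (c k j t + (t - a) * N k j)) + (\<Sum>k<n2. A2 j k * (c2 k i t + (t - a) * N i k)) + N i j)
    (at t within {a..})"
    by (auto intro!: derivative_eq_intros z_deriv c_deriv c2_deriv i j t)
  moreover have "((\<Sum>k<n1. A1 i k * (z k j t + c2 j k t)) + (\<Sum>k<n2. A2 j k * (z i k t + c i k t)))
    + (\<Sum>k<n1. A1 i k * (c k j t + (t - a) * N k j)) + (\<Sum>k<n2. A2 j k * (c2 k i t + (t - a) * N i k))
    = (\<Sum>k<n1. A1 i k * C k j t) + (\<Sum>k<n2. A2 j k * C i k t)"
  proof -
    have "(\<Sum>k<n1. A1 i k * C k j t) = (\<Sum>k<n1. A1 i k * (z k j t + c2 j k t)) + (\<Sum>k<n1. A1 i k * (c k j t + (t - a) * N k j))"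
      unfolding sum.distrib[symmetric] by (rule sum.cong) (use j t in \<open>auto simp: C_split algebra_simps\<close>)
    moreover have "(\<Sum>k<n2. A2 j k * C i k t) = (\<Sum>k<n2. A2 j k * (z i k t + c i k t)) + (\<Sum>k<n2. A2 j k * (c2 k i t + (t - a) * N i k))"
      unfolding sum.distrib[symmetric] by (rule sum.cong) (use i t in \<open>auto simp: C_split algebra_simps\<close>)
    ultimately show ?thesis by simp
  qed
  ultimately have "((\<lambda>t. z i j t + c i j t + c2 j i t + (t - a) * N i j) has_real_derivative
    (\<Sum>k<n1. A1 i k * C k j t) + (\<Sum>k<n2. A2 j k * C i k t) + N i j) (at t within {a..})" by simp
  then show ?thesis
    by (rule has_field_derivative_transform_within[where d = 1]) (use t C_split[OF i j] in auto)
qed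

end

subsection \<open>Covariance matrices\<close>

context prob_space
begin

lemma rand_vec_component: "rand_vec M n X \<Longrightarrow> i < n \<Longrightarrow> sq_int (\<lambda>\<omega>. X \<omega> $ i)"
  by (simp add: rand_vec_def sq_int_def)

lemma rand_vec_carrier: "rand_vec M n X \<Longrightarrow> \<omega> \<in> space M \<Longrightarrow> X \<omega> \<in> carrier_vec n"
  by (simp add: rand_vec_def)

lemma sq_int_cong: "(\<And>\<omega>. \<omega> \<in> space M \<Longrightarrow> f \<omega> = g \<omega>) \<Longrightarrow> sq_int f \<longleftrightarrow> sq_int g"
  unfolding sq_int_def
  by (intro conj_cong measurable_cong Bochner_Integration.integrable_cong) auto

lemma rand_vecI:
  assumes "\<And>\<omega>. \<omega> \<in> space M \<Longrightarrow> X \<omega> \<in> carrier_vec n" "\<And>i. i < n \<Longrightarrow> sq_int (\<lambda>\<omega>. X \<omega> $ i)"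
  shows "rand_vec M n X"
  using assms by (simp add: rand_vec_def sq_int_def)

lemma mult_mat_vec_index:
  "A \<in> carrier_mat k n \<Longrightarrow> x \<in> carrier_vec n \<Longrightarrow> i < k \<Longrightarrow> (A *\<^sub>v x) $ i = (\<Sum>l<n. A $$ (i,l) * x $ l)"
  by (simp add: scalar_prod_def atLeast0LessThan)

lemma rand_vec_mult:
  assumes A: "A \<in> carrier_mat k n" and X: "rand_vec M n X"
  shows "rand_vec M k (\<lambda>\<omega>. A *\<^sub>v X \<omega>)"
proof (rule rand_vecI)
  show "A *\<^sub>v X \<omega> \<in> carrier_vec k" if "\<omega> \<in> space M" for \<omega>
    using A rand_vec_carrier[OF X that] by simp
  fix i assume i: "i < k"
  have "sq_int (\<lambda>\<omega>. \<Sum>l<n. A $$ (i,l) * X \<omega> $ l)"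
    by (intro sq_int_sum sq_int_mult rand_vec_component[OF X]) auto
  then show "sq_int (\<lambda>\<omega>. (A *\<^sub>v X \<omega>) $ i)"
    by (rule sq_int_cong[THEN iffD1, rotated]) (use mult_mat_vec_index[OF A rand_vec_carrier[OF X] i] in simp)
qed

lemma rand_vec_add:
  assumes X: "rand_vec M n X" and Y: "rand_vec M n Y"
  shows "rand_vec M n (\<lambda>\<omega>. X \<omega> + Y \<omega>)"
proof (rule rand_vecI)
  show "X \<omega> + Y \<omega> \<in> carrier_vec n" if "\<omega> \<in> space M" for \<omega>
    using rand_vec_carrier[OF X that] rand_vec_carrier[OF Y that] by simp
  fix i assume i: "i < n"
  have "sq_int (\<lambda>\<omega>. X \<omega> $ i + Y \<omega> $ i)"
    by (intro sq_int_add rand_vec_component[OF X i] rand_vec_component[OF Y i])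
  then show "sq_int (\<lambda>\<omega>. (X \<omega> + Y \<omega>) $ i)"
  proof (rule sq_int_cong[THEN iffD1, rotated])
    fix \<omega> assume "\<omega> \<in> space M"
    then have "dim_vec (Y \<omega>) = n" using rand_vec_carrier[OF Y] by (intro carrier_vecD)
    then show "X \<omega> $ i + Y \<omega> $ i = (X \<omega> + Y \<omega>) $ i" using i by simp
  qed
qed

lemma cov_mat_carrier: "cov_mat M n m X Y \<in> carrier_mat n m"
  by (simp add: cov_mat_def)

lemma cov_mat_index: "i < n \<Longrightarrow> j < m \<Longrightarrow> cov_mat M n m X Y $$ (i,j) =
  expectation (\<lambda>\<omega>. (X \<omega> $ i - expectation (\<lambda>\<eta>. X \<eta> $ i)) * (Y \<omega> $ j - expectation (\<lambda>\<eta>. Y \<eta> $ j)))"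
  by (simp add: cov_mat_def)

lemma cov_mat_cong:
  assumes "\<And>\<omega>. \<omega> \<in> space M \<Longrightarrow> X \<omega> = X' \<omega>" "\<And>\<omega>. \<omega> \<in> space M \<Longrightarrow> Y \<omega> = Y' \<omega>"
  shows "cov_mat M n m X Y = cov_mat M n m X' Y'"
proof -
  have "expectation (\<lambda>\<eta>. X \<eta> $ i) = expectation (\<lambda>\<eta>. X' \<eta> $ i)" for i
    by (rule Bochner_Integration.integral_cong) (use assms in auto)
  moreover have "expectation (\<lambda>\<eta>. Y \<eta> $ i) = expectation (\<lambda>\<eta>. Y' \<eta> $ i)" for i
    by (rule Bochner_Integration.integral_cong) (use assms in auto)
  ultimately show ?thesis
    unfolding cov_mat_def
    by (intro cong_mat refl) (auto intro!: Bochner_Integration.integral_cong simp: assms)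
qed

lemma cov_mat_transpose: "transpose_mat (cov_mat M n m X Y) = cov_mat M m n Y X"
  by (rule eq_matI) (auto simp: cov_mat_def mult.commute)

lemma cov_mat_mult_left:
  assumes A: "A \<in> carrier_mat k n" and X: "rand_vec M n X" and Y: "rand_vec M m Y"
  shows "cov_mat M k m (\<lambda>\<omega>. A *\<^sub>v X \<omega>) Y = A * cov_mat M n m X Y"
proof (rule eq_matI)
  fix i j assume "i < dim_row (A * cov_mat M n m X Y)" "j < dim_col (A * cov_mat M n m X Y)"
  then have i: "i < k" and j: "j < m" using A by (auto simp: cov_mat_def)
  let ?Y = "\<lambda>\<omega>. Y \<omega> $ j - expectation (\<lambda>\<eta>. Y \<eta> $ j)"
  let ?X = "\<lambda>l \<omega>. X \<omega> $ l - expectation (\<lambda>\<eta>. X \<eta> $ l)"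
  have m: "expectation (\<lambda>\<eta>. (A *\<^sub>v X \<eta>) $ i) = (\<Sum>l<n. A $$ (i,l) * expectation (\<lambda>\<eta>. X \<eta> $ l))"
  proof -
    have "expectation (\<lambda>\<eta>. (A *\<^sub>v X \<eta>) $ i) = expectation (\<lambda>\<eta>. \<Sum>l<n. A $$ (i,l) * X \<eta> $ l)"
      by (rule Bochner_Integration.integral_cong[OF refl])
        (rule mult_mat_vec_index[OF A rand_vec_carrier[OF X] i])
    then show ?thesis
      using sq_int_integrable[OF rand_vec_component[OF X]] by (simp add: Bochner_Integration.integral_sum)
  qed
  have "cov_mat M k m (\<lambda>\<omega>. A *\<^sub>v X \<omega>) Y $$ (i,j)
      = expectation (\<lambda>\<omega>. \<Sum>l<n. A $$ (i,l) * (?X l \<omega> * ?Y \<omega>))"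
    unfolding cov_mat_index[OF i j] m
    by (rule Bochner_Integration.integral_cong[OF refl],
        subst mult_mat_vec_index[OF A rand_vec_carrier[OF X] i])
      (auto simp: sum_subtractf[symmetric] right_diff_distrib[symmetric] sum_distrib_right mult.assoc)
  also have "\<dots> = (\<Sum>l<n. A $$ (i,l) * expectation (\<lambda>\<omega>. ?X l \<omega> * ?Y \<omega>))"
  proof -
    have "integrable M (\<lambda>\<omega>. A $$ (i,l) * (?X l \<omega> * ?Y \<omega>))" if "l < n" for l
      by (intro Bochner_Integration.integrable_mult_right sq_int_product sq_int_diff sq_int_const
          rand_vec_component[OF X that] rand_vec_component[OF Y j])
    then have "expectation (\<lambda>\<omega>. \<Sum>l<n. A $$ (i,l) * (?X l \<omega> * ?Y \<omega>))
        = (\<Sum>l<n. expectation (\<lambda>\<omega>. A $$ (i,l) * (?X l \<omega> * ?Y \<omega>)))"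
      by (intro Bochner_Integration.integral_sum) auto
    then show ?thesis by simp
  qed
  also have "\<dots> = (A * cov_mat M n m X Y) $$ (i,j)"
    using A i j by (auto simp: scalar_prod_def cov_mat_def atLeast0LessThan)
  finally show "cov_mat M k m (\<lambda>\<omega>. A *\<^sub>v X \<omega>) Y $$ (i,j) = (A * cov_mat M n m X Y) $$ (i,j)" .
qed (use A in \<open>auto simp: cov_mat_def\<close>)

lemma cov_mat_add_left:
  assumes X: "rand_vec M n X" and X': "rand_vec M n X'" and Y: "rand_vec M m Y"
  shows "cov_mat M n m (\<lambda>\<omega>. X \<omega> + X' \<omega>) Y = cov_mat M n m X Y + cov_mat M n m X' Y"
proof (rule eq_matI)
  fix i j assume "i < dim_row (cov_mat M n m X Y + cov_mat M n m X' Y)"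
    "j < dim_col (cov_mat M n m X Y + cov_mat M n m X' Y)"
  then have i: "i < n" and j: "j < m" by (auto simp: cov_mat_def)
  let ?Y = "\<lambda>\<omega>. Y \<omega> $ j - expectation (\<lambda>\<eta>. Y \<eta> $ j)"
  let ?X = "\<lambda>\<omega>. X \<omega> $ i - expectation (\<lambda>\<eta>. X \<eta> $ i)"
  let ?X' = "\<lambda>\<omega>. X' \<omega> $ i - expectation (\<lambda>\<eta>. X' \<eta> $ i)"
  have ix: "(X \<omega> + X' \<omega>) $ i = X \<omega> $ i + X' \<omega> $ i" if "\<omega> \<in> space M" for \<omega>
    using rand_vec_carrier[OF X' that] i by simp
  have "expectation (\<lambda>\<eta>. (X \<eta> + X' \<eta>) $ i) = expectation (\<lambda>\<eta>. X \<eta> $ i + X' \<eta> $ i)"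
    by (rule Bochner_Integration.integral_cong[OF refl]) (rule ix)
  also have "\<dots> = expectation (\<lambda>\<eta>. X \<eta> $ i) + expectation (\<lambda>\<eta>. X' \<eta> $ i)"
    by (intro Bochner_Integration.integral_add sq_int_integrable rand_vec_component[OF X i]
        rand_vec_component[OF X' i])
  finally have "cov_mat M n m (\<lambda>\<omega>. X \<omega> + X' \<omega>) Y $$ (i,j) = expectation (\<lambda>\<omega>. ?X \<omega> * ?Y \<omega> + ?X' \<omega> * ?Y \<omega>)"
    unfolding cov_mat_index[OF i j]
    by (intro Bochner_Integration.integral_cong refl) (simp add: ix algebra_simps)
  also have "\<dots> = expectation (\<lambda>\<omega>. ?X \<omega> * ?Y \<omega>) + expectation (\<lambda>\<omega>. ?X' \<omega> * ?Y \<omega>)"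
    by (intro Bochner_Integration.integral_add sq_int_product sq_int_diff sq_int_const
        rand_vec_component[OF X i] rand_vec_component[OF X' i] rand_vec_component[OF Y j])
  finally show "cov_mat M n m (\<lambda>\<omega>. X \<omega> + X' \<omega>) Y $$ (i,j) = (cov_mat M n m X Y + cov_mat M n m X' Y) $$ (i,j)"
    using i j by (simp add: cov_mat_index cov_mat_carrier[THEN carrier_matD(1)] cov_mat_carrier[THEN carrier_matD(2)])
qed (auto simp: cov_mat_def)

lemma cov_mat_linear:
  assumes A: "A \<in> carrier_mat k n" and B: "B \<in> carrier_mat k m"
    and X: "rand_vec M n X" and Y: "rand_vec M m Y"
  shows "fm (cov_mat M k k (\<lambda>\<omega>. A *\<^sub>v X \<omega> + B *\<^sub>v Y \<omega>) (\<lambda>\<omega>. A *\<^sub>v X \<omega> + B *\<^sub>v Y \<omega>))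
    = fm A * fm (cov_mat M n n X X) * adj (fm A) + fm A * fm (cov_mat M n m X Y) * adj (fm B)
    + fm B * adj (fm (cov_mat M n m X Y)) * adj (fm A) + fm B * fm (cov_mat M m m Y Y) * adj (fm B)"
proof -
  let ?U = "\<lambda>\<omega>. A *\<^sub>v X \<omega> + B *\<^sub>v Y \<omega>"
  have AX: "rand_vec M k (\<lambda>\<omega>. A *\<^sub>v X \<omega>)" and BY: "rand_vec M k (\<lambda>\<omega>. B *\<^sub>v Y \<omega>)"
    using rand_vec_mult A B X Y by auto
  have U: "rand_vec M k ?U" by (rule rand_vec_add[OF AX BY])
  have fmm: "fm (C * cov_mat M n' m' P R) = fm C * fm (cov_mat M n' m' P R)"
    if "C \<in> carrier_mat k n'" for C n' m' P R
    using that by (intro fm_times) (simp add: cov_mat_def)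
  have left: "fm (cov_mat M k j ?U W) = fm A * fm (cov_mat M n j X W) + fm B * fm (cov_mat M m j Y W)"
    if "rand_vec M j W" for j W
    using fm_add[OF mult_carrier_mat[OF A cov_mat_carrier[of n j X W]] mult_carrier_mat[OF B cov_mat_carrier[of m j Y W]]]
    by (simp add: cov_mat_add_left[OF AX BY that] cov_mat_mult_left[OF A X that] cov_mat_mult_left[OF B Y that]
        fmm[OF A] fmm[OF B])
  have flip: "fm (cov_mat M i j P W) = adj (fm (cov_mat M j i W P))" for i j P W
    by (simp add: fm_transpose[symmetric] cov_mat_transpose)
  have "fm (cov_mat M k k ?U ?U) = fm A * adj (fm (cov_mat M k n ?U X)) + fm B * adj (fm (cov_mat M k m ?U Y))"
    by (simp only: left[OF U] flip[of n k X ?U] flip[of m k Y ?U])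
  also have "\<dots> = fm A * adj (fm A * fm (cov_mat M n n X X) + fm B * fm (cov_mat M m n Y X))
      + fm B * adj (fm A * fm (cov_mat M n m X Y) + fm B * fm (cov_mat M m m Y Y))"
    by (simp add: left[OF X] left[OF Y])
  also have "\<dots> = fm A * (adj (fm (cov_mat M n n X X)) * adj (fm A)) + fm A * (adj (fm (cov_mat M m n Y X)) * adj (fm B))
      + (fm B * (adj (fm (cov_mat M n m X Y)) * adj (fm A)) + fm B * (adj (fm (cov_mat M m m Y Y)) * adj (fm B)))"
    by (simp add: distrib_left)
  also have "\<dots> = fm A * (fm (cov_mat M n n X X) * adj (fm A)) + fm A * (fm (cov_mat M n m X Y) * adj (fm B))
      + (fm B * (adj (fm (cov_mat M n m X Y)) * adj (fm A)) + fm B * (fm (cov_mat M m m Y Y) * adj (fm B)))"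
    by (simp only: flip[of n n X X, symmetric] flip[of n m X Y, symmetric] flip[of m m Y Y, symmetric])
  finally show ?thesis by (simp add: mult.assoc add.assoc)
qed

subsection \<open>Noise processes\<close>

lemma white_noise_product:
  assumes c: "cov_mat M k1 k2 b1 b2 = r \<cdot>\<^sub>m N" and N: "N \<in> carrier_mat k1 k2"
    and z: "\<And>i. i < k1 \<Longrightarrow> expectation (\<lambda>\<omega>. b1 \<omega> $ i) = 0" "\<And>i. i < k2 \<Longrightarrow> expectation (\<lambda>\<omega>. b2 \<omega> $ i) = 0"
    and rv: "rand_vec M k1 b1" "rand_vec M k2 b2"
  shows "expectation (\<lambda>\<omega>. (\<Sum>l<k1. B i l * (b1 \<omega> $ l)) * (\<Sum>m<k2. D j m * (b2 \<omega> $ m)))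
    = r * (\<Sum>l<k1. \<Sum>m<k2. B i l * N $$ (l,m) * D j m)"
proof -
  have e: "expectation (\<lambda>\<omega>. b1 \<omega> $ l * b2 \<omega> $ m) = r * N $$ (l,m)" if "l < k1" "m < k2" for l m
    using cov_mat_index[OF that, of "b1" "b2"] z that c N by simp
  have i: "integrable M (\<lambda>\<omega>. B i l * D j m * (b1 \<omega> $ l * b2 \<omega> $ m))" if "l < k1" "m < k2" for l m
    by (intro Bochner_Integration.integrable_mult_right sq_int_product rand_vec_component[OF rv(1)]
        rand_vec_component[OF rv(2)] that)
  have "expectation (\<lambda>\<omega>. (\<Sum>l<k1. B i l * (b1 \<omega> $ l)) * (\<Sum>m<k2. D j m * (b2 \<omega> $ m)))
      = expectation (\<lambda>\<omega>. \<Sum>l<k1. \<Sum>m<k2. B i l * D j m * (b1 \<omega> $ l * b2 \<omega> $ m))"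
    by (simp add: sum_product mult_ac)
  also have "\<dots> = (\<Sum>l<k1. expectation (\<lambda>\<omega>. \<Sum>m<k2. B i l * D j m * (b1 \<omega> $ l * b2 \<omega> $ m)))"
    by (intro Bochner_Integration.integral_sum Bochner_Integration.integrable_sum i) auto
  also have "\<dots> = (\<Sum>l<k1. \<Sum>m<k2. expectation (\<lambda>\<omega>. B i l * D j m * (b1 \<omega> $ l * b2 \<omega> $ m)))"
    by (intro sum.cong refl Bochner_Integration.integral_sum i) auto
  also have "\<dots> = (\<Sum>l<k1. \<Sum>m<k2. r * (B i l * N $$ (l,m) * D j m))"
    by (intro sum.cong refl) (simp add: e mult_ac)
  finally show ?thesis by (simp add: sum_distrib_left)
qed

lemma white_noise_driven_state:
  assumes wn: "white_noise_driven M a n k A B Q P0 \<beta> X"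
    and A: "A \<in> carrier_mat n n" and B: "B \<in> carrier_mat n k" and Q: "Q \<in> carrier_mat k k"
  shows "noise_state M a n (\<lambda>i j. A $$ (i,j)) (\<lambda>i t \<omega>. X t \<omega> $ i) (\<lambda>i t \<omega>. \<Sum>l<k. B $$ (i,l) * (\<beta> t \<omega> $ l))"
proof
  have X: "rand_vec M n (X t)" if "a \<le> t" for t using wn that unfolding white_noise_driven_def by blast
  have b: "rand_vec M k (\<beta> t)" "\<And>i. i < k \<Longrightarrow> expectation (\<lambda>\<omega>. \<beta> t \<omega> $ i) = 0" if "a \<le> t" for t
    using wn that unfolding white_noise_driven_def white_noise_primitive_def by blast+
  fix i s t \<omega> assume i: "i < n"
  show "sq_int (\<lambda>\<omega>. X s \<omega> $ i)" if "a \<le> s" by (rule rand_vec_component[OF X[OF that] i])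
  show "sq_int (\<lambda>\<omega>. \<Sum>l<k. B $$ (i,l) * (\<beta> s \<omega> $ l))" if "a \<le> s"
    by (intro sq_int_sum sq_int_mult rand_vec_component[OF b(1)[OF that]]) auto
  assume w: "\<omega> \<in> space M"
  show "continuous_on {a..} (\<lambda>s. X s \<omega> $ i)" using wn w i unfolding white_noise_driven_def by blast
  assume t: "a \<le> t"
  have eq: "X t \<omega> = X a \<omega> + vec n (\<lambda>i. integral {a..t} (\<lambda>s. (A *\<^sub>v X s \<omega>) $ i)) + B *\<^sub>v \<beta> t \<omega>"
    using wn w t unfolding white_noise_driven_def by blast
  have "X t \<omega> $ i = X a \<omega> $ i + integral {a..t} (\<lambda>s. (A *\<^sub>v X s \<omega>) $ i) + (B *\<^sub>v \<beta> t \<omega>) $ i"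
    by (subst eq) (use i B in simp)
  also have "integral {a..t} (\<lambda>s. (A *\<^sub>v X s \<omega>) $ i) = integral {a..t} (\<lambda>s. \<Sum>k<n. A $$ (i,k) * X s \<omega> $ k)"
    by (rule Henstock_Kurzweil_Integration.integral_cong)
      (rule mult_mat_vec_index[OF A rand_vec_carrier[OF X w] i], simp)
  also have "(B *\<^sub>v \<beta> t \<omega>) $ i = (\<Sum>l<k. B $$ (i,l) * (\<beta> t \<omega> $ l))"
    by (rule mult_mat_vec_index[OF B rand_vec_carrier[OF b(1)[OF t] w] i])
  finally show "X t \<omega> $ i = X a \<omega> $ i + integral {a..t} (\<lambda>s. \<Sum>k<n. A $$ (i,k) * X s \<omega> $ k)
      + (\<Sum>l<k. B $$ (i,l) * (\<beta> t \<omega> $ l))" .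
next
  have b: "rand_vec M k (\<beta> t)" "\<And>i. i < k \<Longrightarrow> expectation (\<lambda>\<omega>. \<beta> t \<omega> $ i) = 0"
    "cov_mat M k k (\<beta> t) (\<beta> t) = (min t t - a) \<cdot>\<^sub>m Q" if "a \<le> t" for t
    using wn that unfolding white_noise_driven_def white_noise_primitive_def by blast+
  fix T assume T: "a \<le> T"
  let ?N = "\<lambda>i. \<Sum>l<k. \<Sum>m<k. B $$ (i,l) * Q $$ (l,m) * B $$ (i,m)"
  have "expectation (\<lambda>\<omega>. (\<Sum>l<k. B $$ (i,l) * (\<beta> s \<omega> $ l))\<^sup>2) \<le> (T - a) * (\<Sum>i<n. \<bar>?N i\<bar>)"
    if "i < n" "a \<le> s" "s \<le> T" for i s
  proof -
    have "expectation (\<lambda>\<omega>. (\<Sum>l<k. B $$ (i,l) * (\<beta> s \<omega> $ l))\<^sup>2) = (s - a) * ?N i"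
      using white_noise_product[OF b(3)[OF that(2)] Q b(2)[OF that(2)] b(2)[OF that(2)] b(1)[OF that(2)]
          b(1)[OF that(2)], of "\<lambda>i l. B $$ (i,l)" i "\<lambda>i l. B $$ (i,l)" i]
      by (simp add: power2_eq_square)
    also have "\<dots> \<le> (T - a) * (\<Sum>i<n. \<bar>?N i\<bar>)"
    proof -
      have "(s - a) * ?N i \<le> (s - a) * \<bar>?N i\<bar>" using that by (intro mult_left_mono) auto
      also have "\<dots> \<le> (T - a) * (\<Sum>i<n. \<bar>?N i\<bar>)"
        using that member_le_sum[of i "{..<n}" "\<lambda>i. \<bar>?N i\<bar>"] by (intro mult_mono) auto
      finally show ?thesis .
    qed
    finally show ?thesis .
  qed
  then show "\<exists>K. \<forall>i<n. \<forall>s. a \<le> s \<and> s \<le> T \<longrightarrow> expectation (\<lambda>\<omega>. (\<Sum>l<k. B $$ (i,l) * (\<beta> s \<omega> $ l))\<^sup>2) \<le> K"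
    by blast
qed

text \<open>The centered components of the two processes form a \<open>noise_pair\<close>. One process taken twice gives the
equation of its covariance; \<open>N = 0\<close> gives the cross covariance of uncorrelated noises.\<close>

theorem covariance_lyapunov:
  assumes wn1: "white_noise_driven M a n1 k1 A1 B1 Q1 P1 \<beta>1 X1"
    and wn2: "white_noise_driven M a n2 k2 A2 B2 Q2 P2 \<beta>2 X2"
    and d1: "A1 \<in> carrier_mat n1 n1" "B1 \<in> carrier_mat n1 k1" "Q1 \<in> carrier_mat k1 k1"
    and d2: "A2 \<in> carrier_mat n2 n2" "B2 \<in> carrier_mat n2 k2" "Q2 \<in> carrier_mat k2 k2"
    and N: "N \<in> carrier_mat k1 k2"
    and \<beta>\<beta>: "\<And>s t. a \<le> s \<Longrightarrow> a \<le> t \<Longrightarrow> cov_mat M k1 k2 (\<beta>1 s) (\<beta>2 t) = (min s t - a) \<cdot>\<^sub>m N"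
    and X\<beta>: "\<And>t. a \<le> t \<Longrightarrow> cov_mat M n1 k2 (X1 a) (\<beta>2 t) = 0\<^sub>m n1 k2"
    and \<beta>X: "\<And>t. a \<le> t \<Longrightarrow> cov_mat M n2 k1 (X2 a) (\<beta>1 t) = 0\<^sub>m n2 k1"
    and t: "a \<le> t"
  shows "has_mderiv a (\<lambda>t. cov_mat M n1 n2 (X1 t) (X2 t))
    (A1 * cov_mat M n1 n2 (X1 t) (X2 t) + cov_mat M n1 n2 (X1 t) (X2 t) * transpose_mat A2
      + B1 * N * transpose_mat B2) t"
proof -
  have X1: "rand_vec M n1 (X1 t)" if "a \<le> t" for t using wn1 that unfolding white_noise_driven_def by blast
  have X2: "rand_vec M n2 (X2 t)" if "a \<le> t" for t using wn2 that unfolding white_noise_driven_def by blast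
  have b1: "rand_vec M k1 (\<beta>1 t)" "\<And>i. i < k1 \<Longrightarrow> expectation (\<lambda>\<omega>. \<beta>1 t \<omega> $ i) = 0" if "a \<le> t" for t
    using wn1 that unfolding white_noise_driven_def white_noise_primitive_def by blast+
  have b2: "rand_vec M k2 (\<beta>2 t)" "\<And>i. i < k2 \<Longrightarrow> expectation (\<lambda>\<omega>. \<beta>2 t \<omega> $ i) = 0" if "a \<le> t" for t
    using wn2 that unfolding white_noise_driven_def white_noise_primitive_def by blast+
  let ?g1 = "\<lambda>i t \<omega>. \<Sum>l<k1. B1 $$ (i,l) * (\<beta>1 t \<omega> $ l)"
  let ?g2 = "\<lambda>i t \<omega>. \<Sum>l<k2. B2 $$ (i,l) * (\<beta>2 t \<omega> $ l)"
  let ?X1 = "\<lambda>i t \<omega>. X1 t \<omega> $ i - expectation (\<lambda>\<omega>. X1 t \<omega> $ i)"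
  let ?X2 = "\<lambda>i t \<omega>. X2 t \<omega> $ i - expectation (\<lambda>\<omega>. X2 t \<omega> $ i)"
  let ?N = "\<lambda>i j. \<Sum>l<k1. \<Sum>m<k2. B1 $$ (i,l) * N $$ (l,m) * B2 $$ (j,m)"
  have "noise_state M a n1 (\<lambda>i j. A1 $$ (i,j)) ?X1 ?g1"
  proof (rule noise_state.centered[OF white_noise_driven_state[OF wn1 d1]])
    fix i s assume "a \<le> s"
    then show "expectation (?g1 i s) = 0"
      using b1(2)[of s] sq_int_integrable[OF rand_vec_component[OF b1(1)[of s]]]
      by (simp add: Bochner_Integration.integral_sum)
  qed
  moreover have "noise_state M a n2 (\<lambda>i j. A2 $$ (i,j)) ?X2 ?g2"
  proof (rule noise_state.centered[OF white_noise_driven_state[OF wn2 d2]])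
    fix i s assume "a \<le> s"
    then show "expectation (?g2 i s) = 0"
      using b2(2)[of s] sq_int_integrable[OF rand_vec_component[OF b2(1)[of s]]]
      by (simp add: Bochner_Integration.integral_sum)
  qed
  moreover have "expectation (\<lambda>\<omega>. ?X1 i a \<omega> * ?g2 j t \<omega>) = 0" if "i < n1" "a \<le> t" for i j t
  proof -
    have "expectation (\<lambda>\<omega>. ?X1 i a \<omega> * (\<beta>2 t \<omega> $ l)) = 0" if l: "l < k2" for l
      using cov_mat_index[OF \<open>i < n1\<close> l, of "X1 a" "\<beta>2 t"] X\<beta>[OF \<open>a \<le> t\<close>] b2(2)[OF \<open>a \<le> t\<close> l] \<open>i < n1\<close> l by simp
    moreover have "integrable M (\<lambda>\<omega>. B2 $$ (j,l) * (?X1 i a \<omega> * (\<beta>2 t \<omega> $ l)))" if l: "l < k2" for l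
      by (intro Bochner_Integration.integrable_mult_right sq_int_product sq_int_diff sq_int_const
          rand_vec_component[OF X1[OF order_refl] \<open>i < n1\<close>] rand_vec_component[OF b2(1)[OF \<open>a \<le> t\<close>] l])
    then have "expectation (\<lambda>\<omega>. \<Sum>l<k2. B2 $$ (j,l) * (?X1 i a \<omega> * (\<beta>2 t \<omega> $ l)))
        = (\<Sum>l<k2. expectation (\<lambda>\<omega>. B2 $$ (j,l) * (?X1 i a \<omega> * (\<beta>2 t \<omega> $ l))))"
      by (intro Bochner_Integration.integral_sum) auto
    moreover have "expectation (\<lambda>\<omega>. ?X1 i a \<omega> * ?g2 j t \<omega>)
        = expectation (\<lambda>\<omega>. \<Sum>l<k2. B2 $$ (j,l) * (?X1 i a \<omega> * (\<beta>2 t \<omega> $ l)))"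
      by (simp add: sum_distrib_left mult_ac)
    ultimately show ?thesis by simp
  qed
  moreover have "expectation (\<lambda>\<omega>. ?X2 i a \<omega> * ?g1 j t \<omega>) = 0" if "i < n2" "a \<le> t" for i j t
  proof -
    have "expectation (\<lambda>\<omega>. ?X2 i a \<omega> * (\<beta>1 t \<omega> $ l)) = 0" if l: "l < k1" for l
      using cov_mat_index[OF \<open>i < n2\<close> l, of "X2 a" "\<beta>1 t"] \<beta>X[OF \<open>a \<le> t\<close>] b1(2)[OF \<open>a \<le> t\<close> l] \<open>i < n2\<close> l by simp
    moreover have "integrable M (\<lambda>\<omega>. B1 $$ (j,l) * (?X2 i a \<omega> * (\<beta>1 t \<omega> $ l)))" if l: "l < k1" for l
      by (intro Bochner_Integration.integrable_mult_right sq_int_product sq_int_diff sq_int_const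
          rand_vec_component[OF X2[OF order_refl] \<open>i < n2\<close>] rand_vec_component[OF b1(1)[OF \<open>a \<le> t\<close>] l])
    then have "expectation (\<lambda>\<omega>. \<Sum>l<k1. B1 $$ (j,l) * (?X2 i a \<omega> * (\<beta>1 t \<omega> $ l)))
        = (\<Sum>l<k1. expectation (\<lambda>\<omega>. B1 $$ (j,l) * (?X2 i a \<omega> * (\<beta>1 t \<omega> $ l))))"
      by (intro Bochner_Integration.integral_sum) auto
    moreover have "expectation (\<lambda>\<omega>. ?X2 i a \<omega> * ?g1 j t \<omega>)
        = expectation (\<lambda>\<omega>. \<Sum>l<k1. B1 $$ (j,l) * (?X2 i a \<omega> * (\<beta>1 t \<omega> $ l)))"
      by (simp add: sum_distrib_left mult_ac)
    ultimately show ?thesis by simp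
  qed
  moreover have "expectation (\<lambda>\<omega>. ?g1 i s \<omega> * ?g2 j t \<omega>) = (min s t - a) * ?N i j" if "a \<le> s" "a \<le> t" for i j s t
    by (rule white_noise_product[OF \<beta>\<beta>[OF that] N b1(2)[OF that(1)] b2(2)[OF that(2)] b1(1)[OF that(1)] b2(1)[OF that(2)],
        of "\<lambda>i l. B1 $$ (i,l)" i "\<lambda>j m. B2 $$ (j,m)" j])
  ultimately interpret np: noise_pair M a n1 "\<lambda>i j. A1 $$ (i,j)" ?X1 ?g1 n2 "\<lambda>i j. A2 $$ (i,j)" ?X2 ?g2 ?N
    by (simp add: noise_pair_def noise_pair_axioms_def)
  let ?C = "cov_mat M n1 n2 (X1 t) (X2 t)"
  have C: "cov_mat M n1 n2 (X1 s) (X2 s) $$ (i,j) = np.C i j s" if "i < n1" "j < n2" for i j s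
    using that by (simp add: cov_mat_index np.C_def)
  have sums: "{0..<n} = {..<n}" for n :: nat by auto
  show ?thesis
    unfolding has_mderiv_def
  proof (intro conjI allI impI)
    show "dim_row (A1 * ?C + ?C * transpose_mat A2 + B1 * N * transpose_mat B2) = dim_row ?C"
      "dim_col (A1 * ?C + ?C * transpose_mat A2 + B1 * N * transpose_mat B2) = dim_col ?C"
      using d1 d2 by (auto simp: cov_mat_def)
    fix i j assume "i < dim_row ?C" "j < dim_col ?C"
    then have ij: "i < n1" "j < n2" by (auto simp: cov_mat_def)
    have 1: "(A1 * ?C) $$ (i,j) = (\<Sum>k<n1. A1 $$ (i,k) * np.C k j t)"
      using ij d1 C by (auto simp: scalar_prod_def sums cov_mat_carrier[THEN carrier_matD(1)]
          cov_mat_carrier[THEN carrier_matD(2)])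
    have 2: "(?C * transpose_mat A2) $$ (i,j) = (\<Sum>k<n2. A2 $$ (j,k) * np.C i k t)"
      using ij d2 C by (auto simp: scalar_prod_def sums cov_mat_carrier[THEN carrier_matD(1)]
          cov_mat_carrier[THEN carrier_matD(2)] mult.commute)
    have 3: "(B1 * N * transpose_mat B2) $$ (i,j) = ?N i j"
      using ij d1 d2 N
      by (simp add: scalar_prod_def sums sum_distrib_left mult.assoc)
    have "(A1 * ?C + ?C * transpose_mat A2 + B1 * N * transpose_mat B2) $$ (i,j)
      = (\<Sum>k<n1. A1 $$ (i,k) * np.C k j t) + (\<Sum>k<n2. A2 $$ (j,k) * np.C i k t) + ?N i j"
      using 1 2 3 ij d1 d2 by (simp add: cov_mat_carrier[THEN carrier_matD(1)] cov_mat_carrier[THEN carrier_matD(2)])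
    then show "((\<lambda>s. cov_mat M n1 n2 (X1 s) (X2 s) $$ (i,j)) has_real_derivative
        (A1 * ?C + ?C * transpose_mat A2 + B1 * N * transpose_mat B2) $$ (i,j)) (at t within {a..})"
      using np.C_deriv[OF ij t] C[OF ij] by simp
  qed
qed

end

text \<open>The difference of two solutions solves a homogeneous linear equation.\<close>

lemma lyapunov_unique:
  assumes A1: "A1 \<in> carrier_mat n n" and A2: "A2 \<in> carrier_mat m m" and N: "N \<in> carrier_mat n m"
    and X: "\<And>t. a \<le> t \<Longrightarrow> X t \<in> carrier_mat n m"
      "\<And>t. a \<le> t \<Longrightarrow> has_mderiv a X (A1 * X t + X t * transpose_mat A2 + N) t"
    and Y: "\<And>t. a \<le> t \<Longrightarrow> Y t \<in> carrier_mat n m"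
      "\<And>t. a \<le> t \<Longrightarrow> has_mderiv a Y (A1 * Y t + Y t * transpose_mat A2 + N) t"
    and start: "X a = Y a" and t: "a \<le> t"
  shows "X t = Y t"
proof -
  have d: "((\<lambda>s. fm (X s)) has_vector_derivative (fm A1 * fm (X t) + fm (X t) * adj (fm A2) + fm N)) (at t within {a..})"
    if "\<And>t. a \<le> t \<Longrightarrow> X t \<in> carrier_mat n m"
      "\<And>t. a \<le> t \<Longrightarrow> has_mderiv a X (A1 * X t + X t * transpose_mat A2 + N) t" "a \<le> t" for X t
  proof -
    have "fm (A1 * X t + X t * transpose_mat A2 + N) = fm A1 * fm (X t) + fm (X t) * adj (fm A2) + fm N"
      using that(1)[OF that(3)] A1 A2 N
      by (simp add: fm_add[of _ n m] fm_times fm_transpose mult_carrier_mat[of _ n n])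
    then show ?thesis using has_mderiv_fm[OF that(2)[OF that(3)] that(3,1)] by simp
  qed
  have "fm (X t) - fm (Y t) = 0"
  proof (rule linear_ode_zero[of a _ "\<lambda>_. fm A1" "\<lambda>_. adj (fm A2)"])
    show "((\<lambda>t. fm (X t) - fm (Y t)) has_vector_derivative
        fm A1 * (fm (X r) - fm (Y r)) + (fm (X r) - fm (Y r)) * adj (fm A2)) (at r within {a..})" if "a \<le> r" for r
    proof -
      have e: "p * x + x * q + c - (p * y + y * q + c) = p * (x - y) + (x - y) * q" for p q x y c :: fsmat
        by (simp add: algebra_simps)
      show ?thesis
        by (rule has_vector_derivative_eq_rhs[OF has_vector_derivative_diff[OF d[OF X that] d[OF Y that]] e])
    qed
  qed (use start t in auto)
  then show ?thesis using X(1)[OF t] Y(1)[OF t] by (intro fm_inject[of _ n m]) auto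
qed

section \<open>The matrices of the filter\<close>

subsection \<open>Block matrices\<close>

lemma fm_add': "dim_row A = dim_row B \<Longrightarrow> dim_col A = dim_col B \<Longrightarrow> fm (A + B) = fm A + fm B"
  by (rule fm_add[of A "dim_row A" "dim_col A"]) auto

lemma fm_diff': "dim_row A = dim_row B \<Longrightarrow> dim_col A = dim_col B \<Longrightarrow> fm (A - B) = fm A - fm B"
  by (rule fm_diff[of A "dim_row A" "dim_col A"]) auto

lemma hcat_four_block:
  assumes "A \<in> carrier_mat n k1" "B \<in> carrier_mat n k2"
  shows "hcat A B = four_block_mat A B (0\<^sub>m 0 k1) (0\<^sub>m 0 k2)"
  unfolding hcat_def append_rows_def using assms
  by (subst transpose_four_block_mat[of _ k1 n _ 0 _ k2]) auto

lemma hcat_carrier: "A \<in> carrier_mat n k1 \<Longrightarrow> B \<in> carrier_mat n k2 \<Longrightarrow> hcat A B \<in> carrier_mat n (k1 + k2)"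
  by (auto simp: hcat_def)

lemma fm_hcat_times_append:
  assumes A: "A \<in> carrier_mat n k1" "B \<in> carrier_mat n k2" and X: "X \<in> carrier_mat k1 m" "Y \<in> carrier_mat k2 m"
  shows "fm (hcat A B * (X @\<^sub>r Y)) = fm A * fm X + fm B * fm Y"
proof -
  have "hcat A B * (X @\<^sub>r Y) = four_block_mat (A * X + B * Y) (A * 0\<^sub>m k1 0 + B * 0\<^sub>m k2 0)
      (0\<^sub>m 0 k1 * X + 0\<^sub>m 0 k2 * Y) (0\<^sub>m 0 k1 * 0\<^sub>m k1 0 + 0\<^sub>m 0 k2 * 0\<^sub>m k2 0)"
    unfolding hcat_four_block[OF A] append_rows_def using X A
    by (subst mult_four_block_mat[of _ n k1 _ k2 _ 0 _ _ m _ 0]) auto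
  also have "fm \<dots> = fm (A * X + B * Y)"
    by (rule fsmat_eqI) (use A X in \<open>auto simp: ent_fm\<close>)
  finally show ?thesis using A X by (simp add: fm_add' fm_times)
qed

lemma append_times_hcat:
  assumes A: "A \<in> carrier_mat n k1" "B \<in> carrier_mat n k2" and X: "X \<in> carrier_mat m1 n" "Y \<in> carrier_mat m2 n"
  shows "(X @\<^sub>r Y) * hcat A B = four_block_mat (X * A) (X * B) (Y * A) (Y * B)"
  unfolding hcat_four_block[OF A] append_rows_def using X A
  by (subst mult_four_block_mat[of _ m1 n _ 0 _ m2 _ _ k1 _ k2]) auto

lemma four_block_mat_eq_one:
  fixes A B C D :: "real mat"
  assumes "A \<in> carrier_mat k1 k1" "B \<in> carrier_mat k1 k2" "C \<in> carrier_mat k2 k1" "D \<in> carrier_mat k2 k2"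
    and e: "four_block_mat A B C D = 1\<^sub>m (k1 + k2)"
  shows "A = 1\<^sub>m k1" "B = 0\<^sub>m k1 k2" "C = 0\<^sub>m k2 k1" "D = 1\<^sub>m k2"
proof -
  have i: "four_block_mat A B C D $$ (i,j) = 1\<^sub>m (k1 + k2) $$ (i,j)" for i j by (simp only: e)
  show "A = 1\<^sub>m k1"
  proof (rule eq_matI)
    fix p q assume "p < dim_row (1\<^sub>m k1 :: real mat)" "q < dim_col (1\<^sub>m k1 :: real mat)"
    then show "A $$ (p,q) = 1\<^sub>m k1 $$ (p,q)" using i[of p q] assms(1-4) by (simp split: if_splits)
  qed (use assms in auto)
  show "B = 0\<^sub>m k1 k2"
  proof (rule eq_matI)
    fix p q assume "p < dim_row (0\<^sub>m k1 k2 :: real mat)" "q < dim_col (0\<^sub>m k1 k2 :: real mat)"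
    then show "B $$ (p,q) = 0\<^sub>m k1 k2 $$ (p,q)" using i[of p "k1 + q"] assms(1-4) by simp
  qed (use assms in auto)
  show "C = 0\<^sub>m k2 k1"
  proof (rule eq_matI)
    fix p q assume "p < dim_row (0\<^sub>m k2 k1 :: real mat)" "q < dim_col (0\<^sub>m k2 k1 :: real mat)"
    then show "C $$ (p,q) = 0\<^sub>m k2 k1 $$ (p,q)" using i[of "k1 + p" q] assms(1-4) by simp
  qed (use assms in auto)
  show "D = 1\<^sub>m k2"
  proof (rule eq_matI)
    fix p q assume "p < dim_row (1\<^sub>m k2 :: real mat)" "q < dim_col (1\<^sub>m k2 :: real mat)"
    then show "D $$ (p,q) = 1\<^sub>m k2 $$ (p,q)" using i[of "k1 + p" "k1 + q"] assms(1-4) by simp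
  qed (use assms in auto)
qed

lemma orthonormal_blocks:
  assumes A: "A \<in> carrier_mat n k1" "B \<in> carrier_mat n k2" and n: "n = k1 + k2"
    and o: "transpose_mat (hcat A B) * hcat A B = 1\<^sub>m n"
  shows "adj (fm A) * fm A = un k1" "adj (fm A) * fm B = 0" "adj (fm B) * fm A = 0" "adj (fm B) * fm B = un k2"
    and "fm A * adj (fm A) + fm B * adj (fm B) = un n"
proof -
  have t: "transpose_mat (hcat A B) = transpose_mat A @\<^sub>r transpose_mat B" by (simp add: hcat_def)
  have fb: "four_block_mat (transpose_mat A * A) (transpose_mat A * B) (transpose_mat B * A) (transpose_mat B * B)
      = 1\<^sub>m (k1 + k2)"
    using o unfolding t using append_times_hcat[OF A, of "transpose_mat A" k1 "transpose_mat B" k2] A n by simp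
  note b = four_block_mat_eq_one[OF _ _ _ _ fb]
  have "fm (transpose_mat A * A) = un k1" "fm (transpose_mat A * B) = 0"
    "fm (transpose_mat B * A) = 0" "fm (transpose_mat B * B) = un k2"
    using b A by (auto simp: un_def fm_zero)
  then show "adj (fm A) * fm A = un k1" "adj (fm A) * fm B = 0" "adj (fm B) * fm A = 0" "adj (fm B) * fm B = un k2"
    using A by (simp_all add: fm_times fm_transpose)
  have c: "hcat A B \<in> carrier_mat n n" using hcat_carrier[OF A] n by simp
  have "hcat A B * transpose_mat (hcat A B) = 1\<^sub>m n"
    by (rule mat_mult_left_right_inverse[OF _ c o]) (use c in auto)
  then have "fm (hcat A B * (transpose_mat A @\<^sub>r transpose_mat B)) = un n" by (simp add: t un_def)
  then show "fm A * adj (fm A) + fm B * adj (fm B) = un n"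
    using fm_hcat_times_append[OF A, of "transpose_mat A" n "transpose_mat B"] A by (simp add: fm_transpose)
qed

lemma corner_inverse_commute:
  assumes "shape n n X" "shape n n Y" "X * Y = un n"
  shows "Y * X = un n"
proof -
  obtain A where A: "A \<in> carrier_mat n n" "fm A = X" using shape_obtain_mat[OF assms(1)] .
  obtain B where B: "B \<in> carrier_mat n n" "fm B = Y" using shape_obtain_mat[OF assms(2)] .
  have "A * B = 1\<^sub>m n"
    by (rule fm_inject[of _ n n]) (use A B assms(3) in \<open>auto simp: fm_times un_def\<close>)
  then have "B * A = 1\<^sub>m n" by (rule mat_mult_left_right_inverse[OF A(1) B(1)])
  then have "fm (B * A) = un n" by (simp add: un_def)
  then show ?thesis using A B by (simp add: fm_times)
qed

lemma shape_zero_dim: "shape n 0 X \<Longrightarrow> X = 0" "shape 0 n X \<Longrightarrow> X = 0"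
  by (auto simp: shape_def intro!: fsmat_eqI)

text \<open>A repeated column would leave fewer than \<open>k\<close> candidates for a basis of the column space. Hence the
columns are distinct, as the correspondence between relations among the columns and vectors in the
kernel presupposes.\<close>

lemma full_column_rank_injective:
  fixes A :: "real mat"
  assumes A: "A \<in> carrier_mat n k" and r: "vec_space.rank n A = k"
    and x: "x \<in> carrier_vec k" "A *\<^sub>v x = 0\<^sub>v n"
  shows "x = 0\<^sub>v k"
proof (rule ccontr)
  assume x0: "x \<noteq> 0\<^sub>v k"
  interpret vec_space "TYPE(real)" n .
  have "distinct (cols A)"
  proof (rule ccontr)
    assume nd: "\<not> distinct (cols A)"
    obtain T where T: "maximal T (\<lambda>T. T \<subseteq> set (cols A) \<and> lin_indpt T)"
      using maximal_exists[of "(\<lambda>T. T \<subseteq> set (cols A) \<and> lin_indpt T)" "card (set (cols A))" "{}"]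
      by (meson List.finite_set card_mono empty_iff empty_subsetI finite_lin_indpt2 rev_finite_subset)
    then have "rank A = card T" by (rule rank_card_indpt[OF A])
    also have "\<dots> \<le> card (set (cols A))" using T by (intro card_mono) (auto simp: maximal_def)
    also have "\<dots> < length (cols A)" using nd card_length distinct_card card_distinct le_neq_implies_less by blast
    finally show False using r A by simp
  qed
  then show False using lin_depI[OF A x(1) x0 x(2)] full_rank_lin_indpt[OF A r] by blast
qed

subsection \<open>Differentiable functions on a half line\<close>

text \<open>Differentiability without a name for the derivative: it is used for the continuity of the filter
matrices and for the existence of a derivative of \<open>G2 M2\<close>, whose formula never matters.\<close>

definition diffb :: "real \<Rightarrow> (real \<Rightarrow> fsmat) \<Rightarrow> bool" where
  "diffb a f \<longleftrightarrow> (\<forall>t\<ge>a. \<exists>D. (f has_vector_derivative D) (at t within {a..}))"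

lemma diffbI: "(\<And>t. a \<le> t \<Longrightarrow> (f has_vector_derivative D t) (at t within {a..})) \<Longrightarrow> diffb a f"
  by (auto simp: diffb_def)

lemma diffbD: "diffb a f \<Longrightarrow> a \<le> t \<Longrightarrow>
    (f has_vector_derivative vector_derivative f (at t within {a..})) (at t within {a..})"
  unfolding diffb_def using differentiableI_vector vector_derivative_works by blast

lemma diffb_const: "diffb a (\<lambda>_. c)" by (rule diffbI) (rule has_vector_derivative_const)
lemma diffb_add: "diffb a f \<Longrightarrow> diffb a g \<Longrightarrow> diffb a (\<lambda>t. f t + g t)"
  by (rule diffbI) (rule has_vector_derivative_add[OF diffbD diffbD])
lemma diffb_diff: "diffb a f \<Longrightarrow> diffb a g \<Longrightarrow> diffb a (\<lambda>t. f t - g t)"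
  by (rule diffbI) (rule has_vector_derivative_diff[OF diffbD diffbD])
lemma diffb_mult: "diffb a f \<Longrightarrow> diffb a g \<Longrightarrow> diffb a (\<lambda>t. f t * g t)"
  by (rule diffbI) (rule has_vector_derivative_mult[OF diffbD diffbD])
lemma diffb_adj: "diffb a f \<Longrightarrow> diffb a (\<lambda>t. adj (f t))"
  by (rule diffbI) (rule has_vector_derivative_adj[OF diffbD])

lemmas diffb_intros = diffb_const diffb_add diffb_diff diffb_mult diffb_adj

lemma diffb_cong: "diffb a f \<Longrightarrow> (\<And>t. a \<le> t \<Longrightarrow> g t = f t) \<Longrightarrow> diffb a g"
  unfolding diffb_def by (metis (no_types, lifting) atLeast_iff has_vector_derivative_transform)

lemma diffb_continuous: "diffb a f \<Longrightarrow> continuous_on {a..} f"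
  unfolding diffb_def continuous_on_eq_continuous_within
  by (auto intro: has_vector_derivative_continuous)

lemma diffb_inverse:
  assumes "diffb a f"
    and "\<And>s. a \<le> s \<Longrightarrow> f s * g s = u" "\<And>s. a \<le> s \<Longrightarrow> g s * f s = u"
    and "\<And>s. a \<le> s \<Longrightarrow> u * g s = g s" "\<And>s. a \<le> s \<Longrightarrow> g s * u = g s"
  shows "diffb a g"
  unfolding diffb_def
proof (intro allI impI)
  fix t assume t: "a \<le> t"
  then obtain D where "(f has_vector_derivative D) (at t within {a..})" using assms(1) by (auto simp: diffb_def)
  from inverse_has_vector_derivative[OF this _ _ _ _ _, of g u] assms t
  show "\<exists>D. (g has_vector_derivative D) (at t within {a..})" by auto
qed

lemma diffb_of_mderiv:
  "(\<And>t. a \<le> t \<Longrightarrow> has_mderiv a X (X' t) t) \<Longrightarrow> (\<And>t. a \<le> t \<Longrightarrow> X t \<in> carrier_mat n m) \<Longrightarrow>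
    diffb a (\<lambda>t. fm (X t))"
  by (rule diffbI) (rule has_mderiv_fm)

lemma at_within_Ici_nontrivial: "a \<le> t \<Longrightarrow> at t within {a..} \<noteq> bot" for a t :: real
proof -
  assume "a \<le> t"
  then have "t islimpt {a..t + 1}" by (simp add: islimpt_Icc)
  then have "at t within {a..t + 1} \<noteq> bot" by (simp only: trivial_limit_within not_not)
  then show ?thesis by (simp add: at_within_Icc_Ici)
qed

lemma fm_mderiv:
  assumes d: "((\<lambda>s. fm (X s)) has_vector_derivative D) (at t within {a..})" and t: "a \<le> t"
    and c: "\<And>s. a \<le> s \<Longrightarrow> X s \<in> carrier_mat n m"
  shows "fm (mderiv a X t) = D" "mderiv a X t \<in> carrier_mat n m"
proof -
  show "mderiv a X t \<in> carrier_mat n m" using c[OF t] by (simp add: mderiv_def)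
  have e: "((\<lambda>s. ent (fm (X s)) i j) has_vector_derivative ent D i j) (at t within {a..})" for i j
    using has_vector_derivative_ent[OF d] by (simp add: has_real_derivative_iff_has_vector_derivative)
  show "fm (mderiv a X t) = D"
  proof (rule fsmat_eqI)
    fix i j
    show "ent (fm (mderiv a X t)) i j = ent D i j"
    proof (cases "i < n \<and> j < m")
      case True
      have "((\<lambda>s. X s $$ (i,j)) has_vector_derivative ent D i j) (at t within {a..})"
        by (rule has_vector_derivative_transform[OF _ _ e]) (use t c True in \<open>auto simp: ent_fm\<close>)
      then have "vector_derivative (\<lambda>s. X s $$ (i,j)) (at t within {a..}) = ent D i j"
        by (rule vector_derivative_within[OF at_within_Ici_nontrivial[OF t]])
      then show ?thesis using True c[OF t] by (simp add: ent_fm mderiv_def)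
    next
      case False
      have "((\<lambda>_. 0 :: real) has_vector_derivative ent D i j) (at t within {a..})"
        by (rule has_vector_derivative_transform[OF _ _ e]) (use t c False in \<open>auto simp: ent_fm\<close>)
      then have "ent D i j = 0"
        using vector_derivative_within[OF at_within_Ici_nontrivial[OF t] has_vector_derivative_const[of "0 :: real"]]
          vector_derivative_within[OF at_within_Ici_nontrivial[OF t]] by metis
      then show ?thesis using False c[OF t] by (auto simp: ent_fm mderiv_def)
    qed
  qed
qed

lemma mderiv_unique:
  assumes "has_mderiv a X X' t" "a \<le> t" "\<And>s. a \<le> s \<Longrightarrow> X s \<in> carrier_mat n m"
  shows "mderiv a X t = X'"
proof -
  have "X' \<in> carrier_mat n m" using assms(1) assms(3)[OF assms(2)] by (auto simp: has_mderiv_def)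
  then show ?thesis
    using fm_mderiv[OF has_mderiv_fm[OF assms] assms(2,3)] by (intro fm_inject[of _ n m]) auto
qed

lemma msmooth_diffb:
  assumes s: "msmooth a X" and c: "\<And>t. a \<le> t \<Longrightarrow> X t \<in> carrier_mat n m"
  shows "diffb a (\<lambda>t. fm (X t))" "diffb a (\<lambda>t. fm (mderiv a X t))"
    "\<And>t. a \<le> t \<Longrightarrow> mderiv a X t \<in> carrier_mat n m"
    "\<And>t. a \<le> t \<Longrightarrow> ((\<lambda>t. fm (X t)) has_vector_derivative fm (mderiv a X t)) (at t within {a..})"
proof -
  obtain D where D: "D 0 = X" "\<And>k t. a \<le> t \<Longrightarrow> has_mderiv a (D k) (D (Suc k) t) t"
    using s by (auto simp: msmooth_def)
  have d1: "has_mderiv a X (D 1 t) t" if "a \<le> t" for t using D(2)[of t 0] D(1) that by simp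
  have m: "mderiv a X t = D 1 t" if "a \<le> t" for t by (rule mderiv_unique[OF d1[OF that] that c])
  show c1: "mderiv a X t \<in> carrier_mat n m" if "a \<le> t" for t using c[OF that] by (simp add: mderiv_def)
  show "diffb a (\<lambda>t. fm (X t))" by (rule diffb_of_mderiv[OF d1 c])
  show "((\<lambda>t. fm (X t)) has_vector_derivative fm (mderiv a X t)) (at t within {a..})" if "a \<le> t" for t
    using has_mderiv_fm[OF d1[OF that] that c] m[OF that] by simp
  have "diffb a (\<lambda>t. fm (D 1 t))"
    by (rule diffb_of_mderiv[where X' = "D (Suc 1)" and n = n and m = m]) (use D(2) m c1 in auto)
  then show "diffb a (\<lambda>t. fm (mderiv a X t))" by (rule diffb_cong) (simp add: m)
qed

subsection \<open>Dimensions and algebraic identities\<close>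

text \<open>What the hypotheses say about the matrices alone. The symmetry and semidefiniteness of the initial
values hold because these are covariances.\<close>

locale alise_data =
  fixes S :: alise
  assumes sm: "system_matrices S" and nc: "noise_covariances S"
    and noise_dims: "mAw S \<in> carrier_mat (nw S) (nw S)" "mAv S \<in> carrier_mat (ny S) (ny S)"
      "mAvd S \<in> carrier_mat (ny S) (ny S)" "mBw S \<in> carrier_mat (nw S) (nwG S)"
      "mBv S \<in> carrier_mat (ny S) (nvG S)" "psd (nwG S) (mQG S)" "posdef (nvG S) (mRG S)"
    and P0_sym: "transpose_mat (mP0w S) = mP0w S" "transpose_mat (mP0v S) = mP0v S"
    and rank_CG: "\<And>t. t0 S \<le> t \<Longrightarrow> vec_space.rank (ny S - pH S) (C2 S t * G2 S t) = nd S - pH S"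
    and R2_posdef: "\<And>t. t0 S \<le> t \<Longrightarrow> posdef (ny S - pH S) (R2 S t)"
    and Rtil2_posdef: "\<And>t. pH S < nd S \<Longrightarrow> t0 S \<le> t \<Longrightarrow> posdef (ny S - pH S) (Rtil2 S t)"
    and ric: "riccati_solution S (mPx S)"
    and P0x_psd: "psd (nx S) (mPx S (t0 S))"
begin

abbreviation "a \<equiv> t0 S"
abbreviation "n \<equiv> nx S"
abbreviation "l \<equiv> ny S"
abbreviation "h \<equiv> pH S"
abbreviation "l2 \<equiv> ny S - pH S"
abbreviation "p2 \<equiv> nd S - pH S"

lemma dim_le: "h \<le> l" "h \<le> nd S" "0 < n" "h + l2 = l" "h + p2 = nd S"
  using sm by (auto simp: system_matrices_def)

lemma svd: "svd_of_H S" using sm by (simp add: system_matrices_def)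

lemma base_carrier:
  assumes "a \<le> t"
  shows "mA S t \<in> carrier_mat n n" "mB S t \<in> carrier_mat n (nu S)" "mG S t \<in> carrier_mat n (nd S)"
    "mW S t \<in> carrier_mat n (nw S)" "mC S t \<in> carrier_mat l n" "mD S t \<in> carrier_mat l (nu S)"
    "mH S t \<in> carrier_mat l (nd S)"
    "mU1 S t \<in> carrier_mat l h" "mU2 S t \<in> carrier_mat l l2" "mV1 S t \<in> carrier_mat (nd S) h"
    "mV2 S t \<in> carrier_mat (nd S) p2" "mSg S t \<in> carrier_mat h h"
    "mPw S t \<in> carrier_mat (nw S) (nw S)" "mPv S t \<in> carrier_mat (l + l) (l + l)"
    "mPx S t \<in> carrier_mat n n" "sel_v S \<in> carrier_mat l (l + l)" "sel_vd S \<in> carrier_mat l (l + l)"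
proof -
  show "mA S t \<in> carrier_mat n n" "mB S t \<in> carrier_mat n (nu S)" "mG S t \<in> carrier_mat n (nd S)"
    "mW S t \<in> carrier_mat n (nw S)" "mC S t \<in> carrier_mat l n" "mD S t \<in> carrier_mat l (nu S)"
    "mH S t \<in> carrier_mat l (nd S)"
    using sm assms unfolding system_matrices_def by blast+
  show "mU1 S t \<in> carrier_mat l h" "mU2 S t \<in> carrier_mat l l2" "mV1 S t \<in> carrier_mat (nd S) h"
    "mV2 S t \<in> carrier_mat (nd S) p2" "mSg S t \<in> carrier_mat h h"
    using svd assms unfolding svd_of_H_def by blast+
  show "mPw S t \<in> carrier_mat (nw S) (nw S)" "mPv S t \<in> carrier_mat (l + l) (l + l)"
    using nc assms by (auto simp: noise_covariances_def)
  show "mPx S t \<in> carrier_mat n n" using ric assms by (auto simp: riccati_solution_def)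
  show "sel_v S \<in> carrier_mat l (l + l)" "sel_vd S \<in> carrier_mat l (l + l)"
    by (auto simp: sel_v_def sel_vd_def intro!: hcat_carrier)
qed

lemma smooth:
  assumes "X \<in> {mA S, mB S, mG S, mC S, mD S, mW S}"
  shows "msmooth a X" "mbounded a X"
  using sm assms unfolding system_matrices_def by blast+

lemma derived_carrier:
  assumes t: "a \<le> t"
  shows "Rn S t \<in> carrier_mat l l" "Rbar S t \<in> carrier_mat l l" "Rgrave S t \<in> carrier_mat l l"
    "T2 S t \<in> carrier_mat l2 l" "T1 S t \<in> carrier_mat h l" "G1 S t \<in> carrier_mat n h" "G2 S t \<in> carrier_mat n p2"
    "C1 S t \<in> carrier_mat h n" "C2 S t \<in> carrier_mat l2 n" "D1 S t \<in> carrier_mat h (nu S)"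
    "D2 S t \<in> carrier_mat l2 (nu S)" "R1 S t \<in> carrier_mat h h" "R2 S t \<in> carrier_mat l2 l2"
    "Rbar2 S t \<in> carrier_mat l2 l2" "Rgrave2 S t \<in> carrier_mat l2 l2" "Rgrave12 S t \<in> carrier_mat h l2"
    "M1 S t \<in> carrier_mat h h" "Ahat S t \<in> carrier_mat n n" "Qhat S t \<in> carrier_mat n n"
    "Cdot S t \<in> carrier_mat l n" "Ddot S t \<in> carrier_mat l (nu S)" "Rtil2 S t \<in> carrier_mat l2 l2"
    "M2 S t \<in> carrier_mat p2 l2" "Proj S t \<in> carrier_mat n n" "Abar S t \<in> carrier_mat n n"
    "Bbar S t \<in> carrier_mat n (nu S)" "Gbar S t \<in> carrier_mat n h" "Qbar S t \<in> carrier_mat n n"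
    "L S t \<in> carrier_mat n l2" "Phi1 S t \<in> carrier_mat n l" "Phi2 S t \<in> carrier_mat n (nu S)"
    "Kmix S t \<in> carrier_mat n l2" "Ae S t \<in> carrier_mat n n" "Qe S t \<in> carrier_mat n n"
    "Xi S t \<in> carrier_mat n n" "Le S t \<in> carrier_mat n l2"
    "minv (R2 S t) \<in> carrier_mat l2 l2" "minv (Rtil2 S t) \<in> carrier_mat l2 l2"
proof -
  note d = base_carrier[OF t, THEN carrier_matD(1)] base_carrier[OF t, THEN carrier_matD(2)]
  show 1: "Rn S t \<in> carrier_mat l l" "Rbar S t \<in> carrier_mat l l" "Rgrave S t \<in> carrier_mat l l"
    by (intro carrier_matI; simp add: Rn_def Rbar_def Rgrave_def d)+
  note d = d 1[THEN carrier_matD(1)] 1[THEN carrier_matD(2)]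
  show 2: "T2 S t \<in> carrier_mat l2 l" "T1 S t \<in> carrier_mat h l"
    by (intro carrier_matI; simp add: T1_def T2_def d)+
  note d = d 2[THEN carrier_matD(1)] 2[THEN carrier_matD(2)]
  show 3: "G1 S t \<in> carrier_mat n h" "G2 S t \<in> carrier_mat n p2"
    "C1 S t \<in> carrier_mat h n" "C2 S t \<in> carrier_mat l2 n" "D1 S t \<in> carrier_mat h (nu S)"
    "D2 S t \<in> carrier_mat l2 (nu S)" "R1 S t \<in> carrier_mat h h" "R2 S t \<in> carrier_mat l2 l2"
    "Rbar2 S t \<in> carrier_mat l2 l2" "Rgrave2 S t \<in> carrier_mat l2 l2" "Rgrave12 S t \<in> carrier_mat h l2"
    by (intro carrier_matI; simp add: G1_def G2_def C1_def C2_def D1_def D2_def R1_def R2_def Rbar2_def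
        Rgrave2_def Rgrave12_def d)+
  note d = d 3[THEN carrier_matD(1)] 3[THEN carrier_matD(2)]
  show 4: "M1 S t \<in> carrier_mat h h" unfolding M1_def by (rule minv_carrier[OF base_carrier(12)[OF t]])
  note d = d 4[THEN carrier_matD(1)] 4[THEN carrier_matD(2)]
  show 5: "Ahat S t \<in> carrier_mat n n" "Qhat S t \<in> carrier_mat n n"
    "Cdot S t \<in> carrier_mat l n" "Ddot S t \<in> carrier_mat l (nu S)" "Rtil2 S t \<in> carrier_mat l2 l2"
    by (intro carrier_matI; simp add: Ahat_def Qhat_def Cdot_def Ddot_def mderiv_def Rtil2_def Let_def d)+
  show 6: "minv (R2 S t) \<in> carrier_mat l2 l2" "minv (Rtil2 S t) \<in> carrier_mat l2 l2"
    by (rule minv_carrier, rule 3, rule minv_carrier, rule 5)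
  note d = d 5[THEN carrier_matD(1)] 5[THEN carrier_matD(2)] 6[THEN carrier_matD(1)] 6[THEN carrier_matD(2)]
  have "transpose_mat (G2 S t) * transpose_mat (C2 S t) * minv (Rtil2 S t) * C2 S t * G2 S t \<in> carrier_mat p2 p2"
    by (intro carrier_matI; simp add: d)
  from minv_carrier[OF this] show 7: "M2 S t \<in> carrier_mat p2 l2"
    by (intro carrier_matI; simp add: M2_def d)
  note d = d 7[THEN carrier_matD(1)] 7[THEN carrier_matD(2)]
  show "Proj S t \<in> carrier_mat n n" "Abar S t \<in> carrier_mat n n"
    "Bbar S t \<in> carrier_mat n (nu S)" "Gbar S t \<in> carrier_mat n h"
    "Qbar S t \<in> carrier_mat n n" "L S t \<in> carrier_mat n l2" "Phi1 S t \<in> carrier_mat n l"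
    "Phi2 S t \<in> carrier_mat n (nu S)" "Kmix S t \<in> carrier_mat n l2" "Ae S t \<in> carrier_mat n n"
    "Qe S t \<in> carrier_mat n n" "Xi S t \<in> carrier_mat n n" "Le S t \<in> carrier_mat n l2"
    by (intro carrier_matI; simp add: Abar_def Bbar_def Gbar_def Qbar_def L_def gain_def Phi1_def Phi2_def
        Kmix_def Ae_def Qe_def Xi_def Le_def Proj_def d)+
qed

lemmas carriers = base_carrier derived_carrier
lemmas dims = carriers[THEN carrier_matD(1)] carriers[THEN carrier_matD(2)]
lemmas fm_simps = fm_add' fm_diff' fm_uminus fm_times fm_transpose

lemma R2_alt: "transpose_mat (mU2 S t) * Rn S t * mU2 S t = R2 S t"
  by (simp add: R2_def T2_def)

text \<open>Dimensions are dealt with here once; with these equations all identities between filter matrices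
become ring identities.\<close>

lemma images:
  assumes t: "a \<le> t"
  shows "fm (Rn S t) = fm (sel_v S) * fm (mPv S t) * adj (fm (sel_v S))"
    "fm (Rbar S t) = fm (sel_vd S) * fm (mPv S t) * adj (fm (sel_vd S))"
    "fm (Rgrave S t) = fm (sel_v S) * fm (mPv S t) * adj (fm (sel_vd S))"
    "fm (T2 S t) = adj (fm (mU2 S t))"
    "fm (G1 S t) = fm (mG S t) * fm (mV1 S t)" "fm (G2 S t) = fm (mG S t) * fm (mV2 S t)"
    "fm (C1 S t) = fm (T1 S t) * fm (mC S t)" "fm (C2 S t) = fm (T2 S t) * fm (mC S t)"
    "fm (D1 S t) = fm (T1 S t) * fm (mD S t)" "fm (D2 S t) = fm (T2 S t) * fm (mD S t)"
    "fm (R1 S t) = fm (T1 S t) * fm (Rn S t) * adj (fm (T1 S t))"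
    "fm (R2 S t) = fm (T2 S t) * fm (Rn S t) * adj (fm (T2 S t))"
    "fm (Rbar2 S t) = fm (T2 S t) * fm (Rbar S t) * adj (fm (T2 S t))"
    "fm (Rgrave2 S t) = fm (T2 S t) * fm (Rgrave S t) * adj (fm (T2 S t))"
    "fm (Rgrave12 S t) = fm (T1 S t) * fm (Rgrave S t) * adj (fm (T2 S t))"
    "fm (Ahat S t) = fm (mA S t) - fm (G1 S t) * fm (M1 S t) * fm (C1 S t)"
    "fm (Qhat S t) = fm (mW S t) * fm (mPw S t) * adj (fm (mW S t))
      + fm (G1 S t) * fm (M1 S t) * fm (R1 S t) * adj (fm (M1 S t)) * adj (fm (G1 S t))"
    "fm (Proj S t) = un n - fm (G2 S t) * fm (M2 S t) * fm (C2 S t)"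
    "fm (Abar S t) = fm (Proj S t) * fm (Ahat S t) - fm (G2 S t) * fm (M2 S t) * fm (T2 S t) * fm (Cdot S t)"
    "fm (Bbar S t) = fm (Proj S t) * (fm (mB S t) - fm (G1 S t) * fm (M1 S t) * fm (D1 S t))
      - fm (G2 S t) * fm (M2 S t) * fm (T2 S t) * fm (Ddot S t)"
    "fm (Gbar S t) = fm (Proj S t) * fm (G1 S t)"
    "fm (Qbar S t) = fm (Proj S t) * fm (Qhat S t) * adj (fm (Proj S t))
      + fm (G2 S t) * fm (M2 S t) * fm (Rbar2 S t) * adj (fm (M2 S t)) * adj (fm (G2 S t))"
    "P \<in> carrier_mat n n \<Longrightarrow> fm (gain S t P)
      = (fm P * adj (fm (C2 S t)) - fm (G2 S t) * fm (M2 S t) * adj (fm (Rgrave2 S t))) * fm (minv (R2 S t))"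
    "fm (Phi1 S t) = fm (G2 S t) * fm (M2 S t) * fm (T2 S t)"
    "fm (Phi2 S t) = - (fm (G2 S t) * fm (M2 S t) * fm (D2 S t))"
    "fm (Kmix S t) = fm (G2 S t) * fm (M2 S t) * adj (fm (Rgrave2 S t)) * fm (minv (R2 S t))"
    "fm (Ae S t) = fm (Abar S t) + fm (Kmix S t) * fm (C2 S t)"
    "fm (Qe S t) = fm (Qbar S t) - fm (Kmix S t) * fm (Rgrave2 S t) * adj (fm (M2 S t)) * adj (fm (G2 S t))"
    "fm (Xi S t) = fm (Proj S t) * fm (G1 S t) * fm (M1 S t) * fm (Rgrave12 S t) * adj (fm (M2 S t)) * adj (fm (G2 S t))"
    "fm (Le S t) = fm (mPx S t) * adj (fm (C2 S t)) * fm (minv (R2 S t))"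
    "fm (T1 S t) = adj (fm (mU1 S t)) - adj (fm (mU1 S t)) * fm (Rn S t) * fm (mU2 S t) * fm (minv (R2 S t))
      * adj (fm (mU2 S t))"
  by (simp add: Rn_def fm_simps dims[OF t], simp add: Rbar_def fm_simps dims[OF t], simp add: Rgrave_def fm_simps dims[OF t],
      simp add: T2_def fm_simps dims[OF t], simp add: G1_def fm_simps dims[OF t], simp add: G2_def fm_simps dims[OF t],
      simp add: C1_def fm_simps dims[OF t], simp add: C2_def fm_simps dims[OF t], simp add: D1_def fm_simps dims[OF t],
      simp add: D2_def fm_simps dims[OF t], simp add: R1_def fm_simps dims[OF t], simp add: R2_def fm_simps dims[OF t],
      simp add: Rbar2_def fm_simps dims[OF t], simp add: Rgrave2_def fm_simps dims[OF t], simp add: Rgrave12_def fm_simps dims[OF t],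
      simp add: Ahat_def fm_simps dims[OF t], simp add: Qhat_def fm_simps dims[OF t], simp add: Proj_def un_def fm_simps dims[OF t],
      simp add: Abar_def fm_simps dims[OF t], simp add: Bbar_def fm_simps dims[OF t], simp add: Gbar_def fm_simps dims[OF t],
      simp add: Qbar_def fm_simps dims[OF t], simp add: gain_def fm_simps dims[OF t], simp add: Phi1_def fm_simps dims[OF t],
      simp add: Phi2_def fm_simps dims[OF t], simp add: Kmix_def fm_simps dims[OF t], simp add: Ae_def fm_simps dims[OF t],
      simp add: Qe_def Kmix_def fm_simps dims[OF t], simp add: Xi_def fm_simps dims[OF t], simp add: Le_def fm_simps dims[OF t],
      simp add: T1_def R2_alt fm_simps dims[OF t])

lemma Rtil2_image:
  assumes t: "a \<le> t"
  shows "fm (Rtil2 S t) = (fm (C2 S t) * fm (Ahat S t) + fm (T2 S t) * fm (Cdot S t)) * fm (mPx S t)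
      * adj (fm (C2 S t) * fm (Ahat S t) + fm (T2 S t) * fm (Cdot S t))
    + fm (C2 S t) * fm (Qhat S t) * adj (fm (C2 S t)) + fm (Rbar2 S t)
    - adj (fm (Rgrave12 S t)) * adj (fm (M1 S t)) * adj (fm (G1 S t)) * adj (fm (C2 S t))
    - fm (C2 S t) * fm (G1 S t) * fm (M1 S t) * fm (Rgrave12 S t)"
  unfolding Rtil2_def Let_def by (simp add: fm_add' fm_diff' fm_times fm_transpose dims[OF t])

lemma un_image:
  assumes t: "a \<le> t"
  shows "un n * fm (mPx S t) = fm (mPx S t)" "fm (mPx S t) * un n = fm (mPx S t)"
    "un n * fm (G2 S t) = fm (G2 S t)" "un n * fm (G1 S t) = fm (G1 S t)"
    "un l2 * fm (C2 S t) = fm (C2 S t)" "fm (C2 S t) * un n = fm (C2 S t)"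
    "un l2 * fm (T2 S t) = fm (T2 S t)" "fm (G2 S t) * un p2 = fm (G2 S t)"
    "un n * fm (mA S t) = fm (mA S t)" "un n * fm (mB S t) = fm (mB S t)" "un n * fm (mW S t) = fm (mW S t)"
    "un n * fm (mG S t) = fm (mG S t)" "fm (mG S t) * un (nd S) = fm (mG S t)"
    "un h * fm (mSg S t) = fm (mSg S t)" "un h * fm (M1 S t) = fm (M1 S t)" "fm (M1 S t) * un h = fm (M1 S t)"
    "fm (G1 S t) * un h = fm (G1 S t)"
  using carriers[OF t] by (auto intro!: un_times times_un shape_fm)

lemma R2_inverse:
  assumes t: "a \<le> t"
  shows "fm (R2 S t) * fm (minv (R2 S t)) = un l2" "fm (minv (R2 S t)) * fm (R2 S t) = un l2"
    "adj (fm (minv (R2 S t))) = fm (minv (R2 S t))" "adj (fm (R2 S t)) = fm (R2 S t)"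
    "un l2 * fm (minv (R2 S t)) = fm (minv (R2 S t))" "fm (minv (R2 S t)) * un l2 = fm (minv (R2 S t))"
    "pos (fm (minv (R2 S t)))"
proof -
  note m = minv_posdef[OF R2_posdef[OF t]]
  show "fm (R2 S t) * fm (minv (R2 S t)) = un l2" "fm (minv (R2 S t)) * fm (R2 S t) = un l2"
    "adj (fm (minv (R2 S t))) = fm (minv (R2 S t))" "adj (fm (R2 S t)) = fm (R2 S t)"
    "un l2 * fm (minv (R2 S t)) = fm (minv (R2 S t))" "fm (minv (R2 S t)) * un l2 = fm (minv (R2 S t))"
    "pos (fm (minv (R2 S t)))"
    using m posdef_imp_psd[OF R2_posdef[OF t]] un_times[OF shape_fm[OF m(1)]] times_un[OF shape_fm[OF m(1)]]
    by (simp_all add: psd_iff_pos pos_adj)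
qed

lemma U_blocks:
  assumes t: "a \<le> t"
  shows "adj (fm (mU1 S t)) * fm (mU1 S t) = un h" "adj (fm (mU2 S t)) * fm (mU1 S t) = 0"
    "adj (fm (mU2 S t)) * fm (mU2 S t) = un l2"
    "fm (mV1 S t) * adj (fm (mV1 S t)) + fm (mV2 S t) * adj (fm (mV2 S t)) = un (nd S)"
    "fm (mH S t) = fm (mU1 S t) * fm (mSg S t) * adj (fm (mV1 S t))"
proof -
  have U: "transpose_mat (hcat (mU1 S t) (mU2 S t)) * hcat (mU1 S t) (mU2 S t) = 1\<^sub>m l"
    and V: "transpose_mat (hcat (mV1 S t) (mV2 S t)) * hcat (mV1 S t) (mV2 S t) = 1\<^sub>m (nd S)"
    and H: "mH S t = hcat (mU1 S t) (mU2 S t) * four_block_mat (mSg S t) (0\<^sub>m h p2) (0\<^sub>m l2 h) (0\<^sub>m l2 p2)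
      * transpose_mat (hcat (mV1 S t) (mV2 S t))"
    using svd t unfolding svd_of_H_def by blast+
  note c = base_carrier[OF t]
  show "adj (fm (mU1 S t)) * fm (mU1 S t) = un h" "adj (fm (mU2 S t)) * fm (mU1 S t) = 0"
    "adj (fm (mU2 S t)) * fm (mU2 S t) = un l2"
    using orthonormal_blocks[OF c(8,9) dim_le(4)[symmetric] U] by auto
  show "fm (mV1 S t) * adj (fm (mV1 S t)) + fm (mV2 S t) * adj (fm (mV2 S t)) = un (nd S)"
    using orthonormal_blocks[OF c(10,11) dim_le(5)[symmetric] V] by auto
  let ?V1 = "transpose_mat (mV1 S t)" and ?V2 = "transpose_mat (mV2 S t)"
  have "four_block_mat (mSg S t) (0\<^sub>m h p2) (0\<^sub>m l2 h) (0\<^sub>m l2 p2) * (?V1 @\<^sub>r ?V2)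
      = (mSg S t * ?V1) @\<^sub>r 0\<^sub>m l2 (nd S)"
    unfolding append_rows_def using c
    by (subst mult_four_block_mat[of _ h h _ p2 _ l2 _ _ "nd S" _ 0]) (auto simp: mult_carrier_mat)
  then have "mH S t = hcat (mU1 S t) (mU2 S t) * ((mSg S t * ?V1) @\<^sub>r 0\<^sub>m l2 (nd S))"
  proof -
    have "hcat (mU1 S t) (mU2 S t) \<in> carrier_mat l l" "hcat (mV1 S t) (mV2 S t) \<in> carrier_mat (nd S) (nd S)"
      using hcat_carrier[OF c(8,9)] hcat_carrier[OF c(10,11)] dim_le(4,5) by simp_all
    moreover have "four_block_mat (mSg S t) (0\<^sub>m h p2) (0\<^sub>m l2 h) (0\<^sub>m l2 p2) \<in> carrier_mat (h + l2) (h + p2)"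
      using c(12) by (intro four_block_carrier_mat) auto
    moreover assume "four_block_mat (mSg S t) (0\<^sub>m h p2) (0\<^sub>m l2 h) (0\<^sub>m l2 p2) * (?V1 @\<^sub>r ?V2)
      = (mSg S t * ?V1) @\<^sub>r 0\<^sub>m l2 (nd S)"
    moreover have "transpose_mat (hcat (mV1 S t) (mV2 S t)) = ?V1 @\<^sub>r ?V2" by (simp add: hcat_def)
    ultimately show ?thesis
      unfolding H dim_le(4,5)
      by (metis assoc_mult_mat transpose_carrier_mat)
  qed
  then have "fm (mH S t) = fm (mU1 S t) * fm (mSg S t * ?V1) + fm (mU2 S t) * fm (0\<^sub>m l2 (nd S))"
    using fm_hcat_times_append[OF c(8,9), of "mSg S t * ?V1" "nd S" "0\<^sub>m l2 (nd S)"] c by simp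
  then show "fm (mH S t) = fm (mU1 S t) * fm (mSg S t) * adj (fm (mV1 S t))"
    using c by (simp add: fm_times fm_transpose fm_zero mult.assoc)
qed

lemma M1_inverse:
  assumes t: "a \<le> t"
  shows "fm (M1 S t) * fm (mSg S t) = un h" "fm (mSg S t) * fm (M1 S t) = un h"
proof -
  have r: "vec_space.rank h (mSg S t) = h" using svd t unfolding svd_of_H_def by blast
  note c = base_carrier(12)[OF t]
  show "fm (M1 S t) * fm (mSg S t) = un h" "fm (mSg S t) * fm (M1 S t) = un h"
    unfolding M1_def
    using minv_of_injective[OF c full_column_rank_injective[OF c r]] by auto
qed

text \<open>The transformations \<open>T1, T2\<close> separate the output into a part that determines \<open>d1\<close> and a part
  free of the unknown input, with uncorrelated noises.\<close>

lemma decoupling: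
  assumes t: "a \<le> t"
  shows "fm (T1 S t) * fm (mH S t) = fm (mSg S t) * adj (fm (mV1 S t))" "fm (T2 S t) * fm (mH S t) = 0"
    "fm (T1 S t) * fm (Rn S t) * adj (fm (T2 S t)) = 0"
proof -
  note U = U_blocks[OF t] and I = images[OF t] and R = R2_inverse[OF t]
  have "fm (T1 S t) * fm (mU1 S t) = un h"
    unfolding I(31) by (simp add: left_diff_distrib mult.assoc U)
  then show "fm (T1 S t) * fm (mH S t) = fm (mSg S t) * adj (fm (mV1 S t))"
    unfolding U(5) by (simp add: mult.assoc[symmetric] un_image[OF t])
  show "fm (T2 S t) * fm (mH S t) = 0"
    unfolding U(5) I(4) by (simp add: mult.assoc[symmetric] U)
  have R2: "adj (fm (mU2 S t)) * (fm (Rn S t) * fm (mU2 S t)) = fm (R2 S t)"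
    unfolding I(12) I(4) by (simp add: mult.assoc)
  have "fm (mU2 S t) * un l2 = fm (mU2 S t)" by (rule times_un[OF shape_fm[OF base_carrier(9)[OF t]]])
  then show "fm (T1 S t) * fm (Rn S t) * adj (fm (T2 S t)) = 0"
    unfolding I(31) I(4) by (simp add: left_diff_distrib mult.assoc R2 R)
qed

definition "gram t = transpose_mat (G2 S t) * transpose_mat (C2 S t) * minv (Rtil2 S t) * C2 S t * G2 S t"

lemma gram_image: "a \<le> t \<Longrightarrow>
    fm (gram t) = adj (fm (G2 S t)) * adj (fm (C2 S t)) * fm (minv (Rtil2 S t)) * fm (C2 S t) * fm (G2 S t)"
  unfolding gram_def by (simp add: fm_times fm_transpose dims)

lemma M2_image: "a \<le> t \<Longrightarrow>
    fm (M2 S t) = fm (minv (gram t)) * adj (fm (G2 S t)) * adj (fm (C2 S t)) * fm (minv (Rtil2 S t))"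
proof -
  assume t: "a \<le> t"
  have "gram t \<in> carrier_mat p2 p2" by (intro carrier_matI; simp add: gram_def dims[OF t])
  from minv_carrier[OF this] show ?thesis
    unfolding M2_def gram_def[symmetric] by (simp add: fm_times fm_transpose dims[OF t])
qed

text \<open>The form of the inverse of \<open>Rtil2\<close> vanishes only at zero, and \<open>C2 G2\<close> has full column rank.\<close>

lemma gram_inverse:
  assumes t: "a \<le> t" and h: "h < nd S"
  shows "minv (gram t) \<in> carrier_mat p2 p2" "fm (gram t) * fm (minv (gram t)) = un p2"
    "fm (minv (gram t)) * fm (gram t) = un p2"
proof -
  have c: "gram t \<in> carrier_mat p2 p2" by (intro carrier_matI; simp add: gram_def dims[OF t])
  note R = minv_posdef[OF Rtil2_posdef[OF h t]]
  let ?K = "fm (C2 S t) * fm (G2 S t)" and ?b = "fm (minv (Rtil2 S t))"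
  have "x = 0\<^sub>v p2" if x: "x \<in> carrier_vec p2" "gram t *\<^sub>v x = 0\<^sub>v p2" for x
  proof -
    let ?y = "?K * fv x"
    have "fm (gram t) * fv x = 0" using x c by (simp add: mult_mat_vec_zero_iff)
    then have "inner ?y (?b * ?y) = 0"
      by (simp add: gram_image[OF t] inner_times_left mult.assoc)
    then have "?b * ?y = 0" using pos_norm_mult_sq_norm[OF R(4), of ?y] by simp
    then have "fm (Rtil2 S t) * (?b * ?y) = 0" by simp
    then have "un l2 * ?y = 0" by (simp add: mult.assoc[symmetric] R)
    then have "?y = 0" by (simp add: mult.assoc[symmetric] un_image[OF t])
    then have "fm (C2 S t * G2 S t) * fv x = 0" by (simp add: fm_times dims[OF t])
    then have "(C2 S t * G2 S t) *\<^sub>v x = 0\<^sub>v l2"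
      using mult_mat_vec_zero_iff[of "C2 S t * G2 S t" l2 p2 x] carriers[OF t] x by auto
    then show "x = 0\<^sub>v p2"
      by (rule full_column_rank_injective[OF _ rank_CG[OF t] x(1), rotated]) (use carriers[OF t] in auto)
  qed
  from minv_of_injective[OF c this]
  show "minv (gram t) \<in> carrier_mat p2 p2" "fm (gram t) * fm (minv (gram t)) = un p2"
    "fm (minv (gram t)) * fm (gram t) = un p2" by auto
qed

text \<open>If the block \<open>G2\<close> is empty, both sides are zero; the invertibility of \<open>Rtil2\<close> is at hand only in the
other case.\<close>

lemma M2_left_inverse:
  assumes t: "a \<le> t"
  shows "fm (M2 S t) * fm (C2 S t) * fm (G2 S t) = un p2"
proof (cases "h < nd S")
  case True
  have "fm (M2 S t) * fm (C2 S t) * fm (G2 S t) = fm (minv (gram t)) * fm (gram t)"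
    unfolding M2_image[OF t] gram_image[OF t] by (simp add: mult.assoc)
  then show ?thesis using gram_inverse[OF t True] by simp
next
  case False
  then have p: "p2 = 0" by simp
  have "fm (G2 S t) = 0" using shape_fm[OF derived_carrier(7)[OF t]] p by (intro shape_zero_dim(1)) simp
  moreover have "un p2 = 0" using shape_un[of p2] p by (intro shape_zero_dim(1)) simp
  ultimately show ?thesis by simp
qed

lemma Proj_G2: "a \<le> t \<Longrightarrow> fm (Proj S t) * fm (G2 S t) = 0"
  unfolding images(18) using M2_left_inverse[of t]
  by (simp add: left_diff_distrib un_image mult.assoc)

text \<open>The gain of the filter is the Kalman-Bucy gain of the equivalent system minus the gain that is
already contained in the equivalent state equation.\<close>

lemma L_split: "a \<le> t \<Longrightarrow> fm (L S t) = fm (Le S t) - fm (Kmix S t)"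
  using base_carrier(15)[of t]
  by (simp add: L_def images left_diff_distrib)

subsection \<open>Differentiability of the filter matrices\<close>

lemma base_diffb:
  shows "diffb a (\<lambda>t. fm (mA S t))" "diffb a (\<lambda>t. fm (mB S t))" "diffb a (\<lambda>t. fm (mG S t))"
    "diffb a (\<lambda>t. fm (mW S t))" "diffb a (\<lambda>t. fm (mC S t))" "diffb a (\<lambda>t. fm (mD S t))"
    "diffb a (\<lambda>t. fm (Cdot S t))" "diffb a (\<lambda>t. fm (Ddot S t))"
    "diffb a (\<lambda>t. fm (mU1 S t))" "diffb a (\<lambda>t. fm (mU2 S t))" "diffb a (\<lambda>t. fm (mV1 S t))"
    "diffb a (\<lambda>t. fm (mV2 S t))" "diffb a (\<lambda>t. fm (mSg S t))"
    "diffb a (\<lambda>t. fm (mPw S t))" "diffb a (\<lambda>t. fm (mPv S t))" "diffb a (\<lambda>t. fm (mPx S t))"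
    and U2_deriv: "\<And>t. a \<le> t \<Longrightarrow> ((\<lambda>t. fm (mU2 S t)) has_vector_derivative 0) (at t within {a..})"
    and C_deriv: "\<And>t. a \<le> t \<Longrightarrow> ((\<lambda>t. fm (mC S t)) has_vector_derivative fm (Cdot S t)) (at t within {a..})"
    and D_deriv: "\<And>t. a \<le> t \<Longrightarrow> ((\<lambda>t. fm (mD S t)) has_vector_derivative fm (Ddot S t)) (at t within {a..})"
proof -
  show "diffb a (\<lambda>t. fm (mA S t))" by (rule msmooth_diffb(1)[OF smooth(1) base_carrier(1)]) simp
  show "diffb a (\<lambda>t. fm (mB S t))" by (rule msmooth_diffb(1)[OF smooth(1) base_carrier(2)]) simp
  show "diffb a (\<lambda>t. fm (mG S t))" by (rule msmooth_diffb(1)[OF smooth(1) base_carrier(3)]) simp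
  show "diffb a (\<lambda>t. fm (mW S t))" by (rule msmooth_diffb(1)[OF smooth(1) base_carrier(4)]) simp
  show "diffb a (\<lambda>t. fm (mC S t))" by (rule msmooth_diffb(1)[OF smooth(1) base_carrier(5)]) simp
  show "diffb a (\<lambda>t. fm (mD S t))" by (rule msmooth_diffb(1)[OF smooth(1) base_carrier(6)]) simp
  show "diffb a (\<lambda>t. fm (Cdot S t))"
    unfolding Cdot_def by (rule msmooth_diffb(2)[OF smooth(1) base_carrier(5)]) simp
  show "diffb a (\<lambda>t. fm (Ddot S t))"
    unfolding Ddot_def by (rule msmooth_diffb(2)[OF smooth(1) base_carrier(6)]) simp
  show "((\<lambda>t. fm (mC S t)) has_vector_derivative fm (Cdot S t)) (at t within {a..})" if "a \<le> t" for t
    unfolding Cdot_def by (rule msmooth_diffb(4)[OF smooth(1) base_carrier(5) that]) simp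
  show "((\<lambda>t. fm (mD S t)) has_vector_derivative fm (Ddot S t)) (at t within {a..})" if "a \<le> t" for t
    unfolding Ddot_def by (rule msmooth_diffb(4)[OF smooth(1) base_carrier(6) that]) simp
  obtain E F where sv: "\<And>t. a \<le> t \<Longrightarrow> has_mderiv a (mU1 S) (mU1 S t * E t) t"
      "\<And>t. a \<le> t \<Longrightarrow> has_mderiv a (mU2 S) (0\<^sub>m l l2) t"
      "\<And>t. a \<le> t \<Longrightarrow> has_mderiv a (mV1 S) (mV1 S t * F t) t"
      "\<And>t. a \<le> t \<Longrightarrow> has_mderiv a (mV2 S) (0\<^sub>m (nd S) p2) t"
      "\<And>t. a \<le> t \<Longrightarrow> \<exists>Sg'. has_mderiv a (mSg S) Sg' t"
    using svd unfolding svd_of_H_def by blast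
  then obtain Sg' where Sg': "\<And>t. a \<le> t \<Longrightarrow> has_mderiv a (mSg S) (Sg' t) t" by metis
  show "diffb a (\<lambda>t. fm (mU1 S t))" by (rule diffb_of_mderiv[OF sv(1) base_carrier(8)])
  show "diffb a (\<lambda>t. fm (mU2 S t))" by (rule diffb_of_mderiv[OF sv(2) base_carrier(9)])
  show "diffb a (\<lambda>t. fm (mV1 S t))" by (rule diffb_of_mderiv[OF sv(3) base_carrier(10)])
  show "diffb a (\<lambda>t. fm (mV2 S t))" by (rule diffb_of_mderiv[OF sv(4) base_carrier(11)])
  show "diffb a (\<lambda>t. fm (mSg S t))" by (rule diffb_of_mderiv[OF Sg' base_carrier(12)])
  show "((\<lambda>t. fm (mU2 S t)) has_vector_derivative 0) (at t within {a..})" if "a \<le> t" for t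
    using has_mderiv_fm[OF sv(2)[OF that] that base_carrier(9)] by (simp add: fm_zero)
  show "diffb a (\<lambda>t. fm (mPw S t))"
    by (rule diffb_of_mderiv[OF _ base_carrier(13)]) (use nc in \<open>auto simp: noise_covariances_def\<close>)
  show "diffb a (\<lambda>t. fm (mPv S t))"
    by (rule diffb_of_mderiv[OF _ base_carrier(14)]) (use nc in \<open>auto simp: noise_covariances_def\<close>)
  show "diffb a (\<lambda>t. fm (mPx S t))"
    by (rule diffb_of_mderiv[OF _ base_carrier(15)]) (use ric in \<open>auto simp: riccati_solution_def\<close>)
qed

lemma diffb_R2: "diffb a (\<lambda>t. fm (Rn S t))" "diffb a (\<lambda>t. fm (R2 S t))" "diffb a (\<lambda>t. fm (T2 S t))"
proof -
  show R: "diffb a (\<lambda>t. fm (Rn S t))"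
    by (rule diffb_cong[OF _ images(1)]) (intro diffb_intros base_diffb)
  show T: "diffb a (\<lambda>t. fm (T2 S t))"
    by (rule diffb_cong[OF _ images(4)]) (intro diffb_intros base_diffb)
  show "diffb a (\<lambda>t. fm (R2 S t))"
    by (rule diffb_cong[OF _ images(12)]) (intro diffb_intros R T)
qed

lemma diffb_inverses: "diffb a (\<lambda>t. fm (minv (R2 S t)))" "diffb a (\<lambda>t. fm (M1 S t))"
proof -
  show "diffb a (\<lambda>t. fm (minv (R2 S t)))"
    by (rule diffb_inverse[OF diffb_R2(2) R2_inverse(1,2,5,6)])
  show "diffb a (\<lambda>t. fm (M1 S t))"
    by (rule diffb_inverse[OF base_diffb(13) M1_inverse(2,1) un_image(15,16)])
qed

lemma diffb_first:
  shows "diffb a (\<lambda>t. fm (T1 S t))" "diffb a (\<lambda>t. fm (G1 S t))" "diffb a (\<lambda>t. fm (G2 S t))"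
    "diffb a (\<lambda>t. fm (C1 S t))" "diffb a (\<lambda>t. fm (C2 S t))" "diffb a (\<lambda>t. fm (R1 S t))"
    "diffb a (\<lambda>t. fm (Rbar2 S t))" "diffb a (\<lambda>t. fm (Rgrave2 S t))" "diffb a (\<lambda>t. fm (Rgrave12 S t))"
    "diffb a (\<lambda>t. fm (Ahat S t))" "diffb a (\<lambda>t. fm (Qhat S t))" "diffb a (\<lambda>t. fm (Rtil2 S t))"
    "diffb a (\<lambda>t. fm (D2 S t))"
proof -
  note b = base_diffb diffb_R2 diffb_inverses diffb_intros
  show T: "diffb a (\<lambda>t. fm (T1 S t))" by (rule diffb_cong[OF _ images(31)]) (intro b)
  show Ga: "diffb a (\<lambda>t. fm (G1 S t))" by (rule diffb_cong[OF _ images(5)]) (intro b)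
  show Gb: "diffb a (\<lambda>t. fm (G2 S t))" by (rule diffb_cong[OF _ images(6)]) (intro b)
  show Ca: "diffb a (\<lambda>t. fm (C1 S t))" by (rule diffb_cong[OF _ images(7)]) (intro b T)
  show Cb: "diffb a (\<lambda>t. fm (C2 S t))" by (rule diffb_cong[OF _ images(8)]) (intro b)
  note G = Ga Gb and C = Ca Cb
  show "diffb a (\<lambda>t. fm (D2 S t))" by (rule diffb_cong[OF _ images(10)]) (intro b)
  show R1: "diffb a (\<lambda>t. fm (R1 S t))" by (rule diffb_cong[OF _ images(11)]) (intro b T)
  have Rb: "diffb a (\<lambda>t. fm (Rbar S t))" by (rule diffb_cong[OF _ images(2)]) (intro b)
  have Rg: "diffb a (\<lambda>t. fm (Rgrave S t))" by (rule diffb_cong[OF _ images(3)]) (intro b)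
  show Rb2: "diffb a (\<lambda>t. fm (Rbar2 S t))" by (rule diffb_cong[OF _ images(13)]) (intro b Rb)
  show "diffb a (\<lambda>t. fm (Rgrave2 S t))" by (rule diffb_cong[OF _ images(14)]) (intro b Rg)
  show Rg12: "diffb a (\<lambda>t. fm (Rgrave12 S t))" by (rule diffb_cong[OF _ images(15)]) (intro b Rg T)
  show Ah: "diffb a (\<lambda>t. fm (Ahat S t))" by (rule diffb_cong[OF _ images(16)]) (intro b G C)
  show Qh: "diffb a (\<lambda>t. fm (Qhat S t))" by (rule diffb_cong[OF _ images(17)]) (intro b G R1)
  show "diffb a (\<lambda>t. fm (Rtil2 S t))" by (rule diffb_cong[OF _ Rtil2_image]) (intro b G C Rb2 Rg12 Ah Qh)
qed

lemma diffb_M2: "diffb a (\<lambda>t. fm (M2 S t))"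
proof (cases "h < nd S")
  case True
  have Ri: "diffb a (\<lambda>t. fm (minv (Rtil2 S t)))"
    by (rule diffb_inverse[OF diffb_first(12), where u = "un l2"])
      (use minv_posdef[OF Rtil2_posdef[OF True]] derived_carrier(38) in \<open>auto intro!: un_times times_un shape_fm\<close>)
  have "diffb a (\<lambda>t. fm (gram t))"
    by (rule diffb_cong[OF _ gram_image]) (intro diffb_intros diffb_first Ri)
  then have "diffb a (\<lambda>t. fm (minv (gram t)))"
    by (rule diffb_inverse[where u = "un p2"])
      (use gram_inverse[OF _ True] in \<open>auto intro!: un_times times_un shape_fm\<close>)
  then show ?thesis by (intro diffb_cong[OF _ M2_image] diffb_intros diffb_first Ri)
next
  case False
  then have p: "p2 = 0" by simp
  have "fm (M2 S t) = 0" if "a \<le> t" for t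
    using shape_fm[OF derived_carrier(23)[OF that]] p by (intro shape_zero_dim(2)) simp
  then show ?thesis by (rule diffb_cong[OF diffb_const])
qed

lemma diffb_second:
  shows "diffb a (\<lambda>t. fm (Abar S t))" "diffb a (\<lambda>t. fm (Ae S t))" "diffb a (\<lambda>t. fm (Qe S t))"
    "diffb a (\<lambda>t. fm (Qbar S t))"
proof -
  note b = base_diffb diffb_R2 diffb_inverses diffb_first diffb_M2 diffb_intros
  have P: "diffb a (\<lambda>t. fm (Proj S t))" by (rule diffb_cong[OF _ images(18)]) (intro b)
  show A: "diffb a (\<lambda>t. fm (Abar S t))" by (rule diffb_cong[OF _ images(19)]) (intro b P)
  show Q: "diffb a (\<lambda>t. fm (Qbar S t))" by (rule diffb_cong[OF _ images(22)]) (intro b P)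
  have K: "diffb a (\<lambda>t. fm (Kmix S t))" by (rule diffb_cong[OF _ images(26)]) (intro b)
  show "diffb a (\<lambda>t. fm (Ae S t))" by (rule diffb_cong[OF _ images(27)]) (intro b A K)
  show "diffb a (\<lambda>t. fm (Qe S t))" by (rule diffb_cong[OF _ images(28)]) (intro b Q K)
qed

end

section \<open>Stability of the filter\<close>

subsection \<open>Transition matrices and Gramians\<close>

lemma transition_matrixD:
  assumes "transition_matrix a n X \<Phi>" "a \<le> s" "a \<le> t" "X t \<in> carrier_mat n n"
  shows "\<Phi> t s \<in> carrier_mat n n" "fm (\<Phi> s s) = un n"
    "((\<lambda>r. fm (\<Phi> r s)) has_vector_derivative fm (X t) * fm (\<Phi> t s)) (at t within {a..})"
proof -
  have c: "\<Phi> r s \<in> carrier_mat n n" if "a \<le> r" for r using assms that by (simp add: transition_matrix_def)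
  then show "\<Phi> t s \<in> carrier_mat n n" using assms by simp
  show "fm (\<Phi> s s) = un n" using assms by (simp add: transition_matrix_def un_def)
  have "has_mderiv a (\<lambda>r. \<Phi> r s) (X t * \<Phi> t s) t" using assms by (simp add: transition_matrix_def)
  from has_mderiv_fm[OF this assms(3) c] show "((\<lambda>r. fm (\<Phi> r s)) has_vector_derivative fm (X t) * fm (\<Phi> t s)) (at t within {a..})"
    using c[OF assms(3)] assms(4) by (simp add: fm_times)
qed

text \<open>The product of \<open>adj (\<Psi> r q)\<close> and \<open>\<Phi> r p\<close> does not depend on \<open>r\<close>, since \<open>\<Phi>\<close> solves the equation with \<open>X\<close>
and \<open>\<Psi>\<close> its adjoint; evaluation at the endpoints gives both equations.\<close>

lemma transition_dual:
  assumes \<Phi>: "transition_matrix a n X \<Phi>" and \<Psi>: "transition_matrix a n (\<lambda>t. - transpose_mat (X t)) \<Psi>"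
    and X: "\<And>t. a \<le> t \<Longrightarrow> X t \<in> carrier_mat n n" and s: "a \<le> s" and t: "a \<le> t"
  shows "fm (\<Phi> t s) = adj (fm (\<Psi> s t))" "adj (fm (\<Psi> s t)) * fm (\<Phi> s t) = un n"
proof -
  have nX: "- transpose_mat (X r) \<in> carrier_mat n n" if "a \<le> r" for r using X[OF that] by simp
  note P = transition_matrixD[OF \<Phi> _ _ X] and Q = transition_matrixD[OF \<Psi> _ _ nX]
  have const: "adj (fm (\<Psi> r q)) * fm (\<Phi> r p) = adj (fm (\<Psi> r' q)) * fm (\<Phi> r' p)"
    if "a \<le> p" "a \<le> q" "a \<le> r" "a \<le> r'" for p q r r'
  proof -
    have "((\<lambda>r. adj (fm (\<Psi> r q)) * fm (\<Phi> r p)) has_vector_derivative 0) (at r within {a..})" if "r \<in> {a..}" for r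
    proof -
      have r: "a \<le> r" using that by simp
      show ?thesis
        by (rule has_vector_derivative_eq_rhs[OF has_vector_derivative_mult[OF
              has_vector_derivative_adj[OF Q(3)[OF \<open>a \<le> q\<close> r r]] P(3)[OF \<open>a \<le> p\<close> r r]]])
          (simp add: fm_uminus fm_transpose mult.assoc)
    qed
    then obtain k where "\<And>x. x \<in> {a..} \<Longrightarrow> adj (fm (\<Psi> x q)) * fm (\<Phi> x p) = k"
      using has_vector_derivative_zero_constant[of "{a..}"] by (metis (no_types, lifting) convex_real_interval(1))
    then show ?thesis using that by simp
  qed
  have sh: "shape n n (fm (\<Phi> t s))" "shape n n (fm (\<Psi> s t))"
    using P(1)[OF s t t] Q(1)[OF t s s] by (auto intro: shape_fm)
  show "fm (\<Phi> t s) = adj (fm (\<Psi> s t))"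
    using const[OF s t t s] P(2)[OF s s s] Q(2)[OF t t t] un_times[OF sh(1)] times_un[OF shape_adj[OF sh(2)]] by simp
  show "adj (fm (\<Psi> s t)) * fm (\<Phi> s t) = un n"
    using const[OF t t s t] P(2)[OF t t t] Q(2)[OF t t t] un_times[OF shape_un] by simp
qed

lemma mintegral_image:
  assumes c': "\<forall>s\<ge>a. f s \<in> carrier_mat n n" and cont: "continuous_on {a..} (\<lambda>s. fm (f s))"
  shows "a \<le> t \<Longrightarrow> ((\<lambda>t. fm (mintegral n n {a..t} f)) has_vector_derivative fm (f t)) (at t within {a..})"
    and "a \<le> s \<Longrightarrow> s \<le> t \<Longrightarrow> fm (mintegral n n {s..t} f) = fm (mintegral n n {a..t} f) - fm (mintegral n n {a..s} f)"
proof -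
  note c = c'[rule_format]
  have e: "continuous_on {a..} (\<lambda>s. f s $$ (i,j))" if "i < n" "j < n" for i j
  proof (rule continuous_on_eq)
    show "continuous_on {a..} (\<lambda>s. inner (elem i j) (fm (f s)))" by (intro continuous_intros cont)
    show "inner (elem i j) (fm (f s)) = f s $$ (i,j)" if "s \<in> {a..}" for s
      using c[of s] that \<open>i < n\<close> \<open>j < n\<close> by (simp add: inner_elem ent_fm)
  qed
  show "((\<lambda>t. fm (mintegral n n {a..t} f)) has_vector_derivative fm (f t)) (at t within {a..})" if t: "a \<le> t"
  proof (rule has_mderiv_fm[OF _ t, where n = n and m = n])
    show "has_mderiv a (\<lambda>t. mintegral n n {a..t} f) (f t) t"
      unfolding has_mderiv_def
    proof (intro conjI allI impI)
      show "dim_row (f t) = dim_row (mintegral n n {a..t} f)" "dim_col (f t) = dim_col (mintegral n n {a..t} f)"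
        using c[OF t] by (auto simp: mintegral_def)
      fix i j assume "i < dim_row (mintegral n n {a..t} f)" "j < dim_col (mintegral n n {a..t} f)"
      then have ij: "i < n" "j < n" by (auto simp: mintegral_def)
      show "((\<lambda>s. mintegral n n {a..s} f $$ (i,j)) has_real_derivative f t $$ (i,j)) (at t within {a..})"
        by (rule integral_equation_deriv[where y = 0 and h = "\<lambda>s. f s $$ (i,j)"])
          (use ij t e in \<open>auto simp: mintegral_def\<close>)
    qed
  qed (simp add: mintegral_def)
  show "fm (mintegral n n {s..t} f) = fm (mintegral n n {a..t} f) - fm (mintegral n n {a..s} f)" if st: "a \<le> s" "s \<le> t"
  proof (rule fsmat_eqI)
    fix i j
    have "integral {a..s} (\<lambda>s. f s $$ (i,j)) + integral {s..t} (\<lambda>s. f s $$ (i,j)) = integral {a..t} (\<lambda>s. f s $$ (i,j))"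
      if "i < n" "j < n"
      by (rule Henstock_Kurzweil_Integration.integral_combine[OF st]) (rule continuous_Ici_integrable[OF e[OF that]])
    then show "ent (fm (mintegral n n {s..t} f)) i j = ent (fm (mintegral n n {a..t} f) - fm (mintegral n n {a..s} f)) i j"
      by (auto simp: ent_fm mintegral_def algebra_simps)
  qed
qed

lemma loewner_lower:
  assumes "loewner_le n (c \<cdot>\<^sub>m 1\<^sub>m n) A"
  shows "c * (norm (un n * Z))\<^sup>2 \<le> inner Z (fm A * Z)"
proof -
  have A: "A \<in> carrier_mat n n" "psd n (A - c \<cdot>\<^sub>m 1\<^sub>m n)" using assms by (auto simp: loewner_le_def)
  have "fm (A - c \<cdot>\<^sub>m 1\<^sub>m n) = fm A - c *\<^sub>R un n"
    using A(1) by (simp add: fm_diff[of _ n n] fm_smult un_def)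
  then have "0 \<le> inner Z ((fm A - c *\<^sub>R un n) * Z)" using A(2) by (metis posD psd_iff_pos)
  then show ?thesis by (simp add: left_diff_distrib inner_diff_right norm_un_times_sq)
qed

text \<open>\<open>P - adj P\<close> solves a homogeneous linear equation. A Riccati equation may be read as a Lyapunov
equation by counting its quadratic term, symmetric along every solution, to \<open>N\<close>.\<close>

lemma lyapunov_symmetric:
  assumes d: "\<And>t. a \<le> t \<Longrightarrow> (P has_vector_derivative A t * P t + P t * adj (A t) + N t) (at t within {a..})"
    and N: "\<And>t. a \<le> t \<Longrightarrow> adj (N t) = N t" and A: "continuous_on {a..} A"
    and start: "adj (P a) = P a" and t: "a \<le> t"
  shows "adj (P t) = P t"
proof -
  have "P t - adj (P t) = 0"
  proof (rule linear_ode_zero[of a _ A "\<lambda>t. adj (A t)"])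
    show "((\<lambda>t. P t - adj (P t)) has_vector_derivative A r * (P r - adj (P r)) + (P r - adj (P r)) * adj (A r))
        (at r within {a..})" if "a \<le> r" for r
      by (rule has_vector_derivative_eq_rhs[OF has_vector_derivative_diff[OF d[OF that]
            has_vector_derivative_adj[OF d[OF that]]]]) (simp add: N[OF that] algebra_simps)
  qed (use A start t in \<open>auto intro!: continuous_on_adj\<close>)
  then show ?thesis by simp
qed

context alise_data
begin

lemma Pw_deriv: "a \<le> t \<Longrightarrow> ((\<lambda>t. fm (mPw S t)) has_vector_derivative - fm (mAw S) * fm (mPw S t)
    + fm (mPw S t) * adj (- fm (mAw S)) + fm (mBw S) * fm (mQG S) * adj (fm (mBw S))) (at t within {a..})"
proof -
  assume t: "a \<le> t"
  have "has_mderiv a (mPw S) (- (mAw S * mPw S t) - mPw S t * transpose_mat (mAw S)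
      + mBw S * mQG S * transpose_mat (mBw S)) t"
    using nc t by (simp add: noise_covariances_def)
  from has_mderiv_fm[OF this t base_carrier(13)] show ?thesis
    using noise_dims(1-5) noise_dims(6)[unfolded psd_def, THEN conjunct1, THEN carrier_matD(1)]
      noise_dims(6)[unfolded psd_def, THEN conjunct1, THEN carrier_matD(2)] base_carrier(13)[OF t]
    by (auto simp: fm_add' fm_diff' fm_uminus fm_times fm_transpose minus_mult_left[symmetric] dest!: carrier_matD)
qed

lemma aug_carrier: "Av_aug S \<in> carrier_mat (l + l) (l + l)" "Bv_aug S \<in> carrier_mat (l + l) (nvG S)"
  using noise_dims by (auto simp: Av_aug_def Bv_aug_def)

lemma Pv_deriv: "a \<le> t \<Longrightarrow> ((\<lambda>t. fm (mPv S t)) has_vector_derivative fm (Av_aug S) * fm (mPv S t)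
    + fm (mPv S t) * adj (fm (Av_aug S)) + fm (Bv_aug S) * fm (mRG S) * adj (fm (Bv_aug S))) (at t within {a..})"
proof -
  assume t: "a \<le> t"
  have "has_mderiv a (mPv S) (Av_aug S * mPv S t + mPv S t * transpose_mat (Av_aug S)
      + Bv_aug S * mRG S * transpose_mat (Bv_aug S)) t"
    using nc t by (simp add: noise_covariances_def)
  from has_mderiv_fm[OF this t base_carrier(14)] show ?thesis
    using noise_dims(7)[unfolded posdef_def, THEN conjunct1, THEN carrier_matD(1)]
      noise_dims(7)[unfolded posdef_def, THEN conjunct1, THEN carrier_matD(2)] base_carrier(14)[OF t] aug_carrier
    by (auto simp: fm_add' fm_times fm_transpose dest!: carrier_matD)
qed

lemma adj_covariances:
  assumes t: "a \<le> t"
  shows "adj (fm (mPw S t)) = fm (mPw S t)" "adj (fm (mPv S t)) = fm (mPv S t)"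
proof -
  have w: "transpose_mat (mQG S) = mQG S" and v: "transpose_mat (mRG S) = mRG S"
    using noise_dims by (auto simp: psd_def posdef_def)
  have s: "mPw S a = mP0w S" "mPv S a = mP0v S" using nc by (auto simp: noise_covariances_def)
  show "adj (fm (mPw S t)) = fm (mPw S t)"
    by (rule lyapunov_symmetric[OF Pw_deriv _ _ _ t])
      (use w s P0_sym in \<open>auto simp: mult.assoc fm_transpose[symmetric]\<close>)
  show "adj (fm (mPv S t)) = fm (mPv S t)"
    by (rule lyapunov_symmetric[OF Pv_deriv _ _ _ t])
      (use v s P0_sym in \<open>auto simp: mult.assoc fm_transpose[symmetric]\<close>)
qed

lemma adj_noise:
  assumes t: "a \<le> t"
  shows "adj (fm (Rn S t)) = fm (Rn S t)" "adj (fm (Rbar S t)) = fm (Rbar S t)" "adj (fm (Qbar S t)) = fm (Qbar S t)"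
proof -
  note I = images[OF t]
  show R: "adj (fm (Rn S t)) = fm (Rn S t)" "adj (fm (Rbar S t)) = fm (Rbar S t)"
    unfolding I(1,2) by (simp_all add: adj_covariances[OF t] mult.assoc)
  have "adj (fm (Qhat S t)) = fm (Qhat S t)" "adj (fm (Rbar2 S t)) = fm (Rbar2 S t)"
    unfolding I(17,11,13) by (simp_all add: adj_covariances[OF t] R mult.assoc)
  then show "adj (fm (Qbar S t)) = fm (Qbar S t)"
    unfolding I(22) by (simp add: mult.assoc)
qed

text \<open>For symmetric \<open>P\<close>, completing the square in the gain turns the Riccati equation of the filter
  with correlated noises into the standard one of the equivalent system.\<close>

definition "infoS t = adj (fm (C2 S t)) * fm (minv (R2 S t)) * fm (C2 S t)"

lemma riccati_deriv:
  assumes P: "riccati_solution S P" and t: "a \<le> t"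
  shows "P t \<in> carrier_mat n n"
    "((\<lambda>t. fm (P t)) has_vector_derivative fm (Abar S t) * fm (P t) + fm (P t) * adj (fm (Abar S t))
      + (fm (Qbar S t) - fm (gain S t (P t)) * fm (R2 S t) * adj (fm (gain S t (P t))))) (at t within {a..})"
proof -
  have c: "P s \<in> carrier_mat n n" if "a \<le> s" for s using P that by (simp add: riccati_solution_def)
  then show c': "P t \<in> carrier_mat n n" using t by simp
  have g: "gain S t (P t) \<in> carrier_mat n l2"
    by (intro carrier_matI; simp add: gain_def dims[OF t] carrier_matD[OF c'])
  have "has_mderiv a P (Abar S t * P t + P t * transpose_mat (Abar S t) + Qbar S t
        - gain S t (P t) * R2 S t * transpose_mat (gain S t (P t))) t"
    using P t by (simp add: riccati_solution_def)
  from has_mderiv_fm[OF this t c]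
  show "((\<lambda>t. fm (P t)) has_vector_derivative fm (Abar S t) * fm (P t) + fm (P t) * adj (fm (Abar S t))
      + (fm (Qbar S t) - fm (gain S t (P t)) * fm (R2 S t) * adj (fm (gain S t (P t))))) (at t within {a..})"
    by (simp add: fm_add' fm_diff' fm_times fm_transpose dims[OF t] carrier_matD[OF c'] carrier_matD[OF g]
        add_diff_eq)
qed

lemma riccati_symmetric:
  assumes P: "riccati_solution S P" and start: "transpose_mat (P a) = P a" and t: "a \<le> t"
  shows "adj (fm (P t)) = fm (P t)"
proof (rule lyapunov_symmetric[OF riccati_deriv(2)[OF P] _ diffb_continuous[OF diffb_second(1)] _ t])
  show "adj (fm (P a)) = fm (P a)" by (simp only: fm_transpose[symmetric] start)
qed (auto simp: adj_noise R2_inverse mult.assoc)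

lemma riccati_standard:
  assumes P: "riccati_solution S P" and start: "transpose_mat (P a) = P a" and t: "a \<le> t"
  shows "((\<lambda>t. fm (P t)) has_vector_derivative fm (Ae S t) * fm (P t) + fm (P t) * adj (fm (Ae S t))
      + fm (Qe S t) - fm (P t) * infoS t * fm (P t)) (at t within {a..})"
proof -
  note I = images[OF t] and R = R2_inverse[OF t]
  have Pc: "P t \<in> carrier_mat n n" by (rule riccati_deriv(1)[OF P t])
  let ?b = "fm (minv (R2 S t))" and ?c = "fm (C2 S t)" and ?P = "fm (P t)"
    and ?N = "fm (G2 S t) * fm (M2 S t) * adj (fm (Rgrave2 S t))"
  have brb: "?b * (fm (R2 S t) * (?b * x)) = ?b * x" for x
    by (simp add: mult.assoc[symmetric] R)
  have ub: "un l2 * (?b * x) = ?b * x" for x by (simp add: mult.assoc[symmetric] R)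
  have sq: "fm (gain S t (P t)) * fm (R2 S t) * adj (fm (gain S t (P t)))
      = (?P * adj ?c - ?N) * (?b * (?c * ?P - adj ?N))"
    unfolding I(23)[OF Pc]
    by (simp add: riccati_symmetric[OF P start t] R brb ub mult.assoc)
  show ?thesis
    by (rule has_vector_derivative_eq_rhs[OF riccati_deriv(2)[OF P t]])
      (unfold sq I(27,28,26) infoS_def, simp add: algebra_simps R)
qed

lemma mPx_symmetric: "transpose_mat (mPx S a) = mPx S a"
  using P0x_psd by (simp add: psd_def)

lemma equiv_riccati: "equiv_riccati S"
  unfolding equiv_riccati_def
proof (intro allI impI)
  fix t assume t: "a \<le> t"
  note R = R2_inverse[OF t]
  have Pt: "adj (fm (mPx S t)) = fm (mPx S t)" by (rule riccati_symmetric[OF ric mPx_symmetric t])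
  have brb: "fm (minv (R2 S t)) * (fm (R2 S t) * (fm (minv (R2 S t)) * x)) = fm (minv (R2 S t)) * x" for x
    by (simp add: mult.assoc[symmetric] R)
  have ub: "un l2 * (fm (minv (R2 S t)) * x) = fm (minv (R2 S t)) * x" for x by (simp add: mult.assoc[symmetric] R)
  have "fm (Ae S t * mPx S t + mPx S t * transpose_mat (Ae S t) + Qe S t - Le S t * R2 S t * transpose_mat (Le S t))
    = fm (Ae S t) * fm (mPx S t) + fm (mPx S t) * adj (fm (Ae S t)) + fm (Qe S t)
      - fm (Le S t) * fm (R2 S t) * adj (fm (Le S t))"
    by (simp add: fm_add' fm_diff' fm_times fm_transpose dims[OF t])
  also have "fm (Le S t) * fm (R2 S t) * adj (fm (Le S t)) = fm (mPx S t) * infoS t * fm (mPx S t)"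
    unfolding images(30)[OF t] infoS_def by (simp add: Pt R brb ub mult.assoc)
  finally have e: "fm (Ae S t * mPx S t + mPx S t * transpose_mat (Ae S t) + Qe S t - Le S t * R2 S t * transpose_mat (Le S t))
    = fm (Ae S t) * fm (mPx S t) + fm (mPx S t) * adj (fm (Ae S t)) + fm (Qe S t) - fm (mPx S t) * infoS t * fm (mPx S t)" .
  show "has_mderiv a (mPx S)
      (Ae S t * mPx S t + mPx S t * transpose_mat (Ae S t) + Qe S t - Le S t * R2 S t * transpose_mat (Le S t)) t"
  proof (rule has_mderiv_of_fm[OF _ t refl, where n = n and m = n])
    show "((\<lambda>t. fm (mPx S t)) has_vector_derivative fm (Ae S t * mPx S t + mPx S t * transpose_mat (Ae S t)
        + Qe S t - Le S t * R2 S t * transpose_mat (Le S t))) (at t within {a..})"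
      unfolding e by (rule riccati_standard[OF ric mPx_symmetric t])
    show "Ae S t * mPx S t + mPx S t * transpose_mat (Ae S t) + Qe S t - Le S t * R2 S t * transpose_mat (Le S t)
        \<in> carrier_mat n n"
      by (intro carrier_matI; simp add: dims[OF t])
  qed (rule base_carrier)
qed

lemma closed_loop_image:
  assumes t: "a \<le> t"
  shows "fm (Abar S t - L S t * C2 S t) = fm (Ae S t) - fm (mPx S t) * infoS t"
  by (simp add: fm_diff' fm_times dims[OF t] infoS_def images(27,30)[OF t] L_split[OF t] algebra_simps)

text \<open>The columns of \<open>mU2\<close> are orthonormal and \<open>mC\<close> is bounded.\<close>

lemma norm_C2_bounded: "\<exists>K. \<forall>t\<ge>a. norm (fm (C2 S t)) \<le> K"
proof -
  obtain K where K: "\<And>t. a \<le> t \<Longrightarrow> norm (fm (mC S t)) \<le> K"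
    using smooth(2)[of "mC S"] by (auto simp: mbounded_def mnorm_fm)
  have "norm (fm (C2 S t)) \<le> norm (un l2) * K" if t: "a \<le> t" for t
  proof -
    let ?u = "fm (mU2 S t)"
    have "(norm ?u)\<^sup>2 = inner (?u * un l2) ?u"
      using times_un[OF shape_fm[OF base_carrier(9)[OF t]]] by (simp add: power2_norm_eq_inner)
    also have "\<dots> = (norm (un l2))\<^sup>2"
      using U_blocks(3)[OF t] by (simp add: inner_times_left power2_norm_eq_inner)
    finally have "norm ?u = norm (un l2)" by simp
    then have "norm (fm (T2 S t)) = norm (un l2)" by (simp add: images(4)[OF t])
    moreover have "norm (fm (C2 S t)) \<le> norm (fm (T2 S t)) * norm (fm (mC S t))"
      unfolding images(8)[OF t] by (rule norm_mult_ineq)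
    ultimately show ?thesis using mult_left_mono[OF K[OF t], of "norm (un l2)"] by simp
  qed
  then show ?thesis by blast
qed

text \<open>The lower bound on \<open>R2\<close> limits its inverse; the upper bound allows the unweighted observability
Gramian of \<open>cond_A2\<close> to be compared with the one weighted by the inverse of \<open>R2\<close>.\<close>

lemma R2_bounds:
  assumes lo: "loewner_le l2 (\<alpha> \<cdot>\<^sub>m 1\<^sub>m l2) (R2 S t)" and \<alpha>: "0 < \<alpha>" and hi: "mnorm (R2 S t) \<le> \<beta>" and t: "a \<le> t"
  shows "norm (fm (minv (R2 S t))) \<le> norm (un l2) / \<alpha>"
    "inner Z (adj (fm (C2 S t)) * fm (C2 S t) * Z) \<le> \<beta> * inner Z (infoS t * Z)"
proof -
  note R = R2_inverse[OF t]
  let ?b = "fm (minv (R2 S t))" and ?r = "fm (R2 S t)"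
  have "\<alpha> * (norm (un l2 * ?b))\<^sup>2 \<le> inner ?b (?r * ?b)" by (rule loewner_lower[OF lo])
  also have "\<dots> \<le> norm ?b * norm (un l2)" unfolding R(1) by (rule norm_cauchy_schwarz)
  finally have "norm ?b * norm ?b \<le> (norm (un l2) / \<alpha>) * norm ?b"
    using \<alpha> by (simp add: R power2_eq_square field_simps)
  then show "norm ?b \<le> norm (un l2) / \<alpha>" by (rule square_le_cancel) (use \<alpha> in simp)
  let ?y = "fm (C2 S t) * Z"
  have pr: "pos ?r" using posdef_imp_psd[OF R2_posdef[OF t]] by (simp add: psd_iff_pos)
  have y: "?r * (?b * ?y) = ?y"
    by (simp add: mult.assoc[symmetric] R un_image[OF t])
  have "(norm (?r * (?b * ?y)))\<^sup>2 \<le> norm ?r * inner (?b * ?y) (?r * (?b * ?y))"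
    by (rule pos_norm_mult_sq_norm[OF pr])
  also have "\<dots> = norm ?r * inner ?y (?b * ?y)" unfolding y by (simp add: inner_commute)
  also have "\<dots> \<le> \<beta> * inner ?y (?b * ?y)"
    using hi posD[OF R(7)] by (intro mult_right_mono) (auto simp: mnorm_fm)
  finally show "inner Z (adj (fm (C2 S t)) * fm (C2 S t) * Z) \<le> \<beta> * inner Z (infoS t * Z)"
    unfolding y by (simp add: infoS_def power2_norm_eq_inner inner_times_left mult.assoc)
qed

lemma infoS_props:
  assumes t: "a \<le> t"
  shows "shape n n (infoS t)" "pos (infoS t)"
proof -
  show "shape n n (infoS t)"
    unfolding infoS_def using carriers[OF t] by (intro shape_times[of n l2 _ l2] shape_times[of n l2 _ l2 l2] shape_adj shape_fm)
  show "pos (infoS t)" unfolding infoS_def by (rule pos_congruence[OF R2_inverse(7)[OF t]])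
qed

text \<open>The transition matrix of the dual pair in \<open>cond_A2\<close> serves as \<open>\<Psi>\<close>; by \<open>transition_dual\<close> it also expresses
the transition matrix in \<open>cond_A3\<close>. The Gramians, given there as integrals over windows, are differences
of their primitives from the initial time.\<close>

theorem filter_kalman_bucy:
  assumes A2: "cond_A2 S" and A3: "cond_A3 S" and A4: "cond_A4 S" and A5: "cond_A5 S"
  obtains \<Psi> \<alpha> q \<sigma> \<epsilon>o b \<epsilon>c \<mu> where
    "kalman_bucy a n (\<lambda>t. fm (Ae S t)) (\<lambda>t. fm (Qe S t)) infoS \<Psi> \<alpha> q \<sigma> \<epsilon>o b \<epsilon>c \<mu>"
proof -
  obtain Qh where Qh: "\<And>t. a \<le> t \<Longrightarrow> psd n (Qh t)" "\<And>t. a \<le> t \<Longrightarrow> Qh t * Qh t = Qe S t"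
    and uc: "unif_compl_controllable a n (Ae S) Qh"
    using A3 by (auto simp: cond_A3_def)
  obtain \<Phi>c \<epsilon>c \<mu>c where \<Phi>c: "transition_matrix a n (Ae S) \<Phi>c" and ec: "0 < \<epsilon>c" "0 < \<mu>c"
    and Wc: "\<And>t. a + \<epsilon>c \<le> t \<Longrightarrow> loewner_le n (\<mu>c \<cdot>\<^sub>m 1\<^sub>m n) (mintegral n n {t - \<epsilon>c..t}
      (\<lambda>s. \<Phi>c t s * Qh s * transpose_mat (Qh s) * transpose_mat (\<Phi>c t s)))"
    using uc unfolding unif_compl_controllable_def Let_def by blast
  obtain \<Phi>o \<epsilon>o \<mu>o where \<Phi>o: "transition_matrix a n (\<lambda>t. - transpose_mat (Ae S t)) \<Phi>o" and eo: "0 < \<epsilon>o" "0 < \<mu>o"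
    and Wo: "\<And>t. a + \<epsilon>o \<le> t \<Longrightarrow> loewner_le n (\<mu>o \<cdot>\<^sub>m 1\<^sub>m n) (mintegral n n {t - \<epsilon>o..t}
      (\<lambda>s. \<Phi>o t s * transpose_mat (C2 S s) * transpose_mat (transpose_mat (C2 S s)) * transpose_mat (\<Phi>o t s)))"
    using A2 unfolding cond_A2_def unif_compl_observable_def unif_compl_controllable_def Let_def by blast
  obtain q where q: "\<And>t. a \<le> t \<Longrightarrow> norm (fm (Qe S t)) \<le> q" using A4 by (auto simp: cond_A4_def mnorm_fm)
  obtain \<alpha>R \<beta> where R: "0 < \<alpha>R" "0 < \<beta>" "\<And>t. a \<le> t \<Longrightarrow> loewner_le l2 (\<alpha>R \<cdot>\<^sub>m 1\<^sub>m l2) (R2 S t)"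
    "\<And>t. a \<le> t \<Longrightarrow> mnorm (R2 S t) \<le> \<beta>"
    using A4 unfolding cond_A4_def by blast
  obtain \<alpha> where \<alpha>: "\<And>t. a \<le> t \<Longrightarrow> norm (fm (Ae S t)) \<le> \<alpha>" using A5 by (auto simp: cond_A5_def mbounded_def mnorm_fm)
  obtain kc where kc: "\<And>t. a \<le> t \<Longrightarrow> norm (fm (C2 S t)) \<le> kc" using norm_C2_bounded by blast
  define \<sigma> where "\<sigma> = kc * (norm (un l2) / \<alpha>R) * kc"
  define \<Psi> where "\<Psi> r t = fm (\<Phi>o r t)" for r t
  have Aec: "Ae S t \<in> carrier_mat n n" "- transpose_mat (Ae S t) \<in> carrier_mat n n" if "a \<le> t" for t
    using derived_carrier(33)[OF that] by auto
  note To = transition_matrixD[OF \<Phi>o _ _ Aec(2)] and Tc = transition_matrixD[OF \<Phi>c _ _ Aec(1)]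
  have dual: "fm (\<Phi>c t s) = adj (fm (\<Phi>o s t))" "adj (fm (\<Phi>o s t)) * fm (\<Phi>c s t) = un n"
    if "a \<le> s" "a \<le> t" for s t
    by (rule transition_dual[OF \<Phi>c \<Phi>o _ that], erule Aec(1))+
  have contS: "continuous_on {a..} infoS"
    unfolding infoS_def by (intro diffb_continuous diffb_intros diffb_first diffb_inverses)
  have contQ: "continuous_on {a..} (\<lambda>t. fm (Qe S t))" by (rule diffb_continuous[OF diffb_second(3)])
  interpret r: riccati a n "\<lambda>t. fm (Ae S t)" "\<lambda>t. fm (Qe S t)" infoS \<Psi> \<alpha> q \<sigma>
  proof
    fix r t assume t: "a \<le> t"
    show "shape n n (fm (Ae S t))" "shape n n (fm (Qe S t))" using derived_carrier(33,34)[OF t] by (auto intro: shape_fm)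
    show "shape n n (infoS t)" "pos (infoS t)" by (fact infoS_props[OF t])+
    show "pos (fm (Qe S t))"
    proof -
      have Q: "pos (fm (Qh t))" "Qh t \<in> carrier_mat n n" using Qh(1)[OF t] by (auto simp: psd_iff_pos)
      have "fm (Qe S t) = fm (Qh t) * fm (Qh t)" using Q(2) by (simp add: Qh(2)[OF t, symmetric] fm_times)
      also have "\<dots> = adj (fm (Qh t)) * un n * fm (Qh t)"
        using pos_adj[OF Q(1)] times_un[OF shape_fm[OF Q(2)]] by simp
      finally show ?thesis using pos_congruence[OF pos_un] by simp
    qed
    show "norm (fm (Ae S t)) \<le> \<alpha>" "norm (fm (Qe S t)) \<le> q" using \<alpha> q t by auto
    show "norm (infoS t) \<le> \<sigma>"
    proof -
      have "norm (infoS t) \<le> norm (adj (fm (C2 S t))) * (norm (fm (minv (R2 S t))) * norm (fm (C2 S t)))"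
        unfolding infoS_def by (rule norm_mult3_le)
      also have "\<dots> \<le> kc * ((norm (un l2) / \<alpha>R) * kc)"
        using kc[OF t] R2_bounds(1)[OF R(3)[OF t] R(1) R(4)[OF t] t] order_trans[OF norm_ge_zero kc[OF t]]
        by (intro mult_mono) (auto intro!: divide_nonneg_pos R(1))
      finally show ?thesis by (simp add: \<sigma>_def mult.assoc)
    qed
    show "\<Psi> t t = un n" using To(2)[OF t t t] by (simp add: \<Psi>_def)
    assume r: "a \<le> r"
    show "shape n n (\<Psi> r t)" unfolding \<Psi>_def by (rule shape_fm[OF To(1)[OF t r r]])
    show "((\<lambda>r. \<Psi> r t) has_vector_derivative - (adj (fm (Ae S r)) * \<Psi> r t)) (at r within {a..})"
      using To(3)[OF t r r] by (simp add: \<Psi>_def fm_uminus fm_transpose minus_mult_left[symmetric])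
  qed (auto intro: diffb_continuous[OF diffb_second(2)] contQ contS)
  have \<Psi>c: "continuous_on {a..} (\<lambda>s. \<Psi> s t)" if "a \<le> t" for t
    unfolding continuous_on_eq_continuous_within
    by (auto intro!: has_vector_derivative_continuous r.\<Psi>_deriv that)
  \<comment> \<open>The square root of \<open>Qe\<close> in \<open>cond_A3\<close> enters the Gramian only through its square.\<close>
  have contr: "r.controllable \<epsilon>c \<mu>c"
    unfolding r.controllable_def
  proof (intro conjI allI impI ec)
    fix t assume t: "a + \<epsilon>c \<le> t"
    then have at: "a \<le> t" "a \<le> t - \<epsilon>c" using ec by auto
    let ?f = "\<lambda>s. \<Phi>c t s * Qh s * transpose_mat (Qh s) * transpose_mat (\<Phi>c t s)"
    have Qc: "Qh s \<in> carrier_mat n n" if "a \<le> s" for s using Qh(1)[OF that] by (simp add: psd_def)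
    have fi: "fm (?f s) = adj (\<Psi> s t) * fm (Qe S s) * \<Psi> s t" if s: "a \<le> s" for s
    proof -
      have "transpose_mat (Qh s) = Qh s" using Qh(1)[OF s] by (simp add: psd_def)
      then have "fm (?f s) = fm (\<Phi>c t s) * (fm (Qh s) * fm (Qh s)) * adj (fm (\<Phi>c t s))"
        using Tc(1)[OF s at(1) at(1)] Qc[OF s] by (simp add: fm_times fm_transpose mult.assoc)
      also have "fm (Qh s) * fm (Qh s) = fm (Qe S s)" using Qc[OF s] by (simp add: Qh(2)[OF s, symmetric] fm_times)
      finally show ?thesis using dual(1)[OF s at(1)] by (simp add: \<Psi>_def)
    qed
    have fc: "?f s \<in> carrier_mat n n" if s: "a \<le> s" for s
      using Tc(1)[OF s at(1) at(1)] Qc[OF s] by (intro carrier_matI) auto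
    have cont: "continuous_on {a..} (\<lambda>s. fm (?f s))"
      by (rule continuous_on_eq[of _ "\<lambda>s. adj (\<Psi> s t) * fm (Qe S s) * \<Psi> s t"])
        (use fi in \<open>auto intro!: continuous_intros \<Psi>c at contQ\<close>)
    have fc': "\<forall>s\<ge>a. ?f s \<in> carrier_mat n n" using fc by blast
    note mi = mintegral_image[OF fc' cont]
    show "\<exists>\<Gamma>. (\<forall>r. t - \<epsilon>c \<le> r \<and> r \<le> t \<longrightarrow>
        (\<Gamma> has_vector_derivative adj (\<Psi> r t) * fm (Qe S r) * \<Psi> r t) (at r within {a..})) \<and>
      (\<forall>Z. \<mu>c * (norm (un n * Z))\<^sup>2 \<le> inner Z ((\<Gamma> t - \<Gamma> (t - \<epsilon>c)) * Z))"
    proof (intro exI[of _ "\<lambda>r. fm (mintegral n n {a..r} ?f)"] conjI allI impI)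
      fix r assume "t - \<epsilon>c \<le> r \<and> r \<le> t"
      then have r: "a \<le> r" using at by simp
      show "((\<lambda>r. fm (mintegral n n {a..r} ?f)) has_vector_derivative adj (\<Psi> r t) * fm (Qe S r) * \<Psi> r t) (at r within {a..})"
        using mi(1)[OF r] by (simp only: fi[OF r])
    next
      fix Z
      have "fm (mintegral n n {t - \<epsilon>c..t} ?f) = fm (mintegral n n {a..t} ?f) - fm (mintegral n n {a..t - \<epsilon>c} ?f)"
        by (rule mi(2)[OF at(2)]) (use ec in simp)
      then show "\<mu>c * (norm (un n * Z))\<^sup>2 \<le> inner Z ((fm (mintegral n n {a..t} ?f) - fm (mintegral n n {a..t - \<epsilon>c} ?f)) * Z)"
        using loewner_lower[OF Wc[OF t], of Z] by simp
    qed
  qed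
  \<comment> \<open>The transition matrix of \<open>cond_A3\<close>, dual to \<open>\<Psi>\<close>, plays the part of \<open>\<Phi>\<close>.\<close>
  have obs: "r.observable \<epsilon>o (norm (un n) / (\<mu>o / \<beta>))"
    unfolding r.observable_def
  proof (intro conjI allI impI eo)
    fix t assume t: "a + \<epsilon>o \<le> t"
    then have at: "a \<le> t" "a \<le> t - \<epsilon>o" using eo by auto
    define \<Phi> where "\<Phi> r = fm (\<Phi>c r t)" for r
    have \<Phi>d: "(\<Phi> has_vector_derivative fm (Ae S r) * \<Phi> r) (at r within {a..})" if "a \<le> r" for r
      unfolding \<Phi>_def by (rule Tc(3)[OF at(1) that that])
    have \<Phi>c: "continuous_on {a..} \<Phi>"
      unfolding continuous_on_eq_continuous_within by (auto intro!: has_vector_derivative_continuous \<Phi>d)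
    let ?g = "\<lambda>s. \<Phi>o t s * transpose_mat (C2 S s) * transpose_mat (transpose_mat (C2 S s)) * transpose_mat (\<Phi>o t s)"
    have gi: "fm (?g s) = adj (\<Phi> s) * (adj (fm (C2 S s)) * fm (C2 S s)) * \<Phi> s" if s: "a \<le> s" for s
      using To(1)[OF s at(1) at(1)] derived_carrier(9)[OF s] dual(1)[OF at(1) s]
      by (simp add: fm_times fm_transpose \<Phi>_def mult.assoc)
    have gc: "?g s \<in> carrier_mat n n" if s: "a \<le> s" for s
      using To(1)[OF s at(1) at(1)] derived_carrier(9)[OF s] by (intro carrier_matI) auto
    have gcont: "continuous_on {a..} (\<lambda>s. fm (?g s))"
      by (rule continuous_on_eq[of _ "\<lambda>s. adj (\<Phi> s) * (adj (fm (C2 S s)) * fm (C2 S s)) * \<Phi> s"])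
        (use gi in \<open>auto intro!: continuous_intros \<Phi>c diffb_continuous[OF diffb_first(5)]\<close>)
    have gc': "\<forall>s\<ge>a. ?g s \<in> carrier_mat n n" using gc by blast
    note gm = mintegral_image[OF gc' gcont]
    define f where "f s = transpose_mat (\<Phi>c s t) * (transpose_mat (C2 S s) * minv (R2 S s) * C2 S s) * \<Phi>c s t" for s
    have fi: "fm (f s) = adj (\<Phi> s) * infoS s * \<Phi> s" if s: "a \<le> s" for s
      using Tc(1)[OF at(1) s s] derived_carrier(9,37)[OF s]
      by (simp add: f_def fm_times fm_transpose \<Phi>_def infoS_def mult.assoc)
    have fc: "f s \<in> carrier_mat n n" if s: "a \<le> s" for s
      unfolding f_def using Tc(1)[OF at(1) s s] by (intro carrier_matI) auto
    have fcont: "continuous_on {a..} (\<lambda>s. fm (f s))"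
      by (rule continuous_on_eq[of _ "\<lambda>s. adj (\<Phi> s) * infoS s * \<Phi> s"])
        (use fi in \<open>auto intro!: continuous_intros \<Phi>c contS\<close>)
    have fc': "\<forall>s\<ge>a. f s \<in> carrier_mat n n" using fc by blast
    note fm' = mintegral_image[OF fc' fcont]
    define F where "F r = fm (mintegral n n {a..r} f)" for r
    define G where "G r = fm (mintegral n n {a..r} ?g)" for r
    have low: "(\<mu>o / \<beta>) * (norm (un n * Z))\<^sup>2 \<le> inner Z ((F t - F (t - \<epsilon>o)) * Z)" for Z
    proof -
      define k where "k r = \<beta> * inner Z (F r * Z) - inner Z (G r * Z)" for r
      have "k (t - \<epsilon>o) \<le> k t"
      proof (rule nondecreasing_within[of "t - \<epsilon>o" t k "\<lambda>r. \<beta> * inner Z (fm (f r) * Z) - inner Z (fm (?g r) * Z)" a])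
        fix r assume "t - \<epsilon>o \<le> r" "r \<le> t"
        then have r: "a \<le> r" using at by simp
        have "((\<lambda>r. inner Z (F r * Z)) has_real_derivative inner Z (fm (f r) * Z)) (at r within {a..})"
          using has_vector_derivative_inner[OF has_vector_derivative_const[of Z]
              has_vector_derivative_mult[OF fm'(1)[OF r] has_vector_derivative_const[of Z]]] by (simp add: F_def)
        moreover have "((\<lambda>r. inner Z (G r * Z)) has_real_derivative inner Z (fm (?g r) * Z)) (at r within {a..})"
          using has_vector_derivative_inner[OF has_vector_derivative_const[of Z]
              has_vector_derivative_mult[OF gm(1)[OF r] has_vector_derivative_const[of Z]]] by (simp add: G_def)
        ultimately show "(k has_real_derivative \<beta> * inner Z (fm (f r) * Z) - inner Z (fm (?g r) * Z)) (at r within {a..})"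
          unfolding k_def by (intro DERIV_diff DERIV_cmult)
        have "inner (\<Phi> r * Z) (adj (fm (C2 S r)) * fm (C2 S r) * (\<Phi> r * Z)) \<le> \<beta> * inner (\<Phi> r * Z) (infoS r * (\<Phi> r * Z))"
          by (rule R2_bounds(2)[OF R(3)[OF r] R(1) R(4)[OF r] r])
        then show "0 \<le> \<beta> * inner Z (fm (f r) * Z) - inner Z (fm (?g r) * Z)"
          unfolding fi[OF r] gi[OF r] by (simp add: inner_times_left mult.assoc)
      qed (use at eo in auto)
      then have "inner Z ((G t - G (t - \<epsilon>o)) * Z) \<le> \<beta> * inner Z ((F t - F (t - \<epsilon>o)) * Z)"
        by (simp add: k_def left_diff_distrib inner_diff_right right_diff_distrib)
      moreover have "\<mu>o * (norm (un n * Z))\<^sup>2 \<le> inner Z ((G t - G (t - \<epsilon>o)) * Z)"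
        using loewner_lower[OF Wo[OF t], of Z] gm(2)[OF at(2), of t] eo by (simp add: G_def)
      ultimately show ?thesis using R(2) by (simp add: field_simps)
    qed
    have sh: "shape n n (F t - F (t - \<epsilon>o))"
      unfolding F_def by (intro shape_diff shape_fm) (auto simp: mintegral_def)
    have mb: "0 < \<mu>o / \<beta>" using eo R by simp
    obtain B where B: "shape n n B" "(F t - F (t - \<epsilon>o)) * B = un n" "norm B \<le> norm (un n) / (\<mu>o / \<beta>)"
      using corner_inverse[OF sh mb low] by blast
    show "\<exists>\<Phi> W B. \<Phi> t = un n \<and> W t = 0 \<and> W (t - \<epsilon>o) * B = un n \<and> norm B \<le> norm (un n) / (\<mu>o / \<beta>) \<and>
      (\<forall>r. t - \<epsilon>o \<le> r \<and> r \<le> t \<longrightarrow>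
        (\<Phi> has_vector_derivative fm (Ae S r) * \<Phi> r) (at r within {a..}) \<and>
        (W has_vector_derivative - (adj (\<Phi> r) * infoS r * \<Phi> r)) (at r within {a..}) \<and>
        \<Psi> r t * adj (\<Phi> r) = un n)"
    proof (rule exI[of _ \<Phi>], rule exI[of _ "\<lambda>r. F t - F r"], rule exI[of _ B], intro conjI allI impI B(2,3))
      show "\<Phi> t = un n" unfolding \<Phi>_def by (rule Tc(2)[OF at(1) at(1) at(1)])
      fix r assume "t - \<epsilon>o \<le> r \<and> r \<le> t"
      then have r: "a \<le> r" using at by simp
      show "(\<Phi> has_vector_derivative fm (Ae S r) * \<Phi> r) (at r within {a..})" by (rule \<Phi>d[OF r])
      show "((\<lambda>r. F t - F r) has_vector_derivative - (adj (\<Phi> r) * infoS r * \<Phi> r)) (at r within {a..})"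
        unfolding fi[OF r, symmetric] F_def
        using has_vector_derivative_diff[OF has_vector_derivative_const fm'(1)[OF r]] by simp
      have "adj (\<Psi> r t) * \<Phi> r = un n" using dual(2)[OF r at(1)] by (simp add: \<Psi>_def \<Phi>_def)
      then have "\<Phi> r * adj (\<Psi> r t) = un n"
        by (rule corner_inverse_commute[rotated 2])
          (auto simp: \<Phi>_def intro!: shape_adj r.sh\<Psi> r at shape_fm[OF Tc(1)[OF at(1) r r]])
      then show "\<Psi> r t * adj (\<Phi> r) = un n" by (metis adj_adj adj_times adj_un)
    qed simp
  qed
  have "kalman_bucy a n (\<lambda>t. fm (Ae S t)) (\<lambda>t. fm (Qe S t)) infoS \<Psi> \<alpha> q \<sigma> \<epsilon>o (norm (un n) / (\<mu>o / \<beta>)) \<epsilon>c \<mu>c"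
    using r.riccati_axioms obs contr dim_le(3) by (simp add: kalman_bucy_def kalman_bucy_axioms_def)
  then show ?thesis by (rule that)
qed

text \<open>The solution \<open>mPx\<close> starts in a covariance matrix, hence it is one of the positive semidefinite
solutions that merge, and it can be taken for \<open>Pinf\<close>. The closed loop of the filter is that of the
equivalent system (\<open>closed_loop_image\<close>).\<close>

theorem filter_stable:
  assumes A: "cond_A2 S" "cond_A3 S" "cond_A4 S" "cond_A5 S"
  shows "unif_asymp_stable a n (\<lambda>t. Abar S t - L S t * C2 S t)"
    and "\<exists>Pinf. attracts_riccati S Pinf \<and> (\<forall>P'. attracts_riccati S P' \<longrightarrow> asymptotically_equal P' Pinf)"
proof -
  obtain \<Psi> \<alpha> q \<sigma> \<epsilon>o b \<epsilon>c \<mu> where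
    "kalman_bucy a n (\<lambda>t. fm (Ae S t)) (\<lambda>t. fm (Qe S t)) infoS \<Psi> \<alpha> q \<sigma> \<epsilon>o b \<epsilon>c \<mu>"
    using filter_kalman_bucy[OF A] .
  then interpret kb: kalman_bucy a n "\<lambda>t. fm (Ae S t)" "\<lambda>t. fm (Qe S t)" infoS \<Psi> \<alpha> q \<sigma> \<epsilon>o b \<epsilon>c \<mu> .
  have sol: "kb.sol (\<lambda>t. fm (P t))" "\<And>t. a \<le> t \<Longrightarrow> pos (fm (P t))"
    if P: "riccati_solution S P" "psd n (P a)" for P
  proof -
    have s: "transpose_mat (P a) = P a" using P(2) by (simp add: psd_def)
    show k: "kb.sol (\<lambda>t. fm (P t))"
      unfolding kb.sol_def
      using riccati_standard[OF P(1) s] riccati_symmetric[OF P(1) s] riccati_deriv(1)[OF P(1)]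
      by (auto intro: shape_fm)
    have "pos (fm (P a))" using P(2) by (simp add: psd_iff_pos)
    then show "pos (fm (P t))" if "a \<le> t" for t using kb.sol_pos[OF k _ that] by simp
  qed
  have merge: "asymptotically_equal P P'"
    if P: "riccati_solution S P" "psd n (P a)" and P': "riccati_solution S P'" "psd n (P' a)" for P P'
    unfolding asymptotically_equal_def
  proof (rule Lim_transform_eventually[OF kb.solutions_merge[OF sol(1)[OF P] sol(2)[OF P] sol(1)[OF P'] sol(2)[OF P']]])
    show "eventually (\<lambda>t. norm (fm (P t) - fm (P' t)) = mnorm (P t - P' t)) at_top"
      using eventually_ge_at_top[of a]
    proof eventually_elim
      case (elim t)
      then show ?case
        using fm_diff[OF riccati_deriv(1)[OF P(1)] riccati_deriv(1)[OF P'(1)]] by (simp add: mnorm_fm)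
    qed
  qed
  have "attracts_riccati S (mPx S)"
    unfolding attracts_riccati_def
    using ric P0x_psd sol(2)[OF ric P0x_psd] base_carrier(15) merge[OF _ posdef_imp_psd ric P0x_psd]
    by (auto simp: psd_iff_pos)
  moreover have "asymptotically_equal P' (mPx S)" if "attracts_riccati S P'" for P'
    using that by (intro merge ric P0x_psd) (auto simp: attracts_riccati_def)
  ultimately show "\<exists>Pinf. attracts_riccati S Pinf \<and> (\<forall>P'. attracts_riccati S P' \<longrightarrow> asymptotically_equal P' Pinf)"
    by blast
  obtain C \<delta> where C: "0 < C" "0 < \<delta>"
    and bd: "\<And>s x t. a \<le> s \<Longrightarrow> (\<And>t. s \<le> t \<Longrightarrow> shape n 1 (x t)) \<Longrightarrow>
      (\<And>t. s \<le> t \<Longrightarrow> (x has_vector_derivative (fm (Ae S t) - fm (mPx S t) * infoS t) * x t) (at t within {s..})) \<Longrightarrow>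
      s \<le> t \<Longrightarrow> (norm (x t))\<^sup>2 \<le> C * (norm (x s))\<^sup>2"
    and dec: "\<And>s x t k. a \<le> s \<Longrightarrow> (\<And>t. s \<le> t \<Longrightarrow> shape n 1 (x t)) \<Longrightarrow>
      (\<And>t. s \<le> t \<Longrightarrow> (x has_vector_derivative (fm (Ae S t) - fm (mPx S t) * infoS t) * x t) (at t within {s..})) \<Longrightarrow>
      s + real (Suc k) * \<epsilon>c \<le> t \<Longrightarrow> (norm (x t))\<^sup>2 \<le> C / (1 + \<delta>) ^ k * (norm (x s))\<^sup>2"
    by (rule kb.closed_loop_decay[OF sol(1)[OF ric P0x_psd]], erule sol(2)[OF ric P0x_psd], erule that, assumption, blast+)
  let ?X = "\<lambda>t. Abar S t - L S t * C2 S t"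
  have img: "\<And>t. s \<le> t \<Longrightarrow> shape n 1 (fv (x t))"
    "\<And>t. s \<le> t \<Longrightarrow> ((\<lambda>t. fv (x t)) has_vector_derivative (fm (Ae S t) - fm (mPx S t) * infoS t) * fv (x t)) (at t within {s..})"
    if x: "solves_lin s n ?X x" and s: "a \<le> s" for s x
  proof -
    have c: "x t \<in> carrier_vec n" "has_vderiv s x (?X t *\<^sub>v x t) t" if "s \<le> t" for t
      using x that by (auto simp: solves_lin_def)
    show "shape n 1 (fv (x t))" if "s \<le> t" for t by (rule shape_fv[OF c(1)[OF that]])
    show "((\<lambda>t. fv (x t)) has_vector_derivative (fm (Ae S t) - fm (mPx S t) * infoS t) * fv (x t)) (at t within {s..})"
      if t: "s \<le> t" for t
    proof -
      have at: "a \<le> t" using s t by simp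
      have "fv (?X t *\<^sub>v x t) = (fm (Ae S t) - fm (mPx S t) * infoS t) * fv (x t)"
        unfolding closed_loop_image[OF at, symmetric]
        by (rule fv_mult_mat) (use carrier_vecD[OF c(1)[OF t]] in \<open>simp add: dims[OF at]\<close>)
      then show ?thesis using has_vderiv_fv[OF c(2)[OF t] t c(1)] by simp
    qed
  qed
  show "unif_asymp_stable a n ?X"
    unfolding unif_asymp_stable_def
  proof (intro conjI allI impI)
    fix e :: real assume e: "0 < e"
    show "\<exists>d>0. \<forall>s\<ge>a. \<forall>x. solves_lin s n ?X x \<and> vnorm (x s) < d \<longrightarrow> (\<forall>t\<ge>s. vnorm (x t) < e)"
    proof (intro exI[of _ "e / sqrt C"] conjI allI impI)
      show "0 < e / sqrt C" using e C by simp
      fix s x t assume s: "a \<le> s" and x: "solves_lin s n ?X x \<and> vnorm (x s) < e / sqrt C" and t: "s \<le> t"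
      have "(norm (fv (x t)))\<^sup>2 \<le> C * (norm (fv (x s)))\<^sup>2"
        by (rule bd[OF s img(1) img(2) t]) (use x s in auto)
      also have "\<dots> = (sqrt C * norm (fv (x s)))\<^sup>2" using C by (simp add: power_mult_distrib)
      finally have "norm (fv (x t)) \<le> sqrt C * norm (fv (x s))" by (rule power2_le_imp_le) (use C in simp)
      also have "\<dots> < e" using x C by (simp add: vnorm_fv pos_less_divide_eq mult.commute)
      finally show "vnorm (x t) < e" by (simp add: vnorm_fv)
    qed
  next
    show "\<exists>c>0. \<forall>e>0. \<exists>T>0. \<forall>s\<ge>a. \<forall>x. solves_lin s n ?X x \<and> vnorm (x s) < c \<longrightarrow> (\<forall>t\<ge>s + T. vnorm (x t) < e)"
    proof (rule exI[of _ 1], intro conjI allI impI)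
      fix e :: real assume e: "0 < e"
      have "(\<lambda>k. C * (1 / (1 + \<delta>)) ^ k) \<longlonglongrightarrow> C * 0"
        using C by (intro tendsto_intros LIMSEQ_realpow_zero) auto
      then have "eventually (\<lambda>k. C * (1 / (1 + \<delta>)) ^ k < e\<^sup>2) sequentially"
        using e by (intro order_tendstoD(2)) auto
      then obtain k where "C * (1 / (1 + \<delta>)) ^ k < e\<^sup>2" by (auto simp: eventually_sequentially)
      then have k: "C / (1 + \<delta>) ^ k < e\<^sup>2" by (simp add: power_one_over mult_ac)
      show "\<exists>T>0. \<forall>s\<ge>a. \<forall>x. solves_lin s n ?X x \<and> vnorm (x s) < 1 \<longrightarrow> (\<forall>t\<ge>s + T. vnorm (x t) < e)"
      proof (intro exI[of _ "real (Suc k) * \<epsilon>c"] conjI allI impI)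
        show "0 < real (Suc k) * \<epsilon>c" using kb.eps_pos by simp
        fix s x t assume s: "a \<le> s" and x: "solves_lin s n ?X x \<and> vnorm (x s) < 1" and t: "s + real (Suc k) * \<epsilon>c \<le> t"
        have "(norm (fv (x t)))\<^sup>2 \<le> C / (1 + \<delta>) ^ k * (norm (fv (x s)))\<^sup>2"
          by (rule dec[OF s img(1) img(2) t]) (use x s in auto)
        also have "\<dots> \<le> C / (1 + \<delta>) ^ k * 1"
          using x C by (intro mult_left_mono) (auto simp: vnorm_fv power_le_one)
        finally have "(norm (fv (x t)))\<^sup>2 < e\<^sup>2" using k by simp
        then have "norm (fv (x t)) < e" by (rule power2_less_imp_less) (use e in simp)
        then show "vnorm (x t) < e" by (simp add: vnorm_fv)
      qed
    qed simp
  qed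
qed

end

section \<open>The error of the filter and the equivalent system\<close>

subsection \<open>Sample paths\<close>

lemma fv_add': "dim_vec x = dim_vec y \<Longrightarrow> fv (x + y) = fv x + fv y"
  by (rule fv_add[of x "dim_vec y"]) (auto intro: carrier_vecI)

lemma fv_diff': "dim_vec x = dim_vec y \<Longrightarrow> fv (x - y) = fv x - fv y"
  by (rule fv_diff[of x "dim_vec y"]) (auto intro: carrier_vecI)

lemma has_vector_derivative_cong_Ici:
  "(f has_vector_derivative D) (at t within {a..}) \<Longrightarrow> (a :: real) \<le> t \<Longrightarrow> (\<And>s. a \<le> s \<Longrightarrow> g s = f s) \<Longrightarrow>
    (g has_vector_derivative D) (at t within {a..})"
  by (rule has_vector_derivative_transform[of t "{a..}" g f]) auto

text \<open>The upper half of the state equation of the output noise is free of white noise; this is why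
  its sample paths are differentiable.\<close>

lemma noise_velocity:
  assumes wn: "white_noise_driven M (t0 S) (ny S + ny S) k (Av_aug S) (Bv_aug S) R P0 \<beta> vv"
    and d: "mAv S \<in> carrier_mat (ny S) (ny S)" "mAvd S \<in> carrier_mat (ny S) (ny S)"
      "mBv S \<in> carrier_mat (ny S) (nvG S)" and k: "k = nvG S"
    and \<omega>: "\<omega> \<in> space M" and t: "t0 S \<le> t"
  shows "has_vderiv (t0 S) (\<lambda>t. vpart S vv t \<omega>) (vdpart S vv t \<omega>) t"
proof -
  let ?l = "ny S"
  have c: "vv s \<omega> \<in> carrier_vec (?l + ?l)" "\<beta> s \<omega> \<in> carrier_vec k" if "t0 S \<le> s" for s
    using wn that \<omega> unfolding white_noise_driven_def white_noise_primitive_def rand_vec_def by blast+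
  have cont: "continuous_on {t0 S..} (\<lambda>s. vv s \<omega> $ i)" if "i < ?l + ?l" for i
    using wn that \<omega> unfolding white_noise_driven_def by blast
  have eq: "vv s \<omega> = vv (t0 S) \<omega> + vec (?l + ?l) (\<lambda>i. integral {t0 S..s} (\<lambda>r. (Av_aug S *\<^sub>v vv r \<omega>) $ i))
      + Bv_aug S *\<^sub>v \<beta> s \<omega>" if "t0 S \<le> s" for s
    using wn that \<omega> unfolding white_noise_driven_def by blast
  have Ac: "Av_aug S \<in> carrier_mat (?l + ?l) (?l + ?l)" and Bc: "Bv_aug S \<in> carrier_mat (?l + ?l) k"
    using d k by (auto simp: Av_aug_def Bv_aug_def)
  have comp: "((\<lambda>s. vv s \<omega> $ i) has_real_derivative vv t \<omega> $ (?l + i)) (at t within {t0 S..})" if i: "i < ?l" for i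
  proof (rule integral_equation_deriv[where y = "vv (t0 S) \<omega> $ i" and h = "\<lambda>s. vv s \<omega> $ (?l + i)"])
    fix s assume s: "t0 S \<le> s"
    have A: "(Av_aug S *\<^sub>v vv r \<omega>) $ i = vv r \<omega> $ (?l + i)" if r: "t0 S \<le> r" for r
    proof -
      have "(Av_aug S *\<^sub>v vv r \<omega>) $ i = (\<Sum>j<?l + ?l. Av_aug S $$ (i,j) * vv r \<omega> $ j)"
        using Ac c(1)[OF r] i by (simp add: scalar_prod_def atLeast0LessThan)
      also have "\<dots> = (\<Sum>j<?l + ?l. if j = ?l + i then vv r \<omega> $ j else 0)"
        using i d by (intro sum.cong) (auto simp: Av_aug_def)
      also have "\<dots> = vv r \<omega> $ (?l + i)" using i by simp
      finally show ?thesis .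
    qed
    have B: "(Bv_aug S *\<^sub>v \<beta> s \<omega>) $ i = 0"
    proof -
      have "(Bv_aug S *\<^sub>v \<beta> s \<omega>) $ i = (\<Sum>j<k. Bv_aug S $$ (i,j) * \<beta> s \<omega> $ j)"
        using Bc c(2)[OF s] i by (simp add: scalar_prod_def atLeast0LessThan)
      also have "\<dots> = 0" using i d k by (intro sum.neutral) (auto simp: Bv_aug_def append_rows_def)
      finally show ?thesis .
    qed
    have "integral {t0 S..s} (\<lambda>r. (Av_aug S *\<^sub>v vv r \<omega>) $ i) = integral {t0 S..s} (\<lambda>r. vv r \<omega> $ (?l + i))"
      by (rule Henstock_Kurzweil_Integration.integral_cong) (use A in auto)
    moreover have "vv s \<omega> $ i = vv (t0 S) \<omega> $ i + integral {t0 S..s} (\<lambda>r. (Av_aug S *\<^sub>v vv r \<omega>) $ i)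
        + (Bv_aug S *\<^sub>v \<beta> s \<omega>) $ i"
      by (subst eq[OF s]) (use i c(1)[OF order_refl] Bc in auto)
    ultimately show "vv s \<omega> $ i = vv (t0 S) \<omega> $ i + integral {t0 S..s} (\<lambda>s. vv s \<omega> $ (?l + i))"
      using B by linarith
  qed (use i cont t in auto)
  have dv: "dim_vec (vv t \<omega>) = ?l + ?l" using c(1)[OF t] by simp
  show ?thesis
    unfolding has_vderiv_def vpart_def vdpart_def vec_first_def vec_last_def
    using comp dv by auto
qed

lemma sel_image:
  assumes x: "x \<in> carrier_vec (ny S + ny S)"
  shows "sel_v S *\<^sub>v x = vec_first x (ny S)" "sel_vd S *\<^sub>v x = vec_last x (ny S)"
proof -
  let ?l = "ny S"
  have s: "sel_v S \<in> carrier_mat ?l (?l + ?l)" "sel_vd S \<in> carrier_mat ?l (?l + ?l)"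
    by (auto simp: sel_v_def sel_vd_def intro!: hcat_carrier)
  have e: "sel_v S $$ (i,j) = (if j = i then 1 else 0)" "sel_vd S $$ (i,j) = (if j = ?l + i then 1 else 0)"
    if "i < ?l" "j < ?l + ?l" for i j
    using that unfolding sel_v_def sel_vd_def
    by (subst hcat_four_block[of _ ?l ?l _ ?l]; auto)+
  have sum: "(A *\<^sub>v x) $ i = (\<Sum>j<?l + ?l. A $$ (i,j) * x $ j)" if "A \<in> carrier_mat ?l (?l + ?l)" "i < ?l" for A :: "real mat" and i
    using that x by (simp add: scalar_prod_def atLeast0LessThan)
  show "sel_v S *\<^sub>v x = vec_first x ?l"
  proof (rule eq_vecI)
    fix i assume "i < dim_vec (vec_first x ?l)"
    then have i: "i < ?l" by (simp add: vec_first_def)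
    have "(sel_v S *\<^sub>v x) $ i = (\<Sum>j<?l + ?l. if j = i then x $ j else 0)"
      unfolding sum[OF s(1) i] by (rule sum.cong[OF refl]) (use e[OF i] in auto)
    then show "(sel_v S *\<^sub>v x) $ i = vec_first x ?l $ i" using i by (simp add: vec_first_def)
  qed (use s in \<open>simp add: vec_first_def\<close>)
  show "sel_vd S *\<^sub>v x = vec_last x ?l"
  proof (rule eq_vecI)
    fix i assume "i < dim_vec (vec_last x ?l)"
    then have i: "i < ?l" by (simp add: vec_last_def)
    have "(sel_vd S *\<^sub>v x) $ i = (\<Sum>j<?l + ?l. if j = ?l + i then x $ j else 0)"
      unfolding sum[OF s(2) i] by (rule sum.cong[OF refl]) (use e[OF i] in auto)
    then show "(sel_vd S *\<^sub>v x) $ i = vec_last x ?l $ i" using i x by (simp add: vec_last_def)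
  qed (use s in \<open>simp add: vec_last_def\<close>)
qed

text \<open>The ring identity behind the error equation. \<open>M\<close> stands for \<open>G2 M2\<close> with derivative \<open>M'\<close>, and \<open>X - E\<close> for
the estimate. The terms with \<open>M'\<close>, with the input \<open>U\<close> and with the unknown input \<open>Z\<close> cancel.\<close>

lemma error_identity:
  fixes A B G W P M M' L X E T1 T2 C1 C2 D1 D2 G1 M1 Sg Ab Bb Cd Dd Y U V V' Z d w :: fsmat
  assumes T2Y: "T2 * Y = C2 * X + D2 * U + T2 * V" and T1Y: "T1 * Y = C1 * X + D1 * U + Sg * Z + T1 * V"
    and PG: "P * (G * d) = P * (G1 * Z)" and M1: "G1 * (M1 * (Sg * Z)) = G1 * Z"
    and Ab: "Ab = P * (A - G1 * M1 * C1) - M * T2 * Cd" and Bb: "Bb = P * (B - G1 * M1 * D1) - M * T2 * Dd"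
  shows "P * (A * X + B * U + G * d + W * w) + - (M' * C2 + M * (T2 * Cd)) * X - (M * (T2 * V') + M' * (T2 * V))
      - ((Ab - L * C2) * (X - E) + (Bb - L * D2) * U + P * G1 * M1 * (T1 * Y) + L * (T2 * Y) - M' * T2 * Y
        - - (M' * D2 + M * (T2 * Dd)) * U)
    = (Ab - L * C2) * E + (P * W * w - P * G1 * M1 * (T1 * V) - M * T2 * V' - L * (T2 * V))"
  unfolding mult.assoc[of M' T2 Y] T2Y T1Y Ab Bb by (simp add: algebra_simps PG M1)

context alise_data
begin

lemma signal_images:
  assumes t: "a \<le> t" and w: "w \<in> carrier_vec (nw S)" and v: "v \<in> carrier_vec l" and vd: "vd \<in> carrier_vec l"
  shows "v2 S t v \<in> carrier_vec l2" "fv (v2 S t v) = fm (T2 S t) * fv v"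
    "wbar S t w v vd \<in> carrier_vec n"
    "fv (wbar S t w v vd) = fm (Proj S t) * fm (mW S t) * fv w
      - fm (Proj S t) * fm (G1 S t) * fm (M1 S t) * (fm (T1 S t) * fv v)
      - fm (G2 S t) * fm (M2 S t) * fm (T2 S t) * fv vd"
    "we S t w v vd \<in> carrier_vec n"
    "fv (we S t w v vd) = fm (Kmix S t) * (fm (T2 S t) * fv v) + fv (wbar S t w v vd)"
proof -
  note d = dims[OF t] carrier_vecD[OF w] carrier_vecD[OF v] carrier_vecD[OF vd]
  note r = fm_times fv_mult_mat fv_add' fv_diff' d
  show 1: "v2 S t v \<in> carrier_vec l2" by (intro carrier_vecI; simp add: v2_def d)
  show 2: "fv (v2 S t v) = fm (T2 S t) * fv v" by (simp add: v2_def r)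
  show 3: "wbar S t w v vd \<in> carrier_vec n" by (intro carrier_vecI; simp add: wbar_def d)
  show "fv (wbar S t w v vd) = fm (Proj S t) * fm (mW S t) * fv w
      - fm (Proj S t) * fm (G1 S t) * fm (M1 S t) * (fm (T1 S t) * fv v)
      - fm (G2 S t) * fm (M2 S t) * fm (T2 S t) * fv vd"
    by (simp add: wbar_def r mult.assoc)
  show "we S t w v vd \<in> carrier_vec n" by (intro carrier_vecI; simp add: we_def carrier_vecD[OF 3])
  show "fv (we S t w v vd) = fm (Kmix S t) * (fm (T2 S t) * fv v) + fv (wbar S t w v vd)"
    by (simp add: we_def fv_add' fv_mult_mat d carrier_vecD[OF 1] carrier_vecD[OF 3] 2)
qed

text \<open>Since \<open>Kmix (C2 xe - ye + v2) = 0\<close> along every solution, adding this term does not change the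
  solutions; it is chosen to remove the correlation between the two noises.\<close>

lemma correlated_iff_equiv:
  assumes s: "\<And>t. a \<le> t \<Longrightarrow> w t \<in> carrier_vec (nw S)" "\<And>t. a \<le> t \<Longrightarrow> v t \<in> carrier_vec l"
    "\<And>t. a \<le> t \<Longrightarrow> vd t \<in> carrier_vec l"
  shows "correlated_system S w v vd xe ye \<longleftrightarrow> equiv_system S w v vd xe ye"
proof -
  have key: "Ae S t *\<^sub>v xe t + ue S t (C2 S t *\<^sub>v xe t + v2 S t (v t)) + we S t (w t) (v t) (vd t)
      = Abar S t *\<^sub>v xe t + wbar S t (w t) (v t) (vd t)" if t: "a \<le> t" and x: "xe t \<in> carrier_vec n" for t
  proof (rule fv_inject[of _ n])
    note i = signal_images[OF t s[OF t]]
    note d = dims[OF t] carrier_vecD[OF x] i(1,3,5)[THEN carrier_vecD]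
    show "Ae S t *\<^sub>v xe t + ue S t (C2 S t *\<^sub>v xe t + v2 S t (v t)) + we S t (w t) (v t) (vd t) \<in> carrier_vec n"
      "Abar S t *\<^sub>v xe t + wbar S t (w t) (v t) (vd t) \<in> carrier_vec n"
      by (intro carrier_vecI; simp add: d)+
    show "fv (Ae S t *\<^sub>v xe t + ue S t (C2 S t *\<^sub>v xe t + v2 S t (v t)) + we S t (w t) (v t) (vd t))
      = fv (Abar S t *\<^sub>v xe t + wbar S t (w t) (v t) (vd t))"
      by (simp add: fv_add' fv_mult_mat fv_uminus ue_def d i(2,6) images(27)[OF t] algebra_simps)
  qed
  have cg: "(\<forall>t\<ge>a. p t \<and> q t \<and> r t) \<longleftrightarrow> (\<forall>t\<ge>a. p t \<and> q' t \<and> r t)"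
    if "\<And>t. a \<le> t \<Longrightarrow> p t \<Longrightarrow> r t \<Longrightarrow> q t = q' t" for p q q' r
    using that by blast
  show ?thesis
    unfolding correlated_system_def equiv_system_def by (rule cg) (simp add: key)
qed

lemma equiv_error:
  assumes s: "\<And>t. a \<le> t \<Longrightarrow> w t \<in> carrier_vec (nw S)" "\<And>t. a \<le> t \<Longrightarrow> v t \<in> carrier_vec l"
    "\<And>t. a \<le> t \<Longrightarrow> vd t \<in> carrier_vec l"
    and eq: "equiv_system S w v vd xe ye" and kb: "equiv_kalman_bucy S ye xh"
  shows "error_dynamics S w v vd (\<lambda>t. xe t - xh t)"
  unfolding error_dynamics_def
proof (intro allI impI conjI)
  have xe: "xe t \<in> carrier_vec n" "has_vderiv a xe (Ae S t *\<^sub>v xe t + ue S t (ye t) + we S t (w t) (v t) (vd t)) t"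
    "ye t = C2 S t *\<^sub>v xe t + v2 S t (v t)" if "a \<le> t" for t
    using eq that by (auto simp: equiv_system_def)
  have xh: "xh t \<in> carrier_vec n" "has_vderiv a xh (Ae S t *\<^sub>v xh t + ue S t (ye t) + Le S t *\<^sub>v (ye t - C2 S t *\<^sub>v xh t)) t"
    if "a \<le> t" for t
    using kb that by (auto simp: equiv_kalman_bucy_def)
  fix t assume t: "a \<le> t"
  note i = signal_images[OF t s[OF t]]
  note d = dims[OF t] carrier_vecD[OF xe(1)[OF t]] carrier_vecD[OF xh(1)[OF t]] i(1,3,5)[THEN carrier_vecD]
  show "xe t - xh t \<in> carrier_vec n" using xe(1)[OF t] xh(1)[OF t] by simp
  show "has_vderiv a (\<lambda>t. xe t - xh t) ((Abar S t - L S t * C2 S t) *\<^sub>v (xe t - xh t)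
      + (wbar S t (w t) (v t) (vd t) - L S t *\<^sub>v v2 S t (v t))) t"
  proof (rule has_vderiv_of_fv[OF _ t, where n = n and Y = "\<lambda>t. fv (xe t) - fv (xh t)"])
    show "fv (xe s) - fv (xh s) = fv (xe s - xh s)" if "a \<le> s" for s
      using fv_diff[OF xe(1)[OF that] xh(1)[OF that]] by simp
    show "xe s - xh s \<in> carrier_vec n" if "a \<le> s" for s using xe(1)[OF that] xh(1)[OF that] by simp
    show "(Abar S t - L S t * C2 S t) *\<^sub>v (xe t - xh t)
      + (wbar S t (w t) (v t) (vd t) - L S t *\<^sub>v v2 S t (v t)) \<in> carrier_vec n"
      by (intro carrier_vecI; simp add: d)
    have "((\<lambda>t. fv (xe t) - fv (xh t)) has_vector_derivative
        fv (Ae S t *\<^sub>v xe t + ue S t (ye t) + we S t (w t) (v t) (vd t))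
        - fv (Ae S t *\<^sub>v xh t + ue S t (ye t) + Le S t *\<^sub>v (ye t - C2 S t *\<^sub>v xh t))) (at t within {a..})"
      by (intro has_vector_derivative_diff has_vderiv_fv[OF xe(2)[OF t] t xe(1)] has_vderiv_fv[OF xh(2)[OF t] t xh(1)])
    also have "fv (Ae S t *\<^sub>v xe t + ue S t (ye t) + we S t (w t) (v t) (vd t))
        - fv (Ae S t *\<^sub>v xh t + ue S t (ye t) + Le S t *\<^sub>v (ye t - C2 S t *\<^sub>v xh t))
      = fv ((Abar S t - L S t * C2 S t) *\<^sub>v (xe t - xh t) + (wbar S t (w t) (v t) (vd t) - L S t *\<^sub>v v2 S t (v t)))"
      unfolding xe(3)[OF t]
      by (simp add: fv_add' fv_diff' fm_diff' fm_times fv_mult_mat fv_uminus ue_def d i(2,6) images(27)[OF t]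
          L_split[OF t] algebra_simps)
    finally show "((\<lambda>t. fv (xe t) - fv (xh t)) has_vector_derivative
      fv ((Abar S t - L S t * C2 S t) *\<^sub>v (xe t - xh t) + (wbar S t (w t) (v t) (vd t) - L S t *\<^sub>v v2 S t (v t))))
      (at t within {a..})" .
  qed
qed

text \<open>The output enters the estimate only through \<open>T2 y\<close>, which does not contain the unknown input.
  Hence the error is \<open>Proj x - G2 M2 T2 v - \<theta>\<close>; differentiating it, the projection removes \<open>G2 d2\<close>
  and the term driven by \<open>T1 y\<close> in the filter removes \<open>G1 d1\<close>.\<close>

lemma filter_error:
  assumes s: "\<And>t. a \<le> t \<Longrightarrow> w t \<in> carrier_vec (nw S)" "\<And>t. a \<le> t \<Longrightarrow> v t \<in> carrier_vec l"
    "\<And>t. a \<le> t \<Longrightarrow> vd t \<in> carrier_vec l"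
    and ud: "\<And>t. a \<le> t \<Longrightarrow> u t \<in> carrier_vec (nu S)" "\<And>t. a \<le> t \<Longrightarrow> d t \<in> carrier_vec (nd S)"
    and v': "\<And>t. a \<le> t \<Longrightarrow> has_vderiv a v (vd t) t"
    and x: "\<And>t. a \<le> t \<Longrightarrow> x t \<in> carrier_vec n"
      "\<And>t. a \<le> t \<Longrightarrow> has_vderiv a x (mA S t *\<^sub>v x t + mB S t *\<^sub>v u t + mG S t *\<^sub>v d t + mW S t *\<^sub>v w t) t"
    and y: "\<And>t. a \<le> t \<Longrightarrow> y t = mC S t *\<^sub>v x t + mD S t *\<^sub>v u t + mH S t *\<^sub>v d t + v t"
    and \<theta>: "\<And>t. a \<le> t \<Longrightarrow> \<theta> t \<in> carrier_vec n"
      "\<And>t. a \<le> t \<Longrightarrow> has_vderiv a \<theta>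
        ((Abar S t - L S t * C2 S t) *\<^sub>v xhat S t (y t) (u t) (\<theta> t) + (Bbar S t - L S t * D2 S t) *\<^sub>v u t
          + (Gbar S t * M1 S t) *\<^sub>v (T1 S t *\<^sub>v y t) + L S t *\<^sub>v (T2 S t *\<^sub>v y t)
          - mderiv a (Phi1 S) t *\<^sub>v y t - mderiv a (Phi2 S) t *\<^sub>v u t) t"
  shows "error_dynamics S w v vd (\<lambda>t. x t - xhat S t (y t) (u t) (\<theta> t))"
  unfolding error_dynamics_def
proof (intro allI impI conjI)
  define N where "N t = fm (G2 S t) * fm (M2 S t)" for t
  define e where "e t = fm (Proj S t) * fv (x t) - N t * (fm (T2 S t) * fv (v t)) - fv (\<theta> t)" for t
  have dim: "dim_vec (w t) = nw S" "dim_vec (v t) = l" "dim_vec (vd t) = l" "dim_vec (u t) = nu S"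
    "dim_vec (d t) = nd S" "dim_vec (x t) = n" "dim_vec (\<theta> t) = n" "dim_vec (y t) = l"
    "dim_vec (xhat S t (y t) (u t) (\<theta> t)) = n" if "a \<le> t" for t
    using carrier_vecD[OF s(1)[OF that]] carrier_vecD[OF s(2)[OF that]] carrier_vecD[OF s(3)[OF that]]
      carrier_vecD[OF ud(1)[OF that]] carrier_vecD[OF ud(2)[OF that]] carrier_vecD[OF x(1)[OF that]]
      carrier_vecD[OF \<theta>(1)[OF that]] by (simp_all add: y[OF that] xhat_def dims[OF that])
  have yi: "fv (y t) = fm (mC S t) * fv (x t) + fm (mD S t) * fv (u t) + fm (mH S t) * fv (d t) + fv (v t)"
    if "a \<le> t" for t
    unfolding y[OF that] by (simp add: fv_add' fv_mult_mat dims[OF that] dim[OF that])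
  have T2y: "fm (T2 S t) * fv (y t) = fm (C2 S t) * fv (x t) + fm (D2 S t) * fv (u t) + fm (T2 S t) * fv (v t)"
    if t: "a \<le> t" for t
    by (simp add: yi[OF t] distrib_left mult.assoc[symmetric] decoupling(2)[OF t] images(8,10)[OF t])
  have T1y: "fm (T1 S t) * fv (y t) = fm (C1 S t) * fv (x t) + fm (D1 S t) * fv (u t)
      + fm (mSg S t) * (adj (fm (mV1 S t)) * fv (d t)) + fm (T1 S t) * fv (v t)" if t: "a \<le> t" for t
    by (simp add: yi[OF t] distrib_left mult.assoc[symmetric] decoupling(1)[OF t] images(7,9)[OF t])
  have xh: "fv (xhat S t (y t) (u t) (\<theta> t)) = fv (x t) - e t" if t: "a \<le> t" for t
  proof -
    have "fv (xhat S t (y t) (u t) (\<theta> t)) = N t * (fm (T2 S t) * fv (y t)) - N t * fm (D2 S t) * fv (u t) + fv (\<theta> t)"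
      by (simp add: xhat_def N_def fv_add' fv_diff' fv_mult_mat fm_times dims[OF t] dim[OF t])
    also have "\<dots> = fv (x t) - e t"
      using un_times[OF shape_fv[OF x(1)[OF t]]]
      by (simp add: T2y[OF t] e_def images(18)[OF t] N_def[symmetric] algebra_simps)
    finally show ?thesis .
  qed
  have ei: "e t = fv (x t - xhat S t (y t) (u t) (\<theta> t))" if "a \<le> t" for t
    using xh[OF that] by (simp add: fv_diff' dim[OF that])
  fix t assume t: "a \<le> t"
  note i = signal_images[OF t s[OF t]]
  note D = dims[OF t] dim[OF t] i(1,3)[THEN carrier_vecD]
  show ec: "x t - xhat S t (y t) (u t) (\<theta> t) \<in> carrier_vec n" if "a \<le> t" for t
    by (intro carrier_vecI) (simp add: dim[OF that])
  obtain N' where N': "(N has_vector_derivative N') (at t within {a..})"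
    using diffb_mult[OF diffb_first(3) diffb_M2] t unfolding diffb_def N_def by blast
  have T2': "((\<lambda>t. fm (T2 S t)) has_vector_derivative 0) (at t within {a..})"
    by (rule has_vector_derivative_cong_Ici[OF has_vector_derivative_adj[OF U2_deriv[OF t]] t images(4), simplified])
  have C2': "((\<lambda>t. fm (C2 S t)) has_vector_derivative fm (T2 S t) * fm (Cdot S t)) (at t within {a..})"
    using has_vector_derivative_cong_Ici[OF has_vector_derivative_mult[OF T2' C_deriv[OF t]] t images(8)] by simp
  have D2': "((\<lambda>t. fm (D2 S t)) has_vector_derivative fm (T2 S t) * fm (Ddot S t)) (at t within {a..})"
    using has_vector_derivative_cong_Ici[OF has_vector_derivative_mult[OF T2' D_deriv[OF t]] t images(10)] by simp
  have P': "((\<lambda>t. fm (Proj S t)) has_vector_derivative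
      - (N' * fm (C2 S t) + N t * (fm (T2 S t) * fm (Cdot S t)))) (at t within {a..})"
    by (rule has_vector_derivative_cong_Ici[OF _ t images(18)], unfold N_def[symmetric],
        rule has_vector_derivative_eq_rhs[OF has_vector_derivative_diff[OF has_vector_derivative_const
            has_vector_derivative_mult[OF N' C2']]]) simp_all
  have "((\<lambda>t. fm (Phi1 S t)) has_vector_derivative N' * fm (T2 S t)) (at t within {a..})"
    by (rule has_vector_derivative_cong_Ici[OF _ t images(24)], unfold N_def[symmetric],
        rule has_vector_derivative_eq_rhs[OF has_vector_derivative_mult[OF N' T2']]) simp_all
  note p1 = fm_mderiv[OF this t derived_carrier(30)]
  have "((\<lambda>t. fm (Phi2 S t)) has_vector_derivative - (N' * fm (D2 S t) + N t * (fm (T2 S t) * fm (Ddot S t))))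
      (at t within {a..})"
    by (rule has_vector_derivative_cong_Ici[OF _ t images(25)], unfold N_def[symmetric],
        rule has_vector_derivative_eq_rhs[OF has_vector_derivative_minus[OF has_vector_derivative_mult[OF N' D2']]])
      simp_all
  note p2 = fm_mderiv[OF this t derived_carrier(31)]
  let ?x' = "fm (mA S t) * fv (x t) + fm (mB S t) * fv (u t) + fm (mG S t) * fv (d t) + fm (mW S t) * fv (w t)"
  have x': "((\<lambda>t. fv (x t)) has_vector_derivative ?x') (at t within {a..})"
    using has_vderiv_fv[OF x(2)[OF t] t x(1)] by (simp add: fv_add' fv_mult_mat D)
  have \<theta>': "((\<lambda>t. fv (\<theta> t)) has_vector_derivative (fm (Abar S t) - fm (L S t) * fm (C2 S t)) * (fv (x t) - e t)
      + (fm (Bbar S t) - fm (L S t) * fm (D2 S t)) * fv (u t)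
      + fm (Proj S t) * fm (G1 S t) * fm (M1 S t) * (fm (T1 S t) * fv (y t)) + fm (L S t) * (fm (T2 S t) * fv (y t))
      - N' * fm (T2 S t) * fv (y t)
      - - (N' * fm (D2 S t) + N t * (fm (T2 S t) * fm (Ddot S t))) * fv (u t)) (at t within {a..})"
    using has_vderiv_fv[OF \<theta>(2)[OF t] t \<theta>(1)]
    by (simp add: fv_add' fv_diff' fv_mult_mat fm_diff' fm_times D p1(1) p2(1) carrier_matD[OF p1(2)] carrier_matD[OF p2(2)]
        xh[OF t] images(21)[OF t])
  have Gd: "fm (Proj S t) * (fm (mG S t) * fv (d t)) = fm (Proj S t) * (fm (G1 S t) * (adj (fm (mV1 S t)) * fv (d t)))"
  proof -
    have "fv (d t) = (fm (mV1 S t) * adj (fm (mV1 S t)) + fm (mV2 S t) * adj (fm (mV2 S t))) * fv (d t)"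
      unfolding U_blocks(4)[OF t] using un_times[OF shape_fv[OF ud(2)[OF t]]] by simp
    then have "fm (mG S t) * fv (d t) = fm (mG S t) * ((fm (mV1 S t) * adj (fm (mV1 S t))
        + fm (mV2 S t) * adj (fm (mV2 S t))) * fv (d t))"
      by (rule arg_cong)
    also have "\<dots> = fm (G1 S t) * (adj (fm (mV1 S t)) * fv (d t)) + fm (G2 S t) * (adj (fm (mV2 S t)) * fv (d t))"
      unfolding images(5,6)[OF t] by (simp add: algebra_simps)
    finally show ?thesis using Proj_G2[OF t] by (simp add: distrib_left mult.assoc[symmetric])
  qed
  have M1: "fm (G1 S t) * (fm (M1 S t) * (fm (mSg S t) * (adj (fm (mV1 S t)) * fv (d t))))
      = fm (G1 S t) * (adj (fm (mV1 S t)) * fv (d t))"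
  proof -
    have "fm (G1 S t) * (fm (M1 S t) * (fm (mSg S t) * Z)) = fm (G1 S t) * (fm (M1 S t) * fm (mSg S t)) * Z" for Z
      by (simp add: mult.assoc)
    then show ?thesis by (simp add: M1_inverse[OF t] un_image[OF t])
  qed
  have Ab: "fm (Abar S t) = fm (Proj S t) * (fm (mA S t) - fm (G1 S t) * fm (M1 S t) * fm (C1 S t))
      - N t * fm (T2 S t) * fm (Cdot S t)"
    unfolding images(19,16)[OF t] N_def ..
  have Bb: "fm (Bbar S t) = fm (Proj S t) * (fm (mB S t) - fm (G1 S t) * fm (M1 S t) * fm (D1 S t))
      - N t * fm (T2 S t) * fm (Ddot S t)"
    unfolding images(20)[OF t] N_def ..
  have Tv: "((\<lambda>t. fm (T2 S t) * fv (v t)) has_vector_derivative fm (T2 S t) * fv (vd t)) (at t within {a..})"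
    using has_vector_derivative_mult[OF T2' has_vderiv_fv[OF v'[OF t] t s(2)]] by simp
  show "has_vderiv a (\<lambda>t. x t - xhat S t (y t) (u t) (\<theta> t))
      ((Abar S t - L S t * C2 S t) *\<^sub>v (x t - xhat S t (y t) (u t) (\<theta> t))
        + (wbar S t (w t) (v t) (vd t) - L S t *\<^sub>v v2 S t (v t))) t"
  proof (rule has_vderiv_of_fv[OF _ t ei, where n = n])
    have "(e has_vector_derivative fm (Proj S t) * ?x'
        + - (N' * fm (C2 S t) + N t * (fm (T2 S t) * fm (Cdot S t))) * fv (x t)
        - (N t * (fm (T2 S t) * fv (vd t)) + N' * (fm (T2 S t) * fv (v t)))
        - ((fm (Abar S t) - fm (L S t) * fm (C2 S t)) * (fv (x t) - e t)
      + (fm (Bbar S t) - fm (L S t) * fm (D2 S t)) * fv (u t)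
      + fm (Proj S t) * fm (G1 S t) * fm (M1 S t) * (fm (T1 S t) * fv (y t)) + fm (L S t) * (fm (T2 S t) * fv (y t))
      - N' * fm (T2 S t) * fv (y t)
      - - (N' * fm (D2 S t) + N t * (fm (T2 S t) * fm (Ddot S t))) * fv (u t))) (at t within {a..})"
      unfolding e_def[abs_def]
      by (intro has_vector_derivative_diff has_vector_derivative_mult P' x' N' Tv \<theta>'[unfolded e_def])
    from this[unfolded error_identity[OF T2y[OF t] T1y[OF t] Gd M1 Ab Bb]]
    show "(e has_vector_derivative fv ((Abar S t - L S t * C2 S t) *\<^sub>v (x t - xhat S t (y t) (u t) (\<theta> t))
        + (wbar S t (w t) (v t) (vd t) - L S t *\<^sub>v v2 S t (v t)))) (at t within {a..})"
      by (simp add: fv_add' fv_diff' fv_mult_mat fm_diff' fm_times D i(2,4) xh[OF t] N_def mult.assoc)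
    show "(Abar S t - L S t * C2 S t) *\<^sub>v (x t - xhat S t (y t) (u t) (\<theta> t))
        + (wbar S t (w t) (v t) (vd t) - L S t *\<^sub>v v2 S t (v t)) \<in> carrier_vec n"
      by (intro carrier_vecI; simp add: D)
  qed (use ec in auto)
qed

subsection \<open>Covariances\<close>

text \<open>The case \<open>k = 0\<close> yields the covariance of \<open>wbar\<close>, the case \<open>k = Kmix\<close> that of \<open>we\<close>. Because of
\<open>T1 R T2^T = 0\<close> the additional term \<open>k v2\<close> is correlated only with the part of \<open>wbar\<close> that contains the
velocity of \<open>v\<close>.\<close>

lemma noise_covariance_image:
  fixes k :: fsmat
  assumes t: "a \<le> t"
  defines "X \<equiv> fm (Proj S t) * fm (mW S t)"
    and "Y \<equiv> k * fm (T2 S t) * fm (sel_v S) - fm (Proj S t) * fm (G1 S t) * fm (M1 S t) * fm (T1 S t) * fm (sel_v S)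
      - fm (G2 S t) * fm (M2 S t) * fm (T2 S t) * fm (sel_vd S)"
    and "c \<equiv> k * fm (Rgrave2 S t) * adj (fm (M2 S t)) * adj (fm (G2 S t))"
  shows "X * fm (mPw S t) * adj X + Y * fm (mPv S t) * adj Y
    = fm (Qbar S t) + fm (Xi S t) + adj (fm (Xi S t)) + k * fm (R2 S t) * adj k - c - adj c"
proof -
  let ?s = "fm (sel_v S)" and ?sd = "fm (sel_vd S)" and ?V = "fm (mPv S t)"
    and ?T = "fm (T1 S t)" and ?U = "fm (T2 S t)"
  have z: "?T * (?s * (?V * (adj ?s * adj ?U))) = 0"
    using decoupling(3)[OF t] by (simp add: images(1)[OF t] mult.assoc)
  then have "adj (?T * (?s * (?V * (adj ?s * adj ?U)))) = 0" by simp
  then have z': "?U * (?s * (?V * (adj ?s * adj ?T))) = 0"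
    by (simp add: adj_covariances[OF t] mult.assoc)
  have zz: "?T * (?s * (?V * (adj ?s * (adj ?U * x)))) = 0" "?U * (?s * (?V * (adj ?s * (adj ?T * x)))) = 0" for x
    using arg_cong[OF z, of "\<lambda>y. y * x"] arg_cong[OF z', of "\<lambda>y. y * x"] by (simp_all add: mult.assoc)
  show ?thesis
    unfolding X_def Y_def c_def images(22,17,29,11,12,13,14,15)[OF t] images(1,2,3)[OF t]
    by (simp add: algebra_simps zz adj_covariances[OF t])
qed

text \<open>For \<open>k = Kmix\<close> the terms \<open>k R2 k^T\<close>, \<open>c\<close> and \<open>c^T\<close> of the preceding lemma coincide, so that one of them
remains with a negative sign: this is the difference of \<open>Qbar\<close> and \<open>Qe\<close>.\<close>

lemma wbar_covariance:
  assumes p: "prob_space M" and t: "a \<le> t" and w: "rand_vec M (nw S) w" and vv: "rand_vec M (l + l) vv"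
    and C: "cov_mat M (nw S) (nw S) w w = mPw S t" "cov_mat M (l + l) (l + l) vv vv = mPv S t"
      "cov_mat M (nw S) (l + l) w vv = 0\<^sub>m (nw S) (l + l)"
  defines "v \<equiv> \<lambda>\<omega>. vec_first (vv \<omega>) l" and "vd \<equiv> \<lambda>\<omega>. vec_last (vv \<omega>) l"
  shows "cov_mat M n n (\<lambda>\<omega>. wbar S t (w \<omega>) (v \<omega>) (vd \<omega>)) (\<lambda>\<omega>. wbar S t (w \<omega>) (v \<omega>) (vd \<omega>))
      = Qbar S t + Xi S t + transpose_mat (Xi S t)"
    and "cov_mat M n n (\<lambda>\<omega>. we S t (w \<omega>) (v \<omega>) (vd \<omega>)) (\<lambda>\<omega>. we S t (w \<omega>) (v \<omega>) (vd \<omega>))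
      = Qe S t + Xi S t + transpose_mat (Xi S t)"
proof -
  interpret prob_space M by (rule p)
  note d = dims[OF t]
  define X where "X = Proj S t * mW S t"
  define Y where "Y k = k * T2 S t * sel_v S - Proj S t * G1 S t * M1 S t * T1 S t * sel_v S
    - G2 S t * M2 S t * T2 S t * sel_vd S" for k
  have Xc: "X \<in> carrier_mat n (nw S)" by (intro carrier_matI; simp add: X_def d)
  have Yc: "Y k \<in> carrier_mat n (l + l)" if "k \<in> carrier_mat n l2" for k
    using carrier_matD[OF that] by (intro carrier_matI; simp add: Y_def d)
  have Xf: "fm X = fm (Proj S t) * fm (mW S t)" by (simp add: X_def fm_times d)
  have Yf: "fm (Y k) = fm k * fm (T2 S t) * fm (sel_v S)
      - fm (Proj S t) * fm (G1 S t) * fm (M1 S t) * fm (T1 S t) * fm (sel_v S)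
      - fm (G2 S t) * fm (M2 S t) * fm (T2 S t) * fm (sel_vd S)" if "k \<in> carrier_mat n l2" for k
    using carrier_matD[OF that] by (simp add: Y_def fm_times fm_diff' d)
  have cov: "fm (cov_mat M n n U U) = fm (Qbar S t) + fm (Xi S t) + adj (fm (Xi S t)) + fm k * fm (R2 S t) * adj (fm k)
      - fm k * fm (Rgrave2 S t) * adj (fm (M2 S t)) * adj (fm (G2 S t))
      - adj (fm k * fm (Rgrave2 S t) * adj (fm (M2 S t)) * adj (fm (G2 S t)))"
    if k: "k \<in> carrier_mat n l2" and U: "\<And>\<omega>. \<omega> \<in> space M \<Longrightarrow> U \<omega> = X *\<^sub>v w \<omega> + Y k *\<^sub>v vv \<omega>" for k U
  proof -
    have "cov_mat M n n U U = cov_mat M n n (\<lambda>\<omega>. X *\<^sub>v w \<omega> + Y k *\<^sub>v vv \<omega>) (\<lambda>\<omega>. X *\<^sub>v w \<omega> + Y k *\<^sub>v vv \<omega>)"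
      by (rule cov_mat_cong) (use U in auto)
    then have "fm (cov_mat M n n U U) = fm X * fm (mPw S t) * adj (fm X) + fm (Y k) * fm (mPv S t) * adj (fm (Y k))"
      by (simp add: cov_mat_linear[OF Xc Yc[OF k] w vv] C fm_zero)
    also have "\<dots> = fm (Qbar S t) + fm (Xi S t) + adj (fm (Xi S t)) + fm k * fm (R2 S t) * adj (fm k)
      - fm k * fm (Rgrave2 S t) * adj (fm (M2 S t)) * adj (fm (G2 S t))
      - adj (fm k * fm (Rgrave2 S t) * adj (fm (M2 S t)) * adj (fm (G2 S t)))"
      unfolding Xf Yf[OF k] by (rule noise_covariance_image[OF t])
    finally show ?thesis .
  qed
  have sig: "w \<omega> \<in> carrier_vec (nw S)" "v \<omega> \<in> carrier_vec l" "vd \<omega> \<in> carrier_vec l"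
    "fv (v \<omega>) = fm (sel_v S) * fv (vv \<omega>)" "fv (vd \<omega>) = fm (sel_vd S) * fv (vv \<omega>)" "vv \<omega> \<in> carrier_vec (l + l)"
    if \<omega>: "\<omega> \<in> space M" for \<omega>
  proof -
    show "w \<omega> \<in> carrier_vec (nw S)" by (rule rand_vec_carrier[OF w \<omega>])
    show vc: "vv \<omega> \<in> carrier_vec (l + l)" by (rule rand_vec_carrier[OF vv \<omega>])
    show "v \<omega> \<in> carrier_vec l" "vd \<omega> \<in> carrier_vec l"
      by (auto simp: v_def vd_def vec_first_def vec_last_def)
    show "fv (v \<omega>) = fm (sel_v S) * fv (vv \<omega>)" "fv (vd \<omega>) = fm (sel_vd S) * fv (vv \<omega>)"
      using sel_image[OF vc, symmetric] carrier_vecD[OF vc] by (simp_all add: v_def vd_def fv_mult_mat d)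
  qed
  have path: "fv (X *\<^sub>v w \<omega> + Y k *\<^sub>v vv \<omega>) = fm X * fv (w \<omega>) + fm (Y k) * fv (vv \<omega>)"
    "X *\<^sub>v w \<omega> + Y k *\<^sub>v vv \<omega> \<in> carrier_vec n"
    if "\<omega> \<in> space M" "k \<in> carrier_mat n l2" for \<omega> k
    using carrier_matD[OF Xc] carrier_matD[OF Yc[OF that(2)]] carrier_vecD[OF sig(1)[OF that(1)]] carrier_vecD[OF sig(6)[OF that(1)]]
    by (auto simp: fv_add' fv_mult_mat intro!: carrier_vecI)
  show "cov_mat M n n (\<lambda>\<omega>. wbar S t (w \<omega>) (v \<omega>) (vd \<omega>)) (\<lambda>\<omega>. wbar S t (w \<omega>) (v \<omega>) (vd \<omega>))
      = Qbar S t + Xi S t + transpose_mat (Xi S t)"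
  proof (rule fm_inject[of _ n n])
    have 0: "0\<^sub>m n l2 \<in> carrier_mat n l2" by simp
    have "wbar S t (w \<omega>) (v \<omega>) (vd \<omega>) = X *\<^sub>v w \<omega> + Y (0\<^sub>m n l2) *\<^sub>v vv \<omega>" if \<omega>: "\<omega> \<in> space M" for \<omega>
    proof (rule fv_inject[of _ n])
      note i = signal_images[OF t sig(1-3)[OF \<omega>]]
      show "wbar S t (w \<omega>) (v \<omega>) (vd \<omega>) \<in> carrier_vec n" by (rule i)
      show "fv (wbar S t (w \<omega>) (v \<omega>) (vd \<omega>)) = fv (X *\<^sub>v w \<omega> + Y (0\<^sub>m n l2) *\<^sub>v vv \<omega>)"
        unfolding path(1)[OF \<omega> 0] i(4) Xf Yf[OF 0] by (simp add: sig(4,5)[OF \<omega>] fm_zero algebra_simps)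
    qed (rule path(2)[OF \<omega> 0])
    from cov[OF 0 this] show "fm (cov_mat M n n (\<lambda>\<omega>. wbar S t (w \<omega>) (v \<omega>) (vd \<omega>)) (\<lambda>\<omega>. wbar S t (w \<omega>) (v \<omega>) (vd \<omega>)))
      = fm (Qbar S t + Xi S t + transpose_mat (Xi S t))"
      by (simp add: fm_zero fm_add' fm_transpose d)
  qed (auto simp: cov_mat_carrier d intro!: carrier_matI)
  have K: "Kmix S t \<in> carrier_mat n l2" by (rule derived_carrier(32)[OF t])
  show "cov_mat M n n (\<lambda>\<omega>. we S t (w \<omega>) (v \<omega>) (vd \<omega>)) (\<lambda>\<omega>. we S t (w \<omega>) (v \<omega>) (vd \<omega>))
      = Qe S t + Xi S t + transpose_mat (Xi S t)"
  proof (rule fm_inject[of _ n n])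
    have path_eq: "we S t (w \<omega>) (v \<omega>) (vd \<omega>) = X *\<^sub>v w \<omega> + Y (Kmix S t) *\<^sub>v vv \<omega>" if \<omega>: "\<omega> \<in> space M" for \<omega>
    proof (rule fv_inject[of _ n])
      note i = signal_images[OF t sig(1-3)[OF \<omega>]]
      show "we S t (w \<omega>) (v \<omega>) (vd \<omega>) \<in> carrier_vec n" by (rule i)
      show "fv (we S t (w \<omega>) (v \<omega>) (vd \<omega>)) = fv (X *\<^sub>v w \<omega> + Y (Kmix S t) *\<^sub>v vv \<omega>)"
        unfolding path(1)[OF \<omega> K] i(6) i(4) Xf Yf[OF K] by (simp add: sig(4,5)[OF \<omega>] algebra_simps)
    qed (rule path(2)[OF \<omega> K])
    let ?k = "fm (Kmix S t)" and ?c = "fm (Kmix S t) * fm (Rgrave2 S t) * adj (fm (M2 S t)) * adj (fm (G2 S t))"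
    note R = R2_inverse[OF t]
    have ub: "un l2 * (fm (minv (R2 S t)) * x) = fm (minv (R2 S t)) * x" for x
      by (simp add: mult.assoc[symmetric] R)
    have rb: "fm (R2 S t) * (fm (minv (R2 S t)) * x) = un l2 * x" for x
      by (simp add: mult.assoc[symmetric] R)
    have br: "fm (minv (R2 S t)) * (un l2 * x) = fm (minv (R2 S t)) * x" for x
      by (simp add: mult.assoc[symmetric] R)
    have kk: "?k * fm (R2 S t) * adj ?k = ?c" "adj ?c = ?c"
      unfolding images(26)[OF t] by (simp_all add: R rb br ub mult.assoc)
    from cov[OF K path_eq, unfolded kk] show "fm (cov_mat M n n (\<lambda>\<omega>. we S t (w \<omega>) (v \<omega>) (vd \<omega>)) (\<lambda>\<omega>. we S t (w \<omega>) (v \<omega>) (vd \<omega>)))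
      = fm (Qe S t + Xi S t + transpose_mat (Xi S t))"
      by (simp add: fm_add' fm_transpose d images(28)[OF t])
  qed (auto simp: cov_mat_carrier d intro!: carrier_matI)
qed

end

context prob_space
begin

text \<open>The value of the form at \<open>x\<close> is the variance of the scalar \<open>x \<bullet> X\<close>.\<close>

lemma cov_mat_psd:
  assumes X: "rand_vec M n X"
  shows "psd n (cov_mat M n n X X)"
proof -
  let ?C = "cov_mat M n n X X"
  have "0 \<le> x \<bullet> (?C *\<^sub>v x)" if x: "x \<in> carrier_vec n" for x
  proof -
    define A where "A = mat 1 n (\<lambda>(_,j). x $ j)"
    have A: "A \<in> carrier_mat 1 n" by (simp add: A_def)
    have fA: "fm A = adj (fv x)" by (rule fsmat_eqI) (use x in \<open>auto simp: ent_fm ent_fv A_def\<close>)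
    have z: "0\<^sub>m 1 n \<in> carrier_mat 1 n" by simp
    let ?U = "\<lambda>\<omega>. A *\<^sub>v X \<omega> + 0\<^sub>m 1 n *\<^sub>v X \<omega>"
    have "fm (cov_mat M 1 1 ?U ?U) = adj (fv x) * (fm ?C * fv x)"
      using cov_mat_linear[OF A z X X] by (simp add: fA fm_zero mult.assoc)
    moreover have "0 \<le> ent (fm (cov_mat M 1 1 ?U ?U)) 0 0"
      by (simp add: ent_fm cov_mat_def)
    moreover have "ent (adj (fv x) * (fm ?C * fv x)) 0 0 = inner (fv x) (fm ?C * fv x)"
    proof -
      have "elem 0 0 = un 1" by (rule fsmat_eqI) (auto simp: ent_elem ent_un)
      then have "fv x * elem 0 0 = fv x" using times_un[OF shape_fv[OF x]] by simp
      then show ?thesis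
        using inner_times_left[of "fv x" "elem 0 0" "fm ?C * fv x"] by (simp add: inner_elem)
    qed
    moreover have "inner (fv x) (fm ?C * fv x) = x \<bullet> (?C *\<^sub>v x)"
      using x cov_mat_carrier[of n n X X] by (simp add: fv_mult_mat[symmetric] inner_fv)
    ultimately show ?thesis by simp
  qed
  then show ?thesis by (simp add: psd_def cov_mat_carrier cov_mat_transpose)
qed

lemma rand_vec_diff:
  assumes X: "rand_vec M n X" and Y: "rand_vec M n Y"
  shows "rand_vec M n (\<lambda>\<omega>. X \<omega> - Y \<omega>)"
proof (rule rand_vecI)
  show "X \<omega> - Y \<omega> \<in> carrier_vec n" if "\<omega> \<in> space M" for \<omega>
    using rand_vec_carrier[OF X that] rand_vec_carrier[OF Y that] by simp
  fix i assume i: "i < n"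
  have "sq_int (\<lambda>\<omega>. X \<omega> $ i - Y \<omega> $ i)"
    by (intro sq_int_diff rand_vec_component[OF X i] rand_vec_component[OF Y i])
  then show "sq_int (\<lambda>\<omega>. (X \<omega> - Y \<omega>) $ i)"
  proof (rule sq_int_cong[THEN iffD1, rotated])
    fix \<omega> assume "\<omega> \<in> space M"
    then have "dim_vec (Y \<omega>) = n" using rand_vec_carrier[OF Y] by (intro carrier_vecD)
    then show "X \<omega> $ i - Y \<omega> $ i = (X \<omega> - Y \<omega>) $ i" using i by simp
  qed
qed

text \<open>The covariances of the noise processes solve the Lyapunov equations that define \<open>mPw, mPv\<close>,
  with the same initial values, and the cross covariance solves a homogeneous one.\<close>

lemma noise_process_covariances:
  assumes nm: "noise_model M S w vv" and nc: "noise_covariances S" and t: "t0 S \<le> t"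
  shows "cov_mat M (nw S) (nw S) (w t) (w t) = mPw S t"
    "cov_mat M (ny S + ny S) (ny S + ny S) (vv t) (vv t) = mPv S t"
    "cov_mat M (nw S) (ny S + ny S) (w t) (vv t) = 0\<^sub>m (nw S) (ny S + ny S)"
proof -
  let ?m = "ny S + ny S"
  have c: "mAw S \<in> carrier_mat (nw S) (nw S)" "mAv S \<in> carrier_mat (ny S) (ny S)"
    "mAvd S \<in> carrier_mat (ny S) (ny S)" "mBw S \<in> carrier_mat (nw S) (nwG S)" "mBv S \<in> carrier_mat (ny S) (nvG S)"
    and q: "psd (nwG S) (mQG S)" "posdef (nvG S) (mRG S)"
    using nm by (simp_all add: noise_model_def)
  have Q: "mQG S \<in> carrier_mat (nwG S) (nwG S)" and R: "mRG S \<in> carrier_mat (nvG S) (nvG S)"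
    using q by (simp_all add: psd_def posdef_def)
  have A: "- mAw S \<in> carrier_mat (nw S) (nw S)" and Av: "Av_aug S \<in> carrier_mat ?m ?m"
    and Bv: "Bv_aug S \<in> carrier_mat ?m (nvG S)"
    using c by (auto simp: Av_aug_def Bv_aug_def)
  obtain \<beta>w \<beta>v where
    w: "white_noise_driven M (t0 S) (nw S) (nwG S) (- mAw S) (mBw S) (mQG S) (mP0w S) \<beta>w w" and
    v: "white_noise_driven M (t0 S) ?m (nvG S) (Av_aug S) (Bv_aug S) (mRG S) (mP0v S) \<beta>v vv" and
    wv: "\<And>s t. t0 S \<le> s \<Longrightarrow> t0 S \<le> t \<Longrightarrow> cov_mat M (nwG S) (nvG S) (\<beta>w s) (\<beta>v t) = 0\<^sub>m (nwG S) (nvG S)"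
      "\<And>t. t0 S \<le> t \<Longrightarrow> cov_mat M (nw S) (nvG S) (w (t0 S)) (\<beta>v t) = 0\<^sub>m (nw S) (nvG S)"
      "\<And>t. t0 S \<le> t \<Longrightarrow> cov_mat M ?m (nwG S) (vv (t0 S)) (\<beta>w t) = 0\<^sub>m ?m (nwG S)"
      "cov_mat M (nw S) ?m (w (t0 S)) (vv (t0 S)) = 0\<^sub>m (nw S) ?m"
    using nm unfolding noise_model_def by blast
  have w1: "cov_mat M (nw S) (nw S) (w (t0 S)) (w (t0 S)) = mP0w S"
    "\<And>t. t0 S \<le> t \<Longrightarrow> cov_mat M (nw S) (nwG S) (w (t0 S)) (\<beta>w t) = 0\<^sub>m (nw S) (nwG S)"
    "\<And>s t. t0 S \<le> s \<Longrightarrow> t0 S \<le> t \<Longrightarrow> cov_mat M (nwG S) (nwG S) (\<beta>w s) (\<beta>w t) = (min s t - t0 S) \<cdot>\<^sub>m mQG S"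
    using w unfolding white_noise_driven_def white_noise_primitive_def by blast+
  have v1: "cov_mat M ?m ?m (vv (t0 S)) (vv (t0 S)) = mP0v S"
    "\<And>t. t0 S \<le> t \<Longrightarrow> cov_mat M ?m (nvG S) (vv (t0 S)) (\<beta>v t) = 0\<^sub>m ?m (nvG S)"
    "\<And>s t. t0 S \<le> s \<Longrightarrow> t0 S \<le> t \<Longrightarrow> cov_mat M (nvG S) (nvG S) (\<beta>v s) (\<beta>v t) = (min s t - t0 S) \<cdot>\<^sub>m mRG S"
    using v unfolding white_noise_driven_def white_noise_primitive_def by blast+
  have P: "mPw S s \<in> carrier_mat (nw S) (nw S)" "mPv S s \<in> carrier_mat ?m ?m"
    "has_mderiv (t0 S) (mPw S) (- (mAw S * mPw S s) - mPw S s * transpose_mat (mAw S) + mBw S * mQG S * transpose_mat (mBw S)) s"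
    "has_mderiv (t0 S) (mPv S) (Av_aug S * mPv S s + mPv S s * transpose_mat (Av_aug S) + Bv_aug S * mRG S * transpose_mat (Bv_aug S)) s"
    if "t0 S \<le> s" for s
    using nc that by (simp_all add: noise_covariances_def)
  have P0: "mPw S (t0 S) = mP0w S" "mPv S (t0 S) = mP0v S" using nc by (simp_all add: noise_covariances_def)
  have neg: "- mAw S * X + X * transpose_mat (- mAw S) + N = - (mAw S * X) - X * transpose_mat (mAw S) + N"
    if "X \<in> carrier_mat (nw S) (nw S)" "N \<in> carrier_mat (nw S) (nw S)" for X N
    by (rule fm_inject[of _ "nw S" "nw S"])
      (use carrier_matD[OF that(1)] carrier_matD[OF that(2)] carrier_matD[OF c(1)] in
        \<open>auto simp: fm_add' fm_diff' fm_times fm_uminus fm_transpose intro!: carrier_matI\<close>)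
  have N: "mBw S * mQG S * transpose_mat (mBw S) \<in> carrier_mat (nw S) (nw S)"
    "Bv_aug S * mRG S * transpose_mat (Bv_aug S) \<in> carrier_mat ?m ?m"
    using carrier_matD[OF c(4)] carrier_matD[OF Bv] by (auto intro!: carrier_matI)
  show "cov_mat M (nw S) (nw S) (w t) (w t) = mPw S t"
  proof (rule lyapunov_unique[OF A A N(1) _ _ P(1) _ _ t, where X = "\<lambda>t. cov_mat M (nw S) (nw S) (w t) (w t)"])
    show "has_mderiv (t0 S) (\<lambda>t. cov_mat M (nw S) (nw S) (w t) (w t)) (- mAw S * cov_mat M (nw S) (nw S) (w s) (w s)
        + cov_mat M (nw S) (nw S) (w s) (w s) * transpose_mat (- mAw S) + mBw S * mQG S * transpose_mat (mBw S)) s"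
      if "t0 S \<le> s" for s
      by (rule covariance_lyapunov[OF w w A c(4) Q A c(4) Q Q w1(3) w1(2) w1(2) that])
    show "has_mderiv (t0 S) (mPw S) (- mAw S * mPw S s + mPw S s * transpose_mat (- mAw S)
        + mBw S * mQG S * transpose_mat (mBw S)) s" if "t0 S \<le> s" for s
      unfolding neg[OF P(1)[OF that] N(1)] by (rule P(3)[OF that])
  qed (use w1 P0 in \<open>auto simp: cov_mat_carrier\<close>)
  show "cov_mat M ?m ?m (vv t) (vv t) = mPv S t"
  proof (rule lyapunov_unique[OF Av Av N(2) _ _ P(2) P(4) _ t, where X = "\<lambda>t. cov_mat M ?m ?m (vv t) (vv t)"])
    show "has_mderiv (t0 S) (\<lambda>t. cov_mat M ?m ?m (vv t) (vv t)) (Av_aug S * cov_mat M ?m ?m (vv s) (vv s)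
        + cov_mat M ?m ?m (vv s) (vv s) * transpose_mat (Av_aug S) + Bv_aug S * mRG S * transpose_mat (Bv_aug S)) s"
      if "t0 S \<le> s" for s
      by (rule covariance_lyapunov[OF v v Av Bv R Av Bv R R v1(3) v1(2) v1(2) that])
  qed (use v1 P0 in \<open>auto simp: cov_mat_carrier\<close>)
  let ?N = "mBw S * 0\<^sub>m (nwG S) (nvG S) * transpose_mat (Bv_aug S)"
  have Nz: "?N = 0\<^sub>m (nw S) ?m" using c Bv by simp
  show "cov_mat M (nw S) ?m (w t) (vv t) = 0\<^sub>m (nw S) ?m"
  proof (rule lyapunov_unique[OF A Av _ _ _ _ _ _ t, where X = "\<lambda>t. cov_mat M (nw S) ?m (w t) (vv t)"
        and Y = "\<lambda>_. 0\<^sub>m (nw S) ?m" and N = ?N])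
    show "has_mderiv (t0 S) (\<lambda>t. cov_mat M (nw S) ?m (w t) (vv t)) (- mAw S * cov_mat M (nw S) ?m (w s) (vv s)
        + cov_mat M (nw S) ?m (w s) (vv s) * transpose_mat (Av_aug S) + ?N) s" if "t0 S \<le> s" for s
      by (rule covariance_lyapunov[OF w v A c(4) Q Av Bv R _ _ wv(2) wv(3) that]) (use wv(1) in auto)
    have "- mAw S * 0\<^sub>m (nw S) ?m + 0\<^sub>m (nw S) ?m * transpose_mat (Av_aug S) + ?N = 0\<^sub>m (nw S) ?m"
      unfolding Nz using A Av by simp
    then show "has_mderiv (t0 S) (\<lambda>_. 0\<^sub>m (nw S) ?m)
        (- mAw S * 0\<^sub>m (nw S) ?m + 0\<^sub>m (nw S) ?m * transpose_mat (Av_aug S) + ?N) s" for s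
      by (simp add: has_mderiv_def)
  qed (use wv(4) Nz in \<open>auto simp: cov_mat_carrier\<close>)
qed

lemma alise_data_of_model:
  assumes sm: "system_matrices S" and nm: "noise_model M S w vv" and nc: "noise_covariances S"
    and so: "state_and_output M S w vv u d x y" and fl: "alise_filter M S u x y xh0 \<theta>"
  shows "alise_data S"
proof
  show "system_matrices S" "noise_covariances S" by fact+
  show "mAw S \<in> carrier_mat (nw S) (nw S)" "mAv S \<in> carrier_mat (ny S) (ny S)"
    "mAvd S \<in> carrier_mat (ny S) (ny S)" "mBw S \<in> carrier_mat (nw S) (nwG S)"
    "mBv S \<in> carrier_mat (ny S) (nvG S)" "psd (nwG S) (mQG S)" "posdef (nvG S) (mRG S)"
    using nm by (simp_all add: noise_model_def)
  have "cov_mat M (nw S) (nw S) (w (t0 S)) (w (t0 S)) = mP0w S"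
    "cov_mat M (ny S + ny S) (ny S + ny S) (vv (t0 S)) (vv (t0 S)) = mP0v S"
    using nm unfolding noise_model_def white_noise_driven_def by blast+
  then show "transpose_mat (mP0w S) = mP0w S" "transpose_mat (mP0v S) = mP0v S"
    by (metis cov_mat_transpose)+
  show "vec_space.rank (ny S - pH S) (C2 S t * G2 S t) = nd S - pH S" "posdef (ny S - pH S) (R2 S t)"
    if "t0 S \<le> t" for t
    using fl that by (simp_all add: alise_filter_def)
  show "posdef (ny S - pH S) (Rtil2 S t)" if "pH S < nd S" "t0 S \<le> t" for t
    using fl that by (simp add: alise_filter_def)
  show "riccati_solution S (mPx S)" using fl by (simp add: alise_filter_def)
  have r: "rand_vec M (nx S) xh0" "rand_vec M (nx S) (x (t0 S))"
    "mPx S (t0 S) = cov_mat M (nx S) (nx S) (\<lambda>\<omega>. x (t0 S) \<omega> - xh0 \<omega>) (\<lambda>\<omega>. x (t0 S) \<omega> - xh0 \<omega>)"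
    using fl so by (simp_all add: alise_filter_def state_and_output_def)
  show "psd (nx S) (mPx S (t0 S))"
    unfolding r(3) by (rule cov_mat_psd[OF rand_vec_diff[OF r(2,1)]])
qed

end

theorem theorem6:
  fixes M :: "'a measure" and S :: alise
    and w vv u d x y \<theta> :: "real \<Rightarrow> 'a \<Rightarrow> real vec" and xh0 :: "'a \<Rightarrow> real vec"
  assumes "prob_space M"
    and "system_matrices S"
    and "noise_model M S w vv"
    and "noise_covariances S"
    and "inputs M S u d"
    and "state_and_output M S w vv u d x y"
    and "alise_filter M S u x y xh0 \<theta>"
  defines "v \<equiv> vpart S vv" and "vd \<equiv> vdpart S vv"
  shows "(\<forall>\<omega>\<in>space M.
      (let W = (\<lambda>t. w t \<omega>); V = (\<lambda>t. v t \<omega>); Vd = (\<lambda>t. vd t \<omega>) in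
        (\<forall>xe ye. correlated_system S W V Vd xe ye \<longleftrightarrow> equiv_system S W V Vd xe ye) \<and>
        error_dynamics S W V Vd (\<lambda>t. x t \<omega> - xhat S t (y t \<omega>) (u t \<omega>) (\<theta> t \<omega>)) \<and>
        (\<forall>xe ye xh. equiv_system S W V Vd xe ye \<and> equiv_kalman_bucy S ye xh \<longrightarrow>
          error_dynamics S W V Vd (\<lambda>t. xe t - xh t)))) \<and>
    equiv_riccati S \<and>
    (\<forall>t\<ge>t0 S.
      cov_mat M (nx S) (nx S) (\<lambda>\<omega>. wbar S t (w t \<omega>) (v t \<omega>) (vd t \<omega>))
        (\<lambda>\<omega>. wbar S t (w t \<omega>) (v t \<omega>) (vd t \<omega>)) = Qbar S t + Xi S t + transpose_mat (Xi S t) \<and>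
      cov_mat M (nx S) (nx S) (\<lambda>\<omega>. we S t (w t \<omega>) (v t \<omega>) (vd t \<omega>))
        (\<lambda>\<omega>. we S t (w t \<omega>) (v t \<omega>) (vd t \<omega>)) = Qe S t + Xi S t + transpose_mat (Xi S t)) \<and>
    (cond_A2 S \<and> cond_A3 S \<and> cond_A4 S \<and> cond_A5 S \<longrightarrow>
      unif_asymp_stable (t0 S) (nx S) (\<lambda>t. Abar S t - L S t * C2 S t) \<and>
      (\<exists>Pinf. attracts_riccati S Pinf \<and>
        (\<forall>P'. attracts_riccati S P' \<longrightarrow> asymptotically_equal P' Pinf)))"
proof -
  interpret prob_space M by fact
  interpret alise_data S by (rule alise_data_of_model[OF assms(2,3,4,6,7)])
  obtain \<beta>w \<beta>v where
    wn: "white_noise_driven M a (nw S) (nwG S) (- mAw S) (mBw S) (mQG S) (mP0w S) \<beta>w w"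
    and vn: "white_noise_driven M a (l + l) (nvG S) (Av_aug S) (Bv_aug S) (mRG S) (mP0v S) \<beta>v vv"
    using assms(3) unfolding noise_model_def by blast
  have rv: "rand_vec M (nw S) (w t)" "rand_vec M (l + l) (vv t)" if "a \<le> t" for t
    using wn vn that unfolding white_noise_driven_def by blast+
  have 1: "let W = (\<lambda>t. w t \<omega>); V = (\<lambda>t. v t \<omega>); Vd = (\<lambda>t. vd t \<omega>) in
        (\<forall>xe ye. correlated_system S W V Vd xe ye \<longleftrightarrow> equiv_system S W V Vd xe ye) \<and>
        error_dynamics S W V Vd (\<lambda>t. x t \<omega> - xhat S t (y t \<omega>) (u t \<omega>) (\<theta> t \<omega>)) \<and>
        (\<forall>xe ye xh. equiv_system S W V Vd xe ye \<and> equiv_kalman_bucy S ye xh \<longrightarrow>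
          error_dynamics S W V Vd (\<lambda>t. xe t - xh t))" if \<omega>: "\<omega> \<in> space M" for \<omega>
  proof -
    have s: "w t \<omega> \<in> carrier_vec (nw S)" "v t \<omega> \<in> carrier_vec l" "vd t \<omega> \<in> carrier_vec l" if "a \<le> t" for t
      using rand_vec_carrier[OF rv(1)[OF that] \<omega>]
      by (auto simp: v_def vd_def vpart_def vdpart_def vec_first_def vec_last_def)
    have ud: "u t \<omega> \<in> carrier_vec (nu S)" "d t \<omega> \<in> carrier_vec (nd S)" if "a \<le> t" for t
      using assms(5) \<omega> that unfolding inputs_def by blast+
    have x: "x t \<omega> \<in> carrier_vec n" "has_vderiv a (\<lambda>s. x s \<omega>)
        (mA S t *\<^sub>v x t \<omega> + mB S t *\<^sub>v u t \<omega> + mG S t *\<^sub>v d t \<omega> + mW S t *\<^sub>v w t \<omega>) t"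
      "y t \<omega> = mC S t *\<^sub>v x t \<omega> + mD S t *\<^sub>v u t \<omega> + mH S t *\<^sub>v d t \<omega> + v t \<omega>" if "a \<le> t" for t
      using assms(6) \<omega> that unfolding state_and_output_def v_def by blast+
    have th: "\<theta> t \<omega> \<in> carrier_vec n" "has_vderiv a (\<lambda>s. \<theta> s \<omega>)
        ((Abar S t - L S t * C2 S t) *\<^sub>v xhat S t (y t \<omega>) (u t \<omega>) (\<theta> t \<omega>)
          + (Bbar S t - L S t * D2 S t) *\<^sub>v u t \<omega> + (Gbar S t * M1 S t) *\<^sub>v (T1 S t *\<^sub>v y t \<omega>)
          + L S t *\<^sub>v (T2 S t *\<^sub>v y t \<omega>) - mderiv a (Phi1 S) t *\<^sub>v y t \<omega> - mderiv a (Phi2 S) t *\<^sub>v u t \<omega>) t"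
      if "a \<le> t" for t
      using assms(7) \<omega> that unfolding alise_filter_def by blast+
    have v': "has_vderiv a (\<lambda>t. v t \<omega>) (vd t \<omega>) t" if "a \<le> t" for t
      unfolding v_def vd_def by (rule noise_velocity[OF vn noise_dims(2,3,5) refl \<omega> that])
    have iff: "correlated_system S (\<lambda>t. w t \<omega>) (\<lambda>t. v t \<omega>) (\<lambda>t. vd t \<omega>) xe ye
        \<longleftrightarrow> equiv_system S (\<lambda>t. w t \<omega>) (\<lambda>t. v t \<omega>) (\<lambda>t. vd t \<omega>) xe ye" for xe ye
      by (rule correlated_iff_equiv) (rule s, assumption)+
    have err: "error_dynamics S (\<lambda>t. w t \<omega>) (\<lambda>t. v t \<omega>) (\<lambda>t. vd t \<omega>) (\<lambda>t. x t \<omega> - xhat S t (y t \<omega>) (u t \<omega>) (\<theta> t \<omega>))"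
      by (rule filter_error[where u = "\<lambda>t. u t \<omega>" and d = "\<lambda>t. d t \<omega>"]) (fact s ud v' x th)+
    have kb: "error_dynamics S (\<lambda>t. w t \<omega>) (\<lambda>t. v t \<omega>) (\<lambda>t. vd t \<omega>) (\<lambda>t. xe t - xh t)"
      if "equiv_system S (\<lambda>t. w t \<omega>) (\<lambda>t. v t \<omega>) (\<lambda>t. vd t \<omega>) xe ye" "equiv_kalman_bucy S ye xh" for xe ye xh
      by (rule equiv_error[OF _ _ _ that]) (rule s, assumption)+
    show ?thesis unfolding Let_def using iff err kb by blast
  qed
  have 2: "cov_mat M n n (\<lambda>\<omega>. wbar S t (w t \<omega>) (v t \<omega>) (vd t \<omega>)) (\<lambda>\<omega>. wbar S t (w t \<omega>) (v t \<omega>) (vd t \<omega>))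
        = Qbar S t + Xi S t + transpose_mat (Xi S t) \<and>
      cov_mat M n n (\<lambda>\<omega>. we S t (w t \<omega>) (v t \<omega>) (vd t \<omega>)) (\<lambda>\<omega>. we S t (w t \<omega>) (v t \<omega>) (vd t \<omega>))
        = Qe S t + Xi S t + transpose_mat (Xi S t)" if t: "a \<le> t" for t
    unfolding v_def vd_def vpart_def vdpart_def
    by (intro conjI wbar_covariance[OF assms(1) t rv[OF t] noise_process_covariances[OF assms(3,4) t]])
  show ?thesis
    by (intro conjI ballI allI impI equiv_riccati; (rule 1 filter_stable; simp)?)
      (use 2 in auto)
qed

end
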